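(* Consider the mixed $p$-spin model with $\theta_2=0$, $h=0$ and $0<\beta<\beta_f(\xi)$. As $N\to\infty$, in distribution: (i) if $p_e<p_o$, then $N^{3(p_e-2)/4}\log\hat Z_N\to\mathrm N(0,v_{\mathrm{mix},1}^2)$, where $v_{\mathrm{mix},1}^2=v_{3,0,0}(\beta)^2$; (ii) if $p_o<p_e<2p_o$, then $N^{(2p_o+p_e-6)/4}\log\hat Z_N\to\mathrm N(0,v_{\mathrm{mix},2}^2)$, where $$v_{\mathrm{mix},2}^2=\begin{cases}v_{1,2,0}(\beta)^2,& p_o<p_e<2(p_o-1),\\ v_{1,2,0}(\beta)^2+v_{0,4,0}(\beta)^2,& p_e=2(p_o-1);\end{cases}$$ (iii) if $p_e\ge2p_o$, then $N^{p_o-2}\log\hat Z_N\to\mathrm N(0,v_{\mathrm{mix},3}^2)$, where $v_{\mathrm{mix},3}^2=v_{0,4,0}(\beta)^2$.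
   Context: Mixed $p$-spin model. For $p\ge3$, $\mathcal E_{N,p}$ is the set of $p$-tuples $\boldsymbol i=(i_1,\dots,i_p)$ with $1\le i_1<\cdots<i_p\le N$; for $\sigma\in\{-1,+1\}^N$, $\sigma_{\boldsymbol i}=\prod_{j=1}^p\sigma_{i_j}$. The variables $(J_{\boldsymbol i})_{\boldsymbol i\in\cup_{p}\mathcal E_{N,p}}$ are i.i.d., symmetrically distributed with mean zero, variance one and finite fourth moment. The coefficients $(\theta_p)_{p\ge2}$ are real with $\sum_{p\ge2}\theta_p^2/(p-2)!<\infty$ and $\theta_2=0$. Set $$p_e=\min\{\text{even }p\ge4:\theta_p\ne0\},\qquad p_o=\min\{\text{odd }p\ge3:\theta_p\neq0\},$$ both sets being assumed nonempty. Define $$\hat Z_N=\hat Z_N(\beta,0)=\mathbb E_0\prod_{p\ge3}\prod_{\boldsymbol i\in\mathcal E_{N,p}}\big(1+\sigma_{\boldsymbol i}\tanh(\beta\theta_pJ_{\boldsymbol i}/N^{(p-1)/2})\big),$$ where under $\mathbb E_0$ the $\sigma_i$ are i.i.d. uniform on $\{-1,+1\}$, independent of $J$. $\xi(x)=\sum_{p\ge2}\theta_p^2x^p/p!$, $I(x)=\frac12(1+x)\log(1+x)+\frac12(1-x)\log(1-x)$, $\beta_f(\xi)=\inf_{x\in(0,1)}\sqrt{I(x)/\xi(x)}$. With $\eta\sim\mathrm N(0,1)$ and $H_k$ the (probabilists', monic) Hermite polynomial of degree $k$, for nonnegative integers $a_e,a_o$, $$v_{a_e,a_o,0}(\beta)^2=\frac{\beta^{2(a_e+a_o)}\theta_{p_e}^{2a_e}\theta_{p_o}^{2a_o}}{a_e!\,a_o!\,(p_e!)^{a_e/2}(p_o!)^{a_o/2}}\;\mathbb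 E\Big(H_{a_e}\big(H_{p_e}(\eta)/\sqrt{p_e!}\big)H_{a_o}\big(H_{p_o}(\eta)/\sqrt{p_o!}\big)\Big).$$ *)

theory Defs
  imports "HOL-Probability.Probability" "HOL-Probability.Product_PMF"
begin

section \<open>Couplings and critical inverse temperature\<close>

definition xi :: "(nat \<Rightarrow> real) \<Rightarrow> real \<Rightarrow> real" where
  "xi \<theta> x = (\<Sum>\<^sub>\<infinity>p\<in>{2..}. (\<theta> p)\<^sup>2 * x ^ p / fact p)"

definition rate_I :: "real \<Rightarrow> real" where
  "rate_I x = 1 / 2 * (1 + x) * ln (1 + x) + 1 / 2 * (1 - x) * ln (1 - x)"

definition beta_f :: "(real \<Rightarrow> real) \<Rightarrow> real" where
  "beta_f \<xi> = (INF x\<in>{0<..<1}. sqrt (rate_I x / \<xi> x))"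

definition min_even :: "(nat \<Rightarrow> real) \<Rightarrow> nat" where
  "min_even \<theta> = (LEAST p. even p \<and> 4 \<le> p \<and> \<theta> p \<noteq> 0)"

definition min_odd :: "(nat \<Rightarrow> real) \<Rightarrow> nat" where
  "min_odd \<theta> = (LEAST p. odd p \<and> 3 \<le> p \<and> \<theta> p \<noteq> 0)"


section \<open>The model\<close>

text \<open>A tuple \<open>(i\<^sub>1, \<dots>, i\<^sub>p)\<close> with \<open>1 \<le> i\<^sub>1 < \<dots> < i\<^sub>p \<le> N\<close> is a strictly increasing list.\<close>

definition hyperedges :: "nat \<Rightarrow> nat \<Rightarrow> nat list set" where
  "hyperedges N p = {is. length is = p \<and> sorted_wrt (<) is \<and> set is \<subseteq> {1..N}}"

lemma hyperedges_empty: "N < p \<Longrightarrow> hyperedges N p = {}"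
proof (rule ccontr)
  assume "N < p" "hyperedges N p \<noteq> {}"
  then obtain xs where "length xs = p" "sorted_wrt (<) xs" "set xs \<subseteq> {1..N}"
    by (auto simp: hyperedges_def)
  moreover from this have "card (set xs) = p"
    by (auto simp: strict_sorted_iff distinct_card)
  moreover have "card (set xs) \<le> N"
    using \<open>set xs \<subseteq> {1..N}\<close> card_mono[of "{1..N}" "set xs"] by simp
  ultimately show False using \<open>N < p\<close> by simp
qed

definition disorder_index :: "nat list set" where
  "disorder_index = (\<Union>N. \<Union>p\<in>{3..}. hyperedges N p)"

definition spin_product :: "(nat \<Rightarrow> real) \<Rightarrow> nat list \<Rightarrow> real" where
  "spin_product \<sigma> is = (\<Prod>j<length is. \<sigma> (is ! j))"

text \<open>The law of \<open>N\<close> i.i.d. uniform signs; coordinates outside \<open>{1..N}\<close> have the dummy value 1.\<close>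

definition uniform_spins :: "nat \<Rightarrow> (nat \<Rightarrow> real) pmf" where
  "uniform_spins N = Pi_pmf {1..N} 1 (\<lambda>_. pmf_of_set {-1, 1})"

text \<open>
  The disorder enters as a realisation \<open>J\<close>. The product over all \<open>p \<ge> 3\<close> stops at \<open>p = N\<close>
  by \<open>hyperedges_empty\<close>.
\<close>

definition Z_hat :: "(nat \<Rightarrow> real) \<Rightarrow> real \<Rightarrow> (nat list \<Rightarrow> real) \<Rightarrow> nat \<Rightarrow> real" where
  "Z_hat \<theta> \<beta> J N =
     measure_pmf.expectation (uniform_spins N)
       (\<lambda>\<sigma>. \<Prod>p\<in>{3..N}. \<Prod>is\<in>hyperedges N p.
          1 + spin_product \<sigma> is * tanh (\<beta> * \<theta> p * J is / real N powr ((real p - 1) / 2)))"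


section \<open>Limiting variances\<close>

fun hermite :: "nat \<Rightarrow> real \<Rightarrow> real" where
  "hermite 0 x = 1"
| "hermite (Suc 0) x = x"
| "hermite (Suc (Suc n)) x = x * hermite (Suc n) x - real (Suc n) * hermite n x"

text \<open>
  \<open>v_sq \<theta> \<beta> a b\<close> is \<open>v\<^sub>a\<^sub>,\<^sub>b\<^sub>,\<^sub>0(\<beta>)\<^sup>2\<close>: \<open>a\<close> belongs to the even and \<open>b\<close> to the odd index.
\<close>

definition v_sq :: "(nat \<Rightarrow> real) \<Rightarrow> real \<Rightarrow> nat \<Rightarrow> nat \<Rightarrow> real" where
  "v_sq \<theta> \<beta> a b =
     (let pe = min_even \<theta>; po = min_odd \<theta> in
      \<beta> ^ (2 * (a + b)) * \<theta> pe ^ (2 * a) * \<theta> po ^ (2 * b)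
        / (fact a * fact b * fact pe powr (real a / 2) * fact po powr (real b / 2))
      * (\<integral>\<eta>. hermite a (hermite pe \<eta> / sqrt (fact pe)) *
             hermite b (hermite po \<eta> / sqrt (fact po)) \<partial>std_normal_distribution))"

definition v_mix1_sq :: "(nat \<Rightarrow> real) \<Rightarrow> real \<Rightarrow> real" where
  "v_mix1_sq \<theta> \<beta> = v_sq \<theta> \<beta> 3 0"

text \<open>
  Used only if \<open>p\<^sub>o < p\<^sub>e < 2 p\<^sub>o\<close>; as \<open>p\<^sub>e\<close> is even, either \<open>p\<^sub>e < 2 (p\<^sub>o - 1)\<close> or \<open>p\<^sub>e = 2 (p\<^sub>o - 1)\<close>.
\<close>

definition v_mix2_sq :: "(nat \<Rightarrow> real) \<Rightarrow> real \<Rightarrow> real" where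
  "v_mix2_sq \<theta> \<beta> =
     (if min_even \<theta> < 2 * (min_odd \<theta> - 1) then v_sq \<theta> \<beta> 1 2
      else v_sq \<theta> \<beta> 1 2 + v_sq \<theta> \<beta> 0 4)"

definition v_mix3_sq :: "(nat \<Rightarrow> real) \<Rightarrow> real \<Rightarrow> real" where
  "v_mix3_sq \<theta> \<beta> = v_sq \<theta> \<beta> 0 4"

text \<open>
  The image of the standard normal law under scaling by the standard deviation, so that
  \<open>v = 0\<close> gives the point mass at 0.
\<close>

definition centred_normal :: "real \<Rightarrow> real measure" where
  "centred_normal v = distr std_normal_distribution borel (\<lambda>x. sqrt v * x)"

definition converges_in_distribution_to ::
    "'a measure \<Rightarrow> (nat \<Rightarrow> 'a \<Rightarrow> real) \<Rightarrow> real measure \<Rightarrow> bool" where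
  "converges_in_distribution_to M X \<mu> \<longleftrightarrow> weak_conv_m (\<lambda>N. distr M borel (X N)) \<mu>"

end

theory Submission
  imports Defs
begin

text \<open>
  Call a subset of \<open>{1..N}\<close> with at least three elements an edge and let \<open>x N e\<close> be the hyperbolic
  tangent that belongs to it in the partition function. Multiplying out the product over edges and averaging over the spins shows that
  the partition function is the sum of \<open>\<Prod>e\<in>\<Gamma>. x N e\<close> over all closed hypergraphs
  \<open>\<Gamma>\<close>, those in which each vertex has even degree (\<open>Z_hat_expansion\<close>). The \<open>x N e\<close> are
  independent, symmetric and of variance about \<open>\<beta>^2 * \<theta> p^2 / N ^ (p - 1)\<close> for \<open>card e = p\<close>.
  So the products are orthogonal, and variances are sums of positive weights over closed hypergraphs.

  A closed hypergraph has at most half as many vertices as the sum of its edge sizes. Hence all copies of one shape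
  have a total variance of order \<open>N\<close> to the power of minus half the weight \<open>\<Sum>e\<in>\<Gamma>. card e - 2\<close>.
  The empty hypergraph gives 1, and there are no closed ones with one or two edges. By parity the
  number of odd edges is even. So the candidates for the leading order are three even edges, one even
  and two odd edges, and four odd edges, all of minimal size. Comparing their weights yields the three regimes,
  the exponents and the case in which two types tie (\<open>leading_order_even\<close>, \<open>leading_order_mixed\<close>,
  \<open>leading_order_odd\<close>). The numbers of these hypergraphs are spin averages of products of elementary symmetric
  polynomials, which converge to Hermite polynomials of a Gaussian variable; this identifies the limiting
  variances.

  That everything else is negligible needs bounds that are uniform over edges of all sizes up to \<open>N\<close> and over
  all numbers of edges. Sums over closed hypergraphs with \<open>n\<close> edges are at most the \<open>n\<close>-th moment, divided by
  the factorial of \<open>n\<close>, of the field \<open>\<Sum>e. bw N (card e) * chi e\<close> under uniform spins, because the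
  difference has nonnegative Walsh coefficients. The condition that \<open>\<beta>\<close> is below the critical value
  provides an exponential moment of this field of an order larger than 1 (\<open>exp_moment\<close>). With the polynomial moments
  (\<open>field_moment\<close>) this controls the tails (\<open>tail_large\<close>, \<open>tail_small\<close>).

  The sum over the leading hypergraphs is a martingale when edges are revealed in the order of their largest
  vertex. Its conditional variances concentrate, because two correlated hypergraphs have to share vertices, and
  hypercontractivity bounds the fourth moments. Comparing characteristic functions step by step gives asymptotic
  normality with an error of order \<open>1 / sqrt N\<close> (\<open>char_main_family\<close>). Finally the logarithm is linearized and
  the continuity theorem of Levy is applied (\<open>log_partition_CLT\<close>).
\<close>

section \<open>Spin configurations and Walsh functions\<close>

text \<open>The Walsh function of \<open>A\<close>, that is the product of the spins in \<open>A\<close>, when the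
configuration is encoded by the set \<open>B\<close> of its minus spins.\<close>

definition chi :: "nat set \<Rightarrow> nat set \<Rightarrow> real" where
  "chi A B = (-1) ^ card (A \<inter> B)"

text \<open>The expectation over uniform spins on \<open>{1..N}\<close>, in the encoding by sets of minus
spins.\<close>

definition avg :: "nat \<Rightarrow> (nat set \<Rightarrow> real) \<Rightarrow> real" where
  "avg N f = (\<Sum>B\<in>Pow {1..N}. f B) / 2 ^ N"

text \<open>The boundary modulo 2 of a hypergraph. A hypergraph with empty boundary is called closed: each vertex
has even degree.\<close>

definition bd :: "nat set set \<Rightarrow> nat set" where
  "bd \<Gamma> = {i. odd (card {e \<in> \<Gamma>. i \<in> e})}"

definition esym :: "('b \<Rightarrow> real) \<Rightarrow> 'b set \<Rightarrow> nat \<Rightarrow> real" where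
  "esym u E k = (\<Sum>\<Gamma> | \<Gamma> \<subseteq> E \<and> card \<Gamma> = k. \<Prod>e\<in>\<Gamma>. u e)"

definition edges :: "nat \<Rightarrow> nat \<Rightarrow> nat set set" where
  "edges N p = {A. A \<subseteq> {1..N} \<and> card A = p}"

text \<open>The elementary symmetric polynomial of degree \<open>p\<close> in the spins.\<close>

definition ep :: "nat \<Rightarrow> nat \<Rightarrow> nat set \<Rightarrow> real" where
  "ep N p B = esym (\<lambda>i. chi {i} B) {1..N} p"

text \<open>The magnetization.\<close>

definition mag :: "nat \<Rightarrow> nat set \<Rightarrow> real" where
  "mag N B = (\<Sum>i\<in>{1..N}. chi {i} B)"

lemma chi_empty [simp]: "chi {} B = 1"
  by (simp add: chi_def)

lemma chi_single: "chi {i} B = (if i \<in> B then -1 else 1)"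
  by (simp add: chi_def)

lemma chi_single_sq [simp]: "chi {i} B * chi {i} B = 1" "(chi {i} B)\<^sup>2 = 1"
  by (simp_all add: chi_single)

lemma abs_chi [simp]: "\<bar>chi A B\<bar> = 1"
  by (simp add: chi_def power_abs)

lemma chi_insert:
  assumes "finite A" "i \<notin> A"
  shows "chi (insert i A) B = (if i \<in> B then -1 else 1) * chi A B"
  using assms by (simp add: chi_def Int_insert_left)

lemma chi_prod: "finite A \<Longrightarrow> chi A B = (\<Prod>i\<in>A. chi {i} B)"
  by (induction A rule: finite_induct) (simp_all add: chi_insert chi_single)

lemma chi_mult:
  assumes "finite A" "finite A'"
  shows "chi A B * chi A' B = chi (sym_diff A A') B"
proof -
  have 1: "card (A \<inter> B) = card ((A - A') \<inter> B) + card (A \<inter> A' \<inter> B)"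
    by (subst card_Un_disjoint[symmetric]) (use assms in \<open>auto intro!: arg_cong[where f=card]\<close>)
  have 2: "card (A' \<inter> B) = card ((A' - A) \<inter> B) + card (A \<inter> A' \<inter> B)"
    by (subst card_Un_disjoint[symmetric]) (use assms in \<open>auto intro!: arg_cong[where f=card]\<close>)
  have 3: "card (sym_diff A A' \<inter> B) = card ((A - A') \<inter> B) + card ((A' - A) \<inter> B)"
    by (subst card_Un_disjoint[symmetric]) (use assms in \<open>auto intro!: arg_cong[where f=card]\<close>)
  have "(-1::real) ^ card (A \<inter> A' \<inter> B) * (-1) ^ card (A \<inter> A' \<inter> B) = 1"
    by (metis power_mult_distrib mult_minus1 minus_minus power_one)
  then show ?thesis
    unfolding chi_def 1 2 3 power_add by (simp add: algebra_simps)
qed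

lemma bd_empty [simp]: "bd {} = {}"
  by (simp add: bd_def)

lemma bd_insert:
  assumes "finite \<Gamma>" "e \<notin> \<Gamma>"
  shows "bd (insert e \<Gamma>) = sym_diff e (bd \<Gamma>)"
proof -
  have "{f \<in> insert e \<Gamma>. i \<in> f} = (if i \<in> e then insert e {f \<in> \<Gamma>. i \<in> f} else {f \<in> \<Gamma>. i \<in> f})" for i
    by auto
  then have "card {f \<in> insert e \<Gamma>. i \<in> f} = card {f \<in> \<Gamma>. i \<in> f} + (if i \<in> e then 1 else 0)" for i
    using assms by auto
  then show ?thesis by (auto simp: bd_def)
qed

lemma bd_single [simp]: "bd {e} = e"
  using bd_insert[of "{}" e] by simp

lemma bd_subset: "bd \<Gamma> \<subseteq> \<Union>\<Gamma>"
proof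
  fix i assume "i \<in> bd \<Gamma>"
  then have "card {e \<in> \<Gamma>. i \<in> e} \<noteq> 0" by (simp add: bd_def odd_pos)
  then have "{e \<in> \<Gamma>. i \<in> e} \<noteq> {}" by (metis card.empty)
  then show "i \<in> \<Union>\<Gamma>" by auto
qed

text \<open>Walsh functions multiply by symmetric difference, so only the parity of the degrees survives in a
product over edges.\<close>

lemma prod_chi:
  assumes "finite \<Gamma>" "\<And>e. e \<in> \<Gamma> \<Longrightarrow> finite e"
  shows "(\<Prod>e\<in>\<Gamma>. chi e B) = chi (bd \<Gamma>) B"
  using assms
proof (induction \<Gamma> rule: finite_induct)
  case (insert e \<Gamma>)
  have "finite (\<Union>\<Gamma>)" using insert.hyps insert.prems by auto
  then have "finite (bd \<Gamma>)" by (rule finite_subset[OF bd_subset])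
  moreover have "finite e" "(\<Prod>e\<in>\<Gamma>. chi e B) = chi (bd \<Gamma>) B" using insert by auto
  ultimately show ?case using insert.hyps by (simp add: bd_insert chi_mult)
qed simp

lemma avg_add: "avg N (\<lambda>B. f B + g B) = avg N f + avg N g"
  by (simp add: avg_def sum.distrib add_divide_distrib)

lemma avg_diff: "avg N (\<lambda>B. f B - g B) = avg N f - avg N g"
  by (simp add: avg_def sum_subtractf diff_divide_distrib)

lemma avg_cmult: "avg N (\<lambda>B. c * f B) = c * avg N f"
  by (simp add: avg_def sum_distrib_left)

lemma avg_sum: "avg N (\<lambda>B. \<Sum>i\<in>I. f i B) = (\<Sum>i\<in>I. avg N (f i))"
  unfolding avg_def by (subst sum.swap) (simp add: sum_divide_distrib)

lemma avg_const [simp]: "avg N (\<lambda>B. c) = c"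
  by (simp add: avg_def card_Pow)

lemma avg_mono: "(\<And>B. B \<subseteq> {1..N} \<Longrightarrow> f B \<le> g B) \<Longrightarrow> avg N f \<le> avg N g"
  unfolding avg_def by (intro divide_right_mono sum_mono) auto

lemma avg_cong: "(\<And>B. B \<subseteq> {1..N} \<Longrightarrow> f B = g B) \<Longrightarrow> avg N f = avg N g"
  unfolding avg_def by (auto intro!: sum.cong)

lemma avg_chi:
  assumes "A \<subseteq> {1..N}"
  shows "avg N (chi A) = (if A = {} then 1 else 0)"
proof -
  have "(\<Prod>i\<in>B. if i \<in> A then -1 else 1) = chi A B" if "finite B" for B
    using that by (simp add: chi_def prod.If_cases Int_commute Int_def)
  then have "(\<Sum>B\<in>Pow {1..N}. chi A B) =
      (\<Sum>B\<in>Pow {1..N}. (\<Prod>i\<in>B. if i \<in> A then -1 else 1) * (\<Prod>i\<in>{1..N} - B. 1))"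
    using finite_subset[of _ "{1..N}"] by (intro sum.cong refl) simp
  also have "\<dots> = (\<Prod>i\<in>{1..N}. (if i \<in> A then -1 else 1) + (1::real))"
    by (subst prod_add) simp_all
  also have "\<dots> = (if A = {} then 2 ^ N else 0)"
    using assms by auto
  finally show ?thesis by (simp add: avg_def)
qed

lemma finite_esym_index: "finite E \<Longrightarrow> finite {\<Gamma>. \<Gamma> \<subseteq> E \<and> card \<Gamma> = k}"
  by (rule finite_subset[of _ "Pow E"]) auto

lemma esym_0 [simp]: "finite E \<Longrightarrow> esym u E 0 = 1"
proof -
  assume "finite E"
  then have "{\<Gamma>. \<Gamma> \<subseteq> E \<and> card \<Gamma> = 0} = {{}}"
    by (auto dest: finite_subset)
  then show ?thesis by (simp add: esym_def)
qed

lemma esym_gt: "finite E \<Longrightarrow> card E < k \<Longrightarrow> esym u E k = 0"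
proof -
  assume "finite E" "card E < k"
  then have "{\<Gamma>. \<Gamma> \<subseteq> E \<and> card \<Gamma> = k} = {}"
    by (auto dest: card_mono)
  then show ?thesis by (simp only: esym_def sum.empty)
qed

text \<open>Pascal recursion: a set of \<open>k + 1\<close> indices either avoids \<open>x\<close> or contains
it.\<close>

lemma esym_insert:
  assumes "finite E" "x \<notin> E"
  shows "esym u (insert x E) (Suc k) = esym u E (Suc k) + u x * esym u E k"
proof -
  have eq: "{\<Gamma>. \<Gamma> \<subseteq> insert x E \<and> card \<Gamma> = Suc k} =
      {\<Gamma>. \<Gamma> \<subseteq> E \<and> card \<Gamma> = Suc k} \<union> insert x ` {\<Gamma>. \<Gamma> \<subseteq> E \<and> card \<Gamma> = k}" (is "?L = ?A \<union> ?B")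
  proof (intro equalityI subsetI)
    fix \<Gamma> assume \<Gamma>: "\<Gamma> \<in> ?L"
    show "\<Gamma> \<in> ?A \<union> ?B"
    proof (cases "x \<in> \<Gamma>")
      case True
      then have "\<Gamma> = insert x (\<Gamma> - {x})" "\<Gamma> - {x} \<subseteq> E" "card (\<Gamma> - {x}) = k"
        using \<Gamma> assms by (auto dest: finite_subset)
      then show ?thesis by blast
    qed (use \<Gamma> in auto)
  next
    fix \<Gamma> assume "\<Gamma> \<in> ?A \<union> ?B"
    then show "\<Gamma> \<in> ?L"
    proof
      assume "\<Gamma> \<in> ?B"
      then obtain \<Gamma>' where "\<Gamma> = insert x \<Gamma>'" "\<Gamma>' \<subseteq> E" "card \<Gamma>' = k" by auto
      moreover have "finite \<Gamma>'" "x \<notin> \<Gamma>'" using calculation assms by (auto dest: finite_subset)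
      ultimately show ?thesis by auto
    qed auto
  qed
  have inj: "inj_on (insert x) {\<Gamma>. \<Gamma> \<subseteq> E \<and> card \<Gamma> = k}"
  proof (rule inj_onI)
    fix X Y assume *: "X \<in> {\<Gamma>. \<Gamma> \<subseteq> E \<and> card \<Gamma> = k}" "Y \<in> {\<Gamma>. \<Gamma> \<subseteq> E \<and> card \<Gamma> = k}" "insert x X = insert x Y"
    then have "x \<notin> X" "x \<notin> Y" using assms by auto
    then show "X = Y" using *(3) by (simp add: insert_ident)
  qed
  have "esym u (insert x E) (Suc k) = esym u E (Suc k) + (\<Sum>\<Gamma>\<in>?B. \<Prod>e\<in>\<Gamma>. u e)"
    unfolding esym_def eq
    by (intro sum.union_disjoint) (use assms in \<open>auto intro: finite_esym_index\<close>)
  also have "(\<Sum>\<Gamma>\<in>?B. \<Prod>e\<in>\<Gamma>. u e) = (\<Sum>\<Gamma> | \<Gamma> \<subseteq> E \<and> card \<Gamma> = k. u x * (\<Prod>e\<in>\<Gamma>. u e))"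
  proof -
    have "(\<Prod>e\<in>insert x \<Gamma>. u e) = u x * (\<Prod>e\<in>\<Gamma>. u e)" if "\<Gamma> \<subseteq> E" for \<Gamma>
      using that assms by (intro prod.insert) (auto dest: finite_subset)
    then show ?thesis by (subst sum.reindex[OF inj]) (auto intro!: sum.cong)
  qed
  finally show ?thesis by (simp add: esym_def sum_distrib_left)
qed

lemma esym_1: "finite E \<Longrightarrow> esym u E (Suc 0) = sum u E"
proof (induction E rule: finite_induct)
  case empty
  then show ?case by (simp add: esym_gt)
next
  case (insert x E)
  then show ?case by (simp add: esym_insert)
qed

text \<open>Newton's identity for signs. As \<open>u i * u i = 1\<close>, multiplying the symmetric polynomial
of degree \<open>p + 1\<close> by the sum either adds a new index or deletes one, the latter in
\<open>card E - p\<close> ways. So all the symmetric polynomials are polynomials in the magnetization, and the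
recursion is that of the Hermite polynomials after rescaling.\<close>

lemma esym_recursion:
  assumes "finite E" "\<And>i. i \<in> E \<Longrightarrow> u i * u i = 1"
  shows "real (p + 2) * esym u E (Suc (Suc p)) =
    sum u E * esym u E (Suc p) - (real (card E) - real p) * esym u E p"
  using assms
proof (induction E arbitrary: p rule: finite_induct)
  case empty
  then show ?case by (cases p) (simp_all add: esym_gt)
next
  case (insert x E)
  let ?t = "u x" and ?e = "esym u E" and ?M = "sum u E" and ?n = "real (card E)"
  have t: "?t * ?t = 1" using insert by simp
  have IH: "real (p + 2) * ?e (Suc (Suc p)) = ?M * ?e (Suc p) - (?n - real p) * ?e p" for p
    using insert by simp
  have card: "real (card (insert x E)) = ?n + 1" using insert by simp
  have sm: "sum u (insert x E) = ?M + ?t" using insert by simp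
  show ?case
  proof (cases p)
    case 0
    show ?thesis
      using IH[of 0] insert(1,2) t
      unfolding 0 card sm by (simp add: esym_insert esym_1 algebra_simps)
  next
    case (Suc q)
    have alg: "(r + 3) * (a + t * b) = (M + t) * (b + t * c) - (n + 1 - (r + 1)) * (c + t * d)"
      if "(r + 3) * a = M * b - (n - (r + 1)) * c" "(r + 2) * b = M * c - (n - r) * d" "t * t = 1"
      for a b c d r M n t :: real
    proof -
      have "(r + 3) * (a + t * b) = (r + 3) * a + t * ((r + 2) * b) + t * b" by (simp add: algebra_simps)
      also have "\<dots> = M * b + t * M * c + t * b + 1 * c - (n - r) * c - (n - r) * t * d"
        unfolding that(1,2) by (simp add: algebra_simps)
      also have "\<dots> = (M + t) * (b + t * c) - (n + 1 - (r + 1)) * (c + t * d)"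
        unfolding that(3)[symmetric] by (simp add: algebra_simps)
      finally show ?thesis .
    qed
    have "(real q + 3) * ?e (Suc (Suc (Suc q))) = ?M * ?e (Suc (Suc q)) - (?n - (real q + 1)) * ?e (Suc q)"
      "(real q + 2) * ?e (Suc (Suc q)) = ?M * ?e (Suc q) - (?n - real q) * ?e q"
      using IH[of "Suc q"] IH[of q] by (simp_all add: add.commute)
    from alg[OF this t] show ?thesis
      unfolding Suc card sm esym_insert[OF insert(1,2)] by (simp add: add.commute)
  qed
qed

lemma sum_chi_bound: "\<bar>mag N B\<bar> \<le> real N"
proof -
  have "\<bar>mag N B\<bar> \<le> (\<Sum>i\<in>{1..N}. \<bar>chi {i} B\<bar>)"
    unfolding mag_def by (rule sum_abs)
  then show ?thesis by simp
qed

lemma ep_0 [simp]: "ep N 0 B = 1"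
  by (simp add: ep_def)

lemma ep_1 [simp]: "ep N (Suc 0) B = mag N B"
  by (simp add: ep_def mag_def esym_1)

lemma ep_recursion:
  "real (p + 2) * ep N (Suc (Suc p)) B = mag N B * ep N (Suc p) B - (real N - real p) * ep N p B"
  unfolding ep_def mag_def by (subst esym_recursion) simp_all

lemma ep_gt: "N < p \<Longrightarrow> ep N p B = 0"
  by (simp add: ep_def esym_gt)

lemma finite_edges [simp]: "finite (edges N p)"
  unfolding edges_def by (rule finite_subset[of _ "Pow {1..N}"]) auto

lemma ep_eq: "ep N p B = (\<Sum>A\<in>edges N p. chi A B)"
  unfolding ep_def esym_def edges_def
  by (intro sum.cong) (auto simp: chi_prod[symmetric] dest: finite_subset)

lemma card_edges: "card (edges N p) = N choose p"
  unfolding edges_def by (simp add: n_subsets)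

lemma ep_trivial_bound: "fact p * \<bar>ep N p B\<bar> \<le> real N ^ p"
proof -
  have "\<bar>ep N p B\<bar> \<le> (\<Sum>A\<in>edges N p. \<bar>chi A B\<bar>)"
    unfolding ep_eq by (rule sum_abs)
  then have "\<bar>ep N p B\<bar> \<le> real (N choose p)" by (simp add: card_edges)
  then have "fact p * \<bar>ep N p B\<bar> \<le> fact p * real (N choose p)"
    by (rule mult_left_mono) simp
  also have "\<dots> = real ((N choose p) * fact p)" by simp
  also have "\<dots> \<le> real (N ^ p)" using binomial_fact_pow by (simp only: of_nat_le_iff)
  finally show ?thesis by simp
qed

lemma avg_ep_sq:
  "avg N (\<lambda>B. (\<Sum>p\<in>P. b p * ep N p B)\<^sup>2) = (\<Sum>p\<in>P. (b p)\<^sup>2 * real (N choose p))"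
  if "finite P"
proof -
  have orth: "avg N (\<lambda>B. ep N p B * ep N q B) = (if p = q then real (N choose p) else 0)" for p q
  proof -
    have "ep N p B * ep N q B = (\<Sum>A\<in>edges N p. \<Sum>A'\<in>edges N q. chi (sym_diff A A') B)" for B
      unfolding ep_eq sum_product
      by (intro sum.cong refl chi_mult) (auto simp: edges_def dest: finite_subset)
    then have "avg N (\<lambda>B. ep N p B * ep N q B) =
        (\<Sum>A\<in>edges N p. \<Sum>A'\<in>edges N q. avg N (chi (sym_diff A A')))"
      by (simp add: avg_sum)
    also have "\<dots> = (\<Sum>A\<in>edges N p. \<Sum>A'\<in>edges N q. if A' = A then 1 else 0)"
      by (intro sum.cong refl, subst avg_chi) (auto simp: edges_def)
    also have "\<dots> = (\<Sum>A\<in>edges N p. if A \<in> edges N q then 1 else 0)"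
      by (intro sum.cong refl) (simp add: sum.delta)
    also have "\<dots> = (if p = q then real (N choose p) else 0)"
      by (auto simp: card_edges[symmetric]) (auto simp: edges_def)
    finally show ?thesis .
  qed
  have "avg N (\<lambda>B. (\<Sum>p\<in>P. b p * ep N p B)\<^sup>2) =
      avg N (\<lambda>B. \<Sum>p\<in>P. \<Sum>q\<in>P. b p * b q * (ep N p B * ep N q B))"
    by (intro avg_cong) (simp add: power2_eq_square sum_product algebra_simps)
  also have "\<dots> = (\<Sum>p\<in>P. \<Sum>q\<in>P. b p * b q * (if p = q then real (N choose p) else 0))"
    by (simp add: avg_sum avg_cmult orth)
  also have "\<dots> = (\<Sum>p\<in>P. \<Sum>q\<in>P. if q = p then (b p)\<^sup>2 * real (N choose p) else 0)"
    by (intro sum.cong refl) (auto simp: power2_eq_square)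
  finally show ?thesis using that by simp
qed

text \<open>A three-term recursion with coefficients at most \<open>\<bar>M\<bar>\<close> and \<open>N\<close> grows
at most like the powers of \<open>R\<close> as soon as \<open>\<bar>M\<bar> * R + N \<le> R * R\<close>. The
point of the bound is the size \<open>sqrt N ^ p\<close> for typical magnetizations, with no factor depending on
\<open>p\<close>.\<close>

lemma ep_bound:
  assumes "1 \<le> N" "R = \<bar>mag N B\<bar> + sqrt (real N)"
  shows "\<bar>ep N p B\<bar> \<le> R ^ p"
proof -
  define M where "M = mag N B"
  have R0: "0 \<le> R" using assms by simp
  have RR: "\<bar>M\<bar> * R + real N \<le> R * R"
    unfolding assms M_def[symmetric] by (simp add: algebra_simps)
  have "\<bar>ep N p B\<bar> \<le> R ^ p \<and> \<bar>ep N (Suc p) B\<bar> \<le> R ^ Suc p" for p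
  proof (induction p)
    case 0
    then show ?case using assms by simp
  next
    case (Suc p)
    have "\<bar>ep N (Suc (Suc p)) B\<bar> \<le> R ^ Suc (Suc p)"
    proof (cases "p \<le> N")
      case True
      have "\<bar>ep N (Suc (Suc p)) B\<bar> \<le> \<bar>real (p + 2) * ep N (Suc (Suc p)) B\<bar>"
        unfolding abs_mult using mult_right_mono[of 1 "\<bar>real (p + 2)\<bar>" "\<bar>ep N (Suc (Suc p)) B\<bar>"] by simp
      also have "\<dots> \<le> \<bar>M\<bar> * \<bar>ep N (Suc p) B\<bar> + \<bar>real N - real p\<bar> * \<bar>ep N p B\<bar>"
        unfolding ep_recursion M_def abs_mult[symmetric] by (rule abs_triangle_ineq4)
      also have "\<dots> \<le> \<bar>M\<bar> * R ^ Suc p + real N * R ^ p"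
        using Suc True R0 by (intro add_mono mult_mono) auto
      also have "\<dots> = (\<bar>M\<bar> * R + real N) * R ^ p" by (simp add: algebra_simps)
      also have "\<dots> \<le> R * R * R ^ p" using RR R0 by (intro mult_right_mono) auto
      finally show ?thesis by simp
    qed (use R0 in \<open>simp add: ep_gt\<close>)
    with Suc show ?case by simp
  qed
  then show ?thesis by simp
qed

text \<open>For magnetizations of order \<open>N\<close> the symmetric polynomial is close to
\<open>M ^ p / fact p\<close>: the difference counts tuples with a repeated index. Divided by
\<open>fact p\<close> the error is of order \<open>N ^ (p - 1) / fact (p - 2)\<close>, so the summability
of the couplings against \<open>1 / fact (p - 2)\<close> absorbs it.\<close>

lemma ep_approx:
  "\<bar>fact p * ep N p B - mag N B ^ p\<bar> \<le> real p * (real p - 1) / 2 * real N ^ (p - 1)"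
proof (induction p rule: less_induct)
  case (less p)
  define M where "M = mag N B"
  show ?case
  proof (cases "p < 2")
    case True
    then have "p = 0 \<or> p = Suc 0" by auto
    then show ?thesis by auto
  next
    case False
    then obtain q where p: "p = Suc (Suc q)" by (metis less_2_cases_iff nat.exhaust One_nat_def)
    have IH: "\<bar>fact (Suc q) * ep N (Suc q) B - M ^ Suc q\<bar> \<le> real (Suc q) * real q / 2 * real N ^ q"
      using less[of "Suc q"] by (simp add: p M_def)
    have "fact p * ep N p B = fact (Suc q) * (real (q + 2) * ep N (Suc (Suc q)) B)"
      by (simp add: p algebra_simps)
    also have "\<dots> = M * (fact (Suc q) * ep N (Suc q) B) - real (Suc q) * (real N - real q) * (fact q * ep N q B)"
      unfolding ep_recursion M_def by (simp add: algebra_simps)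
    finally have "\<bar>fact p * ep N p B - M ^ p\<bar> =
        \<bar>M * (fact (Suc q) * ep N (Suc q) B - M ^ Suc q) - real (Suc q) * (real N - real q) * (fact q * ep N q B)\<bar>"
      by (simp add: p algebra_simps)
    also have "\<dots> \<le> \<bar>M\<bar> * \<bar>fact (Suc q) * ep N (Suc q) B - M ^ Suc q\<bar> + real (Suc q) * (\<bar>real N - real q\<bar> * (fact q * \<bar>ep N q B\<bar>))"
      by (rule order_trans[OF abs_triangle_ineq4]) (simp add: abs_mult mult.assoc)
    also have "\<dots> \<le> real N * (real (Suc q) * real q / 2 * real N ^ q) + real (Suc q) * (real N * real N ^ q)"
    proof (intro add_mono mult_left_mono)
      show "\<bar>M\<bar> * \<bar>fact (Suc q) * ep N (Suc q) B - M ^ Suc q\<bar> \<le> real N * (real (Suc q) * real q / 2 * real N ^ q)"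
        using IH sum_chi_bound[of N B] by (intro mult_mono) (auto simp: M_def)
      show "\<bar>real N - real q\<bar> * (fact q * \<bar>ep N q B\<bar>) \<le> real N * real N ^ q"
      proof (cases "q \<le> N")
        case True
        then show ?thesis using ep_trivial_bound[of q N B] by (intro mult_mono) auto
      qed (simp add: ep_gt)
    qed simp
    finally show ?thesis by (simp add: p M_def algebra_simps add_divide_distrib)
  qed
qed

lemma avg_exp_mag: "avg N (\<lambda>B. exp (t * mag N B)) = cosh t ^ N"
proof -
  have "exp (t * mag N B) = (\<Prod>i\<in>B. exp (-t)) * (\<Prod>i\<in>{1..N} - B. exp t)" if "B \<subseteq> {1..N}" for B
  proof -
    have "exp (t * mag N B) = (\<Prod>i\<in>{1..N}. exp (t * chi {i} B))"
      by (simp add: mag_def sum_distrib_left exp_sum)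
    also have "\<dots> = (\<Prod>i\<in>B. exp (t * chi {i} B)) * (\<Prod>i\<in>{1..N} - B. exp (t * chi {i} B))"
      using that by (subst prod.subset_diff[of B]) (auto simp: mult.commute)
    finally show ?thesis by (simp add: chi_single)
  qed
  then have "(\<Sum>B\<in>Pow {1..N}. exp (t * mag N B)) =
     (\<Sum>B\<in>Pow {1..N}. (\<Prod>i\<in>B. exp (-t)) * (\<Prod>i\<in>{1..N} - B. exp t))"
    by (intro sum.cong) auto
  also have "\<dots> = (\<Prod>i\<in>{1..N}. exp (-t) + exp t)"
    by (subst prod_add) simp_all
  also have "exp (- t) + exp t = 2 * cosh t"
    by (simp add: cosh_def field_simps)
  also have "(\<Prod>i\<in>{1..N}. 2 * cosh t) = (2 * cosh t) ^ N"
    by simp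
  finally show ?thesis by (simp add: avg_def power_mult_distrib)
qed

lemma cosh_le: "0 \<le> x \<Longrightarrow> x \<le> 1 \<Longrightarrow> cosh x \<le> 1 + (x::real)\<^sup>2"
proof -
  assume x: "0 \<le> x" "x \<le> 1"
  have "exp (-x) \<le> 1 / (1 + x)"
    using exp_ge_add_one_self[of x] x by (simp add: exp_minus field_simps)
  also have "\<dots> \<le> 1 - x + x\<^sup>2"
  proof -
    have "(1 - x + x\<^sup>2) * (1 + x) = 1 + x ^ 3" by (simp add: algebra_simps power2_eq_square power3_eq_cube)
    then show ?thesis using x by (simp add: divide_le_eq)
  qed
  finally show ?thesis using exp_bound[OF x] by (simp add: cosh_def)
qed

lemma power_le_fact_exp: "0 \<le> x \<Longrightarrow> x ^ k \<le> fact k * exp (x::real)"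
proof -
  assume x: "0 \<le> x"
  have "(\<Sum>n\<in>{k}. x ^ n /\<^sub>R fact n) \<le> (\<Sum>n. x ^ n /\<^sub>R fact n)"
    by (rule sum_le_suminf[OF summable_exp_generic]) (use x in auto)
  then show ?thesis by (simp add: exp_def divide_simps mult.commute)
qed

lemma avg_exp_abs_mag:
  assumes "1 \<le> N"
  shows "avg N (\<lambda>B. exp (\<bar>mag N B\<bar> / sqrt (real N))) \<le> 2 * exp 1"
proof -
  let ?s = "1 / sqrt (real N)"
  have "avg N (\<lambda>B. exp (\<bar>mag N B\<bar> / sqrt (real N))) \<le> avg N (\<lambda>B. exp (?s * mag N B) + exp ((-?s) * mag N B))"
    by (intro avg_mono) (auto simp: abs_if)
  also have "\<dots> = 2 * cosh ?s ^ N"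
    unfolding avg_add avg_exp_mag by simp
  also have "cosh ?s ^ N \<le> exp (1 / real N) ^ N"
  proof (rule power_mono)
    have "cosh ?s \<le> 1 + ?s\<^sup>2" using assms by (intro cosh_le) auto
    also have "\<dots> \<le> exp (1 / real N)" by (simp add: power_divide)
    finally show "cosh ?s \<le> exp (1 / real N)" .
  qed (simp add: cosh_real_nonneg)
  also have "exp (1 / real N) ^ N = exp 1"
    using assms by (simp add: exp_of_nat_mult[symmetric])
  finally show ?thesis by simp
qed

section \<open>Moments of the interaction field\<close>

text \<open>The summand 1 makes powers monotone in the exponent.\<close>

definition scaled_mag :: "nat \<Rightarrow> nat set \<Rightarrow> real" where
  "scaled_mag N B = 1 + \<bar>mag N B\<bar> / sqrt (real N)"

lemma scaled_mag_ge_1: "1 \<le> scaled_mag N B"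
  by (simp add: scaled_mag_def)

lemma avg_scaled_mag_power:
  assumes "1 \<le> N"
  shows "avg N (\<lambda>B. scaled_mag N B ^ k) \<le> 2 * fact k * exp 2"
proof -
  have "avg N (\<lambda>B. scaled_mag N B ^ k) \<le> avg N (\<lambda>B. (fact k * exp 1) * exp (\<bar>mag N B\<bar> / sqrt (real N)))"
  proof (rule avg_mono)
    fix B
    have "scaled_mag N B ^ k \<le> fact k * exp (scaled_mag N B)"
      using scaled_mag_ge_1[of N B] by (intro power_le_fact_exp) simp
    then show "scaled_mag N B ^ k \<le> (fact k * exp 1) * exp (\<bar>mag N B\<bar> / sqrt (real N))"
      by (simp add: scaled_mag_def exp_add)
  qed
  also have "\<dots> \<le> (fact k * exp 1) * (2 * exp 1)"
    unfolding avg_cmult using avg_exp_abs_mag[OF assms] by (intro mult_left_mono) auto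
  also have "\<dots> = 2 * fact k * exp 2"
    using exp_add[of 1 "1::real"] by simp
  finally show ?thesis .
qed

lemma ep_scaled_bound:
  assumes "1 \<le> N"
  shows "\<bar>ep N p B\<bar> \<le> sqrt (real N) ^ p * scaled_mag N B ^ p"
proof -
  have "\<bar>mag N B\<bar> + sqrt (real N) = sqrt (real N) * scaled_mag N B"
    using assms by (simp add: scaled_mag_def algebra_simps)
  then show ?thesis
    using ep_bound[OF assms refl, of p B] by (simp add: power_mult_distrib)
qed

lemma abs_sum_power_le:
  fixes x :: "'i \<Rightarrow> real"
  assumes "finite I" "0 < k"
  shows "\<bar>\<Sum>i\<in>I. x i\<bar> ^ k \<le> real (card I) ^ k * (\<Sum>i\<in>I. \<bar>x i\<bar> ^ k)"
proof (cases "I = {}")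
  case True
  then show ?thesis using assms by (simp add: power_0_left)
next
  case False
  define m where "m = Max ((\<lambda>i. \<bar>x i\<bar>) ` I)"
  have "m \<in> (\<lambda>i. \<bar>x i\<bar>) ` I" unfolding m_def using assms False by (intro Max_in) auto
  then obtain j where j: "j \<in> I" "m = \<bar>x j\<bar>" by auto
  have "\<bar>\<Sum>i\<in>I. x i\<bar> \<le> (\<Sum>i\<in>I. \<bar>x i\<bar>)" by (rule sum_abs)
  also have "\<dots> \<le> real (card I) * m"
    using assms by (intro sum_bounded_above) (auto simp: m_def)
  finally have "\<bar>\<Sum>i\<in>I. x i\<bar> ^ k \<le> (real (card I) * m) ^ k" by (intro power_mono) auto
  also have "\<dots> = real (card I) ^ k * \<bar>x j\<bar> ^ k" by (simp add: power_mult_distrib j)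
  also have "\<bar>x j\<bar> ^ k \<le> (\<Sum>i\<in>I. \<bar>x i\<bar> ^ k)"
    using assms j by (intro member_le_sum) auto
  finally show ?thesis by (simp add: mult_left_mono)
qed

lemma abs_add_power_le: "\<bar>x + y\<bar> ^ k \<le> 2 ^ k * (\<bar>x\<bar> ^ k + \<bar>y\<bar> ^ k :: real)"
proof -
  have "\<bar>x + y\<bar> ^ k \<le> (2 * max \<bar>x\<bar> \<bar>y\<bar>) ^ k" by (intro power_mono) auto
  also have "\<dots> = 2 ^ k * (max \<bar>x\<bar> \<bar>y\<bar>) ^ k" by (simp add: power_mult_distrib)
  also have "(max \<bar>x\<bar> \<bar>y\<bar>) ^ k \<le> \<bar>x\<bar> ^ k + \<bar>y\<bar> ^ k" by (simp add: max_def)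
  finally show ?thesis by simp
qed

lemma power_split: "m \<le> n \<Longrightarrow> x ^ (n - m) * x ^ m = (x::real) ^ n"
  by (metis le_add_diff_inverse2 power_add)

lemma fact_add_le: "m + j \<le> N \<Longrightarrow> fact (m + j) \<le> fact m * real N ^ j"
proof (induction j)
  case (Suc j)
  have "fact (m + Suc j) = real (Suc (m + j)) * fact (m + j)" by simp
  also have "\<dots> \<le> real N * (fact m * real N ^ j)"
    using Suc by (intro mult_mono) auto
  finally show ?case by (simp add: algebra_simps)
qed simp

text \<open>In the model \<open>c p\<close> is the square of \<open>\<beta> * \<theta> p\<close>.\<close>

locale couplings =
  fixes c :: "nat \<Rightarrow> real" and S :: real
  assumes c_nonneg: "0 \<le> c p"
    and c_sum: "(\<Sum>p\<in>{2..N}. c p / fact (p - 2)) \<le> S"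
begin

text \<open>The variance scale of one edge variable of size \<open>p\<close>.\<close>

definition bw :: "nat \<Rightarrow> nat \<Rightarrow> real" where
  "bw N p = c p / real N ^ (p - 1)"

text \<open>The sum of \<open>bw N (card e) * chi e B\<close> over the edges whose size lies in
\<open>P\<close>. It is the generating object for second moments: the spin average of its \<open>n\<close>-th power
dominates the total weight of closed hypergraphs with \<open>n\<close> edges.\<close>

definition field :: "nat \<Rightarrow> nat set \<Rightarrow> nat set \<Rightarrow> real" where
  "field N P B = (\<Sum>p\<in>P. bw N p * ep N p B)"

lemma bw_nonneg [simp]: "0 \<le> bw N p"
  by (simp add: bw_def c_nonneg)

lemma S_nonneg: "0 \<le> S"
  using c_sum[of 0] by simp

lemma c_subset_sum: "P \<subseteq> {2..N} \<Longrightarrow> (\<Sum>p\<in>P. c p / fact (p - 2)) \<le> S"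
  by (rule order_trans[OF sum_mono2 c_sum[of N]]) (auto simp: c_nonneg)

lemma c_le: "2 \<le> p \<Longrightarrow> c p \<le> S * fact (p - 2)"
  using c_subset_sum[of "{p}" p] by (simp add: divide_le_eq)

lemma field_low_moment:
  assumes N: "1 \<le> N" and P: "P \<subseteq> {q..N}" "P \<subseteq> {..<Q}" and q: "2 \<le> q"
  shows "\<bar>sqrt (real N) ^ (q - 2) * field N P B\<bar> \<le> (\<Sum>p<Q. c p) * scaled_mag N B ^ Q"
proof -
  define s where "s = sqrt (real N)"
  have s: "1 \<le> s" "real N = s\<^sup>2" using N by (auto simp: s_def)
  define r where "r = scaled_mag N B"
  have r: "1 \<le> r" by (simp add: r_def scaled_mag_ge_1)
  have "\<bar>s ^ (q - 2) * field N P B\<bar> \<le> (\<Sum>p\<in>P. \<bar>s ^ (q - 2) * (bw N p * ep N p B)\<bar>)"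
    unfolding field_def sum_distrib_left by (rule sum_abs)
  also have "\<dots> \<le> (\<Sum>p\<in>P. c p * r ^ Q)"
  proof (rule sum_mono)
    fix p assume p: "p \<in> P"
    then have pq: "q \<le> p" "p < Q" using P by auto
    have s0: "0 \<le> s ^ (q - 2)" using s(1) by (intro zero_le_power) linarith
    have "\<bar>s ^ (q - 2) * (bw N p * ep N p B)\<bar> = s ^ (q - 2) * (bw N p * \<bar>ep N p B\<bar>)"
      unfolding abs_mult abs_of_nonneg[OF s0] abs_of_nonneg[OF bw_nonneg] by (rule refl)
    also have "\<dots> \<le> s ^ (q - 2) * (bw N p * (s ^ p * r ^ p))"
      using ep_scaled_bound[OF N, of p B] s(1) by (intro mult_left_mono) (auto simp: s_def r_def)
    also have "\<dots> = c p * r ^ p * (s ^ (q - 2 + p) / s ^ (2 * (p - 1)))"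
      by (simp add: bw_def s(2) power_add power_mult)
    also have "\<dots> \<le> c p * r ^ Q * 1"
    proof (intro mult_mono)
      have "s ^ (q - 2 + p) \<le> s ^ (2 * (p - 1))" using s pq q by (intro power_increasing) auto
      then show "s ^ (q - 2 + p) / s ^ (2 * (p - 1)) \<le> 1" using s by (simp add: divide_le_eq)
      show "r ^ p \<le> r ^ Q" using r pq by (intro power_increasing) auto
    qed (use r s in \<open>auto simp: c_nonneg\<close>)
    finally show "\<bar>s ^ (q - 2) * (bw N p * ep N p B)\<bar> \<le> c p * r ^ Q" by simp
  qed
  also have "\<dots> \<le> (\<Sum>p<Q. c p * r ^ Q)"
    using P r by (intro sum_mono2) (auto simp: c_nonneg)
  finally show ?thesis by (simp add: s_def r_def sum_distrib_right)
qed

lemma field_high_bound: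
  assumes N: "1 \<le> N" and P: "P \<subseteq> {q..N}" and q: "2 \<le> q"
  shows "\<bar>sqrt (real N) ^ (q - 2) * field N P B\<bar> \<le> sqrt (real N) ^ q * S"
proof -
  define s where "s = sqrt (real N)"
  have s: "1 \<le> s" "real N = s\<^sup>2" using N by (auto simp: s_def)
  have "\<bar>s ^ (q - 2) * field N P B\<bar> \<le> (\<Sum>p\<in>P. \<bar>s ^ (q - 2) * (bw N p * ep N p B)\<bar>)"
    unfolding field_def sum_distrib_left by (rule sum_abs)
  also have "\<dots> \<le> (\<Sum>p\<in>P. s ^ q * (c p / fact (p - 2)))"
  proof (rule sum_mono)
    fix p assume p: "p \<in> P"
    then have pq: "2 \<le> p" using P q by auto
    have "\<bar>ep N p B\<bar> \<le> real N ^ p / fact p"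
      using ep_trivial_bound[of p N B] by (simp add: field_simps)
    also have "\<dots> \<le> real N ^ p / fact (p - 2)"
      by (intro divide_left_mono) (auto intro: fact_mono)
    finally have "\<bar>ep N p B\<bar> \<le> real N ^ p / fact (p - 2)" .
    then have "\<bar>s ^ (q - 2) * (bw N p * ep N p B)\<bar> \<le> s ^ (q - 2) * (bw N p * (real N ^ p / fact (p - 2)))"
      unfolding abs_mult using s by (intro mult_mono) auto
    also have "real N ^ p = real N * real N ^ (p - 1)"
      using pq power_minus_mult[of p "real N"] by (simp add: mult.commute)
    also have "s ^ (q - 2) * (bw N p * (real N * real N ^ (p - 1) / fact (p - 2))) = s ^ (q - 2) * real N * (c p / fact (p - 2))"
      using N by (simp add: bw_def)
    also have "s ^ (q - 2) * real N = s ^ q"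
      unfolding s(2) using q by (rule power_split)
    finally show "\<bar>s ^ (q - 2) * (bw N p * ep N p B)\<bar> \<le> s ^ q * (c p / fact (p - 2))" .
  qed
  also have "\<dots> \<le> s ^ q * S"
    unfolding sum_distrib_left[symmetric] using s P q
    by (intro mult_left_mono c_subset_sum[of _ N]) auto
  finally show ?thesis by (simp add: s_def)
qed

text \<open>Orthogonality of the symmetric polynomials gives a second moment that decays in \<open>N\<close> when
the smallest edge size \<open>Q\<close> exceeds the normalizing size \<open>q\<close>.\<close>

lemma field_high_L2:
  assumes N: "1 \<le> N" and P: "P \<subseteq> {Q..N}" and q: "2 \<le> q" "q \<le> Q"
  shows "avg N (\<lambda>B. (sqrt (real N) ^ (q - 2) * field N P B)\<^sup>2) \<le> S\<^sup>2 * fact (Q - 2) / real N ^ (Q - q)"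
proof -
  have fin: "finite P" using P finite_subset by blast
  have e: "(sqrt (real N) ^ (q - 2))\<^sup>2 = real N ^ (q - 2)"
  proof -
    have "(sqrt (real N) ^ (q - 2))\<^sup>2 = ((sqrt (real N))\<^sup>2) ^ (q - 2)"
      by (simp only: power_mult[symmetric] mult.commute)
    then show ?thesis by simp
  qed
  have "avg N (\<lambda>B. (sqrt (real N) ^ (q - 2) * field N P B)\<^sup>2)
      = real N ^ (q - 2) * (\<Sum>p\<in>P. (bw N p)\<^sup>2 * real (N choose p))"
    unfolding power_mult_distrib avg_cmult field_def avg_ep_sq[OF fin] e by (rule refl)
  also have "\<dots> \<le> real N ^ (q - 2) * (\<Sum>p\<in>P. c p / fact (p - 2) * (S * fact (Q - 2) / real N ^ (Q - 2)))"
  proof (intro mult_left_mono sum_mono)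
    fix p assume p: "p \<in> P"
    then have pq: "Q \<le> p" "p \<le> N" "2 \<le> p" using P q by auto
    have "real (N choose p) * fact p \<le> real N ^ p"
    proof -
      have "real ((N choose p) * fact p) \<le> real (N ^ p)" using binomial_fact_pow by (simp only: of_nat_le_iff)
      then show ?thesis by simp
    qed
    moreover have "real (N choose p) * (fact (p - 2)) \<le> real (N choose p) * fact p"
      by (intro mult_left_mono) (auto intro: fact_mono)
    ultimately have b: "real (N choose p) \<le> real N ^ p / fact (p - 2)" by (simp add: field_simps)
    have f: "fact (p - 2) \<le> fact (Q - 2) * real N ^ (p - Q)"
      using fact_add_le[of "Q - 2" "p - Q" N] pq q by simp
    have "(bw N p)\<^sup>2 * real (N choose p) \<le> (c p * (S * fact (p - 2)) / real N ^ (2 * (p - 1))) * (real N ^ p / fact (p - 2))"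
    proof (intro mult_mono b)
      have "c p * c p \<le> c p * (S * fact (p - 2))" using c_le pq c_nonneg by (intro mult_left_mono) auto
      moreover have "(real N ^ (p - 1))\<^sup>2 = real N ^ (2 * (p - 1))"
        by (simp only: power_mult[symmetric] mult.commute)
      ultimately show "(bw N p)\<^sup>2 \<le> c p * (S * fact (p - 2)) / real N ^ (2 * (p - 1))"
        by (simp only: bw_def power_divide power2_eq_square[of "c p"] divide_right_mono zero_le_power of_nat_0_le_iff)
    qed (auto simp: c_nonneg S_nonneg)
    also have "\<dots> = c p / fact (p - 2) * (S * fact (p - 2) * (real N ^ p / real N ^ (2 * (p - 1))))"
      by simp
    also have "\<dots> \<le> c p / fact (p - 2) * (S * (fact (Q - 2) * real N ^ (p - Q)) * (real N ^ p / real N ^ (2 * (p - 1))))"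
      using f by (intro mult_left_mono mult_right_mono) (auto simp: c_nonneg S_nonneg)
    finally have pre: "(bw N p)\<^sup>2 * real (N choose p) \<le> c p / fact (p - 2) * (S * (fact (Q - 2) * real N ^ (p - Q)) * (real N ^ p / real N ^ (2 * (p - 1))))" .
    have "real N ^ (p - Q) * real N ^ p / real N ^ (2 * (p - 1)) = 1 / real N ^ (Q - 2)"
    proof -
      have "real N ^ (2 * (p - 1)) = real N ^ (p - Q) * real N ^ p * real N ^ (Q - 2)"
        unfolding power_add[symmetric] using pq q by (intro arg_cong[where f="\<lambda>n. real N ^ n"]) auto
      then show ?thesis using N by simp
    qed
    note * = this
    have "S * (fact (Q - 2) * real N ^ (p - Q)) * (real N ^ p / real N ^ (2 * (p - 1))) = S * fact (Q - 2) / real N ^ (Q - 2)"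
    proof -
      have "S * (fact (Q - 2) * real N ^ (p - Q)) * (real N ^ p / real N ^ (2 * (p - 1)))
          = S * fact (Q - 2) * (real N ^ (p - Q) * real N ^ p / real N ^ (2 * (p - 1)))"
        by (simp only: mult.assoc times_divide_eq_right)
      then show ?thesis unfolding * by simp
    qed
    with pre show "(bw N p)\<^sup>2 * real (N choose p) \<le> c p / fact (p - 2) * (S * fact (Q - 2) / real N ^ (Q - 2))"
      by (simp only:)
  qed simp
  also have "\<dots> \<le> real N ^ (q - 2) * (S * (S * fact (Q - 2) / real N ^ (Q - 2)))"
    unfolding sum_distrib_right[symmetric] using P q
    by (intro mult_left_mono mult_right_mono c_subset_sum[of _ N]) (auto simp: S_nonneg)
  also have "\<dots> = S\<^sup>2 * fact (Q - 2) * (real N ^ (q - 2) / real N ^ (Q - 2))"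
    by (simp add: power2_eq_square)
  also have "real N ^ (q - 2) / real N ^ (Q - 2) = 1 / real N ^ (Q - q)"
  proof -
    have "real N ^ (Q - 2) = real N ^ (q - 2) * real N ^ (Q - q)"
      unfolding power_add[symmetric] using q by simp
    then show ?thesis using N by simp
  qed
  finally show ?thesis by simp
qed

text \<open>The estimate has to be uniform in \<open>N\<close> although edge sizes up to \<open>N\<close> occur.
Sizes below a threshold are controlled pointwise by the magnetization. For sizes above it, the trivial bound
\<open>N\<close> to a power is used for all but two of the \<open>k\<close> factors, and the polynomially small
second moment absorbs it.\<close>

lemma field_moment:
  assumes q: "2 \<le> q" and k: "2 \<le> k"
  shows "\<exists>C\<ge>0. \<forall>N\<ge>1. \<forall>P. P \<subseteq> {q..N} \<longrightarrow> avg N (\<lambda>B. \<bar>sqrt (real N) ^ (q - 2) * field N P B\<bar> ^ k) \<le> C"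
proof -
  \<comment> \<open>The threshold makes the gain \<open>1 / N ^ (Q - q)\<close> in the second moment beat
    the loss \<open>sqrt N ^ (q * (k - 2))\<close>.\<close>
  define Q where "Q = k * q"
  have Q: "q \<le> Q" "2 * q \<le> Q" using k by (simp_all add: Q_def)
  define A where "A = (\<Sum>p<Q. c p)"
  have A: "0 \<le> A" by (simp add: A_def sum_nonneg c_nonneg)
  define C where "C = 2 ^ k * (A ^ k * (2 * fact (Q * k) * exp 2) + S ^ k * fact (Q - 2))"
  have "avg N (\<lambda>B. \<bar>sqrt (real N) ^ (q - 2) * field N P B\<bar> ^ k) \<le> C" if N: "1 \<le> N" and P: "P \<subseteq> {q..N}" for N P
  proof -
    define s where "s = sqrt (real N)"
    have s: "1 \<le> s" "real N = s\<^sup>2" using N by (auto simp: s_def)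
    define f1 where "f1 B = s ^ (q - 2) * field N (P \<inter> {..<Q}) B" for B
    define f2 where "f2 B = s ^ (q - 2) * field N (P \<inter> {Q..}) B" for B
    have fin: "finite P" using P finite_subset by blast
    have split: "s ^ (q - 2) * field N P B = f1 B + f2 B" for B
    proof -
      have "P = (P \<inter> {..<Q}) \<union> (P \<inter> {Q..})" by auto
      then have "field N P B = field N (P \<inter> {..<Q}) B + field N (P \<inter> {Q..}) B"
        unfolding field_def using fin by (subst sum.union_disjoint[symmetric]) auto
      then show ?thesis by (simp add: f1_def f2_def algebra_simps)
    qed
    have 1: "avg N (\<lambda>B. \<bar>f1 B\<bar> ^ k) \<le> A ^ k * (2 * fact (Q * k) * exp 2)"
    proof -
      have "avg N (\<lambda>B. \<bar>f1 B\<bar> ^ k) \<le> avg N (\<lambda>B. A ^ k * scaled_mag N B ^ (Q * k))"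
      proof (rule avg_mono)
        fix B
        have "\<bar>f1 B\<bar> \<le> A * scaled_mag N B ^ Q"
          unfolding f1_def A_def s_def using P by (intro field_low_moment N q) auto
        then have "\<bar>f1 B\<bar> ^ k \<le> (A * scaled_mag N B ^ Q) ^ k" by (intro power_mono) auto
        then show "\<bar>f1 B\<bar> ^ k \<le> A ^ k * scaled_mag N B ^ (Q * k)"
          by (simp add: power_mult_distrib power_mult)
      qed
      also have "\<dots> \<le> A ^ k * (2 * fact (Q * k) * exp 2)"
        unfolding avg_cmult using avg_scaled_mag_power[OF N] A by (intro mult_left_mono) auto
      finally show ?thesis .
    qed
    have 2: "avg N (\<lambda>B. \<bar>f2 B\<bar> ^ k) \<le> S ^ k * fact (Q - 2)"
    proof -
      have "avg N (\<lambda>B. \<bar>f2 B\<bar> ^ k) \<le> avg N (\<lambda>B. (s ^ q * S) ^ (k - 2) * (f2 B)\<^sup>2)"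
      proof (rule avg_mono)
        fix B
        have b: "\<bar>f2 B\<bar> \<le> s ^ q * S"
          unfolding f2_def s_def using P by (intro field_high_bound N q) auto
        have "\<bar>f2 B\<bar> ^ k = \<bar>f2 B\<bar> ^ (k - 2) * \<bar>f2 B\<bar> ^ 2"
          using k by (simp only: power_split)
        also have "\<dots> \<le> (s ^ q * S) ^ (k - 2) * \<bar>f2 B\<bar> ^ 2"
          using b by (intro mult_right_mono power_mono) auto
        finally show "\<bar>f2 B\<bar> ^ k \<le> (s ^ q * S) ^ (k - 2) * (f2 B)\<^sup>2" by simp
      qed
      also have "\<dots> \<le> (s ^ q * S) ^ (k - 2) * (S\<^sup>2 * fact (Q - 2) / real N ^ (Q - q))"
        unfolding avg_cmult f2_def s_def using P Q S_nonneg
        by (intro mult_left_mono field_high_L2 N q) auto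
      also have "\<dots> = S ^ k * fact (Q - 2) * (s ^ (q * (k - 2)) / s ^ (2 * (Q - q)))"
      proof -
        have "S ^ k = S ^ (k - 2) * S\<^sup>2" using k by (simp only: power_split)
        then show ?thesis by (simp add: power_mult_distrib s(2) power_mult)
      qed
      also have "\<dots> \<le> S ^ k * fact (Q - 2) * 1"
      proof (intro mult_left_mono)
        have "q * (k - 2) \<le> 2 * (Q - q)" by (simp add: Q_def algebra_simps diff_mult_distrib2)
        then have "s ^ (q * (k - 2)) \<le> s ^ (2 * (Q - q))" using s by (intro power_increasing) auto
        then show "s ^ (q * (k - 2)) / s ^ (2 * (Q - q)) \<le> 1" using s by (simp add: divide_le_eq)
      qed (simp add: S_nonneg)
      finally show ?thesis by simp
    qed
    have "avg N (\<lambda>B. \<bar>s ^ (q - 2) * field N P B\<bar> ^ k) \<le> avg N (\<lambda>B. 2 ^ k * (\<bar>f1 B\<bar> ^ k + \<bar>f2 B\<bar> ^ k))"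
    proof (rule avg_mono)
      fix B
      show "\<bar>s ^ (q - 2) * field N P B\<bar> ^ k \<le> 2 ^ k * (\<bar>f1 B\<bar> ^ k + \<bar>f2 B\<bar> ^ k)"
        unfolding split by (rule abs_add_power_le)
    qed
    also have "\<dots> \<le> C"
      unfolding avg_cmult avg_add C_def using 1 2 by (intro mult_left_mono add_mono) auto
    finally show ?thesis by (simp add: s_def)
  qed
  moreover have "0 \<le> C" using A S_nonneg by (simp add: C_def)
  ultimately show ?thesis by blast
qed

end

text \<open>Chernoff bound; the rate function is the Legendre transform of \<open>ln cosh\<close>. At
\<open>x = 1\<close> the optimal parameter is infinite, and the two extreme configurations are counted
directly.\<close>

lemma mag_tail:
  assumes "0 \<le> x" "x \<le> 1"
  shows "avg N (\<lambda>B. of_bool (real N * x \<le> \<bar>mag N B\<bar>)) \<le> 2 * exp (- (real N * rate_I x))"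
proof (cases "x = 1")
  case False
  then have x: "0 \<le> x" "x < 1" using assms by auto
  define L1 where "L1 = ln (1 + x)"
  define L2 where "L2 = ln (1 - x)"
  have e: "exp L1 = 1 + x" "exp L2 = 1 - x" using x by (simp_all add: L1_def L2_def)
  \<comment> \<open>The optimal Chernoff parameter, the inverse hyperbolic tangent of \<open>x\<close>.\<close>
  define t where "t = (L1 - L2) / 2"
  have "L2 \<le> L1" unfolding L1_def L2_def using x by simp
  then have t: "0 \<le> t" by (simp add: t_def)
  have a: "exp (- (L1 + L2) / 2) * exp L1 = exp t" "exp (- (L1 + L2) / 2) * exp L2 = exp (-t)"
    by (simp_all add: exp_add[symmetric] t_def field_simps)
  have "2 * cosh t = exp (- (L1 + L2) / 2) * exp L1 + exp (- (L1 + L2) / 2) * exp L2"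
    unfolding a by (simp add: cosh_def field_simps)
  also have "\<dots> = exp (- (L1 + L2) / 2) * 2" unfolding e by (simp add: algebra_simps)
  finally have "cosh t = exp (- (L1 + L2) / 2)" by simp
  then have key: "exp (- (t * x)) * cosh t = exp (- rate_I x)"
    by (simp add: exp_add[symmetric] rate_I_def L1_def[symmetric] L2_def[symmetric] t_def field_simps)
  have "avg N (\<lambda>B. of_bool (real N * x \<le> \<bar>mag N B\<bar>))
      \<le> avg N (\<lambda>B. exp (- (t * x)) ^ N * (exp (t * mag N B) + exp ((-t) * mag N B)))"
  proof (rule avg_mono)
    fix B
    have eN: "exp (- (t * x)) ^ N = exp (- (t * (real N * x)))"
      by (simp add: exp_of_nat_mult[symmetric] algebra_simps)
    have "of_bool (real N * x \<le> \<bar>mag N B\<bar>) \<le> exp (t * (\<bar>mag N B\<bar> - real N * x))"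
      using t by auto
    also have "\<dots> = exp (- (t * (real N * x))) * exp (t * \<bar>mag N B\<bar>)"
      by (simp add: exp_add[symmetric] algebra_simps)
    also have "exp (t * \<bar>mag N B\<bar>) \<le> exp (t * mag N B) + exp ((-t) * mag N B)"
      by (auto simp: abs_if)
    finally show "of_bool (real N * x \<le> \<bar>mag N B\<bar>) \<le> exp (- (t * x)) ^ N * (exp (t * mag N B) + exp ((-t) * mag N B))"
      unfolding eN by simp
  qed
  also have "\<dots> = 2 * (exp (- (t * x)) * cosh t) ^ N"
    unfolding avg_cmult avg_add avg_exp_mag by (simp add: power_mult_distrib)
  also have "\<dots> = 2 * exp (- (real N * rate_I x))"
    unfolding key by (simp add: exp_of_nat_mult[symmetric])
  finally show ?thesis .
next
  case True
  have m: "mag N B = real N - 2 * real (card B)" if "B \<subseteq> {1..N}" for B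
  proof -
    have "mag N B = (\<Sum>i\<in>{1..N}. 1 - 2 * of_bool (i \<in> B))"
      unfolding mag_def by (intro sum.cong) (auto simp: chi_single)
    also have "\<dots> = real N - 2 * real (card ({1..N} \<inter> B))"
      by (simp add: sum_subtractf sum_distrib_left[symmetric] Int_def)
    finally show ?thesis using that by (simp add: inf.absorb2)
  qed
  have "of_bool (real N \<le> \<bar>mag N B\<bar>) \<le> (of_bool (B = {}) + of_bool (B = {1..N}) :: real)" if B: "B \<subseteq> {1..N}" for B
  proof (cases "real N \<le> \<bar>mag N B\<bar>")
    case True
    have c: "card B \<le> N" "finite B" using B card_mono[of "{1..N}" B] finite_subset by auto
    with True m[OF B] have "card B = 0 \<or> card B = N" by (auto simp: abs_if split: if_splits)
    then have "B = {} \<or> B = {1..N}"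
    proof
      assume "card B = N" then show ?thesis using card_subset_eq[of "{1..N}" B] B by simp
    qed (use c in auto)
    then show ?thesis by auto
  qed simp
  then have "avg N (\<lambda>B. of_bool (real N * x \<le> \<bar>mag N B\<bar>)) \<le> avg N (\<lambda>B. of_bool (B = {}) + of_bool (B = {1..N}))"
    by (intro avg_mono) (simp add: True)
  also have "\<dots> = 2 / 2 ^ N"
  proof -
    have "avg N (\<lambda>B. of_bool (B = A)) = 1 / 2 ^ N" if "A \<subseteq> {1..N}" for A
      unfolding avg_def of_bool_def using that by (subst sum.delta) auto
    from this[of "{}"] this[of "{1..N}"] show ?thesis by (simp add: avg_add)
  qed
  also have "\<dots> = 2 * exp (- (real N * rate_I x))"
  proof -
    have "exp (real N * ln 2) = (2::real) ^ N" by (simp add: exp_of_nat_mult)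
    then show ?thesis by (simp add: True rate_I_def exp_minus field_simps)
  qed
  finally show ?thesis .
qed

text \<open>By the Chernoff bound the variable \<open>N * rate_I (\<bar>M\<bar> / N)\<close> has an exponential
tail of rate 1, hence exponential moments of every order below 1, uniformly in \<open>N\<close>.\<close>

lemma avg_exp_rate:
  assumes N: "1 \<le> N" and r: "0 \<le> r" "r < 1"
  shows "avg N (\<lambda>B. exp (r * (real N * rate_I (\<bar>mag N B\<bar> / real N)))) \<le> 1 + 2 * exp r / (1 - exp (r - 1))"
proof -
  define m where "m B = \<bar>mag N B\<bar> / real N" for B
  define Y where "Y B = real N * rate_I (m B)" for B
  have m: "0 \<le> m B" "m B \<le> 1" "real N * m B = \<bar>mag N B\<bar>" for B
    using sum_chi_bound[of N B] N by (simp_all add: m_def)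
  have tail: "avg N (\<lambda>B. of_bool (t \<le> Y B)) \<le> 2 * exp (-t)" for t
  proof (cases "\<exists>B\<in>Pow {1..N}. t \<le> Y B")
    case False
    then have "avg N (\<lambda>B. of_bool (t \<le> Y B)) = avg N (\<lambda>B. 0)" by (intro avg_cong) auto
    then show ?thesis by simp
  next
    case True
    define T where "T = {B \<in> Pow {1..N}. t \<le> Y B}"
    have T: "finite T" "T \<noteq> {}" using True by (auto simp: T_def)
    \<comment> \<open>Taking the least value in the level set avoids any appeal to monotonicity of the rate
      function.\<close>
    define x0 where "x0 = Min (m ` T)"
    have "x0 \<in> m ` T" unfolding x0_def using T by (intro Min_in) auto
    then obtain B0 where B0: "B0 \<in> T" "x0 = m B0" by auto
    have "avg N (\<lambda>B. of_bool (t \<le> Y B)) \<le> avg N (\<lambda>B. of_bool (real N * x0 \<le> \<bar>mag N B\<bar>))"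
    proof (rule avg_mono)
      fix B assume B: "B \<subseteq> {1..N}"
      have "real N * x0 \<le> \<bar>mag N B\<bar>" if "t \<le> Y B"
      proof -
        have "x0 \<le> m B" unfolding x0_def using T that B by (intro Min_le) (auto simp: T_def)
        then have "real N * x0 \<le> real N * m B" by (intro mult_left_mono) auto
        then show ?thesis by (simp add: m)
      qed
      then show "(of_bool (t \<le> Y B) :: real) \<le> of_bool (real N * x0 \<le> \<bar>mag N B\<bar>)" by auto
    qed
    also have "\<dots> \<le> 2 * exp (- (real N * rate_I x0))"
      by (rule mag_tail) (simp_all add: B0 m)
    also have "\<dots> \<le> 2 * exp (-t)" using B0 by (simp add: T_def Y_def)
    finally show ?thesis .
  qed
  define L where "L = nat \<lceil>Max (Y ` Pow {1..N})\<rceil>"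
  have L: "Y B \<le> real L" if "B \<subseteq> {1..N}" for B
  proof -
    have "Y B \<le> Max (Y ` Pow {1..N})" using that by (intro Max_ge) auto
    also have "\<dots> \<le> real L" by (simp add: L_def real_nat_ceiling_ge)
    finally show ?thesis .
  qed
  have "avg N (\<lambda>B. exp (r * Y B)) \<le> avg N (\<lambda>B. 1 + (\<Sum>k\<le>L. exp (r * (real k + 1)) * of_bool (real k \<le> Y B)))"
  proof (rule avg_mono)
    fix B assume B: "B \<subseteq> {1..N}"
    show "exp (r * Y B) \<le> 1 + (\<Sum>k\<le>L. exp (r * (real k + 1)) * of_bool (real k \<le> Y B))"
    proof (cases "0 \<le> Y B")
      case True
      define k where "k = nat \<lfloor>Y B\<rfloor>"
      have k: "real k \<le> Y B" "Y B \<le> real k + 1" using True by (auto simp: k_def)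
      have "k \<le> L" using k L[OF B] by (meson of_nat_le_iff order_trans)
      have "exp (r * Y B) \<le> exp (r * (real k + 1)) * of_bool (real k \<le> Y B)"
        using k r by (simp add: mult_left_mono)
      also have "\<dots> \<le> (\<Sum>k\<le>L. exp (r * (real k + 1)) * of_bool (real k \<le> Y B))"
        using \<open>k \<le> L\<close> by (intro member_le_sum[where f="\<lambda>k. exp (r * (real k + 1)) * of_bool (real k \<le> Y B)"]) auto
      finally show ?thesis by simp
    next
      case False
      then have "r * Y B \<le> 0" using r by (simp add: mult_nonneg_nonpos)
      then have "exp (r * Y B) \<le> 1" by simp
      moreover have "0 \<le> (\<Sum>k\<le>L. exp (r * (real k + 1)) * of_bool (real k \<le> Y B))"
        by (intro sum_nonneg) auto
      ultimately show ?thesis by linarith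
    qed
  qed
  also have "\<dots> = 1 + (\<Sum>k\<le>L. exp (r * (real k + 1)) * avg N (\<lambda>B. of_bool (real k \<le> Y B)))"
    unfolding avg_add avg_sum avg_cmult avg_const by (rule refl)
  also have "\<dots> \<le> 1 + (\<Sum>k\<le>L. exp (r * (real k + 1)) * (2 * exp (- real k)))"
    using tail by (intro add_left_mono sum_mono mult_left_mono) auto
  also have "(\<Sum>k\<le>L. exp (r * (real k + 1)) * (2 * exp (- real k))) = 2 * exp r * (\<Sum>k\<le>L. exp (r - 1) ^ k)"
    unfolding sum_distrib_left
    by (intro sum.cong) (auto simp: exp_of_nat_mult[symmetric] exp_add[symmetric] algebra_simps)
  also have "(\<Sum>k\<le>L. exp (r - 1) ^ k) \<le> (\<Sum>k. exp (r - 1) ^ k)"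
    using r by (intro sum_le_suminf summable_geometric) auto
  also have "\<dots> = 1 / (1 - exp (r - 1))" using r by (intro suminf_geometric) auto
  finally show ?thesis by (simp add: Y_def m_def)
qed

context couplings begin

lemma field_upper:
  assumes N: "1 \<le> N" and P: "P \<subseteq> {2..N}"
  shows "field N P B \<le> real N * (\<Sum>p\<in>P. c p * (\<bar>mag N B\<bar> / real N) ^ p / fact p) + S / 2"
proof -
  define m where "m = \<bar>mag N B\<bar> / real N"
  have "field N P B \<le> (\<Sum>p\<in>P. real N * (c p * m ^ p / fact p) + c p / fact (p - 2) / 2)"
    unfolding field_def
  proof (rule sum_mono)
    fix p assume "p \<in> P"
    then have p: "2 \<le> p" using P by auto
    have fp: "fact p = real p * (real p - 1) * fact (p - 2)"
    proof -
      obtain n where "p = Suc (Suc n)" using p by (metis add_2_eq_Suc le_Suc_ex)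
      then show ?thesis by (simp add: algebra_simps)
    qed
    have "fact p * ep N p B \<le> mag N B ^ p + real p * (real p - 1) / 2 * real N ^ (p - 1)"
      using ep_approx[of p N B] by linarith
    also have "mag N B ^ p \<le> \<bar>mag N B\<bar> ^ p" unfolding power_abs[symmetric] by (rule abs_ge_self)
    also have "\<bar>mag N B\<bar> ^ p = real N * m ^ p * real N ^ (p - 1)"
    proof -
      have "real N ^ p = real N * real N ^ (p - 1)"
        using p power_minus_mult[of p "real N"] by (simp add: mult.commute)
      then show ?thesis using N by (simp add: m_def power_divide)
    qed
    finally have "fact p * ep N p B \<le> (real N * m ^ p + real p * (real p - 1) / 2) * real N ^ (p - 1)"
      by (simp add: algebra_simps)
    then have "ep N p B \<le> (real N * m ^ p + real p * (real p - 1) / 2) * real N ^ (p - 1) / fact p"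
      by (simp add: field_simps)
    then have "bw N p * ep N p B \<le> bw N p * ((real N * m ^ p + real p * (real p - 1) / 2) * real N ^ (p - 1) / fact p)"
      by (intro mult_left_mono) auto
    also have "\<dots> = c p * (real N * m ^ p + real p * (real p - 1) / 2) / fact p"
      using N by (simp add: bw_def)
    also have "\<dots> = real N * (c p * m ^ p / fact p) + c p * (real p * (real p - 1)) / fact p / 2"
      by (simp add: add_divide_distrib algebra_simps)
    also have "c p * (real p * (real p - 1)) / fact p = c p / fact (p - 2)"
      unfolding fp using p by simp
    finally show "bw N p * ep N p B \<le> real N * (c p * m ^ p / fact p) + c p / fact (p - 2) / 2" .
  qed
  also have "\<dots> = real N * (\<Sum>p\<in>P. c p * m ^ p / fact p) + (\<Sum>p\<in>P. c p / fact (p - 2)) / 2"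
    by (simp add: sum.distrib sum_distrib_left sum_divide_distrib)
  also have "\<dots> \<le> real N * (\<Sum>p\<in>P. c p * m ^ p / fact p) + S / 2"
    using c_subset_sum[OF P] by simp
  finally show ?thesis by (simp add: m_def)
qed

text \<open>Up to a bounded error the field is \<open>N\<close> times a power series in
\<open>\<bar>M\<bar> / N\<close>. If this series stays below the rate function by a factor \<open>\<rho>\<close>,
exponential moments of every order below \<open>\<rho>\<close> are bounded. Below the critical inverse temperature
such a \<open>\<rho>\<close> above 1 exists, see \<open>beta_gap\<close>.\<close>

lemma exp_moment:
  assumes \<rho>: "0 < \<kappa>" "\<kappa> < \<rho>"
    and I: "\<And>N x. 0 \<le> x \<Longrightarrow> x \<le> 1 \<Longrightarrow> \<rho> * (\<Sum>p\<in>{3..N}. c p * x ^ p / fact p) \<le> rate_I x"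
  shows "\<exists>C\<ge>0. \<forall>N\<ge>1. avg N (\<lambda>B. exp (\<kappa> * field N {3..N} B)) \<le> C"
proof -
  define r where "r = \<kappa> / \<rho>"
  have r: "0 \<le> r" "r < 1" "r * \<rho> = \<kappa>" using \<rho> by (simp_all add: r_def)
  define C where "C = exp (\<kappa> * (S / 2)) * (1 + 2 * exp r / (1 - exp (r - 1)))"
  have "avg N (\<lambda>B. exp (\<kappa> * field N {3..N} B)) \<le> C" if N: "1 \<le> N" for N
  proof -
    have "avg N (\<lambda>B. exp (\<kappa> * field N {3..N} B))
        \<le> avg N (\<lambda>B. exp (\<kappa> * (S / 2)) * exp (r * (real N * rate_I (\<bar>mag N B\<bar> / real N))))"
    proof (rule avg_mono)
      fix B
      define m where "m = \<bar>mag N B\<bar> / real N"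
      have m: "0 \<le> m" "m \<le> 1" using sum_chi_bound[of N B] N by (simp_all add: m_def)
      have "\<kappa> * field N {3..N} B \<le> \<kappa> * (real N * (\<Sum>p\<in>{3..N}. c p * m ^ p / fact p) + S / 2)"
        unfolding m_def using \<rho> N by (intro mult_left_mono field_upper) auto
      also have "\<dots> = \<kappa> * (S / 2) + r * (real N * (\<rho> * (\<Sum>p\<in>{3..N}. c p * m ^ p / fact p)))"
        unfolding r(3)[symmetric] by (simp add: algebra_simps)
      also have "\<dots> \<le> \<kappa> * (S / 2) + r * (real N * rate_I m)"
        using I[OF m] r by (intro add_left_mono mult_left_mono) auto
      finally show "exp (\<kappa> * field N {3..N} B) \<le> exp (\<kappa> * (S / 2)) * exp (r * (real N * rate_I (\<bar>mag N B\<bar> / real N)))"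
        by (simp add: exp_add[symmetric] m_def)
    qed
    also have "\<dots> \<le> C"
      unfolding avg_cmult C_def using avg_exp_rate[OF N r(1,2)] by (intro mult_left_mono) auto
    finally show ?thesis .
  qed
  moreover have "0 \<le> C" using r by (simp add: C_def)
  ultimately show ?thesis by blast
qed

end

section \<open>Closed hypergraphs and positive definiteness\<close>

text \<open>Functions with nonnegative Walsh coefficients. They form a cone closed under products, and their
average, being a Walsh coefficient, is nonnegative.\<close>

inductive pos_def :: "nat \<Rightarrow> (nat set \<Rightarrow> real) \<Rightarrow> bool" for N where
  mono: "0 \<le> a \<Longrightarrow> A \<subseteq> {1..N} \<Longrightarrow> pos_def N (\<lambda>B. a * chi A B)"
| add: "pos_def N f \<Longrightarrow> pos_def N g \<Longrightarrow> pos_def N (\<lambda>B. f B + g B)"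

lemma pos_def_avg: "pos_def N f \<Longrightarrow> 0 \<le> avg N f"
  by (induction rule: pos_def.induct) (auto simp: avg_cmult avg_chi avg_add)

lemma pos_def_zero: "pos_def N (\<lambda>B. 0)"
  using pos_def.mono[of 0 "{}" N] by simp

lemma pos_def_one: "pos_def N (\<lambda>B. 1)"
  using pos_def.mono[of 1 "{}" N] by simp

lemma pos_def_mono_mult:
  assumes "pos_def N g" "0 \<le> a" "A \<subseteq> {1..N}"
  shows "pos_def N (\<lambda>B. (a * chi A B) * g B)"
  using assms(1)
proof (induction rule: pos_def.induct)
  case (mono b A')
  have fin: "finite A" "finite A'" using assms(3) mono finite_subset by blast+
  have "(\<lambda>B. (a * chi A B) * (b * chi A' B)) = (\<lambda>B. (a * b) * chi (sym_diff A A') B)"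
    by (simp add: chi_mult[OF fin, symmetric] algebra_simps)
  moreover have "sym_diff A A' \<subseteq> {1..N}" "0 \<le> a * b" using assms mono by auto
  ultimately show ?case by (simp only: pos_def.mono)
next
  case (add f g)
  then show ?case using pos_def.add[OF add(3,4)] by (simp add: algebra_simps)
qed

lemma pos_def_mult: "pos_def N f \<Longrightarrow> pos_def N g \<Longrightarrow> pos_def N (\<lambda>B. f B * g B)"
proof (induction rule: pos_def.induct)
  case (mono a A)
  then show ?case using pos_def_mono_mult by simp
next
  case (add f1 f2)
  then show ?case using pos_def.add[of N "\<lambda>B. f1 B * g B" "\<lambda>B. f2 B * g B"] by (simp add: algebra_simps)
qed

lemma pos_def_sum: "finite I \<Longrightarrow> (\<And>i. i \<in> I \<Longrightarrow> pos_def N (f i)) \<Longrightarrow> pos_def N (\<lambda>B. \<Sum>i\<in>I. f i B)"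
proof (induction I rule: finite_induct)
  case (insert i I)
  then show ?case using pos_def.add[of N "f i" "\<lambda>B. \<Sum>i\<in>I. f i B"] by simp
qed (simp add: pos_def_zero)

lemma pos_def_prod: "finite I \<Longrightarrow> (\<And>i. i \<in> I \<Longrightarrow> pos_def N (f i)) \<Longrightarrow> pos_def N (\<lambda>B. \<Prod>i\<in>I. f i B)"
proof (induction I rule: finite_induct)
  case (insert i I)
  then show ?case using pos_def_mult[of N "f i" "\<lambda>B. \<Prod>i\<in>I. f i B"] by simp
qed (simp add: pos_def_one)

lemma pos_def_cmult: "pos_def N f \<Longrightarrow> 0 \<le> a \<Longrightarrow> pos_def N (\<lambda>B. a * f B)"
  using pos_def_mono_mult[of N f a "{}"] by simp

lemma pos_def_power: "pos_def N f \<Longrightarrow> pos_def N (\<lambda>B. f B ^ k)"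
  using pos_def_prod[of "{..<k}" N "\<lambda>_. f"] by simp

lemma pos_def_esym:
  assumes "finite E" "\<And>e. e \<in> E \<Longrightarrow> pos_def N (U e)"
  shows "pos_def N (\<lambda>B. esym (\<lambda>e. U e B) E k)"
  unfolding esym_def using assms
  by (intro pos_def_sum pos_def_prod finite_esym_index) (auto dest: finite_subset)

text \<open>In the product of the sum with the symmetric polynomial of degree \<open>k\<close>, the terms with a new
index give \<open>k + 1\<close> times the symmetric polynomial of degree \<open>k + 1\<close>. What is left are
terms with a repeated index, and their Walsh coefficients are nonnegative.\<close>

lemma pos_def_newton:
  assumes "finite E" "\<And>e. e \<in> E \<Longrightarrow> pos_def N (U e)"
  shows "pos_def N (\<lambda>B. (\<Sum>e\<in>E. U e B) * esym (\<lambda>e. U e B) E k - real (Suc k) * esym (\<lambda>e. U e B) E (Suc k))"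
  using assms
proof (induction E arbitrary: k rule: finite_induct)
  case empty
  then show ?case by (simp add: esym_gt pos_def_zero)
next
  case (insert x E)
  let ?X = "\<lambda>B. \<Sum>e\<in>E. U e B" and ?e = "\<lambda>B. esym (\<lambda>e. U e B) E"
  have IH: "pos_def N (\<lambda>B. ?X B * ?e B k - real (Suc k) * ?e B (Suc k))" for k
    using insert by auto
  have x: "pos_def N (U x)" using insert by auto
  show ?case
  proof (cases k)
    case 0
    have "(\<lambda>B. (\<Sum>e\<in>insert x E. U e B) * esym (\<lambda>e. U e B) (insert x E) k - real (Suc k) * esym (\<lambda>e. U e B) (insert x E) (Suc k)) = (\<lambda>B. 0)"
      using insert.hyps by (simp add: 0 esym_1)
    then show ?thesis by (simp only: pos_def_zero)
  next
    case (Suc j)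
    have "pos_def N (\<lambda>B. (?X B * ?e B (Suc j) - real (Suc (Suc j)) * ?e B (Suc (Suc j))) +
        (U x B * (?X B * ?e B j - real (Suc j) * ?e B (Suc j)) + (U x B * U x B) * ?e B j))"
      using insert.prems insert.hyps
      by (intro pos_def.add IH pos_def_mult x pos_def_esym) auto
    also have "(\<lambda>B. (?X B * ?e B (Suc j) - real (Suc (Suc j)) * ?e B (Suc (Suc j))) +
        (U x B * (?X B * ?e B j - real (Suc j) * ?e B (Suc j)) + (U x B * U x B) * ?e B j)) =
      (\<lambda>B. (\<Sum>e\<in>insert x E. U e B) * esym (\<lambda>e. U e B) (insert x E) k - real (Suc k) * esym (\<lambda>e. U e B) (insert x E) (Suc k))"
      unfolding Suc using insert.hyps by (intro ext) (simp add: esym_insert algebra_simps)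
    finally show ?thesis .
  qed
qed

text \<open>Ordered tuples of distinct edges are among all tuples of edges; the surplus has nonnegative Walsh
coefficients. This replaces a count of hypergraphs by a moment.\<close>

lemma pos_def_power_esym:
  assumes "finite E" "\<And>e. e \<in> E \<Longrightarrow> pos_def N (U e)"
  shows "pos_def N (\<lambda>B. (\<Sum>e\<in>E. U e B) ^ n - fact n * esym (\<lambda>e. U e B) E n)"
proof (induction n)
  case 0
  then show ?case using assms by (simp add: pos_def_zero)
next
  case (Suc n)
  let ?X = "\<lambda>B. \<Sum>e\<in>E. U e B" and ?e = "\<lambda>B. esym (\<lambda>e. U e B) E"
  have "pos_def N (\<lambda>B. ?X B * (?X B ^ n - fact n * ?e B n) + fact n * (?X B * ?e B n - real (Suc n) * ?e B (Suc n)))"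
    using assms by (intro pos_def.add pos_def_mult Suc pos_def_sum pos_def_cmult pos_def_newton) auto
  then show ?case by (simp add: algebra_simps)
qed

text \<open>The product that defines the partition function starts at size 3.\<close>

definition all_edges :: "nat \<Rightarrow> nat set set" where
  "all_edges N = {e. e \<subseteq> {1..N} \<and> 3 \<le> card e}"

lemma all_edges_subset: "all_edges N \<subseteq> Pow {1..N}"
  by (auto simp: all_edges_def)

lemma finite_all_edges [simp]: "finite (all_edges N)"
  by (rule finite_subset[OF all_edges_subset]) simp

lemma finite_edge: "e \<in> all_edges N \<Longrightarrow> finite e"
  by (auto simp: all_edges_def dest: finite_subset)

definition closed_sets :: "nat \<Rightarrow> nat \<Rightarrow> nat set set set" where
  "closed_sets N n = {\<Gamma>. \<Gamma> \<subseteq> all_edges N \<and> card \<Gamma> = n \<and> bd \<Gamma> = {}}"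

lemma finite_closed_sets [simp]: "finite (closed_sets N n)"
  by (rule finite_subset[of _ "Pow (all_edges N)"]) (auto simp: closed_sets_def)

lemma avg_prod_chi:
  assumes "\<Gamma> \<subseteq> Pow {1..N}"
  shows "avg N (\<lambda>B. \<Prod>e\<in>\<Gamma>. u e * chi e B) = (if bd \<Gamma> = {} then \<Prod>e\<in>\<Gamma>. u e else 0)"
proof -
  have "finite \<Gamma>" using assms by (rule finite_subset) simp
  moreover have "finite e" if "e \<in> \<Gamma>" for e
    using that assms finite_subset[of e "{1..N}"] by auto
  ultimately have "(\<Prod>e\<in>\<Gamma>. u e * chi e B) = (\<Prod>e\<in>\<Gamma>. u e) * chi (bd \<Gamma>) B" for B
    by (simp add: prod.distrib prod_chi)
  moreover have "bd \<Gamma> \<subseteq> {1..N}" using bd_subset[of \<Gamma>] assms by auto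
  ultimately show ?thesis by (simp add: avg_cmult avg_chi)
qed

lemma avg_esym_subset:
  assumes "E \<subseteq> Pow {1..N}"
  shows "avg N (\<lambda>B. esym (\<lambda>e. u e * chi e B) E n) = (\<Sum>\<Gamma> | \<Gamma> \<subseteq> E \<and> card \<Gamma> = n \<and> bd \<Gamma> = {}. \<Prod>e\<in>\<Gamma>. u e)"
proof -
  have finE: "finite E" using assms finite_subset by auto
  have *: "avg N (\<lambda>B. \<Prod>e\<in>\<Gamma>. u e * chi e B) = (if bd \<Gamma> = {} then \<Prod>e\<in>\<Gamma>. u e else 0)"
    if "\<Gamma> \<subseteq> E" for \<Gamma>
    using that assms by (intro avg_prod_chi) auto
  have "avg N (\<lambda>B. esym (\<lambda>e. u e * chi e B) E n) = (\<Sum>\<Gamma> | \<Gamma> \<subseteq> E \<and> card \<Gamma> = n. if bd \<Gamma> = {} then \<Prod>e\<in>\<Gamma>. u e else 0)"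
    unfolding esym_def avg_sum using * by (intro sum.cong) auto
  also have "\<dots> = (\<Sum>\<Gamma> | \<Gamma> \<subseteq> E \<and> card \<Gamma> = n \<and> bd \<Gamma> = {}. \<Prod>e\<in>\<Gamma>. u e)"
    using finE by (subst sum.inter_filter[symmetric]) (auto simp: finite_esym_index intro!: sum.cong)
  finally show ?thesis .
qed

text \<open>Averaging extracts exactly the closed hypergraphs from a product over edges, and passing from sets to
tuples of edges only adds nonnegative terms.\<close>

lemma closed_sum_le_avg_power:
  assumes "\<And>e. 0 \<le> u e"
  shows "(\<Sum>\<Gamma>\<in>closed_sets N n. \<Prod>e\<in>\<Gamma>. u e) \<le> avg N (\<lambda>B. (\<Sum>e\<in>all_edges N. u e * chi e B) ^ n) / fact n"
proof -
  have "0 \<le> avg N (\<lambda>B. (\<Sum>e\<in>all_edges N. u e * chi e B) ^ n - fact n * esym (\<lambda>e. u e * chi e B) (all_edges N) n)"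
    using assms all_edges_subset by (intro pos_def_avg pos_def_power_esym pos_def.mono) auto
  also have "\<dots> = avg N (\<lambda>B. (\<Sum>e\<in>all_edges N. u e * chi e B) ^ n) - fact n * (\<Sum>\<Gamma>\<in>closed_sets N n. \<Prod>e\<in>\<Gamma>. u e)"
    unfolding avg_diff avg_cmult avg_esym_subset[OF all_edges_subset] closed_sets_def by (rule refl)
  finally show ?thesis by (simp add: field_simps)
qed

lemma exp_remainder_5:
  "exp x - (\<Sum>n<5. x ^ n / fact n) \<le> \<bar>x\<bar> ^ 5 * (1 + exp (x::real))"
proof -
  consider "x = 0" | "0 < x" | "x < 0" by linarith
  then show ?thesis
  proof cases
    case 1
    then have "(\<Sum>n<5. x ^ n / fact n) = (\<Sum>n<5::nat. if n = 0 then 1 else 0)"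
      by (intro sum.cong) (auto simp: power_0_left)
    also have "\<dots> = 1" by (subst sum.delta) auto
    finally show ?thesis using 1 by simp
  next
    case 2
    have "\<exists>t>0. t < x \<and> exp x = (\<Sum>m<5. exp 0 / fact m * x ^ m) + exp t / fact 5 * x ^ 5"
      using 2 by (intro Maclaurin[where diff="\<lambda>_. exp"]) (auto intro!: derivative_eq_intros)
    then obtain t where t: "0 < t" "t < x" "exp x = (\<Sum>m<5. x ^ m / fact m) + exp t / fact 5 * x ^ 5" by auto
    have "exp t / fact 5 * x ^ 5 \<le> (1 + exp x) * x ^ 5"
    proof (intro mult_right_mono)
      have "exp t / fact 5 \<le> exp t / 1" by (intro divide_left_mono) auto
      also have "\<dots> \<le> exp x" using t(2) by simp
      also have "\<dots> \<le> 1 + exp x" by simp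
      finally show "exp t / fact 5 \<le> 1 + exp x" .
    qed (use 2 in auto)
    then show ?thesis using t(3) 2 by (simp add: mult.commute)
  next
    case 3
    have "\<exists>t. x < t \<and> t < 0 \<and> exp x = (\<Sum>m<5. exp 0 / fact m * x ^ m) + exp t / fact 5 * x ^ 5"
      using 3 by (intro Maclaurin_minus[where diff="\<lambda>_. exp"]) (auto intro!: derivative_eq_intros)
    then obtain t where t: "x < t" "t < 0" "exp x = (\<Sum>m<5. x ^ m / fact m) + exp t / fact 5 * x ^ 5" by auto
    have "x ^ 5 \<le> 0" using 3 by (simp add: power_le_zero_eq)
    then have "exp t / fact 5 * x ^ 5 \<le> 0" by (intro mult_nonneg_nonpos) auto
    moreover have "0 \<le> \<bar>x\<bar> ^ 5 * (1 + exp x)" by (intro mult_nonneg_nonneg) (auto simp: add_nonneg_nonneg)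
    ultimately show ?thesis using t(3) by linarith
  qed
qed

text \<open>All moments of a function with nonnegative Walsh coefficients are nonnegative. So the sum over
hypergraphs with at least five edges is at most the tail of the exponential series, of which the remainder is of
fifth order.\<close>

lemma closed_sum_large:
  fixes u :: "nat set \<Rightarrow> real" and N :: nat
  assumes "\<And>e. 0 \<le> u e"
  defines "X \<equiv> \<lambda>B. \<Sum>e\<in>all_edges N. u e * chi e B"
  shows "(\<Sum>n\<in>{5..L}. \<Sum>\<Gamma>\<in>closed_sets N n. \<Prod>e\<in>\<Gamma>. u e) \<le> avg N (\<lambda>B. \<bar>X B\<bar> ^ 5 * (1 + exp (X B)))"
proof -
  define a where "a n = avg N (\<lambda>B. X B ^ n / fact n)" for n
  have a_alt: "a n = avg N (\<lambda>B. X B ^ n) / fact n" for n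
    unfolding a_def using avg_cmult[of N "1 / fact n"] by simp
  have pd: "pos_def N X"
    unfolding X_def using assms all_edges_subset by (intro pos_def_sum pos_def.mono) auto
  have a_nonneg: "0 \<le> a n" for n
    unfolding a_alt using pos_def_avg[OF pos_def_power[OF pd]] by simp
  have a_sums: "a sums avg N (\<lambda>B. exp (X B))"
  proof -
    have "(\<lambda>n. X B ^ n / fact n) sums exp (X B)" for B
      using exp_converges[of "X B"] by (simp add: divide_inverse mult.commute)
    then show ?thesis unfolding a_def avg_def by (intro sums_divide sums_sum) auto
  qed
  have "(\<Sum>n\<in>{5..L}. \<Sum>\<Gamma>\<in>closed_sets N n. \<Prod>e\<in>\<Gamma>. u e) \<le> (\<Sum>n\<in>{5..L}. a n)"
    unfolding a_alt X_def using assms by (intro sum_mono closed_sum_le_avg_power) auto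
  also have "\<dots> \<le> (\<Sum>n. a n) - (\<Sum>n<5. a n)"
  proof -
    have "(\<Sum>n\<in>{..<5} \<union> {5..L}. a n) \<le> (\<Sum>n. a n)"
      using a_sums a_nonneg by (intro sum_le_suminf) (auto simp: sums_iff)
    also have "(\<Sum>n\<in>{..<5} \<union> {5..L}. a n) = (\<Sum>n<5. a n) + (\<Sum>n\<in>{5..L}. a n)"
      by (intro sum.union_disjoint) auto
    finally show ?thesis by simp
  qed
  also have "\<dots> = avg N (\<lambda>B. exp (X B) - (\<Sum>n<5. X B ^ n / fact n))"
  proof -
    have s: "suminf a = avg N (\<lambda>B. exp (X B))" using a_sums by (simp add: sums_iff)
    show ?thesis unfolding avg_diff avg_sum s by (simp add: a_def)
  qed
  also have "\<dots> \<le> avg N (\<lambda>B. \<bar>X B\<bar> ^ 5 * (1 + exp (X B)))"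
    by (intro avg_mono exp_remainder_5)
  finally show ?thesis .
qed

lemma sum_all_edges:
  "(\<Sum>e\<in>all_edges N. f (card e) * chi e B) = (\<Sum>p\<in>{3..N}. f p * ep N p B)"
proof -
  have "all_edges N = (\<Union>p\<in>{3..N}. edges N p)"
  proof (intro equalityI subsetI)
    fix e assume e: "e \<in> all_edges N"
    then have "card e \<le> N" using card_mono[of "{1..N}" e] by (simp add: all_edges_def)
    with e show "e \<in> (\<Union>p\<in>{3..N}. edges N p)" by (auto simp: all_edges_def edges_def)
  qed (auto simp: all_edges_def edges_def)
  then have "(\<Sum>e\<in>all_edges N. f (card e) * chi e B) = (\<Sum>p\<in>{3..N}. \<Sum>e\<in>edges N p. f (card e) * chi e B)"
    by (simp only:) (subst sum.UNION_disjoint; auto simp: edges_def)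
  also have "\<dots> = (\<Sum>p\<in>{3..N}. f p * ep N p B)"
    by (auto simp: ep_eq sum_distrib_left edges_def intro!: sum.cong)
  finally show ?thesis .
qed

text \<open>It trades the product of a large power with \<open>exp x\<close> for a higher power and a slightly
larger exponential moment, in three regimes according to which factor dominates.\<close>

lemma young_exp:
  fixes a x \<kappa> :: real
  assumes "0 \<le> a" "1 < \<kappa>" "1 / (\<kappa> - 1) \<le> real j"
  shows "a * exp x \<le> a + a ^ (j + 1) + exp (\<kappa> * x)"
proof -
  consider "x \<le> 0" | "0 < x" "a \<le> exp ((\<kappa> - 1) * x)" | "0 < x" "exp ((\<kappa> - 1) * x) < a" by linarith
  then show ?thesis
  proof cases
    case 1
    then have "a * exp x \<le> a * 1" using assms by (intro mult_left_mono) auto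
    then show ?thesis using assms by (simp add: add_increasing2)
  next
    case 2
    then have "a * exp x \<le> exp ((\<kappa> - 1) * x) * exp x" by (intro mult_right_mono) auto
    also have "\<dots> = exp (\<kappa> * x)" by (simp add: exp_add[symmetric] algebra_simps)
    finally show ?thesis using assms by (simp add: add_increasing)
  next
    case 3
    have "1 \<le> real j * (\<kappa> - 1)" using assms by (simp add: field_simps)
    then have "1 * x \<le> real j * (\<kappa> - 1) * x" using 3 by (intro mult_right_mono) auto
    then have "exp x \<le> exp ((\<kappa> - 1) * x) ^ j" by (simp add: exp_of_nat_mult[symmetric] mult.assoc)
    also have "\<dots> \<le> a ^ j" using 3 by (intro power_mono) auto
    finally have "a * exp x \<le> a * a ^ j" using assms by (intro mult_left_mono) auto
    then show ?thesis using assms by (simp add: add_increasing add_increasing2)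
  qed
qed

context couplings begin

text \<open>Hypergraphs with five or more edges of size at least \<open>q\<close> have weight at least
\<open>5 * (q - 2)\<close>, which exceeds \<open>K\<close>. The fifth moment of the field normalized by
\<open>sqrt N ^ (q - 2)\<close> carries this power of \<open>N\<close>, and the exponential moment takes care
of all larger numbers of edges at once.\<close>

lemma tail_large:
  assumes q: "3 \<le> q" "\<And>p. 3 \<le> p \<Longrightarrow> p < q \<Longrightarrow> c p = 0"
    and K: "K + 1 \<le> 5 * (q - 2)"
    and \<kappa>: "1 < \<kappa>" "\<And>N. 1 \<le> N \<Longrightarrow> avg N (\<lambda>B. exp (\<kappa> * field N {3..N} B)) \<le> C0"
  shows "\<exists>C\<ge>0. \<forall>N\<ge>1. \<forall>L. sqrt (real N) ^ (K + 1) * (\<Sum>n\<in>{5..L}. \<Sum>\<Gamma>\<in>closed_sets N n. \<Prod>e\<in>\<Gamma>. bw N (card e)) \<le> C"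
proof -
  obtain j :: nat where j: "1 / (\<kappa> - 1) \<le> real j" using real_arch_simple by blast
  obtain C1 where C1: "0 \<le> C1" "\<And>N P. 1 \<le> N \<Longrightarrow> P \<subseteq> {q..N} \<Longrightarrow> avg N (\<lambda>B. \<bar>sqrt (real N) ^ (q - 2) * field N P B\<bar> ^ 5) \<le> C1"
    using field_moment[of q 5] q by auto
  obtain C2 where C2: "0 \<le> C2" "\<And>N P. 1 \<le> N \<Longrightarrow> P \<subseteq> {q..N} \<Longrightarrow> avg N (\<lambda>B. \<bar>sqrt (real N) ^ (q - 2) * field N P B\<bar> ^ (5 * (j + 1))) \<le> C2"
    using field_moment[of q "5 * (j + 1)"] q by auto
  define C where "C = C1 + (C1 + C2 + \<bar>C0\<bar>)"
  have "sqrt (real N) ^ (K + 1) * (\<Sum>n\<in>{5..L}. \<Sum>\<Gamma>\<in>closed_sets N n. \<Prod>e\<in>\<Gamma>. bw N (card e)) \<le> C"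
    if N: "1 \<le> N" for N L
  proof -
    define X where "X B = field N {3..N} B" for B
    have X_alt: "X B = (\<Sum>e\<in>all_edges N. bw N (card e) * chi e B)" for B
      unfolding X_def field_def sum_all_edges by (rule refl)
    have X_q: "X B = field N {q..N} B" for B
      unfolding X_def field_def using q by (intro sum.mono_neutral_right) (auto simp: bw_def)
    define lam where "lam = sqrt (real N) ^ (q - 2)"
    have lam: "0 \<le> lam" by (simp add: lam_def)
    have "sqrt (real N) ^ (K + 1) \<le> sqrt (real N) ^ (5 * (q - 2))"
      using N K by (intro power_increasing) auto
    also have "\<dots> = lam ^ 5" unfolding lam_def power_mult[symmetric] by (simp only: mult.commute)
    finally have s5: "sqrt (real N) ^ (K + 1) \<le> lam ^ 5" .
    have nn: "0 \<le> (\<Sum>n\<in>{5..L}. \<Sum>\<Gamma>\<in>closed_sets N n. \<Prod>e\<in>\<Gamma>. bw N (card e))"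
      by (intro sum_nonneg prod_nonneg) auto
    have "sqrt (real N) ^ (K + 1) * (\<Sum>n\<in>{5..L}. \<Sum>\<Gamma>\<in>closed_sets N n. \<Prod>e\<in>\<Gamma>. bw N (card e))
        \<le> lam ^ 5 * avg N (\<lambda>B. \<bar>X B\<bar> ^ 5 * (1 + exp (X B)))"
      unfolding X_alt using s5 nn lam closed_sum_large[of "\<lambda>e. bw N (card e)" N L]
      by (intro mult_mono) auto
    also have "\<dots> = avg N (\<lambda>B. \<bar>lam * X B\<bar> ^ 5 + \<bar>lam * X B\<bar> ^ 5 * exp (X B))"
      unfolding avg_cmult[symmetric] using lam
      by (intro avg_cong) (simp add: abs_mult power_mult_distrib algebra_simps)
    also have "\<dots> \<le> avg N (\<lambda>B. \<bar>lam * X B\<bar> ^ 5 + (\<bar>lam * X B\<bar> ^ 5 + \<bar>lam * X B\<bar> ^ (5 * (j + 1)) + exp (\<kappa> * X B)))"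
      unfolding power_mult[of _ 5 "j + 1"] by (intro avg_mono add_left_mono young_exp[OF _ \<kappa>(1) j]) simp
    also have "\<dots> \<le> C"
      unfolding avg_add C_def lam_def X_q
      using C1(2)[OF N order_refl] C2(2)[OF N order_refl] \<kappa>(2)[OF N] unfolding X_def[symmetric] X_q
      by (intro add_mono) auto
    finally show ?thesis .
  qed
  moreover have "0 \<le> C" using C1 C2 by (simp add: C_def)
  ultimately show ?thesis by blast
qed

text \<open>A closed hypergraph has at most half as many vertices as the sum of its edge sizes. Hence all copies of
it together carry a total variance of order \<open>1 / sqrt N ^ weight\<close>.\<close>

definition weight :: "nat set set \<Rightarrow> nat" where
  "weight \<Gamma> = (\<Sum>e\<in>\<Gamma>. card e - 2)"

text \<open>For a bounded number of edges the sizes are still unbounded. The coefficients are multiplied by a power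
of \<open>sqrt N\<close> truncated at size \<open>K + 3\<close>; a weight above \<open>K\<close> is then rewarded
by at least \<open>sqrt N ^ (K + 1)\<close>, while the moments of the field with the new coefficients are still
bounded.\<close>

lemma tail_small:
  assumes n: "2 \<le> n"
  shows "\<exists>C\<ge>0. \<forall>N\<ge>1. sqrt (real N) ^ (K + 1) * (\<Sum>\<Gamma> | \<Gamma> \<in> closed_sets N n \<and> K + 1 \<le> weight \<Gamma>. \<Prod>e\<in>\<Gamma>. bw N (card e)) \<le> C"
proof -
  define Q where "Q = K + 3"
  obtain f where f: "\<And>q. 2 \<le> q \<Longrightarrow> 0 \<le> f q" "\<And>q N P. 2 \<le> q \<Longrightarrow> 1 \<le> N \<Longrightarrow> P \<subseteq> {q..N} \<Longrightarrow>
      avg N (\<lambda>B. \<bar>sqrt (real N) ^ (q - 2) * field N P B\<bar> ^ n) \<le> f q"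
    using field_moment[OF _ n] by metis
  define C where "C = real (Suc Q) ^ n * (\<Sum>q\<in>{3..Q}. f q)"
  have C0: "0 \<le> C" unfolding C_def using f(1) by (intro mult_nonneg_nonneg sum_nonneg) auto
  have "sqrt (real N) ^ (K + 1) * (\<Sum>\<Gamma> | \<Gamma> \<in> closed_sets N n \<and> K + 1 \<le> weight \<Gamma>. \<Prod>e\<in>\<Gamma>. bw N (card e)) \<le> C"
    if N: "1 \<le> N" for N
  proof -
    define s where "s = sqrt (real N)"
    have s: "1 \<le> s" using N by (simp add: s_def)
    define g where "g p = s ^ (min p Q - 2) * bw N p" for p
    have g: "0 \<le> g p" for p using s by (simp add: g_def)
    have "s ^ (K + 1) * (\<Sum>\<Gamma> | \<Gamma> \<in> closed_sets N n \<and> K + 1 \<le> weight \<Gamma>. \<Prod>e\<in>\<Gamma>. bw N (card e))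
        \<le> (\<Sum>\<Gamma> | \<Gamma> \<in> closed_sets N n \<and> K + 1 \<le> weight \<Gamma>. \<Prod>e\<in>\<Gamma>. g (card e))"
      unfolding sum_distrib_left
    proof (rule sum_mono)
      fix \<Gamma> assume \<Gamma>: "\<Gamma> \<in> {\<Gamma>. \<Gamma> \<in> closed_sets N n \<and> K + 1 \<le> weight \<Gamma>}"
      then have sub: "\<Gamma> \<subseteq> all_edges N" and fin: "finite \<Gamma>" by (auto simp: closed_sets_def dest: finite_subset)
      have "K + 1 \<le> (\<Sum>e\<in>\<Gamma>. min (card e) Q - 2)"
      proof (cases "\<exists>e\<in>\<Gamma>. Q < card e")
        case True
        then obtain e where e: "e \<in> \<Gamma>" "Q < card e" by auto
        have "(\<lambda>e. min (card e) Q - 2) e \<le> (\<Sum>e\<in>\<Gamma>. min (card e) Q - 2)"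
          using e fin by (intro member_le_sum) auto
        then show ?thesis using e by (simp add: Q_def)
      next
        case False
        then have "(\<Sum>e\<in>\<Gamma>. min (card e) Q - 2) = weight \<Gamma>"
          unfolding weight_def by (intro sum.cong) (auto simp: min_def not_less)
        then show ?thesis using \<Gamma> by simp
      qed
      then have "s ^ (K + 1) \<le> s ^ (\<Sum>e\<in>\<Gamma>. min (card e) Q - 2)" using s by (intro power_increasing) auto
      then have "s ^ (K + 1) * (\<Prod>e\<in>\<Gamma>. bw N (card e)) \<le> s ^ (\<Sum>e\<in>\<Gamma>. min (card e) Q - 2) * (\<Prod>e\<in>\<Gamma>. bw N (card e))"
        by (intro mult_right_mono prod_nonneg) auto
      also have "\<dots> = (\<Prod>e\<in>\<Gamma>. g (card e))" by (simp add: g_def prod.distrib power_sum)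
      finally show "s ^ (K + 1) * (\<Prod>e\<in>\<Gamma>. bw N (card e)) \<le> (\<Prod>e\<in>\<Gamma>. g (card e))" .
    qed
    also have "\<dots> \<le> (\<Sum>\<Gamma>\<in>closed_sets N n. \<Prod>e\<in>\<Gamma>. g (card e))"
      by (intro sum_mono2) (auto intro!: prod_nonneg g)
    also have "\<dots> \<le> avg N (\<lambda>B. (\<Sum>e\<in>all_edges N. g (card e) * chi e B) ^ n) / fact n"
      by (rule closed_sum_le_avg_power) (rule g)
    also have "\<dots> \<le> avg N (\<lambda>B. (\<Sum>e\<in>all_edges N. g (card e) * chi e B) ^ n) / 1"
    proof (intro divide_left_mono)
      show "0 \<le> avg N (\<lambda>B. (\<Sum>e\<in>all_edges N. g (card e) * chi e B) ^ n)"
        using g all_edges_subset by (intro pos_def_avg pos_def_power pos_def_sum pos_def.mono) auto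
    qed auto
    also have "\<dots> \<le> avg N (\<lambda>B. real (Suc Q) ^ n * (\<Sum>q\<in>{3..Q}. \<bar>s ^ (q - 2) * field N ({3..N} \<inter> {p. min p Q = q}) B\<bar> ^ n))"
      unfolding div_by_1
    proof (rule avg_mono)
      fix B
      have "(\<Sum>e\<in>all_edges N. g (card e) * chi e B) = (\<Sum>p\<in>{3..N}. g p * ep N p B)"
        by (rule sum_all_edges)
      also have "\<dots> = (\<Sum>q\<in>{3..Q}. \<Sum>p\<in>{p\<in>{3..N}. min p Q = q}. g p * ep N p B)"
        by (intro sum.group[symmetric]) (auto simp: Q_def)
      also have "\<dots> = (\<Sum>q\<in>{3..Q}. s ^ (q - 2) * field N ({3..N} \<inter> {p. min p Q = q}) B)"
        unfolding field_def sum_distrib_left by (intro sum.cong) (auto simp: g_def)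
      finally have eq: "(\<Sum>e\<in>all_edges N. g (card e) * chi e B) = (\<Sum>q\<in>{3..Q}. s ^ (q - 2) * field N ({3..N} \<inter> {p. min p Q = q}) B)" .
      have "(\<Sum>e\<in>all_edges N. g (card e) * chi e B) ^ n \<le> \<bar>\<Sum>q\<in>{3..Q}. s ^ (q - 2) * field N ({3..N} \<inter> {p. min p Q = q}) B\<bar> ^ n"
        unfolding eq unfolding power_abs[symmetric] by (rule abs_ge_self)
      also have "\<dots> \<le> real (card {3..Q}) ^ n * (\<Sum>q\<in>{3..Q}. \<bar>s ^ (q - 2) * field N ({3..N} \<inter> {p. min p Q = q}) B\<bar> ^ n)"
        using n by (intro abs_sum_power_le) auto
      also have "\<dots> \<le> real (Suc Q) ^ n * (\<Sum>q\<in>{3..Q}. \<bar>s ^ (q - 2) * field N ({3..N} \<inter> {p. min p Q = q}) B\<bar> ^ n)"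
        by (intro mult_right_mono power_mono sum_nonneg) auto
      finally show "(\<Sum>e\<in>all_edges N. g (card e) * chi e B) ^ n \<le> real (Suc Q) ^ n * (\<Sum>q\<in>{3..Q}. \<bar>s ^ (q - 2) * field N ({3..N} \<inter> {p. min p Q = q}) B\<bar> ^ n)" .
    qed
    also have "\<dots> \<le> C"
      unfolding avg_cmult avg_sum C_def s_def
      by (intro mult_left_mono sum_mono f(2) N) (auto simp: min_def split: if_splits)
    finally show ?thesis by (simp add: s_def)
  qed
  then show ?thesis using C0 by blast
qed

end

section \<open>Symmetric polynomials of the spins in the Gaussian limit\<close>

abbreviation gauss :: "real measure" where "gauss \<equiv> std_normal_distribution"

lemma gauss_integral: "f \<in> borel_measurable borel \<Longrightarrow> (\<integral>x. f x \<partial>gauss) = (\<integral>x. std_normal_density x * f x \<partial>lborel)"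
  by (subst integral_density) (auto simp: normal_density_nonneg)

lemma gauss_integrable_power: "integrable gauss (\<lambda>x. x ^ k)"
  by (subst integrable_density) (auto simp: normal_density_nonneg integrable_std_normal_moment)

lemma gauss_power_Suc: "(\<integral>x. x ^ Suc k \<partial>gauss) = real k * (\<integral>x. x ^ (k - 1) \<partial>gauss)"
proof (cases "even k")
  case True
  then obtain j where j: "k = 2 * j" by auto
  have "(\<integral>x. x ^ Suc k \<partial>gauss) = 0"
    using integral_std_normal_moment_odd[of j] by (simp add: gauss_integral j)
  moreover have "real k * (\<integral>x. x ^ (k - 1) \<partial>gauss) = 0"
  proof (cases j)
    case (Suc i)
    then have "k - 1 = 2 * i + 1" by (simp add: j)
    then show ?thesis using integral_std_normal_moment_odd[of i] by (simp add: gauss_integral)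
  qed (simp add: j)
  ultimately show ?thesis by simp
next
  case False
  then obtain j where j: "k = 2 * j + 1" by (auto elim: oddE)
  have 1: "(\<integral>x. x ^ Suc k \<partial>gauss) = fact (2 * (Suc j)) / (2 ^ Suc j * fact (Suc j))"
    using integral_std_normal_moment_even[of "Suc j"] by (simp add: gauss_integral j)
  have 2: "(\<integral>x. x ^ (k - 1) \<partial>gauss) = fact (2 * j) / (2 ^ j * fact j)"
    using integral_std_normal_moment_even[of j] by (simp add: gauss_integral j)
  have "fact (2 * Suc j) = (2 * real j + 2) * ((2 * real j + 1) * fact (2 * j))" by (simp add: algebra_simps)
  moreover have "2 ^ Suc j * fact (Suc j) = (2 * real j + 2) * (2 ^ j * fact j)" by (simp add: algebra_simps)
  moreover have "2 * real j + 2 \<noteq> 0" by linarith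
  ultimately have "fact (2 * (Suc j)) / (2 ^ Suc j * fact (Suc j)) = (2 * real j + 1) * fact (2 * j) / (2 ^ j * fact j)"
    by (simp only: nonzero_mult_divide_mult_cancel_left not_False_eq_True)
  then show ?thesis unfolding 1 2 by (simp add: j)
qed

text \<open>A class of test functions that contains the Hermite polynomials and is stable under the operations used,
without a formal polynomial attached.\<close>

definition poly_like :: "(real \<Rightarrow> real) \<Rightarrow> bool" where
  "poly_like f \<longleftrightarrow> (\<forall>k. integrable gauss (\<lambda>x. f x * x ^ k))"

lemma poly_like_integrable: "poly_like f \<Longrightarrow> integrable gauss f"
  unfolding poly_like_def by (metis (no_types, lifting) mult.right_neutral power_0 Bochner_Integration.integrable_cong)

lemma poly_like_mult_x: "poly_like f \<Longrightarrow> poly_like (\<lambda>x. x * f x)"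
  unfolding poly_like_def
proof
  fix k assume "\<forall>k. integrable gauss (\<lambda>x. f x * x ^ k)"
  then have "integrable gauss (\<lambda>x. f x * x ^ Suc k)" by blast
  then show "integrable gauss (\<lambda>x. x * f x * x ^ k)" by (simp add: algebra_simps)
qed

lemma poly_like_lin: "poly_like f \<Longrightarrow> poly_like g \<Longrightarrow> poly_like (\<lambda>x. f x - c * g x)"
  unfolding poly_like_def by (auto simp: left_diff_distrib mult.assoc)

lemma poly_like_one: "poly_like (\<lambda>x. 1)"
  unfolding poly_like_def by (simp add: gauss_integrable_power)

lemma poly_like_hermite: "poly_like f \<Longrightarrow> poly_like (\<lambda>x. hermite n x * f x)"
proof (induction n rule: less_induct)
  case (less n)
  consider "n = 0" | "n = Suc 0" | m where "n = Suc (Suc m)" by (metis not0_implies_Suc)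
  then show ?case
  proof cases
    case 3
    have "poly_like (\<lambda>x. x * (hermite (Suc m) x * f x) - real (Suc m) * (hermite m x * f x))"
      using less 3 by (intro poly_like_lin poly_like_mult_x) auto
    then show ?thesis by (simp add: 3 algebra_simps)
  qed (use less poly_like_mult_x in auto)
qed

text \<open>Gaussian integration by parts, which lowers the Hermite index and differentiates the power.\<close>

lemma gauss_hermite_power:
  "(\<integral>x. hermite (Suc n) x * x ^ k \<partial>gauss) = real k * (\<integral>x. hermite n x * x ^ (k - 1) \<partial>gauss)"
proof (induction n arbitrary: k rule: less_induct)
  case (less n)
  define a where "a n k = (\<integral>x. hermite n x * x ^ k \<partial>gauss)" for n k
  have int: "integrable gauss (\<lambda>x. hermite n x * x ^ k)" for n k
    using poly_like_hermite[OF poly_like_one, of n] by (simp add: poly_like_def)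
  have rec: "a (Suc (Suc n)) k = a (Suc n) (Suc k) - real (Suc n) * a n k" for n k
  proof -
    have "a (Suc (Suc n)) k = (\<integral>x. hermite (Suc n) x * x ^ Suc k - real (Suc n) * (hermite n x * x ^ k) \<partial>gauss)"
      unfolding a_def by (intro Bochner_Integration.integral_cong) (auto simp: algebra_simps)
    also have "\<dots> = a (Suc n) (Suc k) - real (Suc n) * a n k"
      unfolding a_def using int[of "Suc n" "Suc k"] int[of n k]
      by (subst Bochner_Integration.integral_diff) auto
    finally show ?thesis .
  qed
  have IH: "a (Suc m) k = real k * a m (k - 1)" if "m < n" for m k
    using less[OF that] by (simp add: a_def)
  have "a (Suc n) k = real k * a n (k - 1)"
  proof (cases n)
    case 0
    then show ?thesis using gauss_power_Suc[of k] by (simp add: a_def)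
  next
    case (Suc m)
    have 1: "a (Suc n) k = real (Suc k) * a m k - real (Suc m) * a m k"
      using rec[of m k] IH[of m "Suc k"] by (simp add: Suc)
    show ?thesis
    proof (cases k)
      case 0
      show ?thesis
      proof (cases m)
        case 0
        then show ?thesis using 1 \<open>k = 0\<close> by simp
      next
        case (Suc l)
        then have "a m k = 0" using IH[of l k] \<open>n = Suc m\<close> \<open>k = 0\<close> by simp
        then show ?thesis using 1 \<open>k = 0\<close> by simp
      qed
    next
      case k: (Suc j)
      show ?thesis
      proof (cases m)
        case 0
        have "a n j = a 0 k" using Suc \<open>m = 0\<close> k by (simp add: a_def)
        then show ?thesis using 1 \<open>m = 0\<close> k by (simp add: algebra_simps)
      next
        case m: (Suc l)
        have "a n j = a m (Suc j) - real m * a l j" using rec[of l j] by (simp add: Suc m)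
        moreover have "a m (Suc j) = real (Suc j) * a l j" using IH[of l "Suc j"] by (simp add: Suc m)
        ultimately have "a n j = (real (Suc j) - real m) * a l j" "a m (Suc j) = real (Suc j) * a l j"
          by (simp_all only: left_diff_distrib)
        then have "real (Suc j) * a n j = (real (Suc j) - real m) * a m (Suc j)"
          by (simp only: mult.left_commute)
        then show ?thesis using 1 by (simp add: k algebra_simps)
      qed
    qed
  qed
  then show ?case by (simp add: a_def)
qed

lemma gauss_hermite: "(\<integral>x. hermite n x \<partial>gauss) = (if n = 0 then 1 else 0)"
proof (cases n)
  case 0
  interpret prob_space gauss by (rule prob_space_normal_density) simp
  show ?thesis using 0 prob_space by simp
next
  case (Suc m)
  then show ?thesis using gauss_hermite_power[of m 0] by simp
qed

lemma gauss_hermite_orthogonal: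
  "(\<integral>x. hermite n x * hermite m x \<partial>gauss) = (if n = m then fact n else 0)"
proof (induction n arbitrary: m rule: less_induct)
  case (less n)
  define b where "b n m = (\<integral>x. hermite n x * hermite m x \<partial>gauss)" for n m
  have int: "integrable gauss (\<lambda>x. hermite n x * hermite m x)" for n m
    using poly_like_integrable[OF poly_like_hermite[OF poly_like_hermite[OF poly_like_one, of m], of n]] by simp
  have intx: "integrable gauss (\<lambda>x. x * (hermite n x * hermite m x))" for n m
    using poly_like_integrable[OF poly_like_mult_x[OF poly_like_hermite[OF poly_like_hermite[OF poly_like_one, of m], of n]]] by simp
  define d where "d n m = (\<integral>x. x * (hermite n x * hermite m x) \<partial>gauss)" for n m
  have recl: "b (Suc n) m = d n m - real n * b (n - 1) m" for n m
  proof (cases n)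
    case 0 then show ?thesis by (simp add: b_def d_def)
  next
    case (Suc j)
    have "b (Suc n) m = (\<integral>x. x * (hermite n x * hermite m x) - real n * (hermite (n - 1) x * hermite m x) \<partial>gauss)"
      unfolding b_def Suc by (intro Bochner_Integration.integral_cong) (auto simp: algebra_simps)
    then show ?thesis unfolding b_def d_def using int intx by (subst (asm) Bochner_Integration.integral_diff) auto
  qed
  have sym: "b n m = b m n" "d n m = d m n" for n m
    unfolding b_def d_def by (simp_all add: mult.commute mult.left_commute)
  have IH: "b k m = (if k = m then fact k else 0)" if "k < n" for k m using less[OF that] by (simp add: b_def)
  have "b n m = (if n = m then fact n else 0)"
  proof (cases n)
    case 0
    then show ?thesis using gauss_hermite[of m] by (auto simp: b_def)
  next
    case (Suc k)
    have dk: "d k m = b k (Suc m) + real m * b k (m - 1)"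
      using recl[of m k] sym by simp
    have "b n m = b k (Suc m) + real m * b k (m - 1) - real k * b (k - 1) m"
      using recl[of k m] dk by (simp add: Suc)
    moreover have "b k (Suc m) = (if k = Suc m then fact k else 0)" "b k (m - 1) = (if k = m - 1 then fact k else 0)"
       "b (k - 1) m = (if k - 1 = m then fact (k - 1) else 0)"
      using IH Suc by auto
    ultimately show ?thesis
      by (cases k; cases m) (auto simp: Suc)
  qed
  then show ?case by (simp add: b_def)
qed

text \<open>Normalized so that the recursion below is that of the Hermite polynomials up to the factor
\<open>1 - p / N\<close>.\<close>

definition gp :: "nat \<Rightarrow> nat \<Rightarrow> nat set \<Rightarrow> real" where
  "gp N p B = fact p * ep N p B / sqrt (real N) ^ p"

lemma gp_0 [simp]: "gp N 0 B = 1" by (simp add: gp_def)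

lemma gp_recursion:
  assumes "1 \<le> N"
  shows "gp N (Suc (Suc p)) B = mag N B / sqrt (real N) * gp N (Suc p) B - real (Suc p) * (1 - real p / real N) * gp N p B"
proof -
  define s where "s = sqrt (real N)"
  have s: "0 < s" "s * s = real N" using assms by (simp_all add: s_def)
  have N0: "real N \<noteq> 0" using assms by simp
  have "gp N (Suc (Suc p)) B = fact (Suc p) * (real (p + 2) * ep N (Suc (Suc p)) B) / (s * s * s ^ p)"
    by (simp add: gp_def s_def algebra_simps)
  also have "\<dots> = fact (Suc p) * (mag N B * ep N (Suc p) B - (real N - real p) * ep N p B) / (s * s * s ^ p)"
    unfolding ep_recursion by (rule refl)
  also have "\<dots> = mag N B / s * (fact (Suc p) * ep N (Suc p) B / s ^ Suc p)
      - real (Suc p) * ((real N - real p) / (s * s)) * (fact p * ep N p B / s ^ p)"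
    using s(1) by (simp add: field_simps)
  also have "(real N - real p) / (s * s) = 1 - real p / real N"
    unfolding s(2) using N0 by (simp add: field_simps)
  finally show ?thesis by (simp add: gp_def s_def)
qed

lemma avg_gp: "1 \<le> p \<Longrightarrow> avg N (gp N p) = 0"
proof -
  assume p: "1 \<le> p"
  have "avg N (ep N p) = (\<Sum>A\<in>edges N p. avg N (chi A))"
    unfolding ep_eq avg_sum[symmetric] by (rule refl)
  also have "\<dots> = 0" using p by (intro sum.neutral) (auto simp: edges_def avg_chi)
  finally show ?thesis
    unfolding gp_def using avg_cmult[of N "fact p / sqrt (real N) ^ p" "ep N p"] by simp
qed

text \<open>Convergence of \<open>F N\<close> to \<open>f\<close> of a standard Gaussian, tested only against the
symmetric polynomials. The two conditions are preserved under multiplication by the magnetization and by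
\<open>gp N q\<close>, so mixed moments follow algebraically from the single fact that \<open>gp N p\<close> has
mean zero for positive \<open>p\<close>.\<close>

definition gauss_limit :: "(nat \<Rightarrow> nat set \<Rightarrow> real) \<Rightarrow> (real \<Rightarrow> real) \<Rightarrow> bool" where
  "gauss_limit F f \<longleftrightarrow> poly_like f \<and>
     (\<forall>p. (\<lambda>N. avg N (\<lambda>B. F N B * gp N p B)) \<longlonglongrightarrow> (\<integral>x. f x * hermite p x \<partial>gauss))"

lemma integrable_poly_like_hermite: "poly_like f \<Longrightarrow> integrable gauss (\<lambda>x. f x * hermite p x)"
  using poly_like_integrable[OF poly_like_hermite[of f p]] by (simp add: mult.commute)

lemma gauss_limit_one: "gauss_limit (\<lambda>N B. 1) (\<lambda>x. 1)"
  unfolding gauss_limit_def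
proof (intro conjI allI)
  fix p
  have "avg N (\<lambda>B. 1 * gp N p B) = (if p = 0 then 1 else 0)" for N
    using avg_gp[of p N] by (cases p) auto
  then show "(\<lambda>N. avg N (\<lambda>B. 1 * gp N p B)) \<longlonglongrightarrow> (\<integral>x. 1 * hermite p x \<partial>gauss)"
    by (simp add: gauss_hermite del: mult_1_left)
qed (rule poly_like_one)

lemma gauss_limit_lin:
  assumes "gauss_limit F f" "gauss_limit G g" "c \<longlonglongrightarrow> c'"
  shows "gauss_limit (\<lambda>N B. F N B - c N * G N B) (\<lambda>x. f x - c' * g x)"
  unfolding gauss_limit_def
proof (intro conjI allI)
  show "poly_like (\<lambda>x. f x - c' * g x)" using assms by (auto simp: gauss_limit_def intro: poly_like_lin)
  fix p
  have "avg N (\<lambda>B. (F N B - c N * G N B) * gp N p B) = avg N (\<lambda>B. F N B * gp N p B) - c N * avg N (\<lambda>B. G N B * gp N p B)" for N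
    unfolding avg_cmult[symmetric] avg_diff[symmetric] by (simp add: algebra_simps)
  moreover have "(\<integral>x. (f x - c' * g x) * hermite p x \<partial>gauss) = (\<integral>x. f x * hermite p x \<partial>gauss) - c' * (\<integral>x. g x * hermite p x \<partial>gauss)"
  proof -
    have i: "integrable gauss (\<lambda>x. f x * hermite p x)" "integrable gauss (\<lambda>x. g x * hermite p x)"
      using assms by (auto simp: gauss_limit_def intro: integrable_poly_like_hermite)
    have "(\<integral>x. (f x - c' * g x) * hermite p x \<partial>gauss) = (\<integral>x. f x * hermite p x - c' * (g x * hermite p x) \<partial>gauss)"
      by (intro Bochner_Integration.integral_cong) (auto simp: algebra_simps)
    also have "\<dots> = (\<integral>x. f x * hermite p x \<partial>gauss) - c' * (\<integral>x. g x * hermite p x \<partial>gauss)"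
      using i by (subst Bochner_Integration.integral_diff) auto
    finally show ?thesis .
  qed
  ultimately show "(\<lambda>N. avg N (\<lambda>B. (F N B - c N * G N B) * gp N p B)) \<longlonglongrightarrow> (\<integral>x. (f x - c' * g x) * hermite p x \<partial>gauss)"
    using assms by (auto simp: gauss_limit_def intro!: tendsto_intros)
qed

lemma tendsto_one_minus: "(\<lambda>N. real (Suc p) * (1 - real p / real N)) \<longlonglongrightarrow> real (Suc p)"
proof -
  have "(\<lambda>N. real (Suc p) * (1 - real p / real N)) \<longlonglongrightarrow> real (Suc p) * (1 - 0)"
    by (intro tendsto_intros lim_const_over_n)
  then show ?thesis by simp
qed

text \<open>The recursion expresses the magnetization times \<open>gp N p\<close> through the two neighbouring
symmetric polynomials, and the Hermite recursion does the same in the limit.\<close>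

lemma gauss_limit_mag:
  assumes "gauss_limit F f"
  shows "gauss_limit (\<lambda>N B. mag N B / sqrt (real N) * F N B) (\<lambda>x. x * f x)"
  unfolding gauss_limit_def
proof (intro conjI allI)
  have pl: "poly_like f" using assms by (simp add: gauss_limit_def)
  then show "poly_like (\<lambda>x. x * f x)" by (rule poly_like_mult_x)
  have lim: "(\<lambda>N. avg N (\<lambda>B. F N B * gp N p B)) \<longlonglongrightarrow> (\<integral>x. f x * hermite p x \<partial>gauss)" for p
    using assms by (simp add: gauss_limit_def)
  fix p
  show "(\<lambda>N. avg N (\<lambda>B. mag N B / sqrt (real N) * F N B * gp N p B)) \<longlonglongrightarrow> (\<integral>x. x * f x * hermite p x \<partial>gauss)"
  proof (cases p)
    case 0
    have "avg N (\<lambda>B. mag N B / sqrt (real N) * F N B * gp N p B) = avg N (\<lambda>B. F N B * gp N (Suc 0) B)" for N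
      by (intro avg_cong) (simp add: 0 gp_def)
    then show ?thesis using lim[of "Suc 0"] by (simp add: 0 mult.commute)
  next
    case (Suc q)
    have eq: "\<forall>\<^sub>F N in sequentially. avg N (\<lambda>B. F N B * gp N (Suc (Suc q)) B) + real (Suc q) * (1 - real q / real N) * avg N (\<lambda>B. F N B * gp N q B)
        = avg N (\<lambda>B. mag N B / sqrt (real N) * F N B * gp N p B)"
      using eventually_ge_at_top[of 1]
    proof eventually_elim
      case (elim N)
      show ?case
        unfolding avg_cmult[symmetric] avg_add[symmetric] gp_recursion[OF elim] Suc
        by (intro avg_cong) (simp add: algebra_simps)
    qed
    have "(\<lambda>N. avg N (\<lambda>B. F N B * gp N (Suc (Suc q)) B) + real (Suc q) * (1 - real q / real N) * avg N (\<lambda>B. F N B * gp N q B))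
      \<longlonglongrightarrow> (\<integral>x. f x * hermite (Suc (Suc q)) x \<partial>gauss) + real (Suc q) * (\<integral>x. f x * hermite q x \<partial>gauss)"
      by (intro tendsto_add tendsto_mult lim tendsto_one_minus)
    moreover have "(\<integral>x. f x * hermite (Suc (Suc q)) x \<partial>gauss) + real (Suc q) * (\<integral>x. f x * hermite q x \<partial>gauss)
       = (\<integral>x. f x * hermite (Suc (Suc q)) x + real (Suc q) * (f x * hermite q x) \<partial>gauss)"
      using integrable_poly_like_hermite[OF pl, of "Suc (Suc q)"] integrable_poly_like_hermite[OF pl, of q]
      by (subst Bochner_Integration.integral_add) auto
    moreover have "\<dots> = (\<integral>x. x * f x * hermite p x \<partial>gauss)"
      by (intro Bochner_Integration.integral_cong) (auto simp: Suc algebra_simps)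
    ultimately show ?thesis using eq by (auto intro: Lim_transform_eventually)
  qed
qed

lemma gauss_limit_cong:
  assumes "gauss_limit F f" "\<And>N B. 1 \<le> N \<Longrightarrow> F N B = G N B"
  shows "gauss_limit G f"
  unfolding gauss_limit_def
proof (intro conjI allI)
  show "poly_like f" using assms by (simp add: gauss_limit_def)
  fix p
  have "(\<lambda>N. avg N (\<lambda>B. F N B * gp N p B)) \<longlonglongrightarrow> (\<integral>x. f x * hermite p x \<partial>gauss)"
    using assms(1) by (simp add: gauss_limit_def)
  moreover have "\<forall>\<^sub>F N in sequentially. avg N (\<lambda>B. F N B * gp N p B) = avg N (\<lambda>B. G N B * gp N p B)"
    using eventually_ge_at_top[of 1] by eventually_elim (simp add: assms(2))
  ultimately show "(\<lambda>N. avg N (\<lambda>B. G N B * gp N p B)) \<longlonglongrightarrow> (\<integral>x. f x * hermite p x \<partial>gauss)"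
    by (rule Lim_transform_eventually)
qed

text \<open>Both sides satisfy the same three-term recursion in \<open>q\<close> in the limit.\<close>

lemma gauss_limit_gp:
  assumes "gauss_limit F f"
  shows "gauss_limit (\<lambda>N B. gp N q B * F N B) (\<lambda>x. hermite q x * f x)"
proof (induction q rule: less_induct)
  case (less q)
  consider "q = 0" | "q = Suc 0" | m where "q = Suc (Suc m)" by (metis not0_implies_Suc)
  then show ?case
  proof cases
    case 1
    then show ?thesis using assms by simp
  next
    case 2
    then show ?thesis using gauss_limit_mag[OF assms] by (simp add: gp_def)
  next
    case 3
    have "gauss_limit (\<lambda>N B. mag N B / sqrt (real N) * (gp N (Suc m) B * F N B) - real (Suc m) * (1 - real m / real N) * (gp N m B * F N B))
       (\<lambda>x. x * (hermite (Suc m) x * f x) - real (Suc m) * (hermite m x * f x))"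
      using less 3 by (intro gauss_limit_lin gauss_limit_mag tendsto_one_minus) auto
    also have "(\<lambda>x. x * (hermite (Suc m) x * f x) - real (Suc m) * (hermite m x * f x)) = (\<lambda>x. hermite q x * f x)"
      by (simp add: 3 algebra_simps)
    finally show ?thesis
      by (rule gauss_limit_cong) (simp add: 3 gp_recursion algebra_simps)
  qed
qed

lemma gauss_limit_avg: "gauss_limit F f \<Longrightarrow> (\<lambda>N. avg N (F N)) \<longlonglongrightarrow> (\<integral>x. f x \<partial>gauss)"
  unfolding gauss_limit_def by (drule conjunct2, drule spec[of _ 0]) simp

section \<open>Counting closed hypergraphs by their vertices\<close>

lemma sum_card_degrees:
  assumes "finite \<Gamma>" "\<And>e. e \<in> \<Gamma> \<Longrightarrow> finite e"
  shows "(\<Sum>e\<in>\<Gamma>. card e) = (\<Sum>i\<in>\<Union>\<Gamma>. card {e \<in> \<Gamma>. i \<in> e})"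
proof -
  have fin: "finite (\<Union>\<Gamma>)" using assms by auto
  have "(\<Sum>e\<in>\<Gamma>. card e) = (\<Sum>e\<in>\<Gamma>. \<Sum>i\<in>\<Union>\<Gamma>. of_bool (i \<in> e))"
  proof (intro sum.cong refl)
    fix e assume "e \<in> \<Gamma>"
    then have "\<Union>\<Gamma> \<inter> {i. i \<in> e} = e" by auto
    then show "card e = (\<Sum>i\<in>\<Union>\<Gamma>. of_bool (i \<in> e))" using fin by (simp add: sum.inter_restrict[symmetric] of_bool_def)
  qed
  also have "\<dots> = (\<Sum>i\<in>\<Union>\<Gamma>. \<Sum>e\<in>\<Gamma>. of_bool (i \<in> e))" by (rule sum.swap)
  also have "\<dots> = (\<Sum>i\<in>\<Union>\<Gamma>. card {e \<in> \<Gamma>. i \<in> e})"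
    using assms by (intro sum.cong refl) (simp add: Int_def)
  finally show ?thesis .
qed

lemma closed_degree_ge_2:
  assumes "finite \<Gamma>" "bd \<Gamma> = {}" "i \<in> \<Union>\<Gamma>"
  shows "2 \<le> card {e \<in> \<Gamma>. i \<in> e}" "even (card {e \<in> \<Gamma>. i \<in> e})"
proof -
  show ev: "even (card {e \<in> \<Gamma>. i \<in> e})" using assms(2) by (auto simp: bd_def)
  have "{e \<in> \<Gamma>. i \<in> e} \<noteq> {}" using assms(3) by auto
  then have "card {e \<in> \<Gamma>. i \<in> e} \<noteq> 0" using assms(1) by simp
  then show "2 \<le> card {e \<in> \<Gamma>. i \<in> e}" using ev by presburger
qed

lemma closed_card_Union:
  assumes "finite \<Gamma>" "\<And>e. e \<in> \<Gamma> \<Longrightarrow> finite e" "bd \<Gamma> = {}"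
  shows "2 * card (\<Union>\<Gamma>) \<le> (\<Sum>e\<in>\<Gamma>. card e)"
proof -
  have "(\<Sum>i\<in>\<Union>\<Gamma>. 2) \<le> (\<Sum>i\<in>\<Union>\<Gamma>. card {e \<in> \<Gamma>. i \<in> e})"
    using closed_degree_ge_2[OF assms(1,3)] by (intro sum_mono) auto
  then show ?thesis using sum_card_degrees[OF assms(1,2)] by simp
qed

text \<open>A vertex whose degree is not two has degree at least four, which costs one further factor
\<open>1 / N\<close> in the counts below.\<close>

lemma closed_card_Union_4:
  assumes "finite \<Gamma>" "\<And>e. e \<in> \<Gamma> \<Longrightarrow> finite e" "bd \<Gamma> = {}" "i \<in> \<Union>\<Gamma>" "card {e \<in> \<Gamma>. i \<in> e} \<noteq> 2"
  shows "2 * card (\<Union>\<Gamma>) + 2 \<le> (\<Sum>e\<in>\<Gamma>. card e)"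
proof -
  have fin: "finite (\<Union>\<Gamma>)" using assms by auto
  have 4: "4 \<le> card {e \<in> \<Gamma>. i \<in> e}"
    using closed_degree_ge_2[OF assms(1,3,4)] assms(5) by presburger
  have "(\<Sum>j\<in>\<Union>\<Gamma>. 2) + 2 = (\<Sum>j\<in>\<Union>\<Gamma>. 2 + (if j = i then 2 else 0))"
    using fin assms(4) by (simp add: sum.distrib)
  also have "\<dots> \<le> (\<Sum>j\<in>\<Union>\<Gamma>. card {e \<in> \<Gamma>. j \<in> e})"
  proof (intro sum_mono)
    fix j assume "j \<in> \<Union>\<Gamma>"
    then show "2 + (if j = i then 2 else 0) \<le> card {e \<in> \<Gamma>. j \<in> e}"
      using closed_degree_ge_2(1)[OF assms(1,3), of j] 4 by (cases "j = i") simp_all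
  qed
  finally show ?thesis using sum_card_degrees[OF assms(1,2)] by simp
qed

lemma closed_even_sum_card:
  assumes "finite \<Gamma>" "\<And>e. e \<in> \<Gamma> \<Longrightarrow> finite e" "bd \<Gamma> = {}"
  shows "even (\<Sum>e\<in>\<Gamma>. card e)"
proof -
  have "even (\<Sum>i\<in>\<Union>\<Gamma>. card {e \<in> \<Gamma>. i \<in> e})"
    using closed_degree_ge_2(2)[OF assms(1,3)] by (rule dvd_sum)
  then show ?thesis using sum_card_degrees[OF assms(1,2)] by simp
qed

text \<open>The number of hypergraphs on at most \<open>m\<close> labelled vertices, counted by the size of the
vertex set.\<close>

definition cover_const :: "nat \<Rightarrow> real" where
  "cover_const m = (\<Sum>v\<le>m. 2 ^ (2 ^ v))"

lemma cover_const_nonneg: "0 \<le> cover_const m"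
  by (simp add: cover_const_def sum_nonneg)

text \<open>Choose the vertex set first. There are at most \<open>N ^ (v - card Y)\<close> sets of
\<open>v\<close> vertices that contain \<open>Y\<close>, boundedly many hypergraphs on each, and each has weight at
most \<open>1 / N ^ v\<close> up to the surplus \<open>d\<close>. So prescribing vertices gains the factor
\<open>1 / N\<close> for each of them.\<close>

lemma sum_cover:
  assumes N: "1 \<le> N"
    and \<F>: "\<And>\<Gamma>. \<Gamma> \<in> \<F> \<Longrightarrow> \<Gamma> \<subseteq> Pow {1..N}"
      "\<And>\<Gamma>. \<Gamma> \<in> \<F> \<Longrightarrow> 2 * card (\<Union>\<Gamma>) + d \<le> (\<Sum>e\<in>\<Gamma>. card e)"
      "\<And>\<Gamma>. \<Gamma> \<in> \<F> \<Longrightarrow> card (\<Union>\<Gamma>) \<le> m"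
      "\<And>\<Gamma>. \<Gamma> \<in> \<F> \<Longrightarrow> Y \<subseteq> \<Union>\<Gamma>"
  shows "(\<Sum>\<Gamma>\<in>\<F>. 1 / sqrt (real N) ^ (\<Sum>e\<in>\<Gamma>. card e)) \<le> cover_const m / sqrt (real N) ^ (2 * card Y + d)"
proof -
  define s where "s = sqrt (real N)"
  have s: "1 \<le> s" "s\<^sup>2 = real N" using N by (auto simp: s_def)
  have fin\<F>: "finite \<F>"
    by (rule finite_subset[of _ "Pow (Pow {1..N})"]) (use \<F>(1) in auto)
  define y where "y = card Y"
  have fiber: "real (card {\<Gamma> \<in> \<F>. card (\<Union>\<Gamma>) = v}) \<le> 2 ^ (2 ^ v) * (s ^ (2 * v) / s ^ (2 * y))" for v
  proof (cases "{\<Gamma> \<in> \<F>. card (\<Union>\<Gamma>) = v} = {}")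
    case True
    then show ?thesis using s by (simp only: card.empty) simp
  next
    case False
    then obtain \<Gamma>0 where \<Gamma>0: "\<Gamma>0 \<in> \<F>" "card (\<Union>\<Gamma>0) = v" by auto
    have U0: "\<Union>\<Gamma>0 \<subseteq> {1..N}" using \<F>(1)[OF \<Gamma>0(1)] by auto
    have Y: "Y \<subseteq> {1..N}" "finite Y" using \<F>(4)[OF \<Gamma>0(1)] U0 finite_subset[of Y "{1..N}"] by auto
    have yv: "y \<le> v"
      unfolding y_def \<Gamma>0(2)[symmetric] using \<F>(4)[OF \<Gamma>0(1)] U0 by (intro card_mono) (auto dest: finite_subset)
    define \<V> where "\<V> = {V. Y \<subseteq> V \<and> V \<subseteq> {1..N} \<and> card V = v}"
    have fin\<V>: "finite \<V>" by (rule finite_subset[of _ "Pow {1..N}"]) (auto simp: \<V>_def)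
    have "inj_on (\<lambda>V. V - Y) \<V>" by (rule inj_onI) (auto simp: \<V>_def)
    then have "card \<V> = card ((\<lambda>V. V - Y) ` \<V>)" by (simp add: card_image)
    also have "\<dots> \<le> card {W. W \<subseteq> {1..N} \<and> card W = v - y}"
    proof (intro card_mono)
      show "finite {W. W \<subseteq> {1..N} \<and> card W = v - y}" by (rule finite_subset[of _ "Pow {1..N}"]) auto
      show "(\<lambda>V. V - Y) ` \<V> \<subseteq> {W. W \<subseteq> {1..N} \<and> card W = v - y}"
        using Y by (auto simp: \<V>_def y_def card_Diff_subset)
    qed
    also have "\<dots> = N choose (v - y)" by (simp add: n_subsets)
    also have "\<dots> \<le> N ^ (v - y)"
    proof (cases "v - y \<le> N")
      case True then show ?thesis by (rule binomial_le_pow)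
    next
      case False then show ?thesis by (simp add: binomial_eq_0)
    qed
    finally have c\<V>: "card \<V> \<le> N ^ (v - y)" .
    have "{\<Gamma> \<in> \<F>. card (\<Union>\<Gamma>) = v} \<subseteq> (\<Union>V\<in>\<V>. Pow (Pow V))"
    proof
      fix \<Gamma> assume \<Gamma>: "\<Gamma> \<in> {\<Gamma> \<in> \<F>. card (\<Union>\<Gamma>) = v}"
      then have "\<Union>\<Gamma> \<in> \<V>" using \<F>(1)[of \<Gamma>] \<F>(4)[of \<Gamma>] by (auto simp: \<V>_def)
      moreover have "\<Gamma> \<in> Pow (Pow (\<Union>\<Gamma>))" by auto
      ultimately show "\<Gamma> \<in> (\<Union>V\<in>\<V>. Pow (Pow V))" by blast
    qed
    then have "card {\<Gamma> \<in> \<F>. card (\<Union>\<Gamma>) = v} \<le> card (\<Union>V\<in>\<V>. Pow (Pow V))"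
      using fin\<V> by (intro card_mono) (auto simp: \<V>_def dest: finite_subset)
    also have "\<dots> \<le> (\<Sum>V\<in>\<V>. card (Pow (Pow V)))" by (rule card_UN_le[OF fin\<V>])
    also have "\<dots> = (\<Sum>V\<in>\<V>. 2 ^ (2 ^ v))"
    proof (intro sum.cong refl)
      fix V assume "V \<in> \<V>"
      then have "finite V" "card V = v" by (auto simp: \<V>_def dest: finite_subset)
      then show "card (Pow (Pow V)) = 2 ^ (2 ^ v)" by (simp add: card_Pow)
    qed
    also have "\<dots> \<le> N ^ (v - y) * 2 ^ (2 ^ v)" using c\<V> by simp
    finally have "real (card {\<Gamma> \<in> \<F>. card (\<Union>\<Gamma>) = v}) \<le> real (N ^ (v - y) * 2 ^ (2 ^ v))" by (simp only: of_nat_le_iff)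
    also have "\<dots> = 2 ^ (2 ^ v) * s ^ (2 * (v - y))" by (simp add: s(2) power_mult)
    also have "s ^ (2 * (v - y)) = s ^ (2 * v) / s ^ (2 * y)"
      using s(1) yv power_diff[of s "2 * y" "2 * v"] by (simp add: diff_mult_distrib2)
    finally show ?thesis .
  qed
  have "(\<Sum>\<Gamma>\<in>\<F>. 1 / s ^ (\<Sum>e\<in>\<Gamma>. card e)) \<le> (\<Sum>\<Gamma>\<in>\<F>. 1 / s ^ (2 * card (\<Union>\<Gamma>) + d))"
  proof (rule sum_mono)
    fix \<Gamma> assume "\<Gamma> \<in> \<F>"
    then have "s ^ (2 * card (\<Union>\<Gamma>) + d) \<le> s ^ (\<Sum>e\<in>\<Gamma>. card e)" using \<F>(2) s by (intro power_increasing) auto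
    then show "1 / s ^ (\<Sum>e\<in>\<Gamma>. card e) \<le> 1 / s ^ (2 * card (\<Union>\<Gamma>) + d)" using s by (intro divide_left_mono) auto
  qed
  also have "\<dots> = (\<Sum>v\<le>m. \<Sum>\<Gamma>\<in>{\<Gamma> \<in> \<F>. card (\<Union>\<Gamma>) = v}. 1 / s ^ (2 * card (\<Union>\<Gamma>) + d))"
    using fin\<F> \<F>(3) by (intro sum.group[symmetric]) auto
  also have "\<dots> = (\<Sum>v\<le>m. real (card {\<Gamma> \<in> \<F>. card (\<Union>\<Gamma>) = v}) * (1 / s ^ (2 * v + d)))"
    by (intro sum.cong refl) simp
  also have "\<dots> \<le> (\<Sum>v\<le>m. 2 ^ (2 ^ v) * (s ^ (2 * v) / s ^ (2 * y)) * (1 / s ^ (2 * v + d)))"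
    using s fiber by (intro sum_mono mult_right_mono) auto
  also have "\<dots> = (\<Sum>v\<le>m. 2 ^ (2 ^ v) / s ^ (2 * y + d))"
    using s(1) by (intro sum.cong refl) (simp add: power_add)
  finally show ?thesis by (simp add: cover_const_def s_def y_def sum_divide_distrib)
qed

section \<open>One step of a martingale central limit theorem\<close>

lemma exp_neg_approx:
  fixes u :: real
  assumes "0 \<le> u"
  shows "\<bar>exp (-u) - (1 - u)\<bar> \<le> u\<^sup>2 / 2"
proof (cases "u = 0")
  case False
  then have u: "0 < u" using assms by simp
  have "\<exists>t. -u < t \<and> t < 0 \<and> exp (-u) = (\<Sum>m<2. exp 0 / fact m * (-u) ^ m) + exp t / fact 2 * (-u) ^ 2"
    using u by (intro Maclaurin_minus[where diff="\<lambda>_. exp"]) (auto intro!: derivative_eq_intros)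
  then obtain t where t: "t < 0" "exp (-u) = (1 - u) + exp t / 2 * u\<^sup>2"
    by (auto simp: numeral_2_eq_2)
  have "exp t / 2 * u\<^sup>2 \<le> 1 / 2 * u\<^sup>2" using t by (intro mult_right_mono) auto
  moreover have "0 \<le> exp t / 2 * u\<^sup>2" by simp
  ultimately show ?thesis using t(2) by simp
qed simp

context prob_space begin

lemma integrable_bounded:
  fixes f :: "'a \<Rightarrow> 'b::{banach, second_countable_topology}"
  assumes "f \<in> borel_measurable M" "\<And>\<omega>. \<omega> \<in> space M \<Longrightarrow> norm (f \<omega>) \<le> B"
  shows "integrable M f"
  using assms by (intro integrable_const_bound[where B=B]) auto

lemma expectation_mono_bound:
  fixes f :: "'a \<Rightarrow> 'b::{banach, second_countable_topology}"
  assumes "integrable M f" "integrable M g" "\<And>\<omega>. \<omega> \<in> space M \<Longrightarrow> norm (f \<omega>) \<le> g \<omega>"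
  shows "norm (expectation f) \<le> expectation g"
proof -
  have "norm (expectation f) \<le> expectation (\<lambda>\<omega>. norm (f \<omega>))" by (rule integral_norm_bound)
  also have "\<dots> \<le> expectation g" using assms by (intro integral_mono) auto
  finally show ?thesis .
qed

text \<open>Expand \<open>iexp (t * D)\<close> to second order. The first order vanishes since \<open>D\<close>
is conditionally centred, and the second order is compared with the deterministic value \<open>q\<close> through
\<open>V\<close>, the conditional variance. The hypotheses on \<open>D\<close> and \<open>V\<close> say only what
conditioning would give when tested against \<open>iexp (t * W)\<close>, so no conditional expectations have to
be constructed.\<close>

lemma char_step:
  fixes W D V :: "'a \<Rightarrow> real"
  assumes [measurable]: "W \<in> borel_measurable M" "D \<in> borel_measurable M" "V \<in> borel_measurable M"
    and Db: "\<And>\<omega>. \<omega> \<in> space M \<Longrightarrow> \<bar>D \<omega>\<bar> \<le> b" and Vb: "\<And>\<omega>. \<omega> \<in> space M \<Longrightarrow> \<bar>V \<omega>\<bar> \<le> b'"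
    and ZD: "expectation (\<lambda>\<omega>. iexp (t * W \<omega>) * complex_of_real (D \<omega>)) = 0"
    and ZD2: "expectation (\<lambda>\<omega>. iexp (t * W \<omega>) * complex_of_real ((D \<omega>)\<^sup>2)) =
      expectation (\<lambda>\<omega>. iexp (t * W \<omega>) * complex_of_real (V \<omega>))"
    and q: "0 \<le> q"
  shows "cmod (expectation (\<lambda>\<omega>. iexp (t * (W \<omega> + D \<omega>))) - complex_of_real (exp (- (t\<^sup>2 * q / 2))) * expectation (\<lambda>\<omega>. iexp (t * W \<omega>)))
    \<le> t\<^sup>2 / 2 * expectation (\<lambda>\<omega>. \<bar>V \<omega> - q\<bar>) + \<bar>t\<bar> ^ 3 / 6 * expectation (\<lambda>\<omega>. \<bar>D \<omega>\<bar> ^ 3) + t ^ 4 * q\<^sup>2 / 8"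
proof -
  define Z where "Z \<omega> = iexp (t * W \<omega>)" for \<omega>
  have [measurable]: "Z \<in> borel_measurable M" unfolding Z_def by measurable
  have Z1: "cmod (Z \<omega>) = 1" for \<omega> by (simp add: Z_def)
  define r where "r \<omega> = iexp (t * D \<omega>) - (\<Sum>k\<le>2. (\<i> * complex_of_real (t * D \<omega>)) ^ k / fact k)" for \<omega>
  have [measurable]: "r \<in> borel_measurable M" unfolding r_def by measurable
  have r: "cmod (r \<omega>) \<le> \<bar>t\<bar> ^ 3 / 6 * \<bar>D \<omega>\<bar> ^ 3" for \<omega>
  proof -
    have e: "Suc 2 = 3" "fact 3 = (6::real)" by (simp_all add: fact_numeral)
    show ?thesis
      using iexp_approx1[of "t * D \<omega>" 2]
      unfolding r_def e abs_mult power_mult_distrib times_divide_eq_left .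
  qed
  have expand: "iexp (t * (W \<omega> + D \<omega>)) = Z \<omega> + (\<i> * t) * (Z \<omega> * D \<omega>) - (t\<^sup>2 / 2) * (Z \<omega> * complex_of_real ((D \<omega>)\<^sup>2)) + Z \<omega> * r \<omega>" for \<omega>
  proof -
    have "iexp (t * (W \<omega> + D \<omega>)) = Z \<omega> * iexp (t * D \<omega>)"
      by (simp add: Z_def exp_add[symmetric] algebra_simps)
    also have "iexp (t * D \<omega>) = 1 + \<i> * t * D \<omega> - t\<^sup>2 / 2 * complex_of_real ((D \<omega>)\<^sup>2) + r \<omega>"
      by (simp add: r_def numeral_2_eq_2 algebra_simps)
    finally show ?thesis by (simp add: algebra_simps)
  qed
  have D2b: "\<bar>D \<omega>\<bar> ^ k \<le> b ^ k" if "\<omega> \<in> space M" for k \<omega> using Db[OF that] by (intro power_mono) auto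
  have iZ: "integrable M Z" by (rule integrable_bounded[where B=1]) (simp_all add: Z1)
  have iZD: "integrable M (\<lambda>\<omega>. Z \<omega> * complex_of_real (D \<omega>))"
    by (rule integrable_bounded[where B=b]) (simp_all add: Z1 norm_mult Db)
  have iZD2: "integrable M (\<lambda>\<omega>. Z \<omega> * complex_of_real ((D \<omega>)\<^sup>2))"
    by (rule integrable_bounded[where B="b ^ 2"]) (use D2b[of _ 2] in \<open>simp_all add: Z1 norm_mult norm_power\<close>)
  have iD3: "integrable M (\<lambda>\<omega>. \<bar>D \<omega>\<bar> ^ 3)"
  proof (rule integrable_bounded[where B="b ^ 3"])
    fix \<omega> assume "\<omega> \<in> space M"
    from D2b[OF this] show "norm (\<bar>D \<omega>\<bar> ^ 3) \<le> b ^ 3"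
      by (simp only: real_norm_def abs_of_nonneg zero_le_power abs_ge_zero)
  qed measurable
  have iZr: "integrable M (\<lambda>\<omega>. Z \<omega> * r \<omega>)"
  proof (rule integrable_bounded[where B="\<bar>t\<bar> ^ 3 / 6 * b ^ 3"])
    fix \<omega> assume \<omega>: "\<omega> \<in> space M"
    have "cmod (Z \<omega> * r \<omega>) = cmod (r \<omega>)" by (simp add: norm_mult Z1)
    also have "\<dots> \<le> \<bar>t\<bar> ^ 3 / 6 * \<bar>D \<omega>\<bar> ^ 3" by (rule r)
    also have "\<dots> \<le> \<bar>t\<bar> ^ 3 / 6 * b ^ 3" using D2b[OF \<omega>] by (intro mult_left_mono) auto
    finally show "cmod (Z \<omega> * r \<omega>) \<le> \<bar>t\<bar> ^ 3 / 6 * b ^ 3" .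
  qed measurable
  have iZV: "integrable M (\<lambda>\<omega>. Z \<omega> * complex_of_real (V \<omega> - q))"
  proof (rule integrable_bounded[where B="b' + q"])
    fix \<omega> assume "\<omega> \<in> space M"
    then have "\<bar>V \<omega> - q\<bar> \<le> b' + q"
      using Vb[of \<omega>] q abs_triangle_ineq4[of "V \<omega>" q] by simp
    then show "cmod (Z \<omega> * complex_of_real (V \<omega> - q)) \<le> b' + q"
      by (simp only: norm_mult Z1 norm_of_real mult_1_left)
  qed measurable
  have iV: "integrable M (\<lambda>\<omega>. \<bar>V \<omega> - q\<bar>)"
  proof (rule integrable_bounded[where B="b' + q"])
    fix \<omega> assume "\<omega> \<in> space M"
    then show "norm \<bar>V \<omega> - q\<bar> \<le> b' + q"
      using Vb[of \<omega>] q abs_triangle_ineq4[of "V \<omega>" q] by simp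
  qed measurable
  define I where "I = expectation Z"
  have "expectation (\<lambda>\<omega>. iexp (t * (W \<omega> + D \<omega>))) =
     I + (\<i> * t) * expectation (\<lambda>\<omega>. Z \<omega> * D \<omega>) - (t\<^sup>2 / 2) * expectation (\<lambda>\<omega>. Z \<omega> * complex_of_real ((D \<omega>)\<^sup>2)) + expectation (\<lambda>\<omega>. Z \<omega> * r \<omega>)"
    unfolding expand I_def using iZ iZD iZD2 iZr by simp
  also have "expectation (\<lambda>\<omega>. Z \<omega> * D \<omega>) = 0" using ZD by (simp add: Z_def)
  also have "expectation (\<lambda>\<omega>. Z \<omega> * complex_of_real ((D \<omega>)\<^sup>2)) = expectation (\<lambda>\<omega>. Z \<omega> * complex_of_real (V \<omega>))"
    using ZD2 by (simp add: Z_def)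
  also have "\<dots> = expectation (\<lambda>\<omega>. Z \<omega> * complex_of_real (V \<omega> - q) + q * Z \<omega>)"
    by (intro Bochner_Integration.integral_cong) (auto simp: algebra_simps)
  also have "\<dots> = expectation (\<lambda>\<omega>. Z \<omega> * complex_of_real (V \<omega> - q)) + q * I"
    unfolding I_def using iZV iZ by simp
  finally have main: "expectation (\<lambda>\<omega>. iexp (t * (W \<omega> + D \<omega>))) - complex_of_real (exp (- (t\<^sup>2 * q / 2))) * I =
    - (t\<^sup>2 / 2) * expectation (\<lambda>\<omega>. Z \<omega> * complex_of_real (V \<omega> - q)) + expectation (\<lambda>\<omega>. Z \<omega> * r \<omega>)
      - complex_of_real (exp (- (t\<^sup>2 * q / 2)) - (1 - t\<^sup>2 * q / 2)) * I" (is "_ = ?A + ?B - ?C")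
    by (simp add: algebra_simps)
  have A: "cmod ?A \<le> t\<^sup>2 / 2 * expectation (\<lambda>\<omega>. \<bar>V \<omega> - q\<bar>)"
  proof -
    have "cmod (expectation (\<lambda>\<omega>. Z \<omega> * complex_of_real (V \<omega> - q))) \<le> expectation (\<lambda>\<omega>. \<bar>V \<omega> - q\<bar>)"
      using iZV iV by (rule expectation_mono_bound) (simp only: norm_mult Z1 norm_of_real mult_1_left order_refl)
    then have "t\<^sup>2 / 2 * cmod (expectation (\<lambda>\<omega>. Z \<omega> * complex_of_real (V \<omega> - q))) \<le> t\<^sup>2 / 2 * expectation (\<lambda>\<omega>. \<bar>V \<omega> - q\<bar>)"
      by (rule mult_left_mono) simp
    moreover have "cmod ?A = t\<^sup>2 / 2 * cmod (expectation (\<lambda>\<omega>. Z \<omega> * complex_of_real (V \<omega> - q)))"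
    proof -
      have "\<bar>- (t\<^sup>2 / 2)\<bar> = t\<^sup>2 / 2" by simp
      then show ?thesis by (simp only: norm_mult norm_of_real)
    qed
    ultimately show ?thesis by (simp only:)
  qed
  have B: "cmod ?B \<le> \<bar>t\<bar> ^ 3 / 6 * expectation (\<lambda>\<omega>. \<bar>D \<omega>\<bar> ^ 3)"
  proof -
    have "cmod ?B \<le> expectation (\<lambda>\<omega>. \<bar>t\<bar> ^ 3 / 6 * \<bar>D \<omega>\<bar> ^ 3)"
      using iZr iD3 r by (intro expectation_mono_bound) (auto simp: norm_mult Z1)
    then show ?thesis using iD3 by simp
  qed
  have C: "cmod ?C \<le> t ^ 4 * q\<^sup>2 / 8"
  proof -
    have "cmod I \<le> expectation (\<lambda>\<omega>. 1)"
      unfolding I_def using iZ by (rule expectation_mono_bound) (simp_all add: Z1)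
    then have I1: "cmod I \<le> 1" using prob_space by simp
    have "cmod ?C = \<bar>exp (- (t\<^sup>2 * q / 2)) - (1 - t\<^sup>2 * q / 2)\<bar> * cmod I"
      by (simp only: norm_mult norm_of_real)
    also have "\<dots> \<le> (t\<^sup>2 * q / 2)\<^sup>2 / 2 * 1"
      using q I1 by (intro mult_mono exp_neg_approx) auto
    also have "\<dots> = t ^ 4 * q\<^sup>2 / 8" by (simp add: power_divide power_mult_distrib)
    finally show ?thesis .
  qed
  have "cmod (?A + ?B - ?C) \<le> cmod ?A + cmod ?B + cmod ?C"
    by (meson norm_triangle_ineq4 norm_triangle_ineq order_trans add_right_mono)
  then have "cmod (expectation (\<lambda>\<omega>. iexp (t * (W \<omega> + D \<omega>))) - complex_of_real (exp (- (t\<^sup>2 * q / 2))) * I)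
    \<le> t\<^sup>2 / 2 * expectation (\<lambda>\<omega>. \<bar>V \<omega> - q\<bar>) + \<bar>t\<bar> ^ 3 / 6 * expectation (\<lambda>\<omega>. \<bar>D \<omega>\<bar> ^ 3) + t ^ 4 * q\<^sup>2 / 8"
    unfolding main using A B C by linarith
  then show ?thesis by (simp only: I_def Z_def[abs_def])
qed

end

section \<open>Products of independent symmetric variables\<close>

text \<open>First and third moments vanish for symmetric variables; the fourth moment estimates rest on
both.\<close>

locale sym_indep = prob_space M for M :: "'a measure" +
  fixes x :: "'e \<Rightarrow> 'a \<Rightarrow> real" and E :: "'e set"
  assumes finE: "finite E"
    and indep: "indep_vars (\<lambda>_. borel) x E"
    and x_bound: "\<And>e \<omega>. e \<in> E \<Longrightarrow> \<omega> \<in> space M \<Longrightarrow> \<bar>x e \<omega>\<bar> \<le> 1"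
    and x_mean: "\<And>e. e \<in> E \<Longrightarrow> expectation (x e) = 0"
    and x_third: "\<And>e. e \<in> E \<Longrightarrow> expectation (\<lambda>\<omega>. x e \<omega> ^ 3) = 0"
begin

text \<open>The \<open>\<sigma>\<close>-algebra of the variables indexed by \<open>A\<close>, on the whole sample
space.\<close>

definition generated :: "'e set \<Rightarrow> 'a measure" where
  "generated A = vimage_algebra (space M) (\<lambda>\<omega>. \<lambda>e\<in>A. x e \<omega>) (Pi\<^sub>M A (\<lambda>_. borel))"

lemma x_meas: "e \<in> E \<Longrightarrow> x e \<in> borel_measurable M"
  using indep by (auto simp: indep_vars_def)

lemma space_generated [simp]: "space (generated A) = space M"
  by (simp add: generated_def)

lemma restrict_meas: "A \<subseteq> E \<Longrightarrow> (\<lambda>\<omega>. \<lambda>e\<in>A. x e \<omega>) \<in> measurable M (Pi\<^sub>M A (\<lambda>_. borel))"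
  using x_meas by (intro measurable_restrict) auto

lemma sets_generated: "sets (generated A) = {(\<lambda>\<omega>. \<lambda>e\<in>A. x e \<omega>) -` S \<inter> space M | S. S \<in> sets (Pi\<^sub>M A (\<lambda>_. borel))}"
  unfolding generated_def by (rule sets_vimage_algebra2) (auto simp: space_PiM)

lemma generated_subset: "A \<subseteq> E \<Longrightarrow> sets (generated A) \<subseteq> events"
proof
  fix X assume A: "A \<subseteq> E" and "X \<in> sets (generated A)"
  then obtain S where "S \<in> sets (Pi\<^sub>M A (\<lambda>_. borel))" "X = (\<lambda>\<omega>. \<lambda>e\<in>A. x e \<omega>) -` S \<inter> space M"
    unfolding sets_generated by blast
  then show "X \<in> events" using measurable_sets[OF restrict_meas[OF A]] by simp
qed

lemma generated_meas: "A \<subseteq> E \<Longrightarrow> f \<in> measurable (generated A) N \<Longrightarrow> f \<in> measurable M N"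
proof (rule measurableI)
  fix \<omega> assume "f \<in> measurable (generated A) N" "\<omega> \<in> space M"
  then show "f \<omega> \<in> space N" using measurable_space[of f "generated A" N \<omega>] by simp
next
  fix S assume "A \<subseteq> E" "f \<in> measurable (generated A) N" "S \<in> sets N"
  then show "f -` S \<inter> space M \<in> events"
    using generated_subset[of A] measurable_sets[of f "generated A" N S] by auto
qed

lemma x_generated:
  assumes "e \<in> A"
  shows "x e \<in> borel_measurable (generated A)"
proof -
  have "(\<lambda>\<omega>. \<lambda>e\<in>A. x e \<omega>) \<in> measurable (generated A) (Pi\<^sub>M A (\<lambda>_. borel))"
    unfolding generated_def by (rule measurable_vimage_algebra1) (auto simp: space_PiM)
  then have "(\<lambda>\<omega>. (\<lambda>e\<in>A. x e \<omega>) e) \<in> borel_measurable (generated A)"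
    using assms by (rule measurable_compose[OF _ measurable_component_singleton])
  then show ?thesis using assms by simp
qed

lemma expectation_mult:
  fixes f g :: "'a \<Rightarrow> 'b::{real_normed_field, banach, second_countable_topology}"
  assumes AB: "A \<subseteq> E" "B \<subseteq> E" "A \<inter> B = {}"
    and f: "f \<in> borel_measurable (generated A)" "integrable M f"
    and g: "g \<in> borel_measurable (generated B)" "integrable M g"
  shows "expectation (\<lambda>\<omega>. f \<omega> * g \<omega>) = expectation f * expectation g"
proof (rule indep_var_lebesgue_integral[OF _ f(2) g(2)])
  have ind: "indep_set (sets (generated A)) (sets (generated B))"
  proof -
    have "indep_var (Pi\<^sub>M A (\<lambda>_. borel)) (\<lambda>\<omega>. \<lambda>e\<in>A. x e \<omega>) (Pi\<^sub>M B (\<lambda>_. borel)) (\<lambda>\<omega>. \<lambda>e\<in>B. x e \<omega>)"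
      using indep_var_restrict[OF indep AB(3,1,2)] by simp
    then have "indep_set (sigma_sets (space M) (sets (generated A))) (sigma_sets (space M) (sets (generated B)))"
      unfolding indep_var_eq sets_generated by blast
    then show ?thesis
      using sets.sigma_sets_eq[of "generated A"] sets.sigma_sets_eq[of "generated B"] by simp
  qed
  have sub: "sigma_sets (space M) {h -` S \<inter> space M | S. S \<in> sets borel} \<subseteq> sets (generated C)"
    if "h \<in> borel_measurable (generated C)" for h :: "'a \<Rightarrow> 'b" and C
  proof -
    have "{h -` S \<inter> space M | S. S \<in> sets borel} \<subseteq> sets (generated C)"
      using measurable_sets[OF that] by auto
    from sets.sigma_sets_subset[OF this] show ?thesis by simp
  qed
  show "indep_var borel f borel g"
    unfolding indep_var_eq
  proof (intro conjI)
    show "f \<in> borel_measurable M" by (rule generated_meas[OF AB(1) f(1)])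
    show "g \<in> borel_measurable M" by (rule generated_meas[OF AB(2) g(1)])
    show "indep_set (sigma_sets (space M) {f -` A \<inter> space M |A. A \<in> sets borel}) (sigma_sets (space M) {g -` A \<inter> space M |A. A \<in> sets borel})"
      using ind sub[OF f(1)] sub[OF g(1)] unfolding indep_sets2_eq by blast
  qed
qed

definition xp :: "'e set \<Rightarrow> 'a \<Rightarrow> real" where
  "xp \<Gamma> \<omega> = (\<Prod>e\<in>\<Gamma>. x e \<omega>)"

definition a :: "'e \<Rightarrow> real" where
  "a e = expectation (\<lambda>\<omega>. (x e \<omega>)\<^sup>2)"

definition ap :: "'e set \<Rightarrow> real" where
  "ap \<Gamma> = (\<Prod>e\<in>\<Gamma>. a e)"

lemma a_nonneg: "0 \<le> a e"
  by (simp add: a_def)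

lemma ap_nonneg: "0 \<le> ap \<Gamma>"
  by (simp add: ap_def prod_nonneg a_nonneg)

lemma xp_generated: "\<Gamma> \<subseteq> A \<Longrightarrow> xp \<Gamma> \<in> borel_measurable (generated A)"
  unfolding xp_def[abs_def] using x_generated by (intro borel_measurable_prod) auto

lemma xp_bound: "\<Gamma> \<subseteq> E \<Longrightarrow> \<omega> \<in> space M \<Longrightarrow> \<bar>xp \<Gamma> \<omega>\<bar> \<le> 1"
  unfolding xp_def abs_prod using x_bound by (intro prod_le_1) auto

lemma xp_meas: "\<Gamma> \<subseteq> E \<Longrightarrow> xp \<Gamma> \<in> borel_measurable M"
  using generated_meas[OF _ xp_generated] by blast

lemma xp_empty [simp]: "xp {} \<omega> = 1" by (simp add: xp_def)

lemma xp_insert: "finite \<Gamma> \<Longrightarrow> e \<notin> \<Gamma> \<Longrightarrow> xp (insert e \<Gamma>) \<omega> = x e \<omega> * xp \<Gamma> \<omega>"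
  by (simp add: xp_def)

lemma expectation_x_mult:
  assumes "e \<in> E" "f \<in> borel_measurable (generated (E - {e}))" "\<And>\<omega>. \<omega> \<in> space M \<Longrightarrow> \<bar>f \<omega>\<bar> \<le> b"
  shows "expectation (\<lambda>\<omega>. x e \<omega> ^ k * f \<omega>) = expectation (\<lambda>\<omega>. x e \<omega> ^ k) * expectation f"
proof (rule expectation_mult[where A="{e}" and B="E - {e}"])
  show "(\<lambda>\<omega>. x e \<omega> ^ k) \<in> borel_measurable (generated {e})"
    using x_generated[of e "{e}"] by simp
  show "integrable M (\<lambda>\<omega>. x e \<omega> ^ k)"
  proof (rule integrable_bounded[where B=1])
    show "(\<lambda>\<omega>. x e \<omega> ^ k) \<in> borel_measurable M" using x_meas[OF assms(1)] by simp
    fix \<omega> assume "\<omega> \<in> space M"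
    then show "norm (x e \<omega> ^ k) \<le> 1"
      unfolding real_norm_def power_abs using x_bound[OF assms(1)] by (intro power_le_one) auto
  qed
  show "integrable M f"
    using assms generated_meas[of "E - {e}"] by (intro integrable_bounded[where B=b]) auto
qed (use assms in auto)

lemma expectation_xp_mult_ne:
  assumes "\<Gamma> \<subseteq> E" "\<Gamma>' \<subseteq> E" "\<Gamma> \<noteq> \<Gamma>'"
  shows "expectation (\<lambda>\<omega>. xp \<Gamma> \<omega> * xp \<Gamma>' \<omega>) = 0"
proof -
  have *: "expectation (\<lambda>\<omega>. xp A \<omega> * xp B \<omega>) = 0" if AB: "A \<subseteq> E" "B \<subseteq> E" "e \<in> A" "e \<notin> B" for A B e
  proof -
    have fin: "finite A" using AB finE finite_subset by blast
    have "expectation (\<lambda>\<omega>. xp A \<omega> * xp B \<omega>) = expectation (\<lambda>\<omega>. x e \<omega> ^ 1 * (xp (A - {e}) \<omega> * xp B \<omega>))"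
      using xp_insert[of "A - {e}" e] fin AB by (simp add: insert_absorb mult.assoc)
    also have "\<dots> = expectation (\<lambda>\<omega>. x e \<omega> ^ 1) * expectation (\<lambda>\<omega>. xp (A - {e}) \<omega> * xp B \<omega>)"
    proof (rule expectation_x_mult[where b=1])
      show "(\<lambda>\<omega>. xp (A - {e}) \<omega> * xp B \<omega>) \<in> borel_measurable (generated (E - {e}))"
        using AB by (intro borel_measurable_times xp_generated) auto
      show "\<bar>xp (A - {e}) \<omega> * xp B \<omega>\<bar> \<le> 1" if "\<omega> \<in> space M" for \<omega>
        unfolding abs_mult using AB that by (intro mult_le_one xp_bound) auto
    qed (use AB in auto)
    also have "\<dots> = 0" using x_mean AB by auto
    finally show ?thesis .
  qed
  from assms(3) obtain e where "e \<in> \<Gamma> \<and> e \<notin> \<Gamma>' \<or> e \<in> \<Gamma>' \<and> e \<notin> \<Gamma>" by auto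
  then show ?thesis
    using *[OF assms(1,2)] *[OF assms(2,1)] by (auto simp: mult.commute)
qed

lemma expectation_xp_sq:
  assumes "\<Gamma> \<subseteq> E"
  shows "expectation (\<lambda>\<omega>. (xp \<Gamma> \<omega>)\<^sup>2) = ap \<Gamma>"
proof -
  have "finite \<Gamma>" using assms finE finite_subset by blast
  then show ?thesis using assms
  proof (induction \<Gamma> rule: finite_induct)
    case empty
    then show ?case using prob_space by (simp add: ap_def)
  next
    case (insert e \<Gamma>)
    have "expectation (\<lambda>\<omega>. (xp (insert e \<Gamma>) \<omega>)\<^sup>2) = expectation (\<lambda>\<omega>. x e \<omega> ^ 2 * (xp \<Gamma> \<omega>)\<^sup>2)"
      using insert by (simp add: xp_insert power_mult_distrib)
    also have "\<dots> = expectation (\<lambda>\<omega>. x e \<omega> ^ 2) * expectation (\<lambda>\<omega>. (xp \<Gamma> \<omega>)\<^sup>2)"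
    proof (rule expectation_x_mult[where b=1])
      show "(\<lambda>\<omega>. (xp \<Gamma> \<omega>)\<^sup>2) \<in> borel_measurable (generated (E - {e}))"
        using insert by (intro borel_measurable_power xp_generated) auto
      show "\<bar>(xp \<Gamma> \<omega>)\<^sup>2\<bar> \<le> 1" if "\<omega> \<in> space M" for \<omega>
        unfolding power_abs using insert that by (intro power_le_one xp_bound) auto
    qed (use insert in auto)
    finally show ?case using insert by (simp add: ap_def a_def)
  qed
qed

text \<open>An edge in the symmetric difference contributes its mean, which is zero. So products over different sets
are orthogonal.\<close>

lemma expectation_xp_mult:
  assumes "\<Gamma> \<subseteq> E" "\<Gamma>' \<subseteq> E"
  shows "expectation (\<lambda>\<omega>. xp \<Gamma> \<omega> * xp \<Gamma>' \<omega>) = (if \<Gamma> = \<Gamma>' then ap \<Gamma> else 0)"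
  using expectation_xp_mult_ne[OF assms] expectation_xp_sq[OF assms(1)] by (auto simp: power2_eq_square)

lemma xp_mult_bound:
  assumes "\<Gamma> \<subseteq> E" "\<Gamma>' \<subseteq> E" "\<omega> \<in> space M"
  shows "\<bar>xp \<Gamma> \<omega> * xp \<Gamma>' \<omega>\<bar> \<le> 1"
  unfolding abs_mult using assms by (intro mult_le_one xp_bound) auto

lemma integrable_xp_mult:
  assumes "\<Gamma> \<subseteq> E" "\<Gamma>' \<subseteq> E"
  shows "integrable M (\<lambda>\<omega>. xp \<Gamma> \<omega> * xp \<Gamma>' \<omega>)"
  using assms xp_meas xp_mult_bound by (intro integrable_bounded[where B=1]) auto

lemma expectation_sum_sq:
  assumes "finite I" "\<And>i. i \<in> I \<Longrightarrow> Q i \<subseteq> E"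
  shows "expectation (\<lambda>\<omega>. (\<Sum>i\<in>I. c i * xp (Q i) \<omega>)\<^sup>2) = (\<Sum>i\<in>I. \<Sum>j\<in>I. if Q i = Q j then c i * c j * ap (Q i) else 0)"
proof -
  have "expectation (\<lambda>\<omega>. (\<Sum>i\<in>I. c i * xp (Q i) \<omega>)\<^sup>2) =
      expectation (\<lambda>\<omega>. \<Sum>i\<in>I. \<Sum>j\<in>I. c i * c j * (xp (Q i) \<omega> * xp (Q j) \<omega>))"
    by (simp add: power2_eq_square sum_product algebra_simps)
  also have "\<dots> = (\<Sum>i\<in>I. \<Sum>j\<in>I. c i * c j * expectation (\<lambda>\<omega>. xp (Q i) \<omega> * xp (Q j) \<omega>))"
    using assms by (simp add: Bochner_Integration.integral_sum integrable_xp_mult)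
  also have "\<dots> = (\<Sum>i\<in>I. \<Sum>j\<in>I. if Q i = Q j then c i * c j * ap (Q i) else 0)"
    using assms by (intro sum.cong refl) (simp add: expectation_xp_mult)
  finally show ?thesis .
qed

text \<open>If each product is repeated at most \<open>K\<close> times, the inequality
\<open>2 * c i * c j \<le> (c i)^2 + (c j)^2\<close> reduces the double sum to the diagonal.\<close>

lemma expectation_sum_sq_le:
  assumes "finite I" "\<And>i. i \<in> I \<Longrightarrow> Q i \<subseteq> E"
    and K: "\<And>i. i \<in> I \<Longrightarrow> real (card {j \<in> I. Q j = Q i}) \<le> K"
  shows "expectation (\<lambda>\<omega>. (\<Sum>i\<in>I. c i * xp (Q i) \<omega>)\<^sup>2) \<le> K * (\<Sum>i\<in>I. (c i)\<^sup>2 * ap (Q i))"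
proof -
  define f where "f i j = (if Q i = Q j then (c i)\<^sup>2 * ap (Q i) / 2 else 0)" for i j
  have "expectation (\<lambda>\<omega>. (\<Sum>i\<in>I. c i * xp (Q i) \<omega>)\<^sup>2) =
      (\<Sum>i\<in>I. \<Sum>j\<in>I. if Q i = Q j then c i * c j * ap (Q i) else 0)"
    using assms(1,2) by (rule expectation_sum_sq)
  also have "\<dots> \<le> (\<Sum>i\<in>I. \<Sum>j\<in>I. f i j + f j i)"
  proof (intro sum_mono)
    fix i j
    have "c i * c j \<le> (c i)\<^sup>2 / 2 + (c j)\<^sup>2 / 2"
      using sum_squares_bound[of "c i" "c j"] by simp
    then have "c i * c j * ap (Q i) \<le> ((c i)\<^sup>2 / 2 + (c j)\<^sup>2 / 2) * ap (Q i)"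
      by (intro mult_right_mono ap_nonneg)
    then show "(if Q i = Q j then c i * c j * ap (Q i) else 0) \<le> f i j + f j i"
      by (cases "Q i = Q j") (simp_all add: f_def algebra_simps)
  qed
  also have "\<dots> = (\<Sum>i\<in>I. \<Sum>j\<in>I. f i j) + (\<Sum>i\<in>I. \<Sum>j\<in>I. f j i)" by (simp add: sum.distrib)
  also have "(\<Sum>i\<in>I. \<Sum>j\<in>I. f j i) = (\<Sum>i\<in>I. \<Sum>j\<in>I. f i j)" by (rule sum.swap)
  also have "(\<Sum>i\<in>I. \<Sum>j\<in>I. f i j) = (\<Sum>i\<in>I. real (card {j \<in> I. Q j = Q i}) * ((c i)\<^sup>2 * ap (Q i) / 2))"
  proof (intro sum.cong refl)
    fix i
    have "(\<Sum>j\<in>I. f i j) = (\<Sum>j\<in>{j\<in>I. Q j = Q i}. (c i)\<^sup>2 * ap (Q i) / 2)"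
      unfolding f_def using assms(1) by (subst sum.inter_filter) (auto intro!: sum.cong)
    then show "(\<Sum>j\<in>I. f i j) = real (card {j \<in> I. Q j = Q i}) * ((c i)\<^sup>2 * ap (Q i) / 2)" by simp
  qed
  also have "\<dots> + \<dots> = (\<Sum>i\<in>I. real (card {j \<in> I. Q j = Q i}) * ((c i)\<^sup>2 * ap (Q i)))"
    unfolding sum.distrib[symmetric] by (intro sum.cong refl) simp
  also have "\<dots> \<le> (\<Sum>i\<in>I. K * ((c i)\<^sup>2 * ap (Q i)))"
    using K by (intro sum_mono mult_right_mono) (auto simp: ap_nonneg)
  finally show ?thesis by (simp add: sum_distrib_left)
qed

end

lemma (in prob_space) cauchy_schwarz:
  fixes u v :: "'a \<Rightarrow> real"
  assumes "integrable M (\<lambda>\<omega>. (u \<omega>)\<^sup>2)" "integrable M (\<lambda>\<omega>. (v \<omega>)\<^sup>2)" "integrable M (\<lambda>\<omega>. u \<omega> * v \<omega>)"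
  shows "(expectation (\<lambda>\<omega>. u \<omega> * v \<omega>))\<^sup>2 \<le> expectation (\<lambda>\<omega>. (u \<omega>)\<^sup>2) * expectation (\<lambda>\<omega>. (v \<omega>)\<^sup>2)"
proof -
  define P where "P = expectation (\<lambda>\<omega>. (u \<omega>)\<^sup>2)"
  define Q where "Q = expectation (\<lambda>\<omega>. (v \<omega>)\<^sup>2)"
  define R where "R = expectation (\<lambda>\<omega>. u \<omega> * v \<omega>)"
  have PQ: "0 \<le> P" "0 \<le> Q" by (simp_all add: P_def Q_def)
  have quad: "0 \<le> t\<^sup>2 * P - 2 * t * R + Q" for t
  proof -
    have "0 \<le> expectation (\<lambda>\<omega>. (t * u \<omega> - v \<omega>)\<^sup>2)" by simp
    also have "\<dots> = expectation (\<lambda>\<omega>. t\<^sup>2 * (u \<omega>)\<^sup>2 - 2 * t * (u \<omega> * v \<omega>) + (v \<omega>)\<^sup>2)"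
      by (simp add: power2_eq_square algebra_simps)
    also have "\<dots> = t\<^sup>2 * P - 2 * t * R + Q"
      using assms by (simp add: P_def Q_def R_def)
    finally show ?thesis .
  qed
  show ?thesis
  proof (cases "P = 0")
    case True
    have "R = 0"
    proof (rule ccontr)
      assume "R \<noteq> 0"
      then show False using quad[of "(Q + 1) / (2 * R)"] True by simp
    qed
    then show ?thesis using PQ by (simp add: P_def[symmetric] Q_def[symmetric] R_def[symmetric])
  next
    case False
    then have P: "0 < P" using PQ by simp
    have "(R / P)\<^sup>2 * P - 2 * (R / P) * R + Q = Q - R\<^sup>2 / P"
      using P by (simp add: power2_eq_square field_simps)
    then have "R\<^sup>2 / P \<le> Q" using quad[of "R / P"] by simp
    then have "R\<^sup>2 \<le> P * Q" using P by (simp add: divide_le_eq mult.commute)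
    then show ?thesis by (simp add: P_def Q_def R_def)
  qed
qed

context sym_indep begin

text \<open>A multilinear polynomial of degree at most \<open>d\<close> in the variables.\<close>

definition poly :: "('e set \<Rightarrow> real) \<Rightarrow> 'e set \<Rightarrow> nat \<Rightarrow> 'a \<Rightarrow> real" where
  "poly c A d \<omega> = (\<Sum>\<Gamma> | \<Gamma> \<subseteq> A \<and> card \<Gamma> \<le> d. c \<Gamma> * xp \<Gamma> \<omega>)"

lemma finite_sub: "A \<subseteq> E \<Longrightarrow> finite A"
  using finE finite_subset by blast

lemma poly_const:
  assumes "finite A" "A = {} \<or> d = 0"
  shows "poly c A d \<omega> = c {}"
proof -
  have "\<Gamma> = {}" if "\<Gamma> \<subseteq> A" "card \<Gamma> \<le> d" for \<Gamma>
  proof -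
    have "finite \<Gamma>" using that(1) assms(1) by (rule finite_subset)
    then show ?thesis using that assms(2) by auto
  qed
  then have "{\<Gamma>. \<Gamma> \<subseteq> A \<and> card \<Gamma> \<le> d} = {{}}" by auto
  then show ?thesis by (simp add: poly_def)
qed

text \<open>Conditioning on all variables but one: a multilinear polynomial is affine in each of them.\<close>

lemma poly_insert:
  assumes "finite A" "e \<notin> A"
  shows "poly c (insert e A) (Suc d) \<omega> = poly c A (Suc d) \<omega> + x e \<omega> * poly (\<lambda>\<Gamma>. c (insert e \<Gamma>)) A d \<omega>"
proof -
  let ?S = "\<lambda>d. {\<Gamma>. \<Gamma> \<subseteq> A \<and> card \<Gamma> \<le> d}"
  have fin: "finite (?S d)" for d by (rule finite_subset[of _ "Pow A"]) (use assms in auto)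
  have eq: "{\<Gamma>. \<Gamma> \<subseteq> insert e A \<and> card \<Gamma> \<le> Suc d} = ?S (Suc d) \<union> insert e ` ?S d" (is "?L = _")
  proof (intro equalityI subsetI)
    fix \<Gamma> assume \<Gamma>: "\<Gamma> \<in> ?L"
    show "\<Gamma> \<in> ?S (Suc d) \<union> insert e ` ?S d"
    proof (cases "e \<in> \<Gamma>")
      case True
      have "finite \<Gamma>" using \<Gamma> assms finite_subset[of \<Gamma> "insert e A"] by simp
      moreover have "\<Gamma> = insert e (\<Gamma> - {e})" using True by blast
      moreover have "\<Gamma> - {e} \<subseteq> A" using \<Gamma> by blast
      ultimately have "\<Gamma> - {e} \<in> ?S d" using \<Gamma> True by (simp add: card_Diff_singleton le_diff_conv)
      then show ?thesis using \<open>\<Gamma> = insert e (\<Gamma> - {e})\<close> by blast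
    qed (use \<Gamma> in auto)
  next
    fix \<Gamma> assume "\<Gamma> \<in> ?S (Suc d) \<union> insert e ` ?S d"
    then show "\<Gamma> \<in> ?L"
    proof
      assume "\<Gamma> \<in> insert e ` ?S d"
      then obtain \<Gamma>' where "\<Gamma> = insert e \<Gamma>'" "\<Gamma>' \<subseteq> A" "card \<Gamma>' \<le> d" by auto
      moreover have "card (insert e \<Gamma>') \<le> Suc (card \<Gamma>')" by (rule card_insert_le_m1) auto
      ultimately show ?thesis by auto
    qed auto
  qed
  have inj: "inj_on (insert e) (?S d)"
  proof (rule inj_onI)
    fix X Y assume *: "X \<in> ?S d" "Y \<in> ?S d" "insert e X = insert e Y"
    then have "e \<notin> X" "e \<notin> Y" using assms by auto
    then show "X = Y" using *(3) by (simp add: insert_ident)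
  qed
  have "poly c (insert e A) (Suc d) \<omega> = poly c A (Suc d) \<omega> + (\<Sum>\<Gamma>\<in>insert e ` ?S d. c \<Gamma> * xp \<Gamma> \<omega>)"
    unfolding poly_def eq by (rule sum.union_disjoint) (use assms fin in auto)
  also have "(\<Sum>\<Gamma>\<in>insert e ` ?S d. c \<Gamma> * xp \<Gamma> \<omega>) = (\<Sum>\<Gamma>\<in>?S d. x e \<omega> * (c (insert e \<Gamma>) * xp \<Gamma> \<omega>))"
    unfolding sum.reindex[OF inj]
  proof (intro sum.cong refl)
    fix \<Gamma> assume "\<Gamma> \<in> ?S d"
    then have "finite \<Gamma>" "e \<notin> \<Gamma>" using assms finite_subset[of \<Gamma> A] by auto
    then show "((\<lambda>\<Gamma>. c \<Gamma> * xp \<Gamma> \<omega>) \<circ> insert e) \<Gamma> = x e \<omega> * (c (insert e \<Gamma>) * xp \<Gamma> \<omega>)"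
      by (simp add: xp_insert)
  qed
  finally show ?thesis by (simp add: poly_def sum_distrib_left)
qed

lemma poly_generated: "A \<subseteq> B \<Longrightarrow> poly c A d \<in> borel_measurable (generated B)"
  unfolding poly_def[abs_def] by (intro borel_measurable_sum borel_measurable_times borel_measurable_const xp_generated) auto

lemma poly_bounded:
  assumes "A \<subseteq> E"
  shows "\<exists>b. \<forall>\<omega>\<in>space M. \<bar>poly c A d \<omega>\<bar> \<le> b"
proof (intro exI ballI)
  fix \<omega> assume \<omega>: "\<omega> \<in> space M"
  have "\<bar>poly c A d \<omega>\<bar> \<le> (\<Sum>\<Gamma> | \<Gamma> \<subseteq> A \<and> card \<Gamma> \<le> d. \<bar>c \<Gamma> * xp \<Gamma> \<omega>\<bar>)"
    unfolding poly_def by (rule sum_abs)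
  also have "\<dots> \<le> (\<Sum>\<Gamma> | \<Gamma> \<subseteq> A \<and> card \<Gamma> \<le> d. \<bar>c \<Gamma>\<bar>)"
    using assms \<omega> by (intro sum_mono) (auto simp: abs_mult intro!: mult_left_le xp_bound)
  finally show "\<bar>poly c A d \<omega>\<bar> \<le> (\<Sum>\<Gamma> | \<Gamma> \<subseteq> A \<and> card \<Gamma> \<le> d. \<bar>c \<Gamma>\<bar>)" .
qed

lemma integrable_poly_mult:
  assumes "A \<subseteq> E"
  shows "integrable M (\<lambda>\<omega>. poly c A d \<omega> ^ i * poly c' A d' \<omega> ^ j)"
proof -
  obtain b b' where b: "\<And>\<omega>. \<omega> \<in> space M \<Longrightarrow> \<bar>poly c A d \<omega>\<bar> \<le> b" "\<And>\<omega>. \<omega> \<in> space M \<Longrightarrow> \<bar>poly c' A d' \<omega>\<bar> \<le> b'"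
    using poly_bounded[OF assms] by metis
  have [measurable]: "poly c A d \<in> borel_measurable M" "poly c' A d' \<in> borel_measurable M"
    using generated_meas[OF assms poly_generated] by auto
  show ?thesis
  proof (rule integrable_bounded[where B="b ^ i * b' ^ j"])
    fix \<omega> assume \<omega>: "\<omega> \<in> space M"
    have "0 \<le> b" using b(1)[OF \<omega>] by linarith
    then show "norm (poly c A d \<omega> ^ i * poly c' A d' \<omega> ^ j) \<le> b ^ i * b' ^ j"
      unfolding real_norm_def abs_mult power_abs using b[OF \<omega>] by (intro mult_mono power_mono) auto
  qed measurable
qed

lemma expectation_split:
  assumes "e \<in> E" "A \<subseteq> E" "e \<notin> A"
  shows "expectation (\<lambda>\<omega>. x e \<omega> ^ k * (poly c A d \<omega> ^ i * poly c' A d' \<omega> ^ j)) =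
    expectation (\<lambda>\<omega>. x e \<omega> ^ k) * expectation (\<lambda>\<omega>. poly c A d \<omega> ^ i * poly c' A d' \<omega> ^ j)"
    and "integrable M (\<lambda>\<omega>. x e \<omega> ^ k * (poly c A d \<omega> ^ i * poly c' A d' \<omega> ^ j))"
proof -
  obtain b b' where b: "\<And>\<omega>. \<omega> \<in> space M \<Longrightarrow> \<bar>poly c A d \<omega>\<bar> \<le> b" "\<And>\<omega>. \<omega> \<in> space M \<Longrightarrow> \<bar>poly c' A d' \<omega>\<bar> \<le> b'"
    using poly_bounded[OF assms(2)] by metis
  have bb: "\<bar>poly c A d \<omega> ^ i * poly c' A d' \<omega> ^ j\<bar> \<le> b ^ i * b' ^ j" if \<omega>: "\<omega> \<in> space M" for \<omega>
  proof -
    have "0 \<le> b" using b(1)[OF \<omega>] by linarith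
    then show ?thesis unfolding abs_mult power_abs using b[OF \<omega>] by (intro mult_mono power_mono) auto
  qed
  have m: "(\<lambda>\<omega>. poly c A d \<omega> ^ i * poly c' A d' \<omega> ^ j) \<in> borel_measurable (generated (E - {e}))"
    using assms by (intro borel_measurable_times borel_measurable_power poly_generated) auto
  show "expectation (\<lambda>\<omega>. x e \<omega> ^ k * (poly c A d \<omega> ^ i * poly c' A d' \<omega> ^ j)) =
    expectation (\<lambda>\<omega>. x e \<omega> ^ k) * expectation (\<lambda>\<omega>. poly c A d \<omega> ^ i * poly c' A d' \<omega> ^ j)"
    by (rule expectation_x_mult[OF assms(1) m bb])
  show "integrable M (\<lambda>\<omega>. x e \<omega> ^ k * (poly c A d \<omega> ^ i * poly c' A d' \<omega> ^ j))"
  proof (rule integrable_bounded[where B="1 * (b ^ i * b' ^ j)"])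
    show "(\<lambda>\<omega>. x e \<omega> ^ k * (poly c A d \<omega> ^ i * poly c' A d' \<omega> ^ j)) \<in> borel_measurable M"
      by (rule borel_measurable_times[OF borel_measurable_power[OF x_meas[OF assms(1)]] generated_meas[OF _ m]]) auto
    fix \<omega> assume \<omega>: "\<omega> \<in> space M"
    have "\<bar>x e \<omega> ^ k\<bar> \<le> 1" unfolding power_abs using x_bound[OF assms(1) \<omega>] by (intro power_le_one) auto
    then show "norm (x e \<omega> ^ k * (poly c A d \<omega> ^ i * poly c' A d' \<omega> ^ j)) \<le> 1 * (b ^ i * b' ^ j)"
      unfolding real_norm_def abs_mult[of "x e \<omega> ^ k"] using bb[OF \<omega>] by (intro mult_mono) auto
  qed
qed

text \<open>Hypercontractivity by induction on the variables. For \<open>f + x * g\<close> with \<open>x\<close>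
independent of \<open>f\<close> and \<open>g\<close>, the terms with odd powers of \<open>x\<close> vanish, and the
mixed term \<open>6 * f^2 * g^2\<close> is treated with the Cauchy-Schwarz inequality. The square of the second
moment provides twice the mixed product, and the factor \<open>sqrt K\<close> has to make up for the ratio
\<open>6 / 2\<close>; this is the reason for \<open>9 \<le> K\<close>.\<close>

lemma bonami:
  assumes K: "\<And>e. e \<in> E \<Longrightarrow> expectation (\<lambda>\<omega>. x e \<omega> ^ 4) \<le> K * (a e)\<^sup>2" "9 \<le> K"
    and A: "A \<subseteq> E"
  shows "expectation (\<lambda>\<omega>. poly c A d \<omega> ^ 4) \<le> K ^ d * (expectation (\<lambda>\<omega>. (poly c A d \<omega>)\<^sup>2))\<^sup>2"
  using finite_sub[OF A] A
proof (induction A arbitrary: c d rule: finite_induct)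
  case empty
  have "(1::real) \<le> K ^ d" using K(2) by (intro one_le_power) auto
  then show ?case using prob_space mult_right_mono[of 1 "K ^ d" "c {} ^ 4"] by (simp add: poly_const power_mult[symmetric])
next
  case (insert e A)
  show ?case
  proof (cases d)
    case 0
    then show ?thesis using prob_space insert.hyps by (simp add: poly_const power_mult[symmetric])
  next
    case (Suc n)
    have eE: "e \<in> E" "A \<subseteq> E" using insert by auto
    define g where "g = poly c A (Suc n)"
    define h where "h = poly (\<lambda>\<Gamma>. c (insert e \<Gamma>)) A n"
    define f where "f = poly c (insert e A) d"
    have f: "f \<omega> = g \<omega> + x e \<omega> * h \<omega>" for \<omega>
      unfolding f_def g_def h_def Suc using insert.hyps by (rule poly_insert)
    define m where "m i j = expectation (\<lambda>\<omega>. g \<omega> ^ i * h \<omega> ^ j)" for i j :: nat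
    have split: "expectation (\<lambda>\<omega>. x e \<omega> ^ k * (g \<omega> ^ i * h \<omega> ^ j)) = expectation (\<lambda>\<omega>. x e \<omega> ^ k) * m i j"
      and int: "integrable M (\<lambda>\<omega>. x e \<omega> ^ k * (g \<omega> ^ i * h \<omega> ^ j))" for k i j
      unfolding g_def h_def m_def using expectation_split[OF eE insert.hyps(2)] by auto
    have int': "integrable M (\<lambda>\<omega>. g \<omega> ^ i * h \<omega> ^ j)" for i j
      unfolding g_def h_def by (rule integrable_poly_mult[OF eE(2)])
    have x1: "expectation (\<lambda>\<omega>. x e \<omega> ^ 1) = 0" using x_mean[OF eE(1)] by simp
    have x3: "expectation (\<lambda>\<omega>. x e \<omega> ^ 3) = 0" using x_third[OF eE(1)] .
    have x2: "expectation (\<lambda>\<omega>. x e \<omega> ^ 2) = a e" by (simp add: a_def)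
    have "expectation (\<lambda>\<omega>. (f \<omega>)\<^sup>2) = expectation (\<lambda>\<omega>. g \<omega> ^ 2 * h \<omega> ^ 0 + 2 * (x e \<omega> ^ 1 * (g \<omega> ^ 1 * h \<omega> ^ 1)) + x e \<omega> ^ 2 * (g \<omega> ^ 0 * h \<omega> ^ 2))"
      unfolding f by (intro Bochner_Integration.integral_cong) (auto simp: power2_eq_square algebra_simps)
    also have "\<dots> = m 2 0 + 2 * expectation (\<lambda>\<omega>. x e \<omega> ^ 1 * (g \<omega> ^ 1 * h \<omega> ^ 1)) + expectation (\<lambda>\<omega>. x e \<omega> ^ 2 * (g \<omega> ^ 0 * h \<omega> ^ 2))"
      unfolding m_def
      by (simp only: Bochner_Integration.integral_add Bochner_Integration.integral_mult_right_zero
          Bochner_Integration.integrable_add integrable_mult_right int int')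
    also have "\<dots> = m 2 0 + a e * m 0 2" unfolding split x1 x2 by simp
    finally have f2: "expectation (\<lambda>\<omega>. (f \<omega>)\<^sup>2) = m 2 0 + a e * m 0 2" .
    have "expectation (\<lambda>\<omega>. f \<omega> ^ 4) = expectation (\<lambda>\<omega>. g \<omega> ^ 4 * h \<omega> ^ 0 + 4 * (x e \<omega> ^ 1 * (g \<omega> ^ 3 * h \<omega> ^ 1))
        + 6 * (x e \<omega> ^ 2 * (g \<omega> ^ 2 * h \<omega> ^ 2)) + 4 * (x e \<omega> ^ 3 * (g \<omega> ^ 1 * h \<omega> ^ 3)) + x e \<omega> ^ 4 * (g \<omega> ^ 0 * h \<omega> ^ 4))"
      unfolding f by (intro Bochner_Integration.integral_cong) (auto simp: eval_nat_numeral algebra_simps)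
    also have "\<dots> = m 4 0 + 4 * expectation (\<lambda>\<omega>. x e \<omega> ^ 1 * (g \<omega> ^ 3 * h \<omega> ^ 1)) + 6 * expectation (\<lambda>\<omega>. x e \<omega> ^ 2 * (g \<omega> ^ 2 * h \<omega> ^ 2))
        + 4 * expectation (\<lambda>\<omega>. x e \<omega> ^ 3 * (g \<omega> ^ 1 * h \<omega> ^ 3)) + expectation (\<lambda>\<omega>. x e \<omega> ^ 4 * (g \<omega> ^ 0 * h \<omega> ^ 4))"
      unfolding m_def
      by (simp only: Bochner_Integration.integral_add Bochner_Integration.integral_mult_right_zero
          Bochner_Integration.integrable_add integrable_mult_right int int')
    also have "\<dots> = m 4 0 + 6 * (a e * m 2 2) + expectation (\<lambda>\<omega>. x e \<omega> ^ 4) * m 0 4"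
      unfolding split x1 x2 x3 by simp
    finally have f4: "expectation (\<lambda>\<omega>. f \<omega> ^ 4) = m 4 0 + 6 * (a e * m 2 2) + expectation (\<lambda>\<omega>. x e \<omega> ^ 4) * m 0 4" .
    define G where "G = m 2 0"
    define H where "H = m 0 2"
    have GH: "0 \<le> G" "0 \<le> H" by (simp_all add: G_def H_def m_def)
    have K0: "0 \<le> K" using K(2) by simp
    have g4: "m 4 0 \<le> K ^ Suc n * G\<^sup>2"
      using insert.IH[OF eE(2), of c "Suc n"] by (simp add: m_def G_def g_def)
    have h4: "m 0 4 \<le> K ^ n * H\<^sup>2"
      using insert.IH[OF eE(2), of "\<lambda>\<Gamma>. c (insert e \<Gamma>)" n] by (simp add: m_def H_def h_def)
    have m0: "0 \<le> m 4 0" "0 \<le> m 0 4" by (simp_all add: m_def)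
    have "(m 2 2)\<^sup>2 \<le> m 4 0 * m 0 4"
    proof -
      have "(expectation (\<lambda>\<omega>. (g \<omega>)\<^sup>2 * (h \<omega>)\<^sup>2))\<^sup>2 \<le> expectation (\<lambda>\<omega>. ((g \<omega>)\<^sup>2)\<^sup>2) * expectation (\<lambda>\<omega>. ((h \<omega>)\<^sup>2)\<^sup>2)"
        using int'[of 4 0] int'[of 0 4] int'[of 2 2] by (intro cauchy_schwarz) (simp_all add: power_mult[symmetric])
      then show ?thesis by (simp add: m_def power_mult[symmetric])
    qed
    also have "\<dots> \<le> (K ^ Suc n * G\<^sup>2) * (K ^ n * H\<^sup>2)"
      using g4 h4 m0 K0 by (intro mult_mono) auto
    also have "9 * \<dots> \<le> K * \<dots>"
      using K(2) K0 by (intro mult_right_mono) auto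
    also have "K * ((K ^ Suc n * G\<^sup>2) * (K ^ n * H\<^sup>2)) = (K ^ Suc n * G * H)\<^sup>2"
      by (simp add: power2_eq_square algebra_simps)
    finally have "(3 * m 2 2)\<^sup>2 \<le> (K ^ Suc n * G * H)\<^sup>2"
      by (simp add: power_mult_distrib)
    then have m22: "3 * m 2 2 \<le> K ^ Suc n * G * H"
      by (rule power2_le_imp_le) (use K0 GH in simp)
    have "expectation (\<lambda>\<omega>. x e \<omega> ^ 4) * m 0 4 \<le> K * (a e)\<^sup>2 * (K ^ n * H\<^sup>2)"
      using K(1)[OF eE(1)] h4 m0 K0 by (intro mult_mono) auto
    moreover have "a e * (3 * m 2 2) \<le> a e * (K ^ Suc n * G * H)"
      using m22 by (intro mult_left_mono a_nonneg)
    ultimately have "expectation (\<lambda>\<omega>. f \<omega> ^ 4) \<le> K ^ Suc n * G\<^sup>2 + 2 * (a e * (K ^ Suc n * G * H)) + K * (a e)\<^sup>2 * (K ^ n * H\<^sup>2)"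
      unfolding f4 using g4 by simp
    also have "\<dots> = K ^ d * (G + a e * H)\<^sup>2"
      by (simp add: Suc power2_eq_square algebra_simps)
    finally show ?thesis using f2 by (simp add: f_def G_def H_def)
  qed
qed

section \<open>Concentration of the conditional variance\<close>

lemma xp_split:
  assumes "E0 \<union> E1 \<subseteq> E" "E0 \<inter> E1 = {}" "\<Gamma> \<subseteq> E0 \<union> E1"
  shows "xp \<Gamma> \<omega> = xp (\<Gamma> \<inter> E0) \<omega> * xp (\<Gamma> \<inter> E1) \<omega>" "ap \<Gamma> = ap (\<Gamma> \<inter> E0) * ap (\<Gamma> \<inter> E1)"
proof -
  have fin: "finite \<Gamma>" using assms finE finite_subset by (metis subset_trans)
  have "\<Gamma> = (\<Gamma> \<inter> E0) \<union> (\<Gamma> \<inter> E1)" using assms by auto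
  then have "prod f \<Gamma> = prod f (\<Gamma> \<inter> E0) * prod f (\<Gamma> \<inter> E1)" for f :: "'e \<Rightarrow> real"
    using fin assms prod.union_disjoint[of "\<Gamma> \<inter> E0" "\<Gamma> \<inter> E1" f] by auto
  then show "xp \<Gamma> \<omega> = xp (\<Gamma> \<inter> E0) \<omega> * xp (\<Gamma> \<inter> E1) \<omega>" "ap \<Gamma> = ap (\<Gamma> \<inter> E0) * ap (\<Gamma> \<inter> E1)"
    by (simp_all add: xp_def ap_def)
qed

lemma xp_union:
  assumes "\<Gamma> \<subseteq> E" "\<Gamma>' \<subseteq> E" "\<Gamma> \<inter> \<Gamma>' = {}"
  shows "xp (\<Gamma> \<union> \<Gamma>') \<omega> = xp \<Gamma> \<omega> * xp \<Gamma>' \<omega>" "ap (\<Gamma> \<union> \<Gamma>') = ap \<Gamma> * ap \<Gamma>'"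
  using assms finite_sub by (simp_all add: xp_def ap_def prod.union_disjoint)

lemma expectation_factor:
  fixes Z :: "'a \<Rightarrow> complex"
  assumes E01: "E0 \<subseteq> E" "E1 \<subseteq> E" "E0 \<inter> E1 = {}"
    and Z: "Z \<in> borel_measurable (generated E0)" "\<And>\<omega>. \<omega> \<in> space M \<Longrightarrow> cmod (Z \<omega>) \<le> 1"
    and R: "R \<subseteq> E0" "R' \<subseteq> E0" and T: "T \<subseteq> E1" "T' \<subseteq> E1"
  shows "expectation (\<lambda>\<omega>. Z \<omega> * complex_of_real (xp R \<omega> * xp R' \<omega>) * complex_of_real (xp T \<omega> * xp T' \<omega>))
      = (if T = T' then ap T else 0) * expectation (\<lambda>\<omega>. Z \<omega> * complex_of_real (xp R \<omega> * xp R' \<omega>))" (is "?e = _")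
    and "integrable M (\<lambda>\<omega>. Z \<omega> * complex_of_real (xp R \<omega> * xp R' \<omega>))" (is "integrable M ?f")
    and "integrable M (\<lambda>\<omega>. Z \<omega> * complex_of_real (xp R \<omega> * xp R' \<omega>) * complex_of_real (xp T \<omega> * xp T' \<omega>))" (is "integrable M ?h")
proof -
  have sub: "R \<subseteq> E" "R' \<subseteq> E" "T \<subseteq> E" "T' \<subseteq> E" using E01 R T by auto
  have fm: "?f \<in> borel_measurable (generated E0)"
    by (intro borel_measurable_times[OF Z(1)] measurable_compose[OF borel_measurable_times[OF xp_generated[OF R(1)] xp_generated[OF R(2)]]]
        borel_measurable_continuous_onI continuous_intros)
  have gm: "(\<lambda>\<omega>. complex_of_real (xp T \<omega> * xp T' \<omega>)) \<in> borel_measurable (generated E1)"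
    by (intro measurable_compose[OF borel_measurable_times[OF xp_generated[OF T(1)] xp_generated[OF T(2)]]]
        borel_measurable_continuous_onI continuous_intros)
  have fb: "cmod (?f \<omega>) \<le> 1" if "\<omega> \<in> space M" for \<omega>
    unfolding norm_mult[of "Z \<omega>"] norm_of_real using Z(2)[OF that] xp_mult_bound[OF sub(1,2) that] by (intro mult_le_one) auto
  have gb: "cmod (complex_of_real (xp T \<omega> * xp T' \<omega>)) \<le> 1" if "\<omega> \<in> space M" for \<omega>
    unfolding norm_of_real using xp_mult_bound[OF sub(3,4) that] .
  show fi: "integrable M ?f" by (rule integrable_bounded[OF generated_meas[OF E01(1) fm] fb])
  have gi: "integrable M (\<lambda>\<omega>. complex_of_real (xp T \<omega> * xp T' \<omega>))" by (rule integrable_bounded[OF generated_meas[OF E01(2) gm] gb])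
  show "integrable M ?h"
  proof (rule integrable_bounded[where B=1])
    show "?h \<in> borel_measurable M" by (rule borel_measurable_times[OF generated_meas[OF E01(1) fm] generated_meas[OF E01(2) gm]])
    fix \<omega> assume "\<omega> \<in> space M"
    then show "cmod (?h \<omega>) \<le> 1" unfolding norm_mult[of "?f \<omega>"] using fb gb by (intro mult_le_one) auto
  qed
  have "?e = expectation ?f * expectation (\<lambda>\<omega>. complex_of_real (xp T \<omega> * xp T' \<omega>))"
    by (rule expectation_mult[OF E01 fm fi gm gi])
  also have "expectation (\<lambda>\<omega>. complex_of_real (xp T \<omega> * xp T' \<omega>)) = complex_of_real (expectation (\<lambda>\<omega>. xp T \<omega> * xp T' \<omega>))"
    by (rule integral_of_real[OF integrable_xp_mult[OF sub(3,4)]])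
  also have "\<dots> = (if T = T' then ap T else 0)" using expectation_xp_mult[OF sub(3,4)] by simp
  finally show "?e = (if T = T' then ap T else 0) * expectation ?f" by (simp only: mult.commute)
qed

end

text \<open>One step of the martingale: \<open>E0\<close> are the variables known before the step, \<open>E1\<close>
those revealed in it, and each product in \<open>G\<close> contains a new variable.\<close>

locale level = sym_indep M x E for M :: "'a measure" and x :: "'e \<Rightarrow> 'a \<Rightarrow> real" and E +
  fixes E0 E1 :: "'e set" and G :: "'e set set" and lam :: real
  assumes E01: "E0 \<subseteq> E" "E1 \<subseteq> E" "E0 \<inter> E1 = {}"
    and G: "\<And>\<Gamma>. \<Gamma> \<in> G \<Longrightarrow> \<Gamma> \<subseteq> E0 \<union> E1" "\<And>\<Gamma>. \<Gamma> \<in> G \<Longrightarrow> \<Gamma> \<inter> E1 \<noteq> {}"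
begin

lemma G_sub: "\<Gamma> \<in> G \<Longrightarrow> \<Gamma> \<subseteq> E"
  using G(1) E01 by blast

lemma finG: "finite G"
proof (rule finite_subset)
  show "G \<subseteq> Pow E" using G_sub by blast
qed (simp add: finE)

definition D :: "'a \<Rightarrow> real" where
  "D \<omega> = (\<Sum>\<Gamma>\<in>G. lam * xp \<Gamma> \<omega>)"

text \<open>The conditional variance of \<open>D\<close> given \<open>E0\<close>, in explicit form.\<close>

definition V :: "'a \<Rightarrow> real" where
  "V \<omega> = (\<Sum>\<Gamma>\<in>G. \<Sum>\<Gamma>'\<in>G. lam\<^sup>2 * (if \<Gamma> \<inter> E1 = \<Gamma>' \<inter> E1 then ap (\<Gamma> \<inter> E1) else 0) * (xp (\<Gamma> \<inter> E0) \<omega> * xp (\<Gamma>' \<inter> E0) \<omega>))"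

definition q :: real where
  "q = (\<Sum>\<Gamma>\<in>G. lam\<^sup>2 * ap \<Gamma>)"

lemma q_nonneg: "0 \<le> q"
  by (simp add: q_def sum_nonneg ap_nonneg)

lemma D_meas: "D \<in> borel_measurable M"
  unfolding D_def[abs_def] using xp_meas G_sub by (intro borel_measurable_sum borel_measurable_times) auto

lemma V_generated: "V \<in> borel_measurable (generated E0)"
  unfolding V_def[abs_def] by (intro borel_measurable_sum borel_measurable_times xp_generated borel_measurable_const) auto

lemma V_meas: "V \<in> borel_measurable M"
  by (rule generated_meas[OF E01(1) V_generated])

lemma D_bound: "\<omega> \<in> space M \<Longrightarrow> \<bar>D \<omega>\<bar> \<le> real (card G) * \<bar>lam\<bar>"
proof -
  assume \<omega>: "\<omega> \<in> space M"
  have "\<bar>D \<omega>\<bar> \<le> (\<Sum>\<Gamma>\<in>G. \<bar>lam * xp \<Gamma> \<omega>\<bar>)" unfolding D_def by (rule sum_abs)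
  also have "\<dots> \<le> (\<Sum>\<Gamma>\<in>G. \<bar>lam\<bar>)"
    using \<omega> G_sub by (intro sum_mono) (auto simp: abs_mult intro!: mult_left_le xp_bound)
  finally show ?thesis by simp
qed

lemma V_bound: "\<exists>b. \<forall>\<omega>\<in>space M. \<bar>V \<omega>\<bar> \<le> b"
proof (intro exI ballI)
  fix \<omega> assume \<omega>: "\<omega> \<in> space M"
  let ?c = "\<lambda>\<Gamma> \<Gamma>'. lam\<^sup>2 * (if \<Gamma> \<inter> E1 = \<Gamma>' \<inter> E1 then ap (\<Gamma> \<inter> E1) else 0)"
  have "\<bar>V \<omega>\<bar> \<le> (\<Sum>\<Gamma>\<in>G. \<Sum>\<Gamma>'\<in>G. \<bar>?c \<Gamma> \<Gamma>' * (xp (\<Gamma> \<inter> E0) \<omega> * xp (\<Gamma>' \<inter> E0) \<omega>)\<bar>)"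
    unfolding V_def by (rule order_trans[OF sum_abs sum_mono[OF sum_abs]])
  also have "\<dots> \<le> (\<Sum>\<Gamma>\<in>G. \<Sum>\<Gamma>'\<in>G. \<bar>?c \<Gamma> \<Gamma>'\<bar>)"
  proof (intro sum_mono)
    fix \<Gamma> \<Gamma>'
    have "\<bar>xp (\<Gamma> \<inter> E0) \<omega> * xp (\<Gamma>' \<inter> E0) \<omega>\<bar> \<le> 1" using E01 \<omega> by (intro xp_mult_bound) auto
    then show "\<bar>?c \<Gamma> \<Gamma>' * (xp (\<Gamma> \<inter> E0) \<omega> * xp (\<Gamma>' \<inter> E0) \<omega>)\<bar> \<le> \<bar>?c \<Gamma> \<Gamma>'\<bar>"
      unfolding abs_mult[of "?c \<Gamma> \<Gamma>'"] by (intro mult_left_le) auto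
  qed
  finally show "\<bar>V \<omega>\<bar> \<le> (\<Sum>\<Gamma>\<in>G. \<Sum>\<Gamma>'\<in>G. \<bar>?c \<Gamma> \<Gamma>'\<bar>)" .
qed

lemma xp_G: "\<Gamma> \<in> G \<Longrightarrow> xp \<Gamma> \<omega> = xp (\<Gamma> \<inter> E0) \<omega> * xp (\<Gamma> \<inter> E1) \<omega>"
  using xp_split(1)[of E0 E1 \<Gamma>] E01 G(1) by auto

lemma ap_G: "\<Gamma> \<in> G \<Longrightarrow> ap \<Gamma> = ap (\<Gamma> \<inter> E0) * ap (\<Gamma> \<inter> E1)"
  using xp_split(2)[of E0 E1 \<Gamma>] E01 G(1) by auto

text \<open>Each product contains a centred factor that is independent of the past.\<close>

lemma expectation_ZD:
  fixes Z :: "'a \<Rightarrow> complex"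
  assumes Z: "Z \<in> borel_measurable (generated E0)" "\<And>\<omega>. \<omega> \<in> space M \<Longrightarrow> cmod (Z \<omega>) \<le> 1"
  shows "expectation (\<lambda>\<omega>. Z \<omega> * complex_of_real (D \<omega>)) = 0"
proof -
  note fac = expectation_factor[OF E01 Z]
  have i: "integrable M (\<lambda>\<omega>. Z \<omega> * complex_of_real (xp (\<Gamma> \<inter> E0) \<omega> * xp {} \<omega>) * complex_of_real (xp (\<Gamma> \<inter> E1) \<omega> * xp {} \<omega>))"
    and e: "\<Gamma> \<in> G \<Longrightarrow> expectation (\<lambda>\<omega>. Z \<omega> * complex_of_real (xp (\<Gamma> \<inter> E0) \<omega> * xp {} \<omega>) * complex_of_real (xp (\<Gamma> \<inter> E1) \<omega> * xp {} \<omega>)) = 0" for \<Gamma>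
    using fac(3)[of "\<Gamma> \<inter> E0" "{}" "\<Gamma> \<inter> E1" "{}"] fac(1)[of "\<Gamma> \<inter> E0" "{}" "\<Gamma> \<inter> E1" "{}"] G(2)[of \<Gamma>] by auto
  have "expectation (\<lambda>\<omega>. Z \<omega> * complex_of_real (D \<omega>)) =
    expectation (\<lambda>\<omega>. \<Sum>\<Gamma>\<in>G. complex_of_real lam * (Z \<omega> * complex_of_real (xp (\<Gamma> \<inter> E0) \<omega> * xp {} \<omega>) * complex_of_real (xp (\<Gamma> \<inter> E1) \<omega> * xp {} \<omega>)))"
  proof (intro Bochner_Integration.integral_cong refl)
    fix \<omega>
    have "complex_of_real (D \<omega>) = (\<Sum>\<Gamma>\<in>G. complex_of_real (lam * (xp (\<Gamma> \<inter> E0) \<omega> * xp (\<Gamma> \<inter> E1) \<omega>)))"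
      unfolding D_def of_real_sum by (intro sum.cong refl) (simp only: xp_G)
    then show "Z \<omega> * complex_of_real (D \<omega>) = (\<Sum>\<Gamma>\<in>G. complex_of_real lam * (Z \<omega> * complex_of_real (xp (\<Gamma> \<inter> E0) \<omega> * xp {} \<omega>) * complex_of_real (xp (\<Gamma> \<inter> E1) \<omega> * xp {} \<omega>)))"
      by (simp add: sum_distrib_left algebra_simps)
  qed
  also have "\<dots> = (\<Sum>\<Gamma>\<in>G. complex_of_real lam * expectation (\<lambda>\<omega>. Z \<omega> * complex_of_real (xp (\<Gamma> \<inter> E0) \<omega> * xp {} \<omega>) * complex_of_real (xp (\<Gamma> \<inter> E1) \<omega> * xp {} \<omega>)))"
    by (simp only: Bochner_Integration.integral_sum integrable_mult_right i integral_mult_right_zero)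
  also have "\<dots> = 0" by (intro sum.neutral ballI) (simp only: e mult_zero_right)
  finally show ?thesis .
qed

lemma expectation_ZD2:
  fixes Z :: "'a \<Rightarrow> complex"
  assumes Z: "Z \<in> borel_measurable (generated E0)" "\<And>\<omega>. \<omega> \<in> space M \<Longrightarrow> cmod (Z \<omega>) \<le> 1"
  shows "expectation (\<lambda>\<omega>. Z \<omega> * complex_of_real ((D \<omega>)\<^sup>2)) = expectation (\<lambda>\<omega>. Z \<omega> * complex_of_real (V \<omega>))"
proof -
  note fac = expectation_factor[OF E01 Z]
  let ?f = "\<lambda>\<Gamma> \<Gamma>' \<omega>. Z \<omega> * complex_of_real (xp (\<Gamma> \<inter> E0) \<omega> * xp (\<Gamma>' \<inter> E0) \<omega>)"
  let ?h = "\<lambda>\<Gamma> \<Gamma>' \<omega>. ?f \<Gamma> \<Gamma>' \<omega> * complex_of_real (xp (\<Gamma> \<inter> E1) \<omega> * xp (\<Gamma>' \<inter> E1) \<omega>)"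
  have i: "integrable M (?h \<Gamma> \<Gamma>')" "integrable M (?f \<Gamma> \<Gamma>')"
    and e: "expectation (?h \<Gamma> \<Gamma>') = (if \<Gamma> \<inter> E1 = \<Gamma>' \<inter> E1 then ap (\<Gamma> \<inter> E1) else 0) * expectation (?f \<Gamma> \<Gamma>')" for \<Gamma> \<Gamma>'
    using fac(2,3)[of "\<Gamma> \<inter> E0" "\<Gamma>' \<inter> E0" "\<Gamma> \<inter> E1" "\<Gamma>' \<inter> E1"] fac(1)[of "\<Gamma> \<inter> E0" "\<Gamma>' \<inter> E0" "\<Gamma> \<inter> E1" "\<Gamma>' \<inter> E1"] by auto
  have "expectation (\<lambda>\<omega>. Z \<omega> * complex_of_real ((D \<omega>)\<^sup>2)) = expectation (\<lambda>\<omega>. \<Sum>\<Gamma>\<in>G. \<Sum>\<Gamma>'\<in>G. complex_of_real (lam\<^sup>2) * ?h \<Gamma> \<Gamma>' \<omega>)"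
  proof (intro Bochner_Integration.integral_cong refl)
    fix \<omega>
    have "(D \<omega>)\<^sup>2 = (\<Sum>\<Gamma>\<in>G. \<Sum>\<Gamma>'\<in>G. lam\<^sup>2 * ((xp (\<Gamma> \<inter> E0) \<omega> * xp (\<Gamma>' \<inter> E0) \<omega>) * (xp (\<Gamma> \<inter> E1) \<omega> * xp (\<Gamma>' \<inter> E1) \<omega>)))"
      unfolding D_def power2_eq_square sum_product
      by (intro sum.cong refl) (simp add: xp_G)
    then show "Z \<omega> * complex_of_real ((D \<omega>)\<^sup>2) = (\<Sum>\<Gamma>\<in>G. \<Sum>\<Gamma>'\<in>G. complex_of_real (lam\<^sup>2) * ?h \<Gamma> \<Gamma>' \<omega>)"
      by (simp add: sum_distrib_left algebra_simps)
  qed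
  also have "\<dots> = (\<Sum>\<Gamma>\<in>G. \<Sum>\<Gamma>'\<in>G. complex_of_real (lam\<^sup>2) * expectation (?h \<Gamma> \<Gamma>'))"
    by (simp only: Bochner_Integration.integral_sum Bochner_Integration.integrable_sum integrable_mult_right i integral_mult_right_zero)
  also have "\<dots> = (\<Sum>\<Gamma>\<in>G. \<Sum>\<Gamma>'\<in>G. complex_of_real (lam\<^sup>2 * (if \<Gamma> \<inter> E1 = \<Gamma>' \<inter> E1 then ap (\<Gamma> \<inter> E1) else 0)) * expectation (?f \<Gamma> \<Gamma>'))"
    by (intro sum.cong refl, subst e) (simp only: of_real_mult mult.assoc)
  also have "\<dots> = expectation (\<lambda>\<omega>. \<Sum>\<Gamma>\<in>G. \<Sum>\<Gamma>'\<in>G. complex_of_real (lam\<^sup>2 * (if \<Gamma> \<inter> E1 = \<Gamma>' \<inter> E1 then ap (\<Gamma> \<inter> E1) else 0)) * ?f \<Gamma> \<Gamma>' \<omega>)"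
    by (simp only: Bochner_Integration.integral_sum Bochner_Integration.integrable_sum integrable_mult_right i integral_mult_right_zero)
  also have "\<dots> = expectation (\<lambda>\<omega>. Z \<omega> * complex_of_real (V \<omega>))"
  proof (intro Bochner_Integration.integral_cong refl)
    fix \<omega>
    show "(\<Sum>\<Gamma>\<in>G. \<Sum>\<Gamma>'\<in>G. complex_of_real (lam\<^sup>2 * (if \<Gamma> \<inter> E1 = \<Gamma>' \<inter> E1 then ap (\<Gamma> \<inter> E1) else 0)) * ?f \<Gamma> \<Gamma>' \<omega>) = Z \<omega> * complex_of_real (V \<omega>)"
      unfolding V_def of_real_sum sum_distrib_left
      by (intro sum.cong refl) (simp only: of_real_mult mult_ac)
  qed
  finally show ?thesis .
qed

lemma expectation_D2: "expectation (\<lambda>\<omega>. (D \<omega>)\<^sup>2) = q"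
proof -
  have "expectation (\<lambda>\<omega>. (D \<omega>)\<^sup>2) = (\<Sum>\<Gamma>\<in>G. \<Sum>\<Gamma>'\<in>G. if \<Gamma> = \<Gamma>' then lam * lam * ap \<Gamma> else 0)"
    unfolding D_def using expectation_sum_sq[where I=G and Q="\<lambda>\<Gamma>. \<Gamma>" and c="\<lambda>_. lam", OF finG G_sub] by simp
  also have "\<dots> = q"
    using finG by (simp add: q_def power2_eq_square)
  finally show ?thesis .
qed

lemma expectation_xp_4:
  assumes K: "\<And>e. e \<in> E \<Longrightarrow> expectation (\<lambda>\<omega>. x e \<omega> ^ 4) \<le> K * (a e)\<^sup>2" "0 \<le> K"
    and "\<Gamma> \<subseteq> E"
  shows "expectation (\<lambda>\<omega>. xp \<Gamma> \<omega> ^ 4) \<le> K ^ card \<Gamma> * (ap \<Gamma>)\<^sup>2"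
  using finite_sub[OF assms(3)] assms(3)
proof (induction \<Gamma> rule: finite_induct)
  case empty
  then show ?case using prob_space by (simp add: ap_def)
next
  case (insert e \<Gamma>)
  have "expectation (\<lambda>\<omega>. xp (insert e \<Gamma>) \<omega> ^ 4) = expectation (\<lambda>\<omega>. x e \<omega> ^ 4 * xp \<Gamma> \<omega> ^ 4)"
    using insert by (simp add: xp_insert power_mult_distrib)
  also have "\<dots> = expectation (\<lambda>\<omega>. x e \<omega> ^ 4) * expectation (\<lambda>\<omega>. xp \<Gamma> \<omega> ^ 4)"
  proof (rule expectation_x_mult[where b=1])
    show "(\<lambda>\<omega>. xp \<Gamma> \<omega> ^ 4) \<in> borel_measurable (generated (E - {e}))"
      using insert by (intro borel_measurable_power xp_generated) auto
    show "\<bar>xp \<Gamma> \<omega> ^ 4\<bar> \<le> 1" if "\<omega> \<in> space M" for \<omega>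
      unfolding power_abs using insert that by (intro power_le_one xp_bound) auto
  qed (use insert in auto)
  also have "\<dots> \<le> (K * (a e)\<^sup>2) * (K ^ card \<Gamma> * (ap \<Gamma>)\<^sup>2)"
    using insert K by (intro mult_mono) auto
  also have "\<dots> = K ^ card (insert e \<Gamma>) * (ap (insert e \<Gamma>))\<^sup>2"
    using insert by (simp add: ap_def power_mult_distrib)
  finally show ?case .
qed

lemma integrable_xp_power:
  assumes "\<Gamma> \<subseteq> E" "\<Gamma>' \<subseteq> E"
  shows "integrable M (\<lambda>\<omega>. xp \<Gamma> \<omega> ^ i * xp \<Gamma>' \<omega> ^ j)"
proof (rule integrable_bounded[where B=1])
  show "(\<lambda>\<omega>. xp \<Gamma> \<omega> ^ i * xp \<Gamma>' \<omega> ^ j) \<in> borel_measurable M"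
    using xp_meas[OF assms(1)] xp_meas[OF assms(2)] by (intro borel_measurable_times borel_measurable_power)
  fix \<omega> assume "\<omega> \<in> space M"
  then show "norm (xp \<Gamma> \<omega> ^ i * xp \<Gamma>' \<omega> ^ j) \<le> 1"
    unfolding real_norm_def abs_mult power_abs using assms by (intro mult_le_one power_le_one xp_bound) auto
qed

text \<open>Squares over disjoint sets are independent; in the other case the fourth moments bound the
covariance.\<close>

lemma covariance_xp_sq:
  assumes K: "\<And>e. e \<in> E \<Longrightarrow> expectation (\<lambda>\<omega>. x e \<omega> ^ 4) \<le> K * (a e)\<^sup>2" "1 \<le> K"
    and R: "R \<subseteq> E" "R' \<subseteq> E" "card R \<le> 2" "card R' \<le> 2"
  shows "expectation (\<lambda>\<omega>. ((xp R \<omega>)\<^sup>2 - ap R) * ((xp R' \<omega>)\<^sup>2 - ap R')) \<le> (if R \<inter> R' = {} then 0 else K\<^sup>2 * (ap R * ap R'))"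
proof -
  have i: "integrable M (\<lambda>\<omega>. (xp R \<omega>)\<^sup>2 * (xp R' \<omega>)\<^sup>2)" "integrable M (\<lambda>\<omega>. (xp R \<omega>)\<^sup>2)" "integrable M (\<lambda>\<omega>. (xp R' \<omega>)\<^sup>2)"
    using integrable_xp_power[OF R(1,2), of 2 2] integrable_xp_power[OF R(1,2), of 2 0] integrable_xp_power[OF R(1,2), of 0 2] by simp_all
  have "expectation (\<lambda>\<omega>. ((xp R \<omega>)\<^sup>2 - ap R) * ((xp R' \<omega>)\<^sup>2 - ap R'))
      = expectation (\<lambda>\<omega>. (xp R \<omega>)\<^sup>2 * (xp R' \<omega>)\<^sup>2 - ap R' * (xp R \<omega>)\<^sup>2 - ap R * (xp R' \<omega>)\<^sup>2 + ap R * ap R')"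
    by (simp add: algebra_simps)
  also have "\<dots> = expectation (\<lambda>\<omega>. (xp R \<omega>)\<^sup>2 * (xp R' \<omega>)\<^sup>2) - ap R * ap R'"
    using i expectation_xp_sq[OF R(1)] expectation_xp_sq[OF R(2)] prob_space by simp
  finally have cov: "expectation (\<lambda>\<omega>. ((xp R \<omega>)\<^sup>2 - ap R) * ((xp R' \<omega>)\<^sup>2 - ap R')) = expectation (\<lambda>\<omega>. (xp R \<omega>)\<^sup>2 * (xp R' \<omega>)\<^sup>2) - ap R * ap R'" .
  show ?thesis
  proof (cases "R \<inter> R' = {}")
    case True
    have "expectation (\<lambda>\<omega>. (xp R \<omega>)\<^sup>2 * (xp R' \<omega>)\<^sup>2) = expectation (\<lambda>\<omega>. (xp R \<omega>)\<^sup>2) * expectation (\<lambda>\<omega>. (xp R' \<omega>)\<^sup>2)"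
      using R i by (intro expectation_mult[OF R(1,2) True] borel_measurable_power xp_generated) auto
    then show ?thesis unfolding cov using True expectation_xp_sq[OF R(1)] expectation_xp_sq[OF R(2)] by simp
  next
    case False
    have "(expectation (\<lambda>\<omega>. (xp R \<omega>)\<^sup>2 * (xp R' \<omega>)\<^sup>2))\<^sup>2 \<le> expectation (\<lambda>\<omega>. ((xp R \<omega>)\<^sup>2)\<^sup>2) * expectation (\<lambda>\<omega>. ((xp R' \<omega>)\<^sup>2)\<^sup>2)"
      using i integrable_xp_power[OF R(1,2), of 4 0] integrable_xp_power[OF R(1,2), of 0 4]
      by (intro cauchy_schwarz) (simp_all add: power_mult[symmetric])
    also have "\<dots> = expectation (\<lambda>\<omega>. xp R \<omega> ^ 4) * expectation (\<lambda>\<omega>. xp R' \<omega> ^ 4)"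
      by (simp add: power_mult[symmetric])
    also have "\<dots> \<le> (K\<^sup>2 * (ap R)\<^sup>2) * (K\<^sup>2 * (ap R')\<^sup>2)"
    proof (intro mult_mono)
      have *: "expectation (\<lambda>\<omega>. xp S \<omega> ^ 4) \<le> K\<^sup>2 * (ap S)\<^sup>2" if "S \<subseteq> E" "card S \<le> 2" for S
      proof -
        have "expectation (\<lambda>\<omega>. xp S \<omega> ^ 4) \<le> K ^ card S * (ap S)\<^sup>2"
          using K that by (intro expectation_xp_4) auto
        also have "\<dots> \<le> K\<^sup>2 * (ap S)\<^sup>2"
          using K that by (intro mult_right_mono power_increasing) auto
        finally show ?thesis .
      qed
      show "expectation (\<lambda>\<omega>. xp R \<omega> ^ 4) \<le> K\<^sup>2 * (ap R)\<^sup>2" "expectation (\<lambda>\<omega>. xp R' \<omega> ^ 4) \<le> K\<^sup>2 * (ap R')\<^sup>2"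
        using * R by auto
    qed auto
    also have "\<dots> = (K\<^sup>2 * (ap R * ap R'))\<^sup>2" by (simp add: power_mult_distrib algebra_simps)
    finally have "expectation (\<lambda>\<omega>. (xp R \<omega>)\<^sup>2 * (xp R' \<omega>)\<^sup>2) \<le> K\<^sup>2 * (ap R * ap R')"
      by (rule power2_le_imp_le) (simp add: ap_nonneg)
    moreover have "0 \<le> ap R * ap R'" by (simp add: ap_nonneg)
    ultimately show ?thesis unfolding cov using False by simp
  qed
qed

text \<open>The part of \<open>V - q\<close> that stems from equal pairs; the other part collects pairs with the
same new part.\<close>

definition diag :: "'a \<Rightarrow> real" where
  "diag \<omega> = (\<Sum>\<Gamma>\<in>G. lam\<^sup>2 * ap (\<Gamma> \<inter> E1) * ((xp (\<Gamma> \<inter> E0) \<omega>)\<^sup>2 - ap (\<Gamma> \<inter> E0)))"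

text \<open>Only pairs that share an old edge are correlated, and \<open>\<eta>\<close> bounds the variance carried
by the partners of a given set.\<close>

lemma diag_sq:
  assumes K: "\<And>e. e \<in> E \<Longrightarrow> expectation (\<lambda>\<omega>. x e \<omega> ^ 4) \<le> K * (a e)\<^sup>2" "1 \<le> K"
    and card: "\<And>\<Gamma>. \<Gamma> \<in> G \<Longrightarrow> card (\<Gamma> \<inter> E0) \<le> 2"
    and \<eta>: "\<And>\<Gamma>. \<Gamma> \<in> G \<Longrightarrow> (\<Sum>\<Gamma>' | \<Gamma>' \<in> G \<and> \<Gamma> \<inter> \<Gamma>' \<inter> E0 \<noteq> {}. lam\<^sup>2 * ap \<Gamma>') \<le> \<eta>"
  shows "expectation (\<lambda>\<omega>. (diag \<omega>)\<^sup>2) \<le> K\<^sup>2 * \<eta> * q"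
proof -
  let ?c = "\<lambda>\<Gamma>. lam\<^sup>2 * ap (\<Gamma> \<inter> E1)" and ?y = "\<lambda>\<Gamma> \<omega>. (xp (\<Gamma> \<inter> E0) \<omega>)\<^sup>2 - ap (\<Gamma> \<inter> E0)"
  have sub: "\<Gamma> \<inter> E0 \<subseteq> E" for \<Gamma> using E01 by auto
  have i: "integrable M (\<lambda>\<omega>. ?y \<Gamma> \<omega> * ?y \<Gamma>' \<omega>)" for \<Gamma> \<Gamma>'
  proof -
    have "integrable M (\<lambda>\<omega>. (xp (\<Gamma> \<inter> E0) \<omega>)\<^sup>2 * (xp (\<Gamma>' \<inter> E0) \<omega>)\<^sup>2 - ap (\<Gamma>' \<inter> E0) * (xp (\<Gamma> \<inter> E0) \<omega> ^ 2 * xp (\<Gamma>' \<inter> E0) \<omega> ^ 0)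
        - ap (\<Gamma> \<inter> E0) * (xp (\<Gamma> \<inter> E0) \<omega> ^ 0 * xp (\<Gamma>' \<inter> E0) \<omega> ^ 2) + ap (\<Gamma> \<inter> E0) * ap (\<Gamma>' \<inter> E0))"
      by (intro Bochner_Integration.integrable_add Bochner_Integration.integrable_diff integrable_mult_right integrable_xp_power sub integrable_const)
    then show ?thesis by (simp add: algebra_simps)
  qed
  have "expectation (\<lambda>\<omega>. (diag \<omega>)\<^sup>2) = expectation (\<lambda>\<omega>. \<Sum>\<Gamma>\<in>G. \<Sum>\<Gamma>'\<in>G. (?c \<Gamma> * ?c \<Gamma>') * (?y \<Gamma> \<omega> * ?y \<Gamma>' \<omega>))"
    unfolding diag_def power2_eq_square[of "sum _ _"] sum_product
    by (intro Bochner_Integration.integral_cong refl sum.cong) (simp only: mult_ac)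
  also have "\<dots> = (\<Sum>\<Gamma>\<in>G. \<Sum>\<Gamma>'\<in>G. (?c \<Gamma> * ?c \<Gamma>') * expectation (\<lambda>\<omega>. ?y \<Gamma> \<omega> * ?y \<Gamma>' \<omega>))"
    by (simp only: Bochner_Integration.integral_sum Bochner_Integration.integrable_sum integrable_mult_right i integral_mult_right_zero)
  also have "\<dots> \<le> (\<Sum>\<Gamma>\<in>G. \<Sum>\<Gamma>'\<in>G. if \<Gamma> \<inter> \<Gamma>' \<inter> E0 \<noteq> {} then K\<^sup>2 * (lam\<^sup>2 * ap \<Gamma>) * (lam\<^sup>2 * ap \<Gamma>') else 0)"
  proof (intro sum_mono)
    fix \<Gamma> \<Gamma>' assume \<Gamma>: "\<Gamma> \<in> G" "\<Gamma>' \<in> G"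
    have "expectation (\<lambda>\<omega>. ?y \<Gamma> \<omega> * ?y \<Gamma>' \<omega>) \<le> (if (\<Gamma> \<inter> E0) \<inter> (\<Gamma>' \<inter> E0) = {} then 0 else K\<^sup>2 * (ap (\<Gamma> \<inter> E0) * ap (\<Gamma>' \<inter> E0)))"
      by (rule covariance_xp_sq[OF K sub sub card[OF \<Gamma>(1)] card[OF \<Gamma>(2)]])
    then have "(?c \<Gamma> * ?c \<Gamma>') * expectation (\<lambda>\<omega>. ?y \<Gamma> \<omega> * ?y \<Gamma>' \<omega>) \<le> (?c \<Gamma> * ?c \<Gamma>') * (if (\<Gamma> \<inter> E0) \<inter> (\<Gamma>' \<inter> E0) = {} then 0 else K\<^sup>2 * (ap (\<Gamma> \<inter> E0) * ap (\<Gamma>' \<inter> E0)))"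
      by (rule mult_left_mono) (simp add: ap_nonneg)
    also have "\<dots> = (if \<Gamma> \<inter> \<Gamma>' \<inter> E0 \<noteq> {} then K\<^sup>2 * (lam\<^sup>2 * ap \<Gamma>) * (lam\<^sup>2 * ap \<Gamma>') else 0)"
    proof -
      have "(\<Gamma> \<inter> E0) \<inter> (\<Gamma>' \<inter> E0) = \<Gamma> \<inter> \<Gamma>' \<inter> E0" by auto
      then show ?thesis by (simp add: ap_G[OF \<Gamma>(1)] ap_G[OF \<Gamma>(2)])
    qed
    finally show "(?c \<Gamma> * ?c \<Gamma>') * expectation (\<lambda>\<omega>. ?y \<Gamma> \<omega> * ?y \<Gamma>' \<omega>) \<le> (if \<Gamma> \<inter> \<Gamma>' \<inter> E0 \<noteq> {} then K\<^sup>2 * (lam\<^sup>2 * ap \<Gamma>) * (lam\<^sup>2 * ap \<Gamma>') else 0)" .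
  qed
  also have "\<dots> = (\<Sum>\<Gamma>\<in>G. K\<^sup>2 * (lam\<^sup>2 * ap \<Gamma>) * (\<Sum>\<Gamma>' | \<Gamma>' \<in> G \<and> \<Gamma> \<inter> \<Gamma>' \<inter> E0 \<noteq> {}. lam\<^sup>2 * ap \<Gamma>'))"
    by (intro sum.cong refl, unfold sum_distrib_left, rule sum.inter_filter[OF finG, symmetric])
  also have "\<dots> \<le> (\<Sum>\<Gamma>\<in>G. K\<^sup>2 * (lam\<^sup>2 * ap \<Gamma>) * \<eta>)"
    using \<eta> by (intro sum_mono mult_left_mono) (auto simp: ap_nonneg)
  also have "\<dots> = K\<^sup>2 * \<eta> * q"
    by (simp add: q_def sum_distrib_left algebra_simps)
  finally show ?thesis .
qed

definition linked :: "('e set \<times> 'e set) set" where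
  "linked = {(\<Gamma>, \<Gamma>'). \<Gamma> \<in> G \<and> \<Gamma>' \<in> G \<and> \<Gamma> \<noteq> \<Gamma>' \<and> \<Gamma> \<inter> E1 = \<Gamma>' \<inter> E1}"

definition off :: "'a \<Rightarrow> real" where
  "off \<omega> = (\<Sum>(\<Gamma>, \<Gamma>')\<in>linked. lam\<^sup>2 * ap (\<Gamma> \<inter> E1) * (xp (\<Gamma> \<inter> E0) \<omega> * xp (\<Gamma>' \<inter> E0) \<omega>))"

lemma V_decomposition: "V \<omega> - q = diag \<omega> + off \<omega>"
proof -
  let ?t = "\<lambda>\<Gamma> \<Gamma>'. lam\<^sup>2 * ap (\<Gamma> \<inter> E1) * (xp (\<Gamma> \<inter> E0) \<omega> * xp (\<Gamma>' \<inter> E0) \<omega>)"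
  have "off \<omega> = (\<Sum>(\<Gamma>, \<Gamma>')\<in>G \<times> G. if \<Gamma> \<noteq> \<Gamma>' \<and> \<Gamma> \<inter> E1 = \<Gamma>' \<inter> E1 then ?t \<Gamma> \<Gamma>' else 0)"
  proof -
    have L: "linked = {p \<in> G \<times> G. fst p \<noteq> snd p \<and> fst p \<inter> E1 = snd p \<inter> E1}"
      unfolding linked_def by (rule set_eqI) (simp add: case_prod_unfold mem_Times_iff)
    show ?thesis unfolding off_def L case_prod_unfold by (rule sum.inter_filter) (simp add: finG)
  qed
  also have "\<dots> = (\<Sum>\<Gamma>\<in>G. \<Sum>\<Gamma>'\<in>G. if \<Gamma> \<noteq> \<Gamma>' \<and> \<Gamma> \<inter> E1 = \<Gamma>' \<inter> E1 then ?t \<Gamma> \<Gamma>' else 0)"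
    by (rule sum.cartesian_product[symmetric])
  finally have off: "off \<omega> = (\<Sum>\<Gamma>\<in>G. \<Sum>\<Gamma>'\<in>G. if \<Gamma> \<noteq> \<Gamma>' \<and> \<Gamma> \<inter> E1 = \<Gamma>' \<inter> E1 then ?t \<Gamma> \<Gamma>' else 0)" .
  have "V \<omega> = (\<Sum>\<Gamma>\<in>G. ?t \<Gamma> \<Gamma> + (\<Sum>\<Gamma>'\<in>G. if \<Gamma> \<noteq> \<Gamma>' \<and> \<Gamma> \<inter> E1 = \<Gamma>' \<inter> E1 then ?t \<Gamma> \<Gamma>' else 0))"
    unfolding V_def
  proof (intro sum.cong refl)
    fix \<Gamma> assume \<Gamma>: "\<Gamma> \<in> G"
    have "(\<Sum>\<Gamma>'\<in>G. lam\<^sup>2 * (if \<Gamma> \<inter> E1 = \<Gamma>' \<inter> E1 then ap (\<Gamma> \<inter> E1) else 0) * (xp (\<Gamma> \<inter> E0) \<omega> * xp (\<Gamma>' \<inter> E0) \<omega>))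
      = (\<Sum>\<Gamma>'\<in>G. (if \<Gamma>' = \<Gamma> then ?t \<Gamma> \<Gamma> else 0) + (if \<Gamma> \<noteq> \<Gamma>' \<and> \<Gamma> \<inter> E1 = \<Gamma>' \<inter> E1 then ?t \<Gamma> \<Gamma>' else 0))"
      by (intro sum.cong refl) auto
    also have "\<dots> = ?t \<Gamma> \<Gamma> + (\<Sum>\<Gamma>'\<in>G. if \<Gamma> \<noteq> \<Gamma>' \<and> \<Gamma> \<inter> E1 = \<Gamma>' \<inter> E1 then ?t \<Gamma> \<Gamma>' else 0)"
      unfolding sum.distrib using \<Gamma> finG by simp
    finally show "(\<Sum>\<Gamma>'\<in>G. lam\<^sup>2 * (if \<Gamma> \<inter> E1 = \<Gamma>' \<inter> E1 then ap (\<Gamma> \<inter> E1) else 0) * (xp (\<Gamma> \<inter> E0) \<omega> * xp (\<Gamma>' \<inter> E0) \<omega>))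
      = ?t \<Gamma> \<Gamma> + (\<Sum>\<Gamma>'\<in>G. if \<Gamma> \<noteq> \<Gamma>' \<and> \<Gamma> \<inter> E1 = \<Gamma>' \<inter> E1 then ?t \<Gamma> \<Gamma>' else 0)" .
  qed
  then have "V \<omega> = (\<Sum>\<Gamma>\<in>G. ?t \<Gamma> \<Gamma>) + off \<omega>" unfolding off sum.distrib .
  moreover have "diag \<omega> = (\<Sum>\<Gamma>\<in>G. ?t \<Gamma> \<Gamma>) - q"
    unfolding diag_def q_def sum_subtractf[symmetric]
    by (intro sum.cong refl) (simp add: ap_G power2_eq_square algebra_simps)
  ultimately show ?thesis by simp
qed

text \<open>For two different sets with the same new part, the product of the old parts is again a product over a
set, namely over the union \<open>Q\<close> of the two disjoint old parts. As this union has at most four elements,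
it arises from at most 16 pairs, so orthogonality up to multiplicity 16 applies. The two old parts have the same
value under \<open>bnd\<close>, and summing over the second one for a fixed first one costs
\<open>\<eta>\<close>.\<close>

lemma off_sq:
  assumes card: "\<And>\<Gamma>. \<Gamma> \<in> G \<Longrightarrow> card (\<Gamma> \<inter> E0) \<le> 2"
    and disj: "\<And>\<Gamma> \<Gamma>'. \<Gamma> \<in> G \<Longrightarrow> \<Gamma>' \<in> G \<Longrightarrow> \<Gamma> \<noteq> \<Gamma>' \<Longrightarrow> \<Gamma> \<inter> E1 = \<Gamma>' \<inter> E1 \<Longrightarrow> \<Gamma> \<inter> \<Gamma>' \<inter> E0 = {}"
    and bnd: "\<And>\<Gamma> \<Gamma>'. \<Gamma> \<in> G \<Longrightarrow> \<Gamma>' \<in> G \<Longrightarrow> \<Gamma> \<inter> E1 = \<Gamma>' \<inter> E1 \<Longrightarrow> bnd (\<Gamma> \<inter> E0) = bnd (\<Gamma>' \<inter> E0)"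
    and \<eta>: "\<And>\<Gamma>. \<Gamma> \<in> G \<Longrightarrow> (\<Sum>\<Gamma>' | \<Gamma>' \<in> G \<and> bnd (\<Gamma>' \<inter> E0) = bnd (\<Gamma> \<inter> E0). lam\<^sup>2 * ap \<Gamma>') \<le> \<eta>"
  shows "expectation (\<lambda>\<omega>. (off \<omega>)\<^sup>2) \<le> 16 * \<eta> * q"
proof -
  define \<phi> where "\<phi> = (\<lambda>(\<Gamma>, \<Gamma>'). (\<Gamma> \<inter> E0, \<Gamma>' \<inter> E0))"
  \<comment> \<open>Pairs are grouped by their old parts; the new part is not determined by them.\<close>
  define I where "I = \<phi> ` linked"
  define Q where "Q = (\<lambda>(R, R'). R \<union> R' :: 'e set)"
  define n where "n i = (\<Sum>p\<in>{p \<in> linked. \<phi> p = i}. lam\<^sup>2 * ap (fst p \<inter> E1))" for i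
  define u where "u R = (\<Sum>\<Gamma> | \<Gamma> \<in> G \<and> \<Gamma> \<inter> E0 = R. lam\<^sup>2 * ap \<Gamma>)" for R
  have finL: "finite linked"
    by (rule finite_subset[of _ "G \<times> G"]) (use finG in \<open>auto simp: linked_def\<close>)
  have finI: "finite I" using finL by (simp add: I_def)
  have I: "fst i \<subseteq> E" "snd i \<subseteq> E" "fst i \<inter> snd i = {}" "card (fst i) \<le> 2" "card (snd i) \<le> 2" if iI: "i \<in> I" for i
  proof -
    obtain p where "p \<in> linked" "i = \<phi> p" using iI unfolding I_def by blast
    then obtain \<Gamma> \<Gamma>' where p: "(\<Gamma>, \<Gamma>') \<in> linked" "i = (\<Gamma> \<inter> E0, \<Gamma>' \<inter> E0)"
      by (cases p) (simp add: \<phi>_def)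
    then show "fst i \<subseteq> E" "snd i \<subseteq> E" "card (fst i) \<le> 2" "card (snd i) \<le> 2"
      using E01 card by (auto simp: linked_def)
    have "\<Gamma> \<inter> \<Gamma>' \<inter> E0 = {}" using p disj by (auto simp: linked_def)
    then show "fst i \<inter> snd i = {}" using p by auto
  qed
  have QE: "Q i \<subseteq> E" if "i \<in> I" for i using I[OF that] by (cases i) (auto simp: Q_def)
  have off: "off \<omega> = (\<Sum>i\<in>I. n i * xp (Q i) \<omega>)" for \<omega>
  proof -
    have "off \<omega> = (\<Sum>i\<in>I. \<Sum>p\<in>{p \<in> linked. \<phi> p = i}. lam\<^sup>2 * ap (fst p \<inter> E1) * (xp (fst p \<inter> E0) \<omega> * xp (snd p \<inter> E0) \<omega>))"
      unfolding off_def I_def using finL by (subst sum.image_gen[where g=\<phi>]) (auto simp: case_prod_unfold)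
    also have "\<dots> = (\<Sum>i\<in>I. n i * xp (Q i) \<omega>)"
    proof (intro sum.cong refl)
      fix i assume i: "i \<in> I"
      have "xp (Q i) \<omega> = xp (fst i) \<omega> * xp (snd i) \<omega>"
        using xp_union(1)[OF I(1,2,3)[OF i]] by (cases i) (simp add: Q_def)
      then show "(\<Sum>p\<in>{p \<in> linked. \<phi> p = i}. lam\<^sup>2 * ap (fst p \<inter> E1) * (xp (fst p \<inter> E0) \<omega> * xp (snd p \<inter> E0) \<omega>)) = n i * xp (Q i) \<omega>"
        unfolding n_def sum_distrib_right
      proof (intro sum.cong refl)
        fix p assume "p \<in> {p \<in> linked. \<phi> p = i}"
        then have "fst i = fst p \<inter> E0" "snd i = snd p \<inter> E0" by (auto simp: \<phi>_def case_prod_unfold)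
        then show "lam\<^sup>2 * ap (fst p \<inter> E1) * (xp (fst p \<inter> E0) \<omega> * xp (snd p \<inter> E0) \<omega>) = lam\<^sup>2 * ap (fst p \<inter> E1) * xp (Q i) \<omega>"
          using \<open>xp (Q i) \<omega> = xp (fst i) \<omega> * xp (snd i) \<omega>\<close> by simp
      qed
    qed
    finally show ?thesis .
  qed
  have mult: "real (card {j \<in> I. Q j = Q i}) \<le> 16" if i: "i \<in> I" for i
  proof -
    have finQ: "finite (Q i)" using QE[OF i] finE finite_subset by blast
    have "card (Q i) \<le> card (fst i) + card (snd i)"
      unfolding Q_def case_prod_unfold by (rule card_Un_le)
    then have c4: "card (Q i) \<le> 4" using I[OF i] by simp
    have "inj_on fst {j \<in> I. Q j = Q i}"
    proof (rule inj_onI)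
      fix j k assume *: "j \<in> {j \<in> I. Q j = Q i}" "k \<in> {j \<in> I. Q j = Q i}" "fst j = fst k"
      have sl: "snd l = Q i - fst l" if l: "l \<in> I" "Q l = Q i" for l
      proof -
        have "Q l = fst l \<union> snd l" by (simp add: Q_def case_prod_unfold)
        then have "Q i = fst l \<union> snd l" using l(2) by simp
        then show ?thesis using I(3)[OF l(1)] by blast
      qed
      have "snd j = Q i - fst j" "snd k = Q i - fst k" using sl * by simp_all
      then show "j = k" using *(3) by (simp add: prod_eq_iff)
    qed
    then have "card {j \<in> I. Q j = Q i} = card (fst ` {j \<in> I. Q j = Q i})" by (simp add: card_image)
    also have "\<dots> \<le> card (Pow (Q i))"
    proof (rule card_mono)
      show "fst ` {j \<in> I. Q j = Q i} \<subseteq> Pow (Q i)"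
      proof
        fix R assume "R \<in> fst ` {j \<in> I. Q j = Q i}"
        then obtain j where "R = fst j" "Q j = Q i" by auto
        then show "R \<in> Pow (Q i)" by (cases j) (auto simp: Q_def)
      qed
    qed (simp add: finQ)
    also have "\<dots> \<le> 2 ^ 4" unfolding card_Pow[OF finQ] using c4 by (intro power_increasing) auto
    finally show ?thesis by simp
  qed
  have linkedD: "fst p \<in> G" "snd p \<in> G" "fst p \<inter> E1 = snd p \<inter> E1" "fst i = fst p \<inter> E0" "snd i = snd p \<inter> E0"
    if "p \<in> linked" "\<phi> p = i" for p i
    unfolding that(2)[symmetric] using that(1) by (cases p, simp add: linked_def \<phi>_def)+
  have fiber: "n i * ap (fst i) \<le> u (fst i)" "n i * ap (snd i) \<le> u (snd i)" for i
  proof -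
    let ?F = "{p \<in> linked. \<phi> p = i}"
    have inj: "inj_on fst ?F" "inj_on snd ?F"
    proof -
      have *: "snd p = snd i \<union> (fst p \<inter> E1)" "fst p = fst i \<union> (snd p \<inter> E1)" if p: "p \<in> ?F" for p
      proof -
        have G': "fst p \<in> G" "snd p \<in> G" "fst p \<inter> E1 = snd p \<inter> E1" "fst i = fst p \<inter> E0" "snd i = snd p \<inter> E0"
          using linkedD[of p i] p by blast+
        show "snd p = snd i \<union> (fst p \<inter> E1)" "fst p = fst i \<union> (snd p \<inter> E1)"
          using G(1)[OF G'(1)] G(1)[OF G'(2)] G'(3-5) by blast+
      qed
      show "inj_on fst ?F"
      proof (rule inj_onI)
        fix p p' assume "p \<in> ?F" "p' \<in> ?F" "fst p = fst p'"
        then show "p = p'" using *(1)[of p] *(1)[of p'] by (simp add: prod_eq_iff)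
      qed
      show "inj_on snd ?F"
      proof (rule inj_onI)
        fix p p' assume "p \<in> ?F" "p' \<in> ?F" "snd p = snd p'"
        then show "p = p'" using *(2)[of p] *(2)[of p'] by (simp add: prod_eq_iff)
      qed
    qed
    have "n i * ap (fst i) = (\<Sum>p\<in>?F. lam\<^sup>2 * ap (fst p))"
      unfolding n_def sum_distrib_right
    proof (intro sum.cong refl)
      fix p assume "p \<in> ?F"
      then have p: "p \<in> linked" "\<phi> p = i" by blast+
      show "lam\<^sup>2 * ap (fst p \<inter> E1) * ap (fst i) = lam\<^sup>2 * ap (fst p)"
        unfolding ap_G[OF linkedD(1)[OF p]] linkedD(4)[OF p] by simp
    qed
    also have "\<dots> = (\<Sum>\<Gamma>\<in>fst ` ?F. lam\<^sup>2 * ap \<Gamma>)" by (simp add: sum.reindex[OF inj(1)])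
    also have "\<dots> \<le> u (fst i)"
      unfolding u_def
    proof (rule sum_mono2)
      show "fst ` ?F \<subseteq> {\<Gamma> \<in> G. \<Gamma> \<inter> E0 = fst i}"
      proof
        fix \<Gamma> assume "\<Gamma> \<in> fst ` ?F"
        then obtain p where p: "p \<in> linked" "\<phi> p = i" "\<Gamma> = fst p" by blast
        show "\<Gamma> \<in> {\<Gamma> \<in> G. \<Gamma> \<inter> E0 = fst i}"
          using linkedD(1)[OF p(1,2)] linkedD(4)[OF p(1,2)] p(3) by simp
      qed
    qed (simp_all add: finG ap_nonneg)
    finally show "n i * ap (fst i) \<le> u (fst i)" .
    have "n i * ap (snd i) = (\<Sum>p\<in>?F. lam\<^sup>2 * ap (snd p))"
      unfolding n_def sum_distrib_right
    proof (intro sum.cong refl)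
      fix p assume "p \<in> ?F"
      then have p: "p \<in> linked" "\<phi> p = i" by blast+
      show "lam\<^sup>2 * ap (fst p \<inter> E1) * ap (snd i) = lam\<^sup>2 * ap (snd p)"
        unfolding ap_G[OF linkedD(2)[OF p]] linkedD(5)[OF p] linkedD(3)[OF p] by simp
    qed
    also have "\<dots> = (\<Sum>\<Gamma>\<in>snd ` ?F. lam\<^sup>2 * ap \<Gamma>)" by (simp add: sum.reindex[OF inj(2)])
    also have "\<dots> \<le> u (snd i)"
      unfolding u_def
    proof (rule sum_mono2)
      show "snd ` ?F \<subseteq> {\<Gamma> \<in> G. \<Gamma> \<inter> E0 = snd i}"
      proof
        fix \<Gamma> assume "\<Gamma> \<in> snd ` ?F"
        then obtain p where p: "p \<in> linked" "\<phi> p = i" "\<Gamma> = snd p" by blast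
        show "\<Gamma> \<in> {\<Gamma> \<in> G. \<Gamma> \<inter> E0 = snd i}"
          using linkedD(2)[OF p(1,2)] linkedD(5)[OF p(1,2)] p(3) by simp
      qed
    qed (simp_all add: finG ap_nonneg)
    finally show "n i * ap (snd i) \<le> u (snd i)" .
  qed
  have n0: "0 \<le> n i" for i unfolding n_def by (intro sum_nonneg) (simp add: ap_nonneg)
  have u0: "0 \<le> u R" for R unfolding u_def by (intro sum_nonneg) (simp add: ap_nonneg)
  let ?\<R> = "(\<lambda>\<Gamma>. \<Gamma> \<inter> E0) ` G"
  have "expectation (\<lambda>\<omega>. (off \<omega>)\<^sup>2) \<le> 16 * (\<Sum>i\<in>I. (n i)\<^sup>2 * ap (Q i))"
    unfolding off using finI QE mult by (rule expectation_sum_sq_le)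
  also have "(\<Sum>i\<in>I. (n i)\<^sup>2 * ap (Q i)) \<le> (\<Sum>i\<in>I. u (fst i) * u (snd i))"
  proof (rule sum_mono)
    fix i assume i: "i \<in> I"
    have "(n i)\<^sup>2 * ap (Q i) = (n i * ap (fst i)) * (n i * ap (snd i))"
      using xp_union(2)[OF I(1,2,3)[OF i]] by (cases i) (simp add: Q_def power2_eq_square)
    also have "\<dots> \<le> u (fst i) * u (snd i)"
      using fiber n0 u0 by (intro mult_mono) (auto simp: ap_nonneg)
    finally show "(n i)\<^sup>2 * ap (Q i) \<le> u (fst i) * u (snd i)" .
  qed
  also have "\<dots> \<le> (\<Sum>(R, R')\<in>Sigma ?\<R> (\<lambda>R. {R' \<in> ?\<R>. bnd R' = bnd R}). u R * u R')"
    unfolding case_prod_unfold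
  proof (rule sum_mono2)
    show "I \<subseteq> Sigma ?\<R> (\<lambda>R. {R' \<in> ?\<R>. bnd R' = bnd R})"
      using bnd by (auto simp: I_def \<phi>_def linked_def)
  qed (use finG u0 in auto)
  also have "\<dots> = (\<Sum>R\<in>?\<R>. \<Sum>R'\<in>{R' \<in> ?\<R>. bnd R' = bnd R}. u R * u R')"
    using finG by (intro sum.Sigma[symmetric]) auto
  also have "\<dots> \<le> (\<Sum>R\<in>?\<R>. u R * \<eta>)"
    unfolding sum_distrib_left[symmetric]
  proof (intro sum_mono mult_left_mono u0)
    fix R assume "R \<in> ?\<R>"
    then obtain \<Gamma> where \<Gamma>: "\<Gamma> \<in> G" "R = \<Gamma> \<inter> E0" by auto
    have "(\<Sum>R'\<in>{R' \<in> ?\<R>. bnd R' = bnd R}. u R') = (\<Sum>\<Gamma>' | \<Gamma>' \<in> G \<and> bnd (\<Gamma>' \<inter> E0) = bnd (\<Gamma> \<inter> E0). lam\<^sup>2 * ap \<Gamma>')"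
    proof -
      have "(\<Sum>\<Gamma>' | \<Gamma>' \<in> G \<and> bnd (\<Gamma>' \<inter> E0) = bnd (\<Gamma> \<inter> E0). lam\<^sup>2 * ap \<Gamma>')
        = (\<Sum>R'\<in>{R' \<in> ?\<R>. bnd R' = bnd R}. \<Sum>\<Gamma>'\<in>{\<Gamma>' \<in> {\<Gamma>' \<in> G. bnd (\<Gamma>' \<inter> E0) = bnd (\<Gamma> \<inter> E0)}. \<Gamma>' \<inter> E0 = R'}. lam\<^sup>2 * ap \<Gamma>')"
        using finG \<Gamma> by (intro sum.group[symmetric]) auto
      also have "\<dots> = (\<Sum>R'\<in>{R' \<in> ?\<R>. bnd R' = bnd R}. u R')"
        unfolding u_def using \<Gamma> by (intro sum.cong refl) auto
      finally show ?thesis by simp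
    qed
    then show "(\<Sum>R'\<in>{R' \<in> ?\<R>. bnd R' = bnd R}. u R') \<le> \<eta>" using \<eta>[OF \<Gamma>(1)] by simp
  qed
  also have "\<dots> = \<eta> * (\<Sum>R\<in>?\<R>. u R)" by (simp add: sum_distrib_left mult.commute)
  also have "(\<Sum>R\<in>?\<R>. u R) = q"
    unfolding u_def q_def by (rule sum.image_gen[symmetric, OF finG])
  finally show ?thesis by simp
qed

lemma off_meas: "off \<in> borel_measurable M" and diag_meas: "diag \<in> borel_measurable M"
proof -
  have sub: "\<Gamma> \<inter> E0 \<subseteq> E" for \<Gamma> using E01 by auto
  show "off \<in> borel_measurable M"
    unfolding off_def[abs_def] case_prod_unfold
    by (intro borel_measurable_sum borel_measurable_times borel_measurable_const xp_meas sub)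
  show "diag \<in> borel_measurable M"
    unfolding diag_def[abs_def]
    by (intro borel_measurable_sum borel_measurable_times borel_measurable_const borel_measurable_diff borel_measurable_power xp_meas sub)
qed

text \<open>The map \<open>bnd\<close> is an invariant of the old part that is determined by the new part; for
closed hypergraphs it is the boundary modulo 2.\<close>

lemma V_concentration:
  assumes K: "\<And>e. e \<in> E \<Longrightarrow> expectation (\<lambda>\<omega>. x e \<omega> ^ 4) \<le> K * (a e)\<^sup>2" "1 \<le> K"
    and card: "\<And>\<Gamma>. \<Gamma> \<in> G \<Longrightarrow> card (\<Gamma> \<inter> E0) \<le> 2"
    and disj: "\<And>\<Gamma> \<Gamma>'. \<Gamma> \<in> G \<Longrightarrow> \<Gamma>' \<in> G \<Longrightarrow> \<Gamma> \<noteq> \<Gamma>' \<Longrightarrow> \<Gamma> \<inter> E1 = \<Gamma>' \<inter> E1 \<Longrightarrow> \<Gamma> \<inter> \<Gamma>' \<inter> E0 = {}"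
    and bnd: "\<And>\<Gamma> \<Gamma>'. \<Gamma> \<in> G \<Longrightarrow> \<Gamma>' \<in> G \<Longrightarrow> \<Gamma> \<inter> E1 = \<Gamma>' \<inter> E1 \<Longrightarrow> bnd (\<Gamma> \<inter> E0) = bnd (\<Gamma>' \<inter> E0)"
    and \<eta>1: "\<And>\<Gamma>. \<Gamma> \<in> G \<Longrightarrow> (\<Sum>\<Gamma>' | \<Gamma>' \<in> G \<and> \<Gamma> \<inter> \<Gamma>' \<inter> E0 \<noteq> {}. lam\<^sup>2 * ap \<Gamma>') \<le> \<eta>"
    and \<eta>2: "\<And>\<Gamma>. \<Gamma> \<in> G \<Longrightarrow> (\<Sum>\<Gamma>' | \<Gamma>' \<in> G \<and> bnd (\<Gamma>' \<inter> E0) = bnd (\<Gamma> \<inter> E0). lam\<^sup>2 * ap \<Gamma>') \<le> \<eta>"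
  shows "expectation (\<lambda>\<omega>. (V \<omega> - q)\<^sup>2) \<le> 2 * (K\<^sup>2 + 16) * \<eta> * q"
    and "integrable M (\<lambda>\<omega>. (V \<omega> - q)\<^sup>2)"
proof -
  have bounded: "\<exists>b. \<forall>\<omega>\<in>space M. \<bar>diag \<omega>\<bar> \<le> b"
  proof (intro exI ballI)
    fix \<omega> assume \<omega>: "\<omega> \<in> space M"
    have "\<bar>diag \<omega>\<bar> \<le> (\<Sum>\<Gamma>\<in>G. \<bar>lam\<^sup>2 * ap (\<Gamma> \<inter> E1) * ((xp (\<Gamma> \<inter> E0) \<omega>)\<^sup>2 - ap (\<Gamma> \<inter> E0))\<bar>)"
      unfolding diag_def by (rule sum_abs)
    also have "\<dots> \<le> (\<Sum>\<Gamma>\<in>G. \<bar>lam\<^sup>2 * ap (\<Gamma> \<inter> E1)\<bar> * (1 + ap (\<Gamma> \<inter> E0)))"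
    proof (rule sum_mono)
      fix \<Gamma>
      have "\<bar>xp (\<Gamma> \<inter> E0) \<omega>\<bar> \<le> 1" using E01 \<omega> by (intro xp_bound) auto
      then have "(xp (\<Gamma> \<inter> E0) \<omega>)\<^sup>2 \<le> 1" by (simp add: abs_square_le_1)
      then have "\<bar>(xp (\<Gamma> \<inter> E0) \<omega>)\<^sup>2 - ap (\<Gamma> \<inter> E0)\<bar> \<le> 1 + ap (\<Gamma> \<inter> E0)"
        unfolding abs_le_iff using ap_nonneg[of "\<Gamma> \<inter> E0"] zero_le_power2[of "xp (\<Gamma> \<inter> E0) \<omega>"] by linarith
      then show "\<bar>lam\<^sup>2 * ap (\<Gamma> \<inter> E1) * ((xp (\<Gamma> \<inter> E0) \<omega>)\<^sup>2 - ap (\<Gamma> \<inter> E0))\<bar> \<le> \<bar>lam\<^sup>2 * ap (\<Gamma> \<inter> E1)\<bar> * (1 + ap (\<Gamma> \<inter> E0))"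
        unfolding abs_mult[of "lam\<^sup>2 * ap (\<Gamma> \<inter> E1)"] by (intro mult_left_mono) auto
    qed
    finally show "\<bar>diag \<omega>\<bar> \<le> (\<Sum>\<Gamma>\<in>G. \<bar>lam\<^sup>2 * ap (\<Gamma> \<inter> E1)\<bar> * (1 + ap (\<Gamma> \<inter> E0)))" .
  qed
  then obtain b where b: "\<And>\<omega>. \<omega> \<in> space M \<Longrightarrow> \<bar>diag \<omega>\<bar> \<le> b" by blast
  obtain b' where b': "\<And>\<omega>. \<omega> \<in> space M \<Longrightarrow> \<bar>V \<omega>\<bar> \<le> b'" using V_bound by blast
  have off_b: "\<bar>off \<omega>\<bar> \<le> b' + q + b" if "\<omega> \<in> space M" for \<omega>
    using b[OF that] b'[OF that] V_decomposition[of \<omega>] q_nonneg by linarith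
  have sq_int: "integrable M (\<lambda>\<omega>. (f \<omega>)\<^sup>2)" if "f \<in> borel_measurable M" "\<And>\<omega>. \<omega> \<in> space M \<Longrightarrow> \<bar>f \<omega>\<bar> \<le> c" for f :: "'a \<Rightarrow> real" and c
  proof (rule integrable_bounded[where B="c\<^sup>2"])
    show "(\<lambda>\<omega>. (f \<omega>)\<^sup>2) \<in> borel_measurable M" using that(1) by simp
    fix \<omega> assume "\<omega> \<in> space M"
    then have "\<bar>f \<omega>\<bar>\<^sup>2 \<le> c\<^sup>2" using that(2) by (intro power_mono) auto
    then show "norm ((f \<omega>)\<^sup>2) \<le> c\<^sup>2" by simp
  qed
  have i: "integrable M (\<lambda>\<omega>. (diag \<omega>)\<^sup>2)" "integrable M (\<lambda>\<omega>. (off \<omega>)\<^sup>2)"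
    using sq_int[OF diag_meas b] sq_int[OF off_meas off_b] by auto
  show iV: "integrable M (\<lambda>\<omega>. (V \<omega> - q)\<^sup>2)"
  proof (rule sq_int)
    show "(\<lambda>\<omega>. V \<omega> - q) \<in> borel_measurable M" using V_meas by simp
    show "\<bar>V \<omega> - q\<bar> \<le> b' + q" if "\<omega> \<in> space M" for \<omega>
      using b'[OF that] q_nonneg by linarith
  qed
  have "expectation (\<lambda>\<omega>. (V \<omega> - q)\<^sup>2) \<le> expectation (\<lambda>\<omega>. 2 * (diag \<omega>)\<^sup>2 + 2 * (off \<omega>)\<^sup>2)"
  proof (rule integral_mono[OF iV])
    show "integrable M (\<lambda>\<omega>. 2 * (diag \<omega>)\<^sup>2 + 2 * (off \<omega>)\<^sup>2)" using i by simp
    fix \<omega>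
    show "(V \<omega> - q)\<^sup>2 \<le> 2 * (diag \<omega>)\<^sup>2 + 2 * (off \<omega>)\<^sup>2"
      unfolding V_decomposition using sum_squares_bound[of "diag \<omega>" "off \<omega>"] by (simp add: power2_sum)
  qed
  also have "\<dots> = 2 * expectation (\<lambda>\<omega>. (diag \<omega>)\<^sup>2) + 2 * expectation (\<lambda>\<omega>. (off \<omega>)\<^sup>2)" using i by simp
  also have "\<dots> \<le> 2 * (K\<^sup>2 * \<eta> * q) + 2 * (16 * \<eta> * q)"
  proof (intro add_mono mult_left_mono)
    show "expectation (\<lambda>\<omega>. (diag \<omega>)\<^sup>2) \<le> K\<^sup>2 * \<eta> * q" by (rule diag_sq[OF K card \<eta>1])
    show "expectation (\<lambda>\<omega>. (off \<omega>)\<^sup>2) \<le> 16 * \<eta> * q" by (rule off_sq[OF card disj bnd \<eta>2])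
  qed simp_all
  finally show "expectation (\<lambda>\<omega>. (V \<omega> - q)\<^sup>2) \<le> 2 * (K\<^sup>2 + 16) * \<eta> * q" by (simp add: algebra_simps)
qed

end

section \<open>Central limit theorem for a family of closed hypergraphs\<close>

lemma sum_UNION_le:
  fixes f :: "'b \<Rightarrow> real"
  assumes "finite A" "\<And>e. e \<in> A \<Longrightarrow> finite (B e)" "\<And>y. 0 \<le> f y"
  shows "sum f (\<Union>e\<in>A. B e) \<le> (\<Sum>e\<in>A. sum f (B e))"
  using assms(1,2)
proof (induction A rule: finite_induct)
  case (insert e A)
  have "sum f (B e \<union> (\<Union>e\<in>A. B e)) + sum f (B e \<inter> (\<Union>e\<in>A. B e)) = sum f (B e) + sum f (\<Union>e\<in>A. B e)"
    using insert by (intro sum.union_inter) auto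
  moreover have "0 \<le> sum f (B e \<inter> (\<Union>e\<in>A. B e))" by (intro sum_nonneg assms(3))
  ultimately show ?case using insert by simp
qed simp

lemma bd_disjoint_union:
  assumes "finite A" "finite B" "A \<inter> B = {}"
  shows "bd (A \<union> B) = sym_diff (bd A) (bd B)"
proof -
  have "card {e \<in> A \<union> B. i \<in> e} = card {e \<in> A. i \<in> e} + card {e \<in> B. i \<in> e}" for i
  proof -
    have "{e \<in> A \<union> B. i \<in> e} = {e \<in> A. i \<in> e} \<union> {e \<in> B. i \<in> e}" by auto
    then show ?thesis using assms by (simp add: card_Un_disjoint disjoint_iff)
  qed
  then show ?thesis by (auto simp: bd_def)
qed

lemma bd_remove:
  assumes "finite R" "e \<in> R"
  shows "bd R = sym_diff e (bd (R - {e}))"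
  using bd_insert[of "R - {e}" e] assms by (simp add: insert_absorb)

lemma bd_determines_small:
  assumes R: "finite R" "card R \<le> 1" "{} \<notin> R" and R': "finite R'" "card R' \<le> 1" "{} \<notin> R'" and eq: "bd R = bd R'"
  shows "R = R'"
proof -
  have *: "S = {} \<or> S = {bd S}" if "finite S" "card S \<le> 1" for S
  proof (cases "card S = 0")
    case False
    then have "card S = 1" using that by linarith
    then show ?thesis by (auto simp: card_1_singleton_iff)
  qed (use that in auto)
  show ?thesis
    using *[OF R(1,2)] *[OF R'(1,2)] eq R(3) R'(3) by (metis bd_empty singletonI)
qed

text \<open>If two such hypergraphs shared an edge, deleting it would leave at most one edge in each, with equal
boundaries, and a single edge is its own boundary.\<close>

lemma bd_eq_disjoint:
  assumes R: "finite R" "card R \<le> 2" "{} \<notin> R" and R': "finite R'" "card R' \<le> 2" "{} \<notin> R'"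
    and eq: "bd R = bd R'" and ne: "R \<noteq> R'"
  shows "R \<inter> R' = {}"
proof (rule ccontr)
  assume "R \<inter> R' \<noteq> {}"
  then obtain e where e: "e \<in> R" "e \<in> R'" by auto
  have "sym_diff e (bd (R - {e})) = sym_diff e (bd (R' - {e}))"
    using bd_remove[OF R(1) e(1)] bd_remove[OF R'(1) e(2)] eq by simp
  then have "bd (R - {e}) = bd (R' - {e})" by blast
  then have "R - {e} = R' - {e}"
    using R R' e by (intro bd_determines_small) (auto simp: card_Diff_singleton)
  then show False using e ne by blast
qed

text \<open>Each edge carries \<open>N ^ (1 - card e)\<close>, and the factor \<open>sqrt N ^ K\<close>
turns the product into \<open>1 / sqrt N\<close> to the sum of the edge sizes, the form for which the vertex
count is made.\<close>

lemma scaled_product_bound: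
  assumes N: "1 \<le> N" and \<Gamma>: "finite \<Gamma>" "\<And>e. e \<in> \<Gamma> \<Longrightarrow> 3 \<le> card e" "(\<Sum>e\<in>\<Gamma>. card e - 2) = K" "card \<Gamma> \<le> 4"
    and u: "\<And>e. e \<in> \<Gamma> \<Longrightarrow> 0 \<le> u e" "\<And>e. e \<in> \<Gamma> \<Longrightarrow> u e \<le> c0 / real N ^ (card e - 1)" and c0: "1 \<le> (c0::real)"
  shows "sqrt (real N) ^ K * (\<Prod>e\<in>\<Gamma>. u e) \<le> c0 ^ 4 * (1 / sqrt (real N) ^ (\<Sum>e\<in>\<Gamma>. card e))"
proof -
  define s where "s = sqrt (real N)"
  have s: "1 \<le> s" "s\<^sup>2 = real N" using N by (simp_all add: s_def)
  have "(\<Prod>e\<in>\<Gamma>. u e) \<le> (\<Prod>e\<in>\<Gamma>. c0 / real N ^ (card e - 1))"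
    using u by (intro prod_mono) auto
  also have "\<dots> = c0 ^ card \<Gamma> / (\<Prod>e\<in>\<Gamma>. s ^ (2 * (card e - 1)))"
    by (simp add: prod_dividef s(2)[symmetric] power_mult)
  also have "(\<Prod>e\<in>\<Gamma>. s ^ (2 * (card e - 1))) = s ^ (\<Sum>e\<in>\<Gamma>. 2 * (card e - 1))" by (simp add: power_sum)
  also have "(\<Sum>e\<in>\<Gamma>. 2 * (card e - 1)) = K + (\<Sum>e\<in>\<Gamma>. card e)"
  proof -
    have "(\<Sum>e\<in>\<Gamma>. 2 * (card e - 1)) = (\<Sum>e\<in>\<Gamma>. (card e - 2) + card e)"
    proof (intro sum.cong refl)
      fix e assume "e \<in> \<Gamma>"
      then have "3 \<le> card e" by (rule \<Gamma>(2))
      then show "2 * (card e - 1) = (card e - 2) + card e" by simp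
    qed
    then show ?thesis using \<Gamma>(3) by (simp add: sum.distrib)
  qed
  finally have "s ^ K * (\<Prod>e\<in>\<Gamma>. u e) \<le> s ^ K * (c0 ^ card \<Gamma> / s ^ (K + (\<Sum>e\<in>\<Gamma>. card e)))"
    using s by (intro mult_left_mono) auto
  also have "\<dots> = c0 ^ card \<Gamma> * (1 / s ^ (\<Sum>e\<in>\<Gamma>. card e))"
    using s(1) by (simp add: power_add)
  also have "\<dots> \<le> c0 ^ 4 * (1 / s ^ (\<Sum>e\<in>\<Gamma>. card e))"
    using \<Gamma>(4) c0 s by (intro mult_right_mono power_increasing) auto
  finally show ?thesis by (simp only: s_def)
qed

text \<open>The hypergraphs of leading order, apart from those whose largest vertex has degree four. All bounds
below are uniform over such families: they depend on the parameters \<open>K\<close>, \<open>c0\<close>,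
\<open>\<kappa>\<close> only, so that \<open>N\<close> can tend to infinity afterwards.\<close>

locale main_family = sym_indep M x E for M :: "'a measure" and x :: "nat set \<Rightarrow> 'a \<Rightarrow> real" and E +
  fixes N K :: nat and G :: "nat set set set" and lam c0 \<kappa> :: real
  assumes N: "1 \<le> N" and E: "E \<subseteq> all_edges N"
    and G: "\<And>\<Gamma>. \<Gamma> \<in> G \<Longrightarrow> \<Gamma> \<subseteq> E" "\<And>\<Gamma>. \<Gamma> \<in> G \<Longrightarrow> bd \<Gamma> = {}" "\<And>\<Gamma>. \<Gamma> \<in> G \<Longrightarrow> card \<Gamma> = 3 \<or> card \<Gamma> = 4"
      "\<And>\<Gamma>. \<Gamma> \<in> G \<Longrightarrow> (\<Sum>e\<in>\<Gamma>. card e - 2) = K" "\<And>\<Gamma>. \<Gamma> \<in> G \<Longrightarrow> card {e \<in> \<Gamma>. Max (\<Union>\<Gamma>) \<in> e} = 2"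
    and lam: "lam\<^sup>2 = sqrt (real N) ^ K"
    and c0: "1 \<le> c0" and a_le: "\<And>e. e \<in> E \<Longrightarrow> a e \<le> c0 / real N ^ (card e - 1)"
    and \<kappa>: "9 \<le> \<kappa>" "\<And>e. e \<in> E \<Longrightarrow> expectation (\<lambda>\<omega>. x e \<omega> ^ 4) \<le> \<kappa> * (a e)\<^sup>2"
begin

text \<open>The filtration reveals the edges in the order of their largest vertex. The hypergraphs with largest
vertex \<open>m\<close> form the increment at time \<open>m\<close>; exactly two of their edges contain
\<open>m\<close>, and the one or two others belong to the past.\<close>

definition Gm :: "nat \<Rightarrow> nat set set set" where
  "Gm m = {\<Gamma> \<in> G. Max (\<Union>\<Gamma>) = m}"

definition past :: "nat \<Rightarrow> nat set set" where
  "past m = {e \<in> E. e \<subseteq> {1..<m}}"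

definition new :: "nat \<Rightarrow> nat set set" where
  "new m = {e \<in> E. m \<in> e \<and> e \<subseteq> {1..m}}"

definition s :: real where "s = sqrt (real N)"

definition C1 :: real where "C1 = c0 ^ 4 * cover_const (K + 8)"

lemma s: "1 \<le> s" "s\<^sup>2 = real N"
  using N by (simp_all add: s_def)

lemma c0_nonneg: "0 \<le> c0"
  using c0 by simp

lemma C1_nonneg: "0 \<le> C1"
  using c0_nonneg by (simp add: C1_def cover_const_nonneg)

lemma G_fin: "\<Gamma> \<in> G \<Longrightarrow> finite \<Gamma>" "\<Gamma> \<in> G \<Longrightarrow> e \<in> \<Gamma> \<Longrightarrow> finite e" "\<Gamma> \<in> G \<Longrightarrow> \<Gamma> \<subseteq> all_edges N"
proof -
  show "\<Gamma> \<in> G \<Longrightarrow> finite \<Gamma>" using G(1) finite_sub by blast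
  show "\<Gamma> \<in> G \<Longrightarrow> \<Gamma> \<subseteq> all_edges N" using G(1) E by blast
  then show "\<Gamma> \<in> G \<Longrightarrow> e \<in> \<Gamma> \<Longrightarrow> finite e" using finite_edge by blast
qed

lemma G_nonempty: "\<Gamma> \<in> G \<Longrightarrow> \<Union>\<Gamma> \<noteq> {}" "\<Gamma> \<in> G \<Longrightarrow> finite (\<Union>\<Gamma>)" "\<Gamma> \<in> G \<Longrightarrow> \<Union>\<Gamma> \<subseteq> {1..N}"
proof -
  assume \<Gamma>: "\<Gamma> \<in> G"
  then have "card \<Gamma> \<noteq> 0" using G(3)[OF \<Gamma>] by auto
  then obtain e where e: "e \<in> \<Gamma>" by (metis card.empty ex_in_conv)
  then have "3 \<le> card e" using G_fin(3)[OF \<Gamma>] by (auto simp: all_edges_def)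
  then have "e \<noteq> {}" by auto
  then show "\<Union>\<Gamma> \<noteq> {}" using e by blast
  show "finite (\<Union>\<Gamma>)" using G_fin[OF \<Gamma>] by blast
  show "\<Union>\<Gamma> \<subseteq> {1..N}" using G_fin(3)[OF \<Gamma>] by (auto simp: all_edges_def)
qed

lemma G_sum_card: "\<Gamma> \<in> G \<Longrightarrow> (\<Sum>e\<in>\<Gamma>. card e) = K + 2 * card \<Gamma>"
proof -
  assume \<Gamma>: "\<Gamma> \<in> G"
  have "(\<Sum>e\<in>\<Gamma>. card e) = (\<Sum>e\<in>\<Gamma>. (card e - 2) + 2)"
  proof (intro sum.cong refl)
    fix e assume "e \<in> \<Gamma>"
    then have "3 \<le> card e" using G_fin(3)[OF \<Gamma>] by (auto simp: all_edges_def)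
    then show "card e = card e - 2 + 2" by simp
  qed
  then show ?thesis unfolding sum.distrib using G(4)[OF \<Gamma>] by simp
qed

lemma G_cover: "\<Gamma> \<in> G \<Longrightarrow> 2 * card (\<Union>\<Gamma>) \<le> (\<Sum>e\<in>\<Gamma>. card e)" "\<Gamma> \<in> G \<Longrightarrow> card (\<Union>\<Gamma>) \<le> K + 8"
proof -
  assume \<Gamma>: "\<Gamma> \<in> G"
  show 1: "2 * card (\<Union>\<Gamma>) \<le> (\<Sum>e\<in>\<Gamma>. card e)"
    using closed_card_Union[OF G_fin(1)[OF \<Gamma>] G_fin(2)[OF \<Gamma>] G(2)[OF \<Gamma>]] .
  have "card \<Gamma> \<le> 4" using G(3)[OF \<Gamma>] by auto
  then show "card (\<Union>\<Gamma>) \<le> K + 8" using 1 G_sum_card[OF \<Gamma>] by linarith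
qed

lemma weight_le: "\<Gamma> \<in> G \<Longrightarrow> lam\<^sup>2 * ap \<Gamma> \<le> c0 ^ 4 * (1 / s ^ (\<Sum>e\<in>\<Gamma>. card e))"
proof -
  assume \<Gamma>: "\<Gamma> \<in> G"
  have "3 \<le> card e" if "e \<in> \<Gamma>" for e using that G_fin(3)[OF \<Gamma>] by (auto simp: all_edges_def)
  moreover have "card \<Gamma> \<le> 4" using G(3)[OF \<Gamma>] by auto
  ultimately show ?thesis
    unfolding lam ap_def s_def using G(1)[OF \<Gamma>] a_le
    by (intro scaled_product_bound[OF N G_fin(1)[OF \<Gamma>] _ G(4)[OF \<Gamma>] _ a_nonneg _ c0]) auto
qed

text \<open>The total variance of the hypergraphs through given vertices loses a factor \<open>N\<close> for each of
them.\<close>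

lemma sum_weight_cover:
  assumes "F \<subseteq> G" "\<And>\<Gamma>. \<Gamma> \<in> F \<Longrightarrow> Y \<subseteq> \<Union>\<Gamma>"
  shows "(\<Sum>\<Gamma>\<in>F. lam\<^sup>2 * ap \<Gamma>) \<le> C1 / s ^ (2 * card Y)"
proof -
  have "(\<Sum>\<Gamma>\<in>F. lam\<^sup>2 * ap \<Gamma>) \<le> c0 ^ 4 * (\<Sum>\<Gamma>\<in>F. 1 / s ^ (\<Sum>e\<in>\<Gamma>. card e))"
    unfolding sum_distrib_left using assms(1) weight_le by (intro sum_mono) auto
  also have "\<dots> \<le> c0 ^ 4 * (cover_const (K + 8) / s ^ (2 * card Y + 0))"
    unfolding s_def
  proof (intro mult_left_mono sum_cover[OF N])
    fix \<Gamma> assume "\<Gamma> \<in> F"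
    then have \<Gamma>: "\<Gamma> \<in> G" using assms(1) by auto
    show "\<Gamma> \<subseteq> Pow {1..N}" using G_fin(3)[OF \<Gamma>] all_edges_subset by blast
    show "2 * card (\<Union>\<Gamma>) + 0 \<le> (\<Sum>e\<in>\<Gamma>. card e)" "card (\<Union>\<Gamma>) \<le> K + 8" using G_cover[OF \<Gamma>] by auto
    show "Y \<subseteq> \<Union>\<Gamma>" using assms(2)[OF \<open>\<Gamma> \<in> F\<close>] .
  qed (use c0_nonneg in auto)
  finally show ?thesis by (simp add: C1_def)
qed

lemma Gm_max: "\<Gamma> \<in> Gm m \<Longrightarrow> m \<in> \<Union>\<Gamma>" "\<Gamma> \<in> Gm m \<Longrightarrow> \<Union>\<Gamma> \<subseteq> {1..m}" "\<Gamma> \<in> Gm m \<Longrightarrow> \<Gamma> \<in> G"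
proof -
  assume \<Gamma>: "\<Gamma> \<in> Gm m"
  then show G': "\<Gamma> \<in> G" by (simp add: Gm_def)
  have m: "Max (\<Union>\<Gamma>) = m" using \<Gamma> by (simp add: Gm_def)
  show "m \<in> \<Union>\<Gamma>" using Max_in[OF G_nonempty(2)[OF G'] G_nonempty(1)[OF G']] by (simp only: m)
  show "\<Union>\<Gamma> \<subseteq> {1..m}"
  proof
    fix i assume "i \<in> \<Union>\<Gamma>"
    then show "i \<in> {1..m}" using Max_ge[OF G_nonempty(2)[OF G'], of i] G_nonempty(3)[OF G'] m by auto
  qed
qed

lemma Gm_new: "\<Gamma> \<in> Gm m \<Longrightarrow> \<Gamma> \<inter> new m = {e \<in> \<Gamma>. m \<in> e}" "\<Gamma> \<in> Gm m \<Longrightarrow> card (\<Gamma> \<inter> new m) = 2"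
proof -
  assume \<Gamma>: "\<Gamma> \<in> Gm m"
  show 1: "\<Gamma> \<inter> new m = {e \<in> \<Gamma>. m \<in> e}"
    using Gm_max(2)[OF \<Gamma>] G(1)[OF Gm_max(3)[OF \<Gamma>]] by (auto simp: new_def)
  show "card (\<Gamma> \<inter> new m) = 2"
    unfolding 1 using G(5)[OF Gm_max(3)[OF \<Gamma>]] \<Gamma> by (simp add: Gm_def)
qed

lemma Gm_past: "\<Gamma> \<in> Gm m \<Longrightarrow> \<Gamma> \<inter> past m = \<Gamma> - (\<Gamma> \<inter> new m)"
proof -
  assume \<Gamma>: "\<Gamma> \<in> Gm m"
  have "e \<in> past m \<longleftrightarrow> m \<notin> e" if e: "e \<in> \<Gamma>" for e
  proof -
    have "e \<subseteq> {1..m}" "e \<in> E" using Gm_max(2)[OF \<Gamma>] G(1)[OF Gm_max(3)[OF \<Gamma>]] e by auto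
    then have "e \<subseteq> {1..<m}" if "m \<notin> e" using that by (auto simp: le_less)
    then show ?thesis using \<open>e \<in> E\<close> by (auto simp: past_def)
  qed
  then show ?thesis unfolding Gm_new(1)[OF \<Gamma>] by auto
qed

lemma level_m: "level M x E (past m) (new m) (Gm m)"
proof
  show "past m \<subseteq> E" "new m \<subseteq> E" "past m \<inter> new m = {}" by (auto simp: past_def new_def)
  fix \<Gamma> assume \<Gamma>: "\<Gamma> \<in> Gm m"
  show "\<Gamma> \<subseteq> past m \<union> new m" using Gm_past[OF \<Gamma>] by blast
  show "\<Gamma> \<inter> new m \<noteq> {}" using Gm_new(2)[OF \<Gamma>] by auto
qed

definition qm :: "nat \<Rightarrow> real" where
  "qm m = (\<Sum>\<Gamma>\<in>Gm m. lam\<^sup>2 * ap \<Gamma>)"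

definition Dm :: "nat \<Rightarrow> 'a \<Rightarrow> real" where
  "Dm m \<omega> = (\<Sum>\<Gamma>\<in>Gm m. lam * xp \<Gamma> \<omega>)"

lemma qm: "0 \<le> qm m" "qm m \<le> C1 / s\<^sup>2"
proof -
  show "0 \<le> qm m" unfolding qm_def by (intro sum_nonneg) (simp add: ap_nonneg)
  have "qm m \<le> C1 / s ^ (2 * card {m})"
    unfolding qm_def using Gm_max by (intro sum_weight_cover) auto
  then show "qm m \<le> C1 / s\<^sup>2" by simp
qed

text \<open>Closedness makes the boundaries of the old and of the new part coincide.\<close>

lemma past_card:
  assumes "\<Gamma> \<in> Gm m"
  shows "card (\<Gamma> \<inter> past m) \<le> 2" "finite (\<Gamma> \<inter> past m)" "{} \<notin> \<Gamma> \<inter> past m" "finite (\<Gamma> \<inter> new m)"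
    "bd (\<Gamma> \<inter> past m) = bd (\<Gamma> \<inter> new m)"
proof -
  have \<Gamma>: "\<Gamma> \<in> G" by (rule Gm_max(3)[OF assms])
  have fin: "finite \<Gamma>" by (rule G_fin(1)[OF \<Gamma>])
  show f: "finite (\<Gamma> \<inter> past m)" "finite (\<Gamma> \<inter> new m)" using fin by auto
  have "card (\<Gamma> \<inter> past m) = card \<Gamma> - 2"
    unfolding Gm_past[OF assms] using fin Gm_new(2)[OF assms] by (subst card_Diff_subset) auto
  then show "card (\<Gamma> \<inter> past m) \<le> 2" using G(3)[OF \<Gamma>] by auto
  show "{} \<notin> \<Gamma> \<inter> past m" using G_fin(3)[OF \<Gamma>] by (auto simp: all_edges_def)
  have "\<Gamma> = (\<Gamma> \<inter> past m) \<union> (\<Gamma> \<inter> new m)" using Gm_past[OF assms] by auto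
  moreover have "(\<Gamma> \<inter> past m) \<inter> (\<Gamma> \<inter> new m) = {}" using Gm_past[OF assms] by auto
  ultimately have "bd \<Gamma> = sym_diff (bd (\<Gamma> \<inter> past m)) (bd (\<Gamma> \<inter> new m))"
    using bd_disjoint_union[OF f] by metis
  then show "bd (\<Gamma> \<inter> past m) = bd (\<Gamma> \<inter> new m)" using G(2)[OF \<Gamma>] by blast
qed

text \<open>The two new edges are different, so their symmetric difference is nonempty; it does not contain
\<open>m\<close>, which lies in both.\<close>

lemma new_bd:
  assumes "\<Gamma> \<in> Gm m"
  shows "bd (\<Gamma> \<inter> past m) \<noteq> {}" "m \<notin> bd (\<Gamma> \<inter> past m)" "finite (bd (\<Gamma> \<inter> past m))"
proof -
  obtain e f where ef: "\<Gamma> \<inter> new m = {e, f}" "e \<noteq> f"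
    using Gm_new(2)[OF assms] by (auto simp: card_2_iff)
  have "bd (\<Gamma> \<inter> new m) = sym_diff e f"
    unfolding ef(1) using bd_insert[of "{f}" e] ef(2) by simp
  then show "bd (\<Gamma> \<inter> past m) \<noteq> {}" unfolding past_card(5)[OF assms] using ef(2) by blast
  have sub: "bd (\<Gamma> \<inter> past m) \<subseteq> {1..<m}"
    using bd_subset[of "\<Gamma> \<inter> past m"] by (auto simp: past_def)
  then show "m \<notin> bd (\<Gamma> \<inter> past m)" "finite (bd (\<Gamma> \<inter> past m))" using finite_subset by auto
qed

text \<open>The constants produced by the weighted inequalities in \<open>level_V\<close> and
\<open>Dm_third\<close>.\<close>

definition C2 :: real where
  "C2 = (1 + 2 * (\<kappa>\<^sup>2 + 16) * (2 * C1) * C1) / 2"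

definition C3 :: real where
  "C3 = (C1 + \<kappa> ^ 4 * C1\<^sup>2) / 2"

lemma abs_le_weighted: "0 < w \<Longrightarrow> \<bar>y\<bar> \<le> (w + y\<^sup>2 / w) / 2" for w y :: real
proof -
  assume w: "0 < w"
  have "0 \<le> (\<bar>y\<bar> - w)\<^sup>2" by simp
  then have "2 * \<bar>y\<bar> * w \<le> w * w + y\<^sup>2" by (simp add: power2_eq_square algebra_simps)
  then show ?thesis using w by (simp add: field_simps power2_eq_square)
qed

text \<open>Partners of a given hypergraph, whether they share an old edge or have the same boundary of the old
part, contain \<open>m\<close> and at least one further prescribed vertex. So \<open>\<eta>\<close> is of order
\<open>N ^ (-2)\<close>, the variance of \<open>V\<close> of order \<open>N ^ (-3)\<close>, and the first
absolute moment of order \<open>N ^ (-3/2)\<close>: over the \<open>N\<close> steps this adds up to an error of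
order \<open>1 / sqrt N\<close>.\<close>

lemma level_V: "expectation (\<lambda>\<omega>. \<bar>level.V M x (past m) (new m) (Gm m) lam \<omega> - qm m\<bar>) \<le> C2 / s ^ 3"
proof -
  interpret L: level M x E "past m" "new m" "Gm m" lam by (rule level_m)
  have q: "L.q = qm m" by (simp add: L.q_def qm_def)
  \<comment> \<open>The factor 2 accounts for the at most two old edges that a partner can share.\<close>
  define \<eta> where "\<eta> = 2 * C1 / s ^ 4"
  have V: "expectation (\<lambda>\<omega>. (L.V \<omega> - L.q)\<^sup>2) \<le> 2 * (\<kappa>\<^sup>2 + 16) * \<eta> * L.q" "integrable M (\<lambda>\<omega>. (L.V \<omega> - L.q)\<^sup>2)"
  proof -
    have \<kappa>1: "1 \<le> \<kappa>" using \<kappa>(1) by simp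
    have disj: "\<Gamma> \<inter> \<Gamma>' \<inter> past m = {}"
      if "\<Gamma> \<in> Gm m" "\<Gamma>' \<in> Gm m" "\<Gamma> \<noteq> \<Gamma>'" "\<Gamma> \<inter> new m = \<Gamma>' \<inter> new m" for \<Gamma> \<Gamma>'
    proof -
      have "\<Gamma> \<inter> past m \<noteq> \<Gamma>' \<inter> past m" using Gm_past[OF that(1)] Gm_past[OF that(2)] that(3,4) by blast
      then have "(\<Gamma> \<inter> past m) \<inter> (\<Gamma>' \<inter> past m) = {}"
        using past_card[OF that(1)] past_card[OF that(2)] that(4) by (intro bd_eq_disjoint) auto
      then show ?thesis by blast
    qed
    have bnd: "bd (\<Gamma> \<inter> past m) = bd (\<Gamma>' \<inter> past m)" if "\<Gamma> \<in> Gm m" "\<Gamma>' \<in> Gm m" "\<Gamma> \<inter> new m = \<Gamma>' \<inter> new m" for \<Gamma> \<Gamma>'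
      using past_card(5)[OF that(1)] past_card(5)[OF that(2)] that(3) by simp
    have \<eta>1: "(\<Sum>\<Gamma>' | \<Gamma>' \<in> Gm m \<and> \<Gamma> \<inter> \<Gamma>' \<inter> past m \<noteq> {}. lam\<^sup>2 * ap \<Gamma>') \<le> \<eta>" if \<Gamma>: "\<Gamma> \<in> Gm m" for \<Gamma>
    proof -
      have "(\<Sum>\<Gamma>' | \<Gamma>' \<in> Gm m \<and> \<Gamma> \<inter> \<Gamma>' \<inter> past m \<noteq> {}. lam\<^sup>2 * ap \<Gamma>')
        \<le> (\<Sum>\<Gamma>'\<in>(\<Union>e\<in>\<Gamma> \<inter> past m. {\<Gamma>' \<in> Gm m. e \<in> \<Gamma>'}). lam\<^sup>2 * ap \<Gamma>')"
        using past_card(2)[OF \<Gamma>] L.finG by (intro sum_mono2) (auto simp: ap_nonneg)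
      also have "\<dots> \<le> (\<Sum>e\<in>\<Gamma> \<inter> past m. \<Sum>\<Gamma>'\<in>{\<Gamma>' \<in> Gm m. e \<in> \<Gamma>'}. lam\<^sup>2 * ap \<Gamma>')"
        using past_card(2)[OF \<Gamma>] L.finG by (intro sum_UNION_le) (auto simp: ap_nonneg)
      also have "\<dots> \<le> (\<Sum>e\<in>\<Gamma> \<inter> past m. C1 / s ^ 4)"
      proof (rule sum_mono)
        fix e assume e: "e \<in> \<Gamma> \<inter> past m"
        then have "e \<in> all_edges N" using E by (auto simp: past_def)
        then have "3 \<le> card e" "finite e" by (simp add: all_edges_def, rule finite_edge)
        moreover have "m \<notin> e" using e by (auto simp: past_def)
        ultimately have "2 \<le> card (insert m e)" by simp
        have "(\<Sum>\<Gamma>'\<in>{\<Gamma>' \<in> Gm m. e \<in> \<Gamma>'}. lam\<^sup>2 * ap \<Gamma>') \<le> C1 / s ^ (2 * card (insert m e))"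
          using Gm_max by (intro sum_weight_cover) auto
        also have "\<dots> \<le> C1 / s ^ 4"
          using \<open>2 \<le> card (insert m e)\<close> s C1_nonneg by (intro divide_left_mono power_increasing mult_pos_pos) auto
        finally show "(\<Sum>\<Gamma>'\<in>{\<Gamma>' \<in> Gm m. e \<in> \<Gamma>'}. lam\<^sup>2 * ap \<Gamma>') \<le> C1 / s ^ 4" .
      qed
      also have "\<dots> = real (card (\<Gamma> \<inter> past m)) * (C1 / s ^ 4)" by simp
      also have "\<dots> \<le> 2 * (C1 / s ^ 4)"
        using past_card(1)[OF \<Gamma>] C1_nonneg s by (intro mult_right_mono) auto
      finally show ?thesis by (simp add: \<eta>_def)
    qed
    have \<eta>2: "(\<Sum>\<Gamma>' | \<Gamma>' \<in> Gm m \<and> bd (\<Gamma>' \<inter> past m) = bd (\<Gamma> \<inter> past m). lam\<^sup>2 * ap \<Gamma>') \<le> \<eta>" if \<Gamma>: "\<Gamma> \<in> Gm m" for \<Gamma>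
    proof -
      let ?S = "bd (\<Gamma> \<inter> past m)"
      have "0 < card ?S" using new_bd[OF \<Gamma>] by (simp add: card_gt_0_iff)
      then have c2: "2 \<le> card (insert m ?S)" using new_bd(2,3)[OF \<Gamma>] by (simp add: Suc_le_eq)
      have "(\<Sum>\<Gamma>' | \<Gamma>' \<in> Gm m \<and> bd (\<Gamma>' \<inter> past m) = ?S. lam\<^sup>2 * ap \<Gamma>') \<le> C1 / s ^ (2 * card (insert m ?S))"
      proof (rule sum_weight_cover)
        show "{\<Gamma>' \<in> Gm m. bd (\<Gamma>' \<inter> past m) = ?S} \<subseteq> G" using Gm_max(3) by blast
        fix \<Gamma>' assume "\<Gamma>' \<in> {\<Gamma>' \<in> Gm m. bd (\<Gamma>' \<inter> past m) = ?S}"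
        then have "\<Gamma>' \<in> Gm m" "bd (\<Gamma>' \<inter> past m) = ?S" by auto
        then show "insert m ?S \<subseteq> \<Union>\<Gamma>'" using bd_subset[of "\<Gamma>' \<inter> past m"] Gm_max(1) by blast
      qed
      also have "\<dots> \<le> C1 / s ^ 4"
        using c2 s C1_nonneg by (intro divide_left_mono power_increasing mult_pos_pos) auto
      also have "\<dots> \<le> \<eta>" using C1_nonneg s by (simp add: \<eta>_def divide_right_mono)
      finally show ?thesis .
    qed
    show "expectation (\<lambda>\<omega>. (L.V \<omega> - L.q)\<^sup>2) \<le> 2 * (\<kappa>\<^sup>2 + 16) * \<eta> * L.q"
      by (rule L.V_concentration(1)[OF \<kappa>(2) \<kappa>1 past_card(1) disj bnd \<eta>1 \<eta>2])
    show "integrable M (\<lambda>\<omega>. (L.V \<omega> - L.q)\<^sup>2)"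
      by (rule L.V_concentration(2)[OF \<kappa>(2) \<kappa>1 past_card(1) disj bnd \<eta>1 \<eta>2])
  qed
  have s3: "0 < s ^ 3" using s by simp
  obtain b where b: "\<And>\<omega>. \<omega> \<in> space M \<Longrightarrow> \<bar>L.V \<omega>\<bar> \<le> b" using L.V_bound by blast
  have iV: "integrable M (\<lambda>\<omega>. \<bar>L.V \<omega> - L.q\<bar>)"
  proof (rule integrable_bounded[where B="b + L.q"])
    show "(\<lambda>\<omega>. \<bar>L.V \<omega> - L.q\<bar>) \<in> borel_measurable M" using L.V_meas by simp
    fix \<omega> assume "\<omega> \<in> space M"
    then show "norm \<bar>L.V \<omega> - L.q\<bar> \<le> b + L.q" using b[of \<omega>] L.q_nonneg by simp
  qed
  have "expectation (\<lambda>\<omega>. \<bar>L.V \<omega> - L.q\<bar>) \<le> expectation (\<lambda>\<omega>. 1 / (2 * s ^ 3) + s ^ 3 / 2 * (L.V \<omega> - L.q)\<^sup>2)"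
  proof (rule integral_mono[OF iV])
    show "integrable M (\<lambda>\<omega>. 1 / (2 * s ^ 3) + s ^ 3 / 2 * (L.V \<omega> - L.q)\<^sup>2)" using V(2) by simp
    fix \<omega>
    show "\<bar>L.V \<omega> - L.q\<bar> \<le> 1 / (2 * s ^ 3) + s ^ 3 / 2 * (L.V \<omega> - L.q)\<^sup>2"
      using abs_le_weighted[of "1 / s ^ 3" "L.V \<omega> - L.q"] s3 by (simp add: add_divide_distrib mult.commute)
  qed
  also have "\<dots> = 1 / (2 * s ^ 3) + s ^ 3 / 2 * expectation (\<lambda>\<omega>. (L.V \<omega> - L.q)\<^sup>2)"
    using V(2) prob_space by simp
  also have "\<dots> \<le> 1 / (2 * s ^ 3) + s ^ 3 / 2 * (2 * (\<kappa>\<^sup>2 + 16) * (2 * C1 / s ^ 4) * (C1 / s\<^sup>2))"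
  proof (intro add_left_mono mult_left_mono order_trans[OF V(1)[unfolded \<eta>_def]])
    show "L.q \<le> C1 / s\<^sup>2" unfolding q by (rule qm(2))
  qed (use s C1_nonneg in auto)
  also have "\<dots> = C2 / s ^ 3"
  proof -
    have "s ^ 4 * s\<^sup>2 = s ^ 3 * s ^ 3" by (simp add: power_add[symmetric])
    then have "s ^ 3 / 2 * (2 * (\<kappa>\<^sup>2 + 16) * (2 * C1 / s ^ 4) * (C1 / s\<^sup>2)) = (2 * (\<kappa>\<^sup>2 + 16) * (2 * C1) * C1) / (2 * s ^ 3)"
      using s3 s(1) by (simp add: field_simps)
    then show ?thesis by (simp add: C2_def add_divide_distrib)
  qed
  finally show ?thesis unfolding q .
qed

text \<open>Interpolation between the second moment, of order \<open>1 / N\<close>, and the fourth moment, of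
order \<open>N ^ (-2)\<close> by hypercontractivity.\<close>

lemma Dm_third: "expectation (\<lambda>\<omega>. \<bar>Dm m \<omega>\<bar> ^ 3) \<le> C3 / s ^ 3"
proof -
  interpret L: level M x E "past m" "new m" "Gm m" lam by (rule level_m)
  have q: "L.q = qm m" by (simp add: L.q_def qm_def)
  have D: "Dm m = L.D" by (intro ext) (simp add: L.D_def Dm_def)
  have Dpoly: "L.D \<omega> = poly (\<lambda>\<Gamma>. if \<Gamma> \<in> Gm m then lam else 0) E 4 \<omega>" for \<omega>
  proof -
    have sub: "Gm m \<subseteq> {\<Gamma>. \<Gamma> \<subseteq> E \<and> card \<Gamma> \<le> 4}" using L.G_sub G(3)[OF Gm_max(3)] by fastforce
    have fin: "finite {\<Gamma>. \<Gamma> \<subseteq> E \<and> card \<Gamma> \<le> 4}" by (rule finite_subset[of _ "Pow E"]) (use finE in auto)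
    show ?thesis
      unfolding L.D_def poly_def using sub fin by (intro sum.mono_neutral_cong_left) auto
  qed
  have D4: "expectation (\<lambda>\<omega>. L.D \<omega> ^ 4) \<le> \<kappa> ^ 4 * (qm m)\<^sup>2"
    unfolding q[symmetric] L.expectation_D2[symmetric] Dpoly by (rule bonami[OF \<kappa>(2) \<kappa>(1) order_refl])
  have Di: "integrable M (\<lambda>\<omega>. L.D \<omega> ^ k)" for k
    using integrable_poly_mult[OF order_refl, of "\<lambda>\<Gamma>. if \<Gamma> \<in> Gm m then lam else 0" 4 k _ _ 0] unfolding Dpoly by simp
  have s0: "0 < s" using s by simp
  have "expectation (\<lambda>\<omega>. \<bar>L.D \<omega>\<bar> ^ 3) \<le> expectation (\<lambda>\<omega>. 1 / (2 * s) * (L.D \<omega>)\<^sup>2 + s / 2 * L.D \<omega> ^ 4)"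
  proof (rule integral_mono)
    show "integrable M (\<lambda>\<omega>. 1 / (2 * s) * (L.D \<omega>)\<^sup>2 + s / 2 * L.D \<omega> ^ 4)"
      using Di by (intro Bochner_Integration.integrable_add integrable_mult_right)
    show "integrable M (\<lambda>\<omega>. \<bar>L.D \<omega>\<bar> ^ 3)" using integrable_abs[OF Di[of 3]] by (simp add: power_abs)
    fix \<omega>
    have "\<bar>L.D \<omega>\<bar> ^ 3 = \<bar>L.D \<omega>\<bar> * (L.D \<omega>)\<^sup>2" by (simp add: power3_eq_cube power2_eq_square)
    also have "\<dots> \<le> (1 / s + (L.D \<omega>)\<^sup>2 / (1 / s)) / 2 * (L.D \<omega>)\<^sup>2"
      using s0 by (intro mult_right_mono abs_le_weighted) auto
    also have "\<dots> = 1 / (2 * s) * (L.D \<omega>)\<^sup>2 + s / 2 * L.D \<omega> ^ 4"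
      by (simp add: field_simps power2_eq_square power4_eq_xxxx)
    finally show "\<bar>L.D \<omega>\<bar> ^ 3 \<le> 1 / (2 * s) * (L.D \<omega>)\<^sup>2 + s / 2 * L.D \<omega> ^ 4" .
  qed
  also have "\<dots> = 1 / (2 * s) * qm m + s / 2 * expectation (\<lambda>\<omega>. L.D \<omega> ^ 4)"
    using Di L.expectation_D2 q by simp
  also have "\<dots> \<le> 1 / (2 * s) * (C1 / s\<^sup>2) + s / 2 * (\<kappa> ^ 4 * (C1 / s\<^sup>2)\<^sup>2)"
    using D4 qm[of m] s0 \<kappa>(1) by (intro add_mono mult_left_mono order_trans[OF D4] power_mono) auto
  also have "\<dots> = C3 / s ^ 3"
    using s0 by (simp add: C3_def power2_eq_square power3_eq_cube field_simps)
  finally show ?thesis by (simp add: D)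
qed

definition err :: "real \<Rightarrow> real" where
  "err t = t\<^sup>2 / 2 * C2 + \<bar>t\<bar> ^ 3 / 6 * C3 + t ^ 4 * C1\<^sup>2 / 8"

lemma step:
  assumes W: "W \<in> borel_measurable (generated (past m))"
  shows "cmod (expectation (\<lambda>\<omega>. iexp (t * (W \<omega> + Dm m \<omega>))) - complex_of_real (exp (- (t\<^sup>2 * qm m / 2))) * expectation (\<lambda>\<omega>. iexp (t * W \<omega>)))
    \<le> err t / s ^ 3"
proof -
  interpret L: level M x E "past m" "new m" "Gm m" lam by (rule level_m)
  have q: "L.q = qm m" by (simp add: L.q_def qm_def)
  have D: "Dm m = L.D" by (intro ext) (simp add: L.D_def Dm_def)
  obtain b where b: "\<And>\<omega>. \<omega> \<in> space M \<Longrightarrow> \<bar>L.V \<omega>\<bar> \<le> b" using L.V_bound by blast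
  have Z: "(\<lambda>\<omega>. iexp (t * W \<omega>)) \<in> borel_measurable (generated (past m))"
    by (rule measurable_compose[OF W]) (intro borel_measurable_continuous_onI continuous_intros)
  have Z1: "cmod (iexp (t * W \<omega>)) \<le> 1" for \<omega> by simp
  have "cmod (expectation (\<lambda>\<omega>. iexp (t * (W \<omega> + L.D \<omega>))) - complex_of_real (exp (- (t\<^sup>2 * qm m / 2))) * expectation (\<lambda>\<omega>. iexp (t * W \<omega>)))
    \<le> t\<^sup>2 / 2 * expectation (\<lambda>\<omega>. \<bar>L.V \<omega> - qm m\<bar>) + \<bar>t\<bar> ^ 3 / 6 * expectation (\<lambda>\<omega>. \<bar>L.D \<omega>\<bar> ^ 3) + t ^ 4 * (qm m)\<^sup>2 / 8"
    by (rule char_step[OF generated_meas[OF L.E01(1) W] L.D_meas L.V_meas L.D_bound b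
        L.expectation_ZD[OF Z Z1] L.expectation_ZD2[OF Z Z1] qm(1)])
  also have "\<dots> \<le> t\<^sup>2 / 2 * (C2 / s ^ 3) + \<bar>t\<bar> ^ 3 / 6 * (C3 / s ^ 3) + t ^ 4 * (C1\<^sup>2 / s ^ 3) / 8"
  proof (intro add_mono mult_left_mono divide_right_mono)
    show "expectation (\<lambda>\<omega>. \<bar>L.V \<omega> - qm m\<bar>) \<le> C2 / s ^ 3" by (rule level_V)
    show "expectation (\<lambda>\<omega>. \<bar>L.D \<omega>\<bar> ^ 3) \<le> C3 / s ^ 3" using Dm_third[of m] by (simp add: D)
    have "(qm m)\<^sup>2 \<le> (C1 / s\<^sup>2)\<^sup>2" using qm by (intro power_mono)
    also have "\<dots> = C1\<^sup>2 / s ^ 4" by (simp add: power_divide power_mult[symmetric])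
    also have "\<dots> \<le> C1\<^sup>2 / s ^ 3" using s by (intro divide_left_mono power_increasing mult_pos_pos) auto
    finally show "(qm m)\<^sup>2 \<le> C1\<^sup>2 / s ^ 3" .
  qed auto
  also have "\<dots> = err t / s ^ 3" by (simp add: err_def add_divide_distrib)
  finally show ?thesis by (simp only: D)
qed

definition W :: "nat \<Rightarrow> 'a \<Rightarrow> real" where
  "W m \<omega> = (\<Sum>j\<in>{1..m}. Dm j \<omega>)"

lemma W_generated: "W m \<in> borel_measurable (generated (past (Suc m)))"
proof -
  have "\<Gamma> \<subseteq> past (Suc m)" if "\<Gamma> \<in> Gm j" "j \<le> m" for \<Gamma> j
  proof
    fix e assume e: "e \<in> \<Gamma>"
    then have "e \<subseteq> {1..j}" using Gm_max(2)[OF that(1)] by blast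
    then have "e \<subseteq> {1..<Suc m}" using that(2) by (auto simp: less_Suc_eq_le)
    then show "e \<in> past (Suc m)" using G(1)[OF Gm_max(3)[OF that(1)]] e by (auto simp: past_def)
  qed
  then show ?thesis
    unfolding W_def[abs_def] Dm_def[abs_def]
    by (intro borel_measurable_sum borel_measurable_times borel_measurable_const xp_generated) auto
qed

text \<open>The errors of the \<open>N\<close> steps add up because the Gaussian factors are at most 1 in
modulus.\<close>

theorem char_main_family:
  "cmod (expectation (\<lambda>\<omega>. iexp (t * (\<Sum>\<Gamma>\<in>G. lam * xp \<Gamma> \<omega>))) - complex_of_real (exp (- (t\<^sup>2 * (\<Sum>\<Gamma>\<in>G. lam\<^sup>2 * ap \<Gamma>) / 2))))
    \<le> err t / s"
proof -
  define Q where "Q m = (\<Sum>j\<in>{1..m}. qm j)" for m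
  have ind: "cmod (expectation (\<lambda>\<omega>. iexp (t * W m \<omega>)) - complex_of_real (exp (- (t\<^sup>2 * Q m / 2)))) \<le> real m * (err t / s ^ 3)" for m
  proof (induction m)
    case 0
    then show ?case using prob_space by (simp add: W_def Q_def)
  next
    case (Suc m)
    define \<Phi> where "\<Phi> m = expectation (\<lambda>\<omega>. iexp (t * W m \<omega>))" for m
    define \<psi> where "\<psi> m = complex_of_real (exp (- (t\<^sup>2 * Q m / 2)))" for m
    let ?e = "complex_of_real (exp (- (t\<^sup>2 * qm (Suc m) / 2)))"
    have st: "cmod (\<Phi> (Suc m) - ?e * \<Phi> m) \<le> err t / s ^ 3"
      using step[OF W_generated[of m], of t] by (simp add: \<Phi>_def W_def add.commute)
    have "\<psi> (Suc m) = ?e * \<psi> m"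
      unfolding \<psi>_def of_real_mult[symmetric] exp_add[symmetric] by (simp add: Q_def algebra_simps add_divide_distrib)
    then have "\<Phi> (Suc m) - \<psi> (Suc m) = (\<Phi> (Suc m) - ?e * \<Phi> m) + ?e * (\<Phi> m - \<psi> m)"
      by (simp add: algebra_simps)
    then have "cmod (\<Phi> (Suc m) - \<psi> (Suc m)) \<le> cmod (\<Phi> (Suc m) - ?e * \<Phi> m) + cmod (?e * (\<Phi> m - \<psi> m))"
      by (simp only: norm_triangle_ineq)
    also have "cmod (?e * (\<Phi> m - \<psi> m)) \<le> 1 * cmod (\<Phi> m - \<psi> m)"
      unfolding norm_mult using qm(1)[of "Suc m"] by (intro mult_right_mono) (auto simp: norm_of_real)
    finally have le: "cmod (\<Phi> (Suc m) - \<psi> (Suc m)) \<le> cmod (\<Phi> (Suc m) - ?e * \<Phi> m) + cmod (\<Phi> m - \<psi> m)"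
      by simp
    have IH: "cmod (\<Phi> m - \<psi> m) \<le> real m * (err t / s ^ 3)"
      using Suc.IH by (simp only: \<Phi>_def \<psi>_def)
    have "cmod (\<Phi> (Suc m) - \<psi> (Suc m)) \<le> err t / s ^ 3 + real m * (err t / s ^ 3)"
      using le st IH by linarith
    also have "\<dots> = real (Suc m) * (err t / s ^ 3)" by (simp only: of_nat_Suc distrib_right mult_1_left)
    finally show ?case by (simp only: \<Phi>_def \<psi>_def)
  qed
  have finG: "finite G" by (rule finite_subset[of _ "Pow E"]) (use G(1) finE in auto)
  have part: "(\<Sum>\<Gamma>\<in>G. f \<Gamma>) = (\<Sum>m\<in>{1..N}. \<Sum>\<Gamma>\<in>Gm m. f \<Gamma>)" for f :: "nat set set \<Rightarrow> real"
  proof -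
    have "(\<lambda>\<Gamma>. Max (\<Union>\<Gamma>)) ` G \<subseteq> {1..N}"
    proof
      fix m assume "m \<in> (\<lambda>\<Gamma>. Max (\<Union>\<Gamma>)) ` G"
      then obtain \<Gamma> where \<Gamma>: "\<Gamma> \<in> G" "m = Max (\<Union>\<Gamma>)" by blast
      then show "m \<in> {1..N}" using Max_in[OF G_nonempty(2,1)[OF \<Gamma>(1)]] G_nonempty(3)[OF \<Gamma>(1)] by blast
    qed
    from sum.group[OF finG _ this, of f] show ?thesis by (simp add: Gm_def)
  qed
  have "W N \<omega> = (\<Sum>\<Gamma>\<in>G. lam * xp \<Gamma> \<omega>)" for \<omega> by (simp only: W_def Dm_def part)
  moreover have "Q N = (\<Sum>\<Gamma>\<in>G. lam\<^sup>2 * ap \<Gamma>)" by (simp only: Q_def qm_def part)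
  moreover have "real N * (err t / s ^ 3) = err t / s"
    using s by (simp add: s(2)[symmetric] power2_eq_square power3_eq_cube)
  ultimately show ?thesis using ind[of N] by simp
qed

end

section \<open>The number of closed hypergraphs of minimal weight\<close>

lemma newton_identities:
  fixes u :: "'b \<Rightarrow> real"
  assumes "finite E"
  shows "2 * esym u E 2 = (sum u E)\<^sup>2 - (\<Sum>e\<in>E. u e ^ 2)"
    and "6 * esym u E 3 = sum u E ^ 3 - 3 * sum u E * (\<Sum>e\<in>E. u e ^ 2) + 2 * (\<Sum>e\<in>E. u e ^ 3)"
    and "24 * esym u E 4 = sum u E ^ 4 - 6 * (sum u E)\<^sup>2 * (\<Sum>e\<in>E. u e ^ 2) + 3 * (\<Sum>e\<in>E. u e ^ 2)\<^sup>2
      + 8 * sum u E * (\<Sum>e\<in>E. u e ^ 3) - 6 * (\<Sum>e\<in>E. u e ^ 4)"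
proof -
  have "2 * esym u E 2 = (sum u E)\<^sup>2 - (\<Sum>e\<in>E. u e ^ 2) \<and>
    6 * esym u E 3 = sum u E ^ 3 - 3 * sum u E * (\<Sum>e\<in>E. u e ^ 2) + 2 * (\<Sum>e\<in>E. u e ^ 3) \<and>
    24 * esym u E 4 = sum u E ^ 4 - 6 * (sum u E)\<^sup>2 * (\<Sum>e\<in>E. u e ^ 2) + 3 * (\<Sum>e\<in>E. u e ^ 2)\<^sup>2
      + 8 * sum u E * (\<Sum>e\<in>E. u e ^ 3) - 6 * (\<Sum>e\<in>E. u e ^ 4)"
    using assms
  proof (induction E rule: finite_induct)
    case empty
    then show ?case by (simp add: esym_gt)
  next
    case (insert x E)
    define e1 e2 e3 e4 where "e1 = sum u E" and "e2 = esym u E 2" and "e3 = esym u E 3" and "e4 = esym u E 4"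
    define p2 p3 p4 where "p2 = (\<Sum>e\<in>E. u e ^ 2)" and "p3 = (\<Sum>e\<in>E. u e ^ 3)" and "p4 = (\<Sum>e\<in>E. u e ^ 4)"
    define t where "t = u x"
    have IH: "2 * e2 = e1 ^ 2 - p2" "6 * e3 = e1 ^ 3 - 3 * e1 * p2 + 2 * p3"
      "24 * e4 = e1 ^ 4 - 6 * e1 ^ 2 * p2 + 3 * p2 ^ 2 + 8 * e1 * p3 - 6 * p4"
      using insert.IH by (simp_all add: e1_def e2_def e3_def e4_def p2_def p3_def p4_def)
    have n: "2 = Suc (Suc 0)" "3 = Suc 2" "4 = Suc (3::nat)" by simp_all
    have es: "esym u (insert x E) 2 = e2 + t * e1" "esym u (insert x E) 3 = e3 + t * e2" "esym u (insert x E) 4 = e4 + t * e3"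
      using esym_insert[OF insert.hyps, of u "Suc 0"] esym_insert[OF insert.hyps, of u 2] esym_insert[OF insert.hyps, of u 3]
        esym_1[OF insert.hyps(1), of u]
      by (simp_all add: e1_def e2_def e3_def e4_def t_def n)
    have ps: "sum u (insert x E) = t + e1" "(\<Sum>e\<in>insert x E. u e ^ 2) = t ^ 2 + p2"
      "(\<Sum>e\<in>insert x E. u e ^ 3) = t ^ 3 + p3" "(\<Sum>e\<in>insert x E. u e ^ 4) = t ^ 4 + p4"
      using insert.hyps by (simp_all add: e1_def p2_def p3_def p4_def t_def)
    have e2: "e2 = (e1 ^ 2 - p2) / 2" and e3: "e3 = (e1 ^ 3 - 3 * e1 * p2 + 2 * p3) / 6"
      and e4: "e4 = (e1 ^ 4 - 6 * e1 ^ 2 * p2 + 3 * p2 ^ 2 + 8 * e1 * p3 - 6 * p4) / 24"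
      using IH by simp_all
    show ?case
      unfolding es ps e4 e3 e2
      by (simp add: power2_eq_square power3_eq_cube power4_eq_xxxx field_simps)
  qed
  then show "2 * esym u E 2 = (sum u E)\<^sup>2 - (\<Sum>e\<in>E. u e ^ 2)"
    "6 * esym u E 3 = sum u E ^ 3 - 3 * sum u E * (\<Sum>e\<in>E. u e ^ 2) + 2 * (\<Sum>e\<in>E. u e ^ 3)"
    "24 * esym u E 4 = sum u E ^ 4 - 6 * (sum u E)\<^sup>2 * (\<Sum>e\<in>E. u e ^ 2) + 3 * (\<Sum>e\<in>E. u e ^ 2)\<^sup>2
      + 8 * sum u E * (\<Sum>e\<in>E. u e ^ 3) - 6 * (\<Sum>e\<in>E. u e ^ 4)" by blast+
qed

definition closed_of :: "nat \<Rightarrow> nat \<Rightarrow> nat \<Rightarrow> nat set set set" where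
  "closed_of N p n = {\<Gamma>. \<Gamma> \<subseteq> edges N p \<and> card \<Gamma> = n \<and> bd \<Gamma> = {}}"

definition closed_mixed :: "nat \<Rightarrow> nat \<Rightarrow> nat \<Rightarrow> nat set set set" where
  "closed_mixed N p q = {\<Gamma>. \<exists>e\<in>edges N p. \<exists>\<Gamma>'\<subseteq>edges N q. card \<Gamma>' = 2 \<and> \<Gamma> = insert e \<Gamma>' \<and> bd \<Gamma> = {}}"

lemma edges_subset: "edges N p \<subseteq> Pow {1..N}"
  by (auto simp: edges_def)

lemma avg_ep: "1 \<le> p \<Longrightarrow> avg N (ep N p) = 0"
proof -
  assume p: "1 \<le> p"
  have "avg N (ep N p) = (\<Sum>A\<in>edges N p. avg N (chi A))"
    unfolding ep_eq avg_sum[symmetric] by (rule refl)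
  also have "\<dots> = 0" using p by (intro sum.neutral) (auto simp: edges_def avg_chi)
  finally show ?thesis .
qed

lemma avg_ep_power2: "avg N (\<lambda>B. ep N p B ^ 2) = real (N choose p)"
  using avg_ep_sq[of "{p}" N "\<lambda>_. 1"] by simp

lemma card_closed_of: "real (card (closed_of N p n)) = avg N (\<lambda>B. esym (\<lambda>e. chi e B) (edges N p) n)"
  using avg_esym_subset[OF edges_subset, of N "\<lambda>_. 1" p n] by (simp add: closed_of_def)

lemma chi_powers: "chi A B ^ 2 = 1" "chi A B ^ 3 = chi A B" "chi A B ^ 4 = 1"
proof -
  have "chi A B * chi A B = \<bar>chi A B\<bar> * \<bar>chi A B\<bar>" by (simp only: abs_mult_self_eq)
  then have 1: "chi A B * chi A B = 1" by simp
  then show "chi A B ^ 2 = 1" by (simp add: power2_eq_square)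
  show "chi A B ^ 3 = chi A B" using 1 by (simp add: power3_eq_cube)
  show "chi A B ^ 4 = 1" using 1 by (simp add: power4_eq_xxxx)
qed

text \<open>In the third power of the symmetric polynomial, tuples with a repeated edge reduce to a single Walsh
function of mean zero. So only ordered triples of different edges remain.\<close>

lemma card_closed_3:
  assumes "1 \<le> p"
  shows "6 * real (card (closed_of N p 3)) = avg N (\<lambda>B. ep N p B ^ 3)"
proof -
  let ?n = "real (card (edges N p))"
  have "6 * esym (\<lambda>e. chi e B) (edges N p) 3 = ep N p B ^ 3 - (3 * ?n - 2) * ep N p B" for B
    unfolding newton_identities(2)[OF finite_edges] chi_powers ep_eq[symmetric] by (simp add: algebra_simps)
  then have "6 * real (card (closed_of N p 3)) = avg N (\<lambda>B. ep N p B ^ 3 - (3 * ?n - 2) * ep N p B)"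
    unfolding card_closed_of avg_cmult[symmetric] by simp
  also have "\<dots> = avg N (\<lambda>B. ep N p B ^ 3) - (3 * ?n - 2) * avg N (ep N p)"
    unfolding avg_diff avg_cmult by (rule refl)
  finally show ?thesis using avg_ep[OF assms] by simp
qed

text \<open>The subtracted terms are the tuples in which edges coincide in pairs, three pairings with the quadruple
coincidence counted three times instead of once. In the limit they turn the fourth moment into the fourth Hermite
polynomial.\<close>

lemma card_closed_4:
  assumes "1 \<le> p"
  shows "24 * real (card (closed_of N p 4)) = avg N (\<lambda>B. ep N p B ^ 4) - 3 * (real (N choose p))\<^sup>2 + 2 * real (N choose p)"
proof -
  let ?n = "real (N choose p)"
  have "24 * esym (\<lambda>e. chi e B) (edges N p) 4 = ep N p B ^ 4 - ((6 * ?n - 8) * ep N p B ^ 2 - (3 * ?n\<^sup>2 - 6 * ?n))" for B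
    unfolding newton_identities(3)[OF finite_edges] chi_powers ep_eq[symmetric]
    by (simp add: algebra_simps card_edges power2_eq_square)
  then have "24 * real (card (closed_of N p 4)) = avg N (\<lambda>B. ep N p B ^ 4 - ((6 * ?n - 8) * ep N p B ^ 2 - (3 * ?n\<^sup>2 - 6 * ?n)))"
    unfolding card_closed_of avg_cmult[symmetric] by simp
  also have "\<dots> = avg N (\<lambda>B. ep N p B ^ 4) - ((6 * ?n - 8) * ?n - (3 * ?n\<^sup>2 - 6 * ?n))"
    unfolding avg_diff avg_cmult avg_ep_power2 avg_const by (rule refl)
  finally show ?thesis by (simp add: algebra_simps power2_eq_square)
qed

text \<open>The edges of size \<open>p\<close> and \<open>q\<close> are different, and a repeated edge of size
\<open>q\<close> would force the edge of size \<open>p\<close> to be empty.\<close>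

lemma card_closed_mixed:
  assumes p: "1 \<le> p" "p \<noteq> q"
  shows "2 * real (card (closed_mixed N p q)) = avg N (\<lambda>B. ep N p B * ep N q B ^ 2)"
proof -
  let ?P = "{\<Gamma>'. \<Gamma>' \<subseteq> edges N q \<and> card \<Gamma>' = 2}"
  let ?S = "{y \<in> edges N p \<times> ?P. bd (insert (fst y) (snd y)) = {}}"
  let ?f = "\<lambda>y. insert (fst y) (snd y)"
  have finP: "finite ?P" by (rule finite_esym_index[OF finite_edges])
  have disj: "e \<notin> \<Gamma>'" if "e \<in> edges N p" "\<Gamma>' \<subseteq> edges N q" for e \<Gamma>'
    using that p by (auto simp: edges_def)
  have inj: "inj_on ?f ?S"
  proof (rule inj_onI)
    fix y z assume y: "y \<in> ?S" and z: "z \<in> ?S" and eq: "?f y = ?f z"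
    have "?f w \<inter> edges N p = {fst w}" "?f w \<inter> edges N q = snd w" if "w \<in> ?S" for w
    proof -
      have w: "fst w \<in> edges N p" "snd w \<subseteq> edges N q" using that by auto
      have "edges N p \<inter> edges N q = {}" using p by (auto simp: edges_def)
      then show "?f w \<inter> edges N p = {fst w}" "?f w \<inter> edges N q = snd w" using w by blast+
    qed
    from this[OF y] this[OF z] eq have "{fst y} = {fst z}" "snd y = snd z" by simp_all
    then show "y = z" by (simp add: prod_eq_iff)
  qed
  have "closed_mixed N p q = ?f ` ?S"
  proof (intro equalityI subsetI)
    fix \<Gamma> assume "\<Gamma> \<in> closed_mixed N p q"
    then obtain e \<Gamma>' where *: "e \<in> edges N p" "\<Gamma>' \<subseteq> edges N q" "card \<Gamma>' = 2" "\<Gamma> = insert e \<Gamma>'" "bd \<Gamma> = {}"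
      by (auto simp: closed_mixed_def)
    then have "(e, \<Gamma>') \<in> ?S" "\<Gamma> = ?f (e, \<Gamma>')" by auto
    then show "\<Gamma> \<in> ?f ` ?S" by blast
  next
    fix \<Gamma> assume "\<Gamma> \<in> ?f ` ?S"
    then obtain y where "y \<in> ?S" "\<Gamma> = ?f y" by blast
    then have "fst y \<in> edges N p" "snd y \<subseteq> edges N q" "card (snd y) = 2" "\<Gamma> = insert (fst y) (snd y)" "bd \<Gamma> = {}" by auto
    then show "\<Gamma> \<in> closed_mixed N p q" unfolding closed_mixed_def by blast
  qed
  then have "real (card (closed_mixed N p q)) = real (card ?S)" by (simp add: card_image[OF inj])
  also have "\<dots> = (\<Sum>y\<in>edges N p \<times> ?P. if bd (?f y) = {} then 1 else 0)"
    using finP by (simp add: sum.inter_filter[symmetric])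
  also have "\<dots> = (\<Sum>y\<in>edges N p \<times> ?P. avg N (\<lambda>B. chi (fst y) B * (\<Prod>f\<in>snd y. chi f B)))"
  proof (intro sum.cong refl)
    fix y assume y: "y \<in> edges N p \<times> ?P"
    then have "snd y \<subseteq> edges N q" by auto
    then have f: "finite (snd y)" "fst y \<notin> snd y" using finite_subset[OF _ finite_edges] disj[of "fst y" "snd y"] y by auto
    have "fst y \<in> edges N p" "snd y \<subseteq> edges N q" using y by auto
    then have "?f y \<subseteq> Pow {1..N}" using edges_subset[of N p] edges_subset[of N q] by blast
    then have "avg N (\<lambda>B. \<Prod>e\<in>?f y. 1 * chi e B) = (if bd (?f y) = {} then \<Prod>e\<in>?f y. 1 else 0)" by (rule avg_prod_chi)
    then show "(if bd (?f y) = {} then 1 else 0) = avg N (\<lambda>B. chi (fst y) B * (\<Prod>f\<in>snd y. chi f B))"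
      using f by simp
  qed
  also have "\<dots> = avg N (\<lambda>B. \<Sum>y\<in>edges N p \<times> ?P. chi (fst y) B * (\<Prod>f\<in>snd y. chi f B))"
    by (rule avg_sum[symmetric])
  also have "\<dots> = avg N (\<lambda>B. ep N p B * esym (\<lambda>e. chi e B) (edges N q) 2)"
    unfolding ep_eq esym_def sum_product sum.cartesian_product by (simp add: case_prod_unfold)
  also have "2 * \<dots> = avg N (\<lambda>B. ep N p B * (2 * esym (\<lambda>e. chi e B) (edges N q) 2))"
    unfolding avg_cmult[symmetric] by (simp add: algebra_simps)
  also have "\<dots> = avg N (\<lambda>B. ep N p B * ep N q B ^ 2 - real (card (edges N q)) * ep N p B)"
    unfolding newton_identities(1)[OF finite_edges] chi_powers ep_eq[symmetric] by (simp add: algebra_simps)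
  also have "\<dots> = avg N (\<lambda>B. ep N p B * ep N q B ^ 2) - real (card (edges N q)) * avg N (ep N p)"
    unfolding avg_diff avg_cmult by (rule refl)
  finally show ?thesis using avg_ep[OF p(1)] by simp
qed

lemma ep_gp: "1 \<le> N \<Longrightarrow> ep N p B = sqrt (real N) ^ p * gp N p B / fact p"
  by (simp add: gp_def)

lemma choose_limit: "(\<lambda>N. real (N choose p) / sqrt (real N) ^ (2 * p)) \<longlonglongrightarrow> 1 / fact p"
proof -
  have "(\<lambda>N. avg N (\<lambda>B. gp N p B * (gp N p B * 1))) \<longlonglongrightarrow> (\<integral>x. hermite p x * (hermite p x * 1) \<partial>gauss)"
    by (intro gauss_limit_avg gauss_limit_gp gauss_limit_one)
  then have "(\<lambda>N. avg N (\<lambda>B. gp N p B * gp N p B) / (fact p)\<^sup>2) \<longlonglongrightarrow> fact p / (fact p)\<^sup>2"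
    using gauss_hermite_orthogonal[of p p] by (intro tendsto_divide) auto
  moreover have "\<forall>\<^sub>F N in sequentially. avg N (\<lambda>B. gp N p B * gp N p B) / (fact p)\<^sup>2 = real (N choose p) / sqrt (real N) ^ (2 * p)"
    using eventually_ge_at_top[of 1]
  proof eventually_elim
    case (elim N)
    have "real (N choose p) = avg N (\<lambda>B. (sqrt (real N) ^ (2 * p) / (fact p)\<^sup>2) * (gp N p B * gp N p B))"
    proof -
      have "sqrt (real N) ^ (2 * p) = sqrt (real N) ^ p * sqrt (real N) ^ p" by (simp only: mult_2 power_add)
      then show ?thesis
        unfolding avg_ep_power2[symmetric] ep_gp[OF elim] by (simp add: power2_eq_square algebra_simps)
    qed
    then show ?case unfolding avg_cmult using elim by (simp add: field_simps)
  qed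
  moreover have "fact p / (fact p)\<^sup>2 = 1 / (fact p :: real)" by (simp add: power2_eq_square)
  ultimately show ?thesis using Lim_transform_eventually by fastforce
qed

lemma closed_3_limit:
  assumes "1 \<le> p"
  shows "(\<lambda>N. real (card (closed_of N p 3)) / sqrt (real N) ^ (3 * p)) \<longlonglongrightarrow> (\<integral>x. hermite p x ^ 3 \<partial>gauss) / (6 * fact p ^ 3)"
proof -
  have "(\<lambda>N. avg N (\<lambda>B. gp N p B * (gp N p B * (gp N p B * 1)))) \<longlonglongrightarrow> (\<integral>x. hermite p x * (hermite p x * (hermite p x * 1)) \<partial>gauss)"
    by (intro gauss_limit_avg gauss_limit_gp gauss_limit_one)
  then have "(\<lambda>N. avg N (\<lambda>B. gp N p B ^ 3) / (6 * fact p ^ 3)) \<longlonglongrightarrow> (\<integral>x. hermite p x ^ 3 \<partial>gauss) / (6 * fact p ^ 3)"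
    by (intro tendsto_divide) (auto simp: power3_eq_cube mult.assoc)
  moreover have "\<forall>\<^sub>F N in sequentially. avg N (\<lambda>B. gp N p B ^ 3) / (6 * fact p ^ 3) = real (card (closed_of N p 3)) / sqrt (real N) ^ (3 * p)"
    using eventually_ge_at_top[of 1]
  proof eventually_elim
    case (elim N)
    have "6 * real (card (closed_of N p 3)) = avg N (\<lambda>B. (sqrt (real N) ^ (3 * p) / fact p ^ 3) * gp N p B ^ 3)"
      unfolding card_closed_3[OF assms] ep_gp[OF elim]
      by (simp add: power_divide power_mult_distrib power_mult[symmetric] mult.commute[of 3])
    then show ?case unfolding avg_cmult using elim by (simp add: field_simps)
  qed
  ultimately show ?thesis by (rule Lim_transform_eventually)
qed

lemma closed_4_limit:
  assumes "1 \<le> p"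
  shows "(\<lambda>N. real (card (closed_of N p 4)) / sqrt (real N) ^ (4 * p)) \<longlonglongrightarrow>
    ((\<integral>x. hermite p x ^ 4 \<partial>gauss) / fact p ^ 4 - 3 / (fact p)\<^sup>2) / 24"
proof -
  have 1: "(\<lambda>N. avg N (\<lambda>B. gp N p B ^ 4)) \<longlonglongrightarrow> (\<integral>x. hermite p x ^ 4 \<partial>gauss)"
  proof -
    have "(\<lambda>N. avg N (\<lambda>B. gp N p B * (gp N p B * (gp N p B * (gp N p B * 1))))) \<longlonglongrightarrow> (\<integral>x. hermite p x * (hermite p x * (hermite p x * (hermite p x * 1))) \<partial>gauss)"
      by (intro gauss_limit_avg gauss_limit_gp gauss_limit_one)
    then show ?thesis by (simp add: power4_eq_xxxx mult.assoc)
  qed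
  have 2: "(\<lambda>N. 1 / sqrt (real N) ^ (2 * p)) \<longlonglongrightarrow> 0"
  proof -
    have "filterlim (\<lambda>N. sqrt (real N) ^ (2 * p)) at_top sequentially"
      using assms by (intro filterlim_pow_at_top filterlim_compose[OF sqrt_at_top filterlim_real_sequentially]) auto
    then show ?thesis by (intro tendsto_divide_0[OF tendsto_const] filterlim_at_top_imp_at_infinity)
  qed
  have "(\<lambda>N. (avg N (\<lambda>B. gp N p B ^ 4) / fact p ^ 4 - 3 * (real (N choose p) / sqrt (real N) ^ (2 * p))\<^sup>2
      + 2 * (real (N choose p) / sqrt (real N) ^ (2 * p)) * (1 / sqrt (real N) ^ (2 * p))) / 24) \<longlonglongrightarrow>
    ((\<integral>x. hermite p x ^ 4 \<partial>gauss) / fact p ^ 4 - 3 * (1 / fact p)\<^sup>2 + 2 * (1 / fact p) * 0) / 24"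
    by (intro tendsto_intros 1 2 choose_limit) auto
  moreover have "\<forall>\<^sub>F N in sequentially. (avg N (\<lambda>B. gp N p B ^ 4) / fact p ^ 4 - 3 * (real (N choose p) / sqrt (real N) ^ (2 * p))\<^sup>2
      + 2 * (real (N choose p) / sqrt (real N) ^ (2 * p)) * (1 / sqrt (real N) ^ (2 * p))) / 24
    = real (card (closed_of N p 4)) / sqrt (real N) ^ (4 * p)"
    using eventually_ge_at_top[of 1]
  proof eventually_elim
    case (elim N)
    define r where "r = sqrt (real N) ^ (2 * p)"
    have r: "0 < r" "sqrt (real N) ^ (4 * p) = r * r"
      using elim by (simp_all add: r_def power_add[symmetric])
    have "avg N (\<lambda>B. ep N p B ^ 4) = avg N (\<lambda>B. (sqrt (real N) ^ (4 * p) / fact p ^ 4) * gp N p B ^ 4)"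
      unfolding ep_gp[OF elim]
      by (simp add: power_divide power_mult_distrib power_mult[symmetric] mult.commute[of 4])
    then have a: "avg N (\<lambda>B. ep N p B ^ 4) = r * r / fact p ^ 4 * avg N (\<lambda>B. gp N p B ^ 4)"
      unfolding avg_cmult r(2) .
    have cq: "real (card (closed_of N p 4)) = (r * r / fact p ^ 4 * avg N (\<lambda>B. gp N p B ^ 4) - 3 * (real (N choose p))\<^sup>2 + 2 * real (N choose p)) / 24"
      using card_closed_4[OF assms, of N] a by simp
    show ?case unfolding r(2) r_def[symmetric] cq using r(1) by (simp add: field_simps power2_eq_square)
  qed
  ultimately have "(\<lambda>N. real (card (closed_of N p 4)) / sqrt (real N) ^ (4 * p)) \<longlonglongrightarrow>
    ((\<integral>x. hermite p x ^ 4 \<partial>gauss) / fact p ^ 4 - 3 * (1 / fact p)\<^sup>2 + 2 * (1 / fact p) * 0) / 24"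
    by (rule Lim_transform_eventually)
  then show ?thesis by (simp add: power_divide)
qed

lemma closed_mixed_limit:
  assumes "1 \<le> p" "p \<noteq> q"
  shows "(\<lambda>N. real (card (closed_mixed N p q)) / sqrt (real N) ^ (p + 2 * q)) \<longlonglongrightarrow>
    (\<integral>x. hermite p x * hermite q x ^ 2 \<partial>gauss) / (2 * fact p * fact q ^ 2)"
proof -
  have "(\<lambda>N. avg N (\<lambda>B. gp N p B * (gp N q B * (gp N q B * 1)))) \<longlonglongrightarrow> (\<integral>x. hermite p x * (hermite q x * (hermite q x * 1)) \<partial>gauss)"
    by (intro gauss_limit_avg gauss_limit_gp gauss_limit_one)
  then have "(\<lambda>N. avg N (\<lambda>B. gp N p B * gp N q B ^ 2) / (2 * fact p * fact q ^ 2)) \<longlonglongrightarrow> (\<integral>x. hermite p x * hermite q x ^ 2 \<partial>gauss) / (2 * fact p * fact q ^ 2)"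
    by (intro tendsto_divide) (auto simp: power2_eq_square)
  moreover have "\<forall>\<^sub>F N in sequentially. avg N (\<lambda>B. gp N p B * gp N q B ^ 2) / (2 * fact p * fact q ^ 2) = real (card (closed_mixed N p q)) / sqrt (real N) ^ (p + 2 * q)"
    using eventually_ge_at_top[of 1]
  proof eventually_elim
    case (elim N)
    have "2 * real (card (closed_mixed N p q)) = avg N (\<lambda>B. (sqrt (real N) ^ (p + 2 * q) / (fact p * fact q ^ 2)) * (gp N p B * gp N q B ^ 2))"
      unfolding card_closed_mixed[OF assms] ep_gp[OF elim]
      by (simp add: power_divide power_mult_distrib power_mult[symmetric] power_add mult.commute[of 2] algebra_simps)
    then show ?case unfolding avg_cmult using elim by (simp add: field_simps)
  qed
  ultimately show ?thesis by (rule Lim_transform_eventually)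
qed

context couplings begin

lemma closed_of_weight_limit:
  assumes p: "2 \<le> p" and lim: "(\<lambda>N. real (card (closed_of N p n)) / sqrt (real N) ^ (n * p)) \<longlonglongrightarrow> l"
  shows "(\<lambda>N. sqrt (real N) ^ (n * (p - 2)) * (\<Sum>\<Gamma>\<in>closed_of N p n. \<Prod>e\<in>\<Gamma>. bw N (card e))) \<longlonglongrightarrow> c p ^ n * l"
proof -
  have "(\<lambda>N. c p ^ n * (real (card (closed_of N p n)) / sqrt (real N) ^ (n * p))) \<longlonglongrightarrow> c p ^ n * l"
    by (intro tendsto_intros lim)
  moreover have "\<forall>\<^sub>F N in sequentially. c p ^ n * (real (card (closed_of N p n)) / sqrt (real N) ^ (n * p))
     = sqrt (real N) ^ (n * (p - 2)) * (\<Sum>\<Gamma>\<in>closed_of N p n. \<Prod>e\<in>\<Gamma>. bw N (card e))"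
    using eventually_ge_at_top[of 1]
  proof eventually_elim
    case (elim N)
    define s where "s = sqrt (real N)"
    have s: "0 < s" "real N = s\<^sup>2" using elim by (simp_all add: s_def)
    have "(\<Sum>\<Gamma>\<in>closed_of N p n. \<Prod>e\<in>\<Gamma>. bw N (card e)) = (\<Sum>\<Gamma>\<in>closed_of N p n. bw N p ^ n)"
    proof (intro sum.cong refl)
      fix \<Gamma> assume "\<Gamma> \<in> closed_of N p n"
      then have *: "\<And>e. e \<in> \<Gamma> \<Longrightarrow> card e = p" "card \<Gamma> = n" by (auto simp: closed_of_def edges_def)
      then show "(\<Prod>e\<in>\<Gamma>. bw N (card e)) = bw N p ^ n" by simp
    qed
    also have "\<dots> = real (card (closed_of N p n)) * (c p ^ n / s ^ (2 * (p - 1) * n))"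
      by (simp add: bw_def s(2) power_divide power_mult)
    also have "s ^ (n * (p - 2)) * \<dots> = c p ^ n * real (card (closed_of N p n)) * (s ^ (n * (p - 2)) / s ^ (2 * (p - 1) * n))"
      by simp
    also have "s ^ (2 * (p - 1) * n) = s ^ (n * (p - 2)) * s ^ (n * p)"
    proof -
      have "2 * (p - 1) = (p - 2) + p" using p by simp
      then have "2 * (p - 1) * n = n * (p - 2) + n * p" by (simp add: algebra_simps)
      then show ?thesis by (simp add: power_add)
    qed
    finally show ?case using s(1) by (simp add: s_def)
  qed
  ultimately show ?thesis by (rule Lim_transform_eventually)
qed

lemma closed_mixed_weight_limit:
  assumes p: "2 \<le> p" "2 \<le> q" "p \<noteq> q"
  shows "(\<lambda>N. sqrt (real N) ^ ((p - 2) + 2 * (q - 2)) * (\<Sum>\<Gamma>\<in>closed_mixed N p q. \<Prod>e\<in>\<Gamma>. bw N (card e))) \<longlonglongrightarrow>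
    c p * c q ^ 2 * ((\<integral>x. hermite p x * hermite q x ^ 2 \<partial>gauss) / (2 * fact p * fact q ^ 2))"
proof -
  have "(\<lambda>N. c p * c q ^ 2 * (real (card (closed_mixed N p q)) / sqrt (real N) ^ (p + 2 * q))) \<longlonglongrightarrow>
     c p * c q ^ 2 * ((\<integral>x. hermite p x * hermite q x ^ 2 \<partial>gauss) / (2 * fact p * fact q ^ 2))"
    using p by (intro tendsto_mult tendsto_const closed_mixed_limit) auto
  moreover have "\<forall>\<^sub>F N in sequentially. c p * c q ^ 2 * (real (card (closed_mixed N p q)) / sqrt (real N) ^ (p + 2 * q))
     = sqrt (real N) ^ ((p - 2) + 2 * (q - 2)) * (\<Sum>\<Gamma>\<in>closed_mixed N p q. \<Prod>e\<in>\<Gamma>. bw N (card e))"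
    using eventually_ge_at_top[of 1]
  proof eventually_elim
    case (elim N)
    define s where "s = sqrt (real N)"
    have s: "0 < s" "real N = s\<^sup>2" using elim by (simp_all add: s_def)
    have "(\<Sum>\<Gamma>\<in>closed_mixed N p q. \<Prod>e\<in>\<Gamma>. bw N (card e)) = (\<Sum>\<Gamma>\<in>closed_mixed N p q. bw N p * bw N q ^ 2)"
    proof (intro sum.cong refl)
      fix \<Gamma> assume "\<Gamma> \<in> closed_mixed N p q"
      then obtain e \<Gamma>' where *: "e \<in> edges N p" "\<Gamma>' \<subseteq> edges N q" "card \<Gamma>' = 2" "\<Gamma> = insert e \<Gamma>'" by (auto simp: closed_mixed_def)
      have "finite \<Gamma>'" "e \<notin> \<Gamma>'" using * p finite_subset[OF *(2)] by (auto simp: edges_def)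
      moreover have "card e = p" "\<And>f. f \<in> \<Gamma>' \<Longrightarrow> card f = q" using * by (auto simp: edges_def)
      ultimately show "(\<Prod>e\<in>\<Gamma>. bw N (card e)) = bw N p * bw N q ^ 2" using * by simp
    qed
    also have "\<dots> = real (card (closed_mixed N p q)) * (c p * c q ^ 2 / (s ^ (2 * (p - 1)) * s ^ (2 * (q - 1) * 2)))"
    proof -
      have "bw N p = c p / s ^ (2 * (p - 1))" unfolding bw_def s(2) by (simp only: power_mult)
      moreover have "bw N q ^ 2 = c q ^ 2 / s ^ (2 * (q - 1) * 2)" unfolding bw_def s(2) power_divide by (simp only: power_mult)
      ultimately show ?thesis by simp
    qed
    also have "s ^ ((p - 2) + 2 * (q - 2)) * \<dots> = c p * c q ^ 2 * real (card (closed_mixed N p q)) * (s ^ ((p - 2) + 2 * (q - 2)) / (s ^ (2 * (p - 1)) * s ^ (2 * (q - 1) * 2)))"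
      by simp
    also have "s ^ (2 * (p - 1)) * s ^ (2 * (q - 1) * 2) = s ^ ((p - 2) + 2 * (q - 2)) * s ^ (p + 2 * q)"
      unfolding power_add[symmetric] using p by (intro arg_cong[where f="\<lambda>k. s ^ k"]) simp
    finally show ?case using s(1) by (simp add: s_def)
  qed
  ultimately show ?thesis by (rule Lim_transform_eventually)
qed

end

section \<open>The temperature condition\<close>

lemma rate_I_nonneg:
  assumes "0 < x" "x < 1"
  shows "0 \<le> rate_I x"
proof -
  have *: "y - 1 \<le> y * ln y" if "0 < y" for y :: real
  proof -
    have "ln (1 / y) \<le> 1 / y - 1" using that by (intro ln_le_minus_one) simp
    then have "1 - 1 / y \<le> ln y" using that by (simp add: ln_div)
    then have "y * (1 - 1 / y) \<le> y * ln y" using that by (intro mult_left_mono) auto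
    then show ?thesis using that by (simp add: algebra_simps)
  qed
  show ?thesis using *[of "1 + x"] *[of "1 - x"] assms by (simp add: rate_I_def)
qed

lemma rate_I_le_ln2:
  assumes "0 < x" "x < 1"
  shows "rate_I x \<le> ln 2"
proof -
  have "(1 + x) * ln (1 + x) \<le> 2 * ln 2" using assms by (intro mult_mono) auto
  moreover have "(1 - x) * ln (1 - x) \<le> 0" using assms by (intro mult_nonneg_nonpos) auto
  ultimately show ?thesis by (simp add: rate_I_def)
qed

text \<open>The definition of the critical inverse temperature by an infimum gives
\<open>b^2 * xi x \<le> rate_I x\<close> for every positive \<open>b\<close> below it. Any \<open>b\<close>
strictly between \<open>\<beta>\<close> and the critical value leaves the factor
\<open>\<rho> = (b / \<beta>)^2\<close>. At 1 the partial sums are continuous from the left, while the rate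
function stays below its value \<open>ln 2\<close>.\<close>

lemma beta_gap:
  assumes sum: "(\<lambda>p. (\<theta> p)\<^sup>2 / fact (p - 2)) summable_on {2..}"
    and \<beta>: "0 < \<beta>" "\<beta> < beta_f (xi \<theta>)"
  shows "\<exists>\<rho>>1. \<forall>N x. 0 \<le> x \<longrightarrow> x \<le> 1 \<longrightarrow> \<rho> * (\<Sum>p\<in>{3..N}. \<beta>\<^sup>2 * (\<theta> p)\<^sup>2 * x ^ p / fact p) \<le> rate_I x"
proof -
  obtain b where b: "\<beta> < b" "b < beta_f (xi \<theta>)" using dense[OF \<beta>(2)] by auto
  have b0: "0 < b" using b \<beta> by simp
  have bdd: "bdd_below ((\<lambda>x. sqrt (rate_I x / xi \<theta> x)) ` {0<..<1})"
  proof (rule bdd_belowI2[where m=0])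
    fix x :: real assume x: "x \<in> {0<..<1}"
    have "0 \<le> xi \<theta> x" unfolding xi_def using x by (intro infsum_nonneg) auto
    then show "0 \<le> sqrt (rate_I x / xi \<theta> x)" using rate_I_nonneg[of x] x by simp
  qed
  have finite_le: "(\<Sum>p\<in>{3..N}. (\<theta> p)\<^sup>2 * x ^ p / fact p) \<le> xi \<theta> x" if x: "0 < x" "x < 1" for N x
    unfolding xi_def
  proof (rule finite_sum_le_infsum)
    show "(\<lambda>p. (\<theta> p)\<^sup>2 * x ^ p / fact p) summable_on {2..}"
    proof (rule summable_on_comparison_test[OF sum])
      fix p :: nat
      have "(\<theta> p)\<^sup>2 * x ^ p \<le> (\<theta> p)\<^sup>2" using x by (intro mult_left_le power_le_one) auto
      moreover have "(fact (p - 2) :: real) \<le> fact p" by (rule fact_mono) simp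
      ultimately show "(\<theta> p)\<^sup>2 * x ^ p / fact p \<le> (\<theta> p)\<^sup>2 / fact (p - 2)"
        by (intro frac_le) auto
    qed (use x in auto)
  qed (use x in auto)
  have inner: "b\<^sup>2 * (\<Sum>p\<in>{3..N}. (\<theta> p)\<^sup>2 * x ^ p / fact p) \<le> rate_I x" if x: "0 < x" "x < 1" for N x
  proof -
    have "b \<le> sqrt (rate_I x / xi \<theta> x)"
      using b cINF_lower[OF bdd, of x] x unfolding beta_f_def by force
    then have "b\<^sup>2 \<le> (sqrt (rate_I x / xi \<theta> x))\<^sup>2" using b0 by (intro power_mono) auto
    also have "\<dots> = rate_I x / xi \<theta> x"
    proof -
      have "0 \<le> xi \<theta> x" unfolding xi_def using x by (intro infsum_nonneg) auto
      then show ?thesis using rate_I_nonneg[OF x] by simp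
    qed
    finally have le: "b\<^sup>2 \<le> rate_I x / xi \<theta> x" .
    have "0 < xi \<theta> x"
    proof (rule ccontr)
      assume "\<not> 0 < xi \<theta> x"
      then have "rate_I x / xi \<theta> x \<le> 0" using rate_I_nonneg[OF x] by (intro divide_nonneg_nonpos) auto
      then show False using le b0 by (smt (verit) zero_less_power)
    qed
    then have "b\<^sup>2 * xi \<theta> x \<le> rate_I x" using le by (simp add: le_divide_eq)
    moreover have "b\<^sup>2 * (\<Sum>p\<in>{3..N}. (\<theta> p)\<^sup>2 * x ^ p / fact p) \<le> b\<^sup>2 * xi \<theta> x"
      using finite_le[OF x] by (rule mult_left_mono) simp
    ultimately show ?thesis by linarith
  qed
  have all: "b\<^sup>2 * (\<Sum>p\<in>{3..N}. (\<theta> p)\<^sup>2 * x ^ p / fact p) \<le> rate_I x" if x: "0 \<le> x" "x \<le> 1" for N x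
  proof -
    consider "x = 0" | "0 < x" "x < 1" | "x = 1" using x by linarith
    then show ?thesis
    proof cases
      case 1
      have "(\<Sum>p\<in>{3..N}. (\<theta> p)\<^sup>2 * x ^ p / fact p) = 0" using 1 by (intro sum.neutral) auto
      then show ?thesis using 1 by (simp add: rate_I_def)
    next
      case 2 then show ?thesis by (rule inner)
    next
      case 3
      let ?P = "\<lambda>x. b\<^sup>2 * (\<Sum>p\<in>{3..N}. (\<theta> p)\<^sup>2 * x ^ p / fact p)"
      have "(?P \<longlongrightarrow> ?P 1) (at_left 1)" by (intro tendsto_intros) auto
      moreover have "\<forall>\<^sub>F x in at_left 1. ?P x \<le> ln 2"
      proof -
        have "\<forall>\<^sub>F x in at_left 1. x \<in> {0<..<1::real}" by (rule eventually_at_left_real) simp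
        then show ?thesis
        proof eventually_elim
          case (elim x)
          then show ?case using inner[of x N] rate_I_le_ln2[of x] by auto
        qed
      qed
      ultimately have "?P 1 \<le> ln 2" by (rule tendsto_upperbound) simp
      then show ?thesis using 3 by (simp add: rate_I_def)
    qed
  qed
  define \<rho> where "\<rho> = b\<^sup>2 / \<beta>\<^sup>2"
  have "\<beta>\<^sup>2 < b\<^sup>2" using b \<beta> by (intro power_strict_mono) auto
  then have "1 < \<rho>" using \<beta> by (simp add: \<rho>_def)
  moreover have "\<rho> * (\<Sum>p\<in>{3..N}. \<beta>\<^sup>2 * (\<theta> p)\<^sup>2 * x ^ p / fact p) = b\<^sup>2 * (\<Sum>p\<in>{3..N}. (\<theta> p)\<^sup>2 * x ^ p / fact p)" for N x
    unfolding sum_distrib_left using \<beta> by (intro sum.cong refl) (simp add: \<rho>_def)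
  ultimately show ?thesis using all by auto
qed

section \<open>Expansion of the partition function\<close>

definition edge_list :: "nat set \<Rightarrow> nat list" where
  "edge_list e = sorted_list_of_set e"

lemma edge_list_bij: "bij_betw edge_list (edges N p) (hyperedges N p)"
proof (rule bij_betw_byWitness[where f'=set])
  show "\<forall>e\<in>edges N p. set (edge_list e) = e"
    by (auto simp: edges_def edge_list_def dest: finite_subset)
  show "\<forall>l\<in>hyperedges N p. edge_list (set l) = l"
    by (auto simp: hyperedges_def edge_list_def intro!: sorted_list_of_set.idem_if_sorted_distinct simp: strict_sorted_iff)
  show "edge_list ` edges N p \<subseteq> hyperedges N p"
  proof
    fix l assume "l \<in> edge_list ` edges N p"
    then obtain e where e: "e \<subseteq> {1..N}" "card e = p" "l = edge_list e" by (auto simp: edges_def)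
    then have "finite e" using finite_subset by blast
    then show "l \<in> hyperedges N p" using e by (simp add: hyperedges_def edge_list_def)
  qed
  show "set ` hyperedges N p \<subseteq> edges N p"
    by (auto simp: hyperedges_def edges_def strict_sorted_iff distinct_card)
qed

lemma edge_list_disorder: "e \<in> all_edges N \<Longrightarrow> edge_list e \<in> disorder_index"
proof -
  assume e: "e \<in> all_edges N"
  then have "e \<in> edges N (card e)" by (simp add: all_edges_def edges_def)
  then have "edge_list e \<in> hyperedges N (card e)" using edge_list_bij bij_betwE by blast
  then show ?thesis using e unfolding disorder_index_def by (auto simp: all_edges_def)
qed

lemma edge_list_inj: "inj_on edge_list (all_edges N)"
proof (rule inj_onI)
  fix e f assume "e \<in> all_edges N" "f \<in> all_edges N" and eq: "edge_list e = edge_list f"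
  then have "finite e" "finite f" by (auto intro: finite_edge)
  have "e = set (edge_list e)" using \<open>finite e\<close> by (simp add: edge_list_def)
  also have "\<dots> = set (edge_list f)" by (rule arg_cong[OF eq])
  also have "\<dots> = f" using \<open>finite f\<close> by (simp add: edge_list_def)
  finally show "e = f" .
qed

definition spins :: "nat set \<Rightarrow> nat \<Rightarrow> real" where
  "spins B i = chi {i} B"

text \<open>Configurations of signs correspond to their sets of minus spins.\<close>

lemma uniform_spins_avg: "measure_pmf.expectation (uniform_spins N) f = avg N (\<lambda>B. f (spins B))"
proof -
  let ?S = "PiE_dflt {1..N} (1::real) (\<lambda>_. {-1, 1})"
  have us: "uniform_spins N = pmf_of_set ?S"
    unfolding uniform_spins_def by (rule Pi_pmf_of_set) auto
  have bij: "bij_betw spins (Pow {1..N}) ?S"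
  proof (rule bij_betw_byWitness[where f'="\<lambda>\<sigma>. {i. \<sigma> i = -1}"])
    show "\<forall>B\<in>Pow {1..N}. {i. spins B i = -1} = B" by (auto simp: spins_def chi_single split: if_splits)
    show "\<forall>\<sigma>\<in>?S. spins {i. \<sigma> i = -1} = \<sigma>" by (auto simp: spins_def chi_single PiE_dflt_def fun_eq_iff)
    show "spins ` Pow {1..N} \<subseteq> ?S" by (auto simp: spins_def chi_single PiE_dflt_def split: if_splits)
    have "i \<in> {1..N}" if "\<sigma> \<in> ?S" "\<sigma> i = -1" for \<sigma> i
    proof (rule ccontr)
      assume "i \<notin> {1..N}"
      then have "\<sigma> i = 1" using that(1) unfolding PiE_dflt_def by blast
      then show False using that(2) by simp
    qed
    then show "(\<lambda>\<sigma>. {i. \<sigma> i = -1}) ` ?S \<subseteq> Pow {1..N}" by blast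
  qed
  have fin: "finite ?S" using bij_betw_finite[OF bij] by simp
  have "card ?S = 2 ^ N" using bij_betw_same_card[OF bij] by (simp add: card_Pow)
  moreover have "?S \<noteq> {}" using \<open>card ?S = 2 ^ N\<close> by auto
  ultimately have "measure_pmf.expectation (uniform_spins N) f = sum f ?S / 2 ^ N"
    unfolding us using fin by (simp add: integral_pmf_of_set)
  also have "sum f ?S = (\<Sum>B\<in>Pow {1..N}. f (spins B))"
    by (rule sum.reindex_bij_betw[OF bij, symmetric])
  finally show ?thesis by (simp add: avg_def)
qed

lemma spin_product_edge: "finite e \<Longrightarrow> spin_product (spins B) (edge_list e) = chi e B"
proof -
  assume e: "finite e"
  have "spin_product (spins B) (edge_list e) = prod_list (map (spins B) (edge_list e))"
    unfolding spin_product_def prod.list_conv_set_nth atLeast0LessThan by simp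
  also have "\<dots> = (\<Prod>i\<in>set (edge_list e). spins B i)"
    by (rule prod.distinct_set_conv_list[symmetric]) (simp add: edge_list_def)
  also have "\<dots> = chi e B" using e by (simp add: edge_list_def spins_def chi_prod[OF e])
  finally show ?thesis .
qed

definition edge_var :: "(nat \<Rightarrow> real) \<Rightarrow> real \<Rightarrow> (nat list \<Rightarrow> real) \<Rightarrow> nat \<Rightarrow> nat set \<Rightarrow> real" where
  "edge_var \<theta> \<beta> J N e = tanh (\<beta> * \<theta> (card e) * J (edge_list e) / real N powr ((real (card e) - 1) / 2))"

lemma Z_hat_avg: "Z_hat \<theta> \<beta> J N = avg N (\<lambda>B. \<Prod>e\<in>all_edges N. 1 + edge_var \<theta> \<beta> J N e * chi e B)"
proof -
  have "Z_hat \<theta> \<beta> J N = avg N (\<lambda>B. \<Prod>p\<in>{3..N}. \<Prod>is\<in>hyperedges N p.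
      1 + spin_product (spins B) is * tanh (\<beta> * \<theta> p * J is / real N powr ((real p - 1) / 2)))"
    unfolding Z_hat_def by (rule uniform_spins_avg)
  also have "\<dots> = avg N (\<lambda>B. \<Prod>p\<in>{3..N}. \<Prod>e\<in>edges N p. 1 + edge_var \<theta> \<beta> J N e * chi e B)"
  proof (intro avg_cong prod.cong refl)
    fix B p
    have "(\<Prod>is\<in>hyperedges N p. 1 + spin_product (spins B) is * tanh (\<beta> * \<theta> p * J is / real N powr ((real p - 1) / 2)))
      = (\<Prod>e\<in>edges N p. 1 + spin_product (spins B) (edge_list e) * tanh (\<beta> * \<theta> p * J (edge_list e) / real N powr ((real p - 1) / 2)))"
      by (rule prod.reindex_bij_betw[OF edge_list_bij, symmetric])
    also have "\<dots> = (\<Prod>e\<in>edges N p. 1 + edge_var \<theta> \<beta> J N e * chi e B)"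
    proof (intro prod.cong refl)
      fix e assume "e \<in> edges N p"
      then have "card e = p" "finite e" using finite_subset[of e "{1..N}"] by (auto simp: edges_def)
      then show "1 + spin_product (spins B) (edge_list e) * tanh (\<beta> * \<theta> p * J (edge_list e) / real N powr ((real p - 1) / 2))
        = 1 + edge_var \<theta> \<beta> J N e * chi e B"
        by (simp add: spin_product_edge edge_var_def mult.commute)
    qed
    finally show "(\<Prod>is\<in>hyperedges N p. 1 + spin_product (spins B) is * tanh (\<beta> * \<theta> p * J is / real N powr ((real p - 1) / 2)))
      = (\<Prod>e\<in>edges N p. 1 + edge_var \<theta> \<beta> J N e * chi e B)" .
  qed
  also have "\<dots> = avg N (\<lambda>B. \<Prod>e\<in>all_edges N. 1 + edge_var \<theta> \<beta> J N e * chi e B)"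
  proof (intro avg_cong)
    fix B
    have "all_edges N = (\<Union>p\<in>{3..N}. edges N p)"
    proof (intro equalityI subsetI)
      fix e assume e: "e \<in> all_edges N"
      then have "card e \<le> N" using card_mono[of "{1..N}" e] by (simp add: all_edges_def)
      with e show "e \<in> (\<Union>p\<in>{3..N}. edges N p)" by (auto simp: all_edges_def edges_def)
    qed (auto simp: all_edges_def edges_def)
    then show "(\<Prod>p\<in>{3..N}. \<Prod>e\<in>edges N p. 1 + edge_var \<theta> \<beta> J N e * chi e B) = (\<Prod>e\<in>all_edges N. 1 + edge_var \<theta> \<beta> J N e * chi e B)"
      by (simp only:) (subst prod.UNION_disjoint; auto simp: edges_def)
  qed
  finally show ?thesis .
qed

text \<open>Multiply out the product over edges; the spin average keeps the closed hypergraphs.\<close>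

lemma Z_hat_expansion:
  "Z_hat \<theta> \<beta> J N = (\<Sum>\<Gamma> | \<Gamma> \<subseteq> all_edges N \<and> bd \<Gamma> = {}. \<Prod>e\<in>\<Gamma>. edge_var \<theta> \<beta> J N e)"
proof -
  let ?u = "\<lambda>e. edge_var \<theta> \<beta> J N e"
  have "Z_hat \<theta> \<beta> J N = avg N (\<lambda>B. \<Sum>\<Gamma>\<in>Pow (all_edges N). \<Prod>e\<in>\<Gamma>. ?u e * chi e B)"
    unfolding Z_hat_avg
  proof (intro avg_cong)
    fix B
    have "(\<Prod>e\<in>all_edges N. ?u e * chi e B + 1) = (\<Sum>\<Gamma>\<in>Pow (all_edges N). (\<Prod>e\<in>\<Gamma>. ?u e * chi e B) * (\<Prod>e\<in>all_edges N - \<Gamma>. 1))"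
      by (rule prod_add) simp
    then show "(\<Prod>e\<in>all_edges N. 1 + ?u e * chi e B) = (\<Sum>\<Gamma>\<in>Pow (all_edges N). \<Prod>e\<in>\<Gamma>. ?u e * chi e B)"
      by (simp add: add.commute)
  qed
  also have "\<dots> = (\<Sum>\<Gamma>\<in>Pow (all_edges N). if bd \<Gamma> = {} then \<Prod>e\<in>\<Gamma>. ?u e else 0)"
    unfolding avg_sum using all_edges_subset by (intro sum.cong refl avg_prod_chi) blast
  also have "\<dots> = (\<Sum>\<Gamma>\<in>{\<Gamma> \<in> Pow (all_edges N). bd \<Gamma> = {}}. \<Prod>e\<in>\<Gamma>. ?u e)"
    by (rule sum.inter_filter[symmetric]) simp
  finally show ?thesis by simp
qed

text \<open>Each factor is positive as \<open>tanh\<close> takes values in the open interval from -1 to 1.\<close>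

lemma Z_hat_pos: "0 < Z_hat \<theta> \<beta> J N"
proof -
  have pos: "0 < (\<Prod>e\<in>all_edges N. 1 + edge_var \<theta> \<beta> J N e * chi e B)" for B
  proof (rule prod_pos)
    fix e
    have "\<bar>edge_var \<theta> \<beta> J N e * chi e B\<bar> < 1"
      unfolding edge_var_def abs_mult abs_chi using tanh_real_lt_1 tanh_real_gt_neg1 by (simp add: abs_less_iff)
    then show "0 < 1 + edge_var \<theta> \<beta> J N e * chi e B" by linarith
  qed
  show ?thesis
    unfolding Z_hat_avg avg_def using pos by (intro divide_pos_pos sum_pos) auto
qed

section \<open>The edge variables of the spin model\<close>

lemma (in prob_space) indep_vars_inj:
  assumes "indep_vars (\<lambda>_. L) X (f ` I)" "inj_on f I"
  shows "indep_vars (\<lambda>_. L) (\<lambda>i. X (f i)) I"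
proof -
  have "indep_vars (\<lambda>j. Pi\<^sub>M {f j} (\<lambda>_. L)) (\<lambda>j \<omega>. \<lambda>i\<in>{f j}. X i \<omega>) I"
    using assms by (intro indep_vars_restrict[where M'="\<lambda>_. L" and I="f ` I"]) (auto simp: disjoint_family_on_def inj_on_def)
  then have "indep_vars (\<lambda>_. L) (\<lambda>j \<omega>. (\<lambda>i\<in>{f j}. X i \<omega>) (f j)) I"
    by (rule indep_vars_compose2) (auto intro: measurable_component_singleton)
  then show ?thesis by simp
qed

lemma sum_Un_le:
  fixes f :: "'b \<Rightarrow> real"
  assumes "finite A" "finite B" "\<And>y. 0 \<le> f y"
  shows "sum f (A \<union> B) \<le> sum f A + sum f B"
proof -
  have "sum f (A \<union> B) + sum f (A \<inter> B) = sum f A + sum f B" using assms by (intro sum.union_inter)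
  moreover have "0 \<le> sum f (A \<inter> B)" using assms by (intro sum_nonneg) auto
  ultimately show ?thesis by linarith
qed

locale spin_model = prob_space M for M :: "'a measure" +
  fixes J :: "nat list \<Rightarrow> 'a \<Rightarrow> real" and \<theta> :: "nat \<Rightarrow> real" and \<beta> :: real
  assumes J_indep: "indep_vars (\<lambda>_. borel) J disorder_index"
    and J_ident: "\<And>i i'. i \<in> disorder_index \<Longrightarrow> i' \<in> disorder_index \<Longrightarrow> distr M borel (J i) = distr M borel (J i')"
    and J_symm: "\<And>i. i \<in> disorder_index \<Longrightarrow> distr M borel (\<lambda>\<omega>. - J i \<omega>) = distr M borel (J i)"
    and J_mean: "\<And>i. i \<in> disorder_index \<Longrightarrow> expectation (J i) = 0"
    and J_var: "\<And>i. i \<in> disorder_index \<Longrightarrow> variance (J i) = 1"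
    and J_fourth: "\<And>i. i \<in> disorder_index \<Longrightarrow> integrable M (\<lambda>\<omega>. J i \<omega> ^ 4)"
    and theta_summable: "(\<lambda>p. (\<theta> p)\<^sup>2 / fact (p - 2)) summable_on {2..}"
    and beta: "0 < \<beta>" "\<beta> < beta_f (xi \<theta>)"

sublocale spin_model \<subseteq> couplings "\<lambda>p. \<beta>\<^sup>2 * (\<theta> p)\<^sup>2" "\<beta>\<^sup>2 * (\<Sum>\<^sub>\<infinity>p\<in>{2..}. (\<theta> p)\<^sup>2 / fact (p - 2))"
proof
  show "0 \<le> \<beta>\<^sup>2 * (\<theta> p)\<^sup>2" for p by simp
  fix N
  have "(\<Sum>p\<in>{2..N}. (\<theta> p)\<^sup>2 / fact (p - 2)) \<le> (\<Sum>\<^sub>\<infinity>p\<in>{2..}. (\<theta> p)\<^sup>2 / fact (p - 2))"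
    by (rule finite_sum_le_infsum[OF theta_summable]) auto
  then have "\<beta>\<^sup>2 * (\<Sum>p\<in>{2..N}. (\<theta> p)\<^sup>2 / fact (p - 2)) \<le> \<beta>\<^sup>2 * (\<Sum>\<^sub>\<infinity>p\<in>{2..}. (\<theta> p)\<^sup>2 / fact (p - 2))"
    by (rule mult_left_mono) simp
  then show "(\<Sum>p\<in>{2..N}. \<beta>\<^sup>2 * (\<theta> p)\<^sup>2 / fact (p - 2)) \<le> \<beta>\<^sup>2 * (\<Sum>\<^sub>\<infinity>p\<in>{2..}. (\<theta> p)\<^sup>2 / fact (p - 2))"
    by (simp add: sum_distrib_left)
qed

context spin_model begin

definition x :: "nat \<Rightarrow> nat set \<Rightarrow> 'a \<Rightarrow> real" where
  "x N e \<omega> = edge_var \<theta> \<beta> (\<lambda>i. J i \<omega>) N e"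

text \<open>The deterministic factor of the coupling in the argument of \<open>tanh\<close>.\<close>

definition k :: "nat \<Rightarrow> nat \<Rightarrow> real" where
  "k N p = \<beta> * \<theta> p / real N powr ((real p - 1) / 2)"

text \<open>Any fixed index serves as a representative of the common law of the couplings.\<close>

definition i0 :: "nat list" where "i0 = edge_list {1, 2, 3}"

definition \<alpha> :: "nat \<Rightarrow> nat \<Rightarrow> real" where
  "\<alpha> N p = expectation (\<lambda>\<omega>. (tanh (k N p * J i0 \<omega>))\<^sup>2)"

definition m4 :: real where "m4 = expectation (\<lambda>\<omega>. J i0 \<omega> ^ 4)"

lemma i0: "i0 \<in> disorder_index"
  unfolding i0_def by (rule edge_list_disorder[of _ 3]) (simp add: all_edges_def)

lemma x_eq: "x N e \<omega> = tanh (k N (card e) * J (edge_list e) \<omega>)"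
  by (simp add: x_def edge_var_def k_def)

lemma J_meas: "i \<in> disorder_index \<Longrightarrow> J i \<in> borel_measurable M"
  using J_indep by (auto simp: indep_vars_def)

lemma J_transfer:
  assumes "i \<in> disorder_index" "f \<in> borel_measurable borel"
  shows "expectation (\<lambda>\<omega>. f (J i \<omega>)) = expectation (\<lambda>\<omega>. f (J i0 \<omega>) :: real)"
proof -
  have "expectation (\<lambda>\<omega>. f (J i \<omega>)) = integral\<^sup>L (distr M borel (J i)) f"
    using assms J_meas by (intro integral_distr[symmetric]) auto
  also have "\<dots> = integral\<^sup>L (distr M borel (J i0)) f" using J_ident[OF assms(1) i0] by simp
  also have "\<dots> = expectation (\<lambda>\<omega>. f (J i0 \<omega>))"
    using assms J_meas i0 by (intro integral_distr) auto
  finally show ?thesis .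
qed

lemma J_odd:
  assumes "i \<in> disorder_index" "f \<in> borel_measurable borel" "\<And>y. f (- y) = - f y"
  shows "expectation (\<lambda>\<omega>. f (J i \<omega>) :: real) = 0"
proof -
  have "expectation (\<lambda>\<omega>. f (J i \<omega>)) = integral\<^sup>L (distr M borel (J i)) f"
    using assms J_meas by (intro integral_distr[symmetric]) auto
  also have "\<dots> = integral\<^sup>L (distr M borel (\<lambda>\<omega>. - J i \<omega>)) f" using J_symm[OF assms(1)] by simp
  also have "\<dots> = expectation (\<lambda>\<omega>. f (- J i \<omega>))"
    using assms J_meas by (intro integral_distr) auto
  also have "\<dots> = - expectation (\<lambda>\<omega>. f (J i \<omega>))" by (simp add: assms(3))
  finally show ?thesis by simp
qed

lemma J_sq: "i \<in> disorder_index \<Longrightarrow> integrable M (\<lambda>\<omega>. (J i \<omega>)\<^sup>2)" "i \<in> disorder_index \<Longrightarrow> expectation (\<lambda>\<omega>. (J i \<omega>)\<^sup>2) = 1"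
proof -
  assume i: "i \<in> disorder_index"
  show "integrable M (\<lambda>\<omega>. (J i \<omega>)\<^sup>2)"
  proof (rule Bochner_Integration.integrable_bound)
    show "integrable M (\<lambda>\<omega>. 1 + J i \<omega> ^ 4)" using J_fourth[OF i] by simp
    show "(\<lambda>\<omega>. (J i \<omega>)\<^sup>2) \<in> borel_measurable M" using J_meas[OF i] by simp
    have "(y::real)\<^sup>2 \<le> 1 + y ^ 4" for y
    proof -
      have "0 \<le> (y\<^sup>2 - 1)\<^sup>2 + y\<^sup>2" by simp
      moreover have "(y\<^sup>2 - 1)\<^sup>2 = y ^ 4 - 2 * y\<^sup>2 + 1" by (simp add: power2_diff power_mult[symmetric])
      ultimately show ?thesis by linarith
    qed
    then show "AE \<omega> in M. norm ((J i \<omega>)\<^sup>2) \<le> norm (1 + J i \<omega> ^ 4)" by auto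
  qed
  show "expectation (\<lambda>\<omega>. (J i \<omega>)\<^sup>2) = 1" using J_var[OF i] J_mean[OF i] by simp
qed

lemma tanh_abs_le: "\<bar>tanh y\<bar> \<le> \<bar>y\<bar>" for y :: real
proof -
  have pos: "tanh y \<le> y" if "0 \<le> y" for y :: real
  proof -
    have "(\<lambda>y. y - tanh y) 0 \<le> (\<lambda>y. y - tanh y) y"
    proof (rule DERIV_nonneg_imp_nondecreasing[OF that])
      fix z :: real
      have "((\<lambda>y. y - tanh y) has_real_derivative 1 - (1 - tanh z ^ 2)) (at z)"
        by (auto intro!: derivative_eq_intros)
      moreover have "0 \<le> 1 - (1 - tanh z ^ 2)" by simp
      ultimately show "\<exists>d. ((\<lambda>y. y - tanh y) has_real_derivative d) (at z) \<and> 0 \<le> d" by blast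
    qed
    then show ?thesis by simp
  qed
  show ?thesis
  proof (cases "0 \<le> y")
    case True
    then show ?thesis using pos[of y] by simp
  next
    case False
    then show ?thesis using pos[of "- y"] by (simp add: abs_if)
  qed
qed

lemma k_sq: "1 \<le> N \<Longrightarrow> 1 \<le> p \<Longrightarrow> (k N p)\<^sup>2 = bw N p"
proof -
  assume N: "1 \<le> N" and p: "1 \<le> p"
  have "(real N powr ((real p - 1) / 2))\<^sup>2 = real N powr (real p - 1)"
    by (simp add: power2_eq_square powr_add[symmetric])
  also have "\<dots> = real N ^ (p - 1)" using N p by (simp add: powr_realpow[symmetric] of_nat_diff)
  finally show ?thesis by (simp add: k_def bw_def power_divide power_mult_distrib)
qed

lemma integrable_tanh: "i \<in> disorder_index \<Longrightarrow> integrable M (\<lambda>\<omega>. tanh (y * J i \<omega>) ^ n)"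
proof (rule integrable_bounded[where B=1])
  assume i: "i \<in> disorder_index"
  have "(\<lambda>z::real. tanh (y * z) ^ n) \<in> borel_measurable borel"
    by (intro borel_measurable_continuous_onI continuous_intros) auto
  then show "(\<lambda>\<omega>. tanh (y * J i \<omega>) ^ n) \<in> borel_measurable M" using J_meas[OF i] by simp
  fix \<omega>
  have "\<bar>tanh (y * J i \<omega>)\<bar> \<le> 1" using tanh_real_lt_1[of "y * J i \<omega>"] tanh_real_gt_neg1[of "y * J i \<omega>"] by linarith
  then show "norm (tanh (y * J i \<omega>) ^ n) \<le> 1" unfolding real_norm_def power_abs by (intro power_le_one) auto
qed

lemma tanh_meas: "(\<lambda>z::real. tanh (y * z) ^ n) \<in> borel_measurable borel"
  by (intro borel_measurable_continuous_onI continuous_intros) auto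

lemma \<alpha>_bounds: "1 \<le> N \<Longrightarrow> 1 \<le> p \<Longrightarrow> \<alpha> N p \<le> bw N p" "0 \<le> \<alpha> N p"
proof -
  assume N: "1 \<le> N" and p: "1 \<le> p"
  have "\<alpha> N p \<le> expectation (\<lambda>\<omega>. (k N p)\<^sup>2 * (J i0 \<omega>)\<^sup>2)"
    unfolding \<alpha>_def
  proof (rule integral_mono)
    show "integrable M (\<lambda>\<omega>. (tanh (k N p * J i0 \<omega>))\<^sup>2)" by (rule integrable_tanh[OF i0])
    show "integrable M (\<lambda>\<omega>. (k N p)\<^sup>2 * (J i0 \<omega>)\<^sup>2)" using J_sq(1)[OF i0] by simp
    fix \<omega>
    have "\<bar>tanh (k N p * J i0 \<omega>)\<bar>\<^sup>2 \<le> \<bar>k N p * J i0 \<omega>\<bar>\<^sup>2" by (intro power_mono tanh_abs_le) simp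
    then show "(tanh (k N p * J i0 \<omega>))\<^sup>2 \<le> (k N p)\<^sup>2 * (J i0 \<omega>)\<^sup>2" by (simp add: power_mult_distrib)
  qed
  also have "\<dots> = bw N p" using J_sq[OF i0] k_sq[OF N p] by simp
  finally show "\<alpha> N p \<le> bw N p" .
next
  show "0 \<le> \<alpha> N p" by (simp add: \<alpha>_def)
qed

lemma edge_fourth: "1 \<le> N \<Longrightarrow> 1 \<le> p \<Longrightarrow> expectation (\<lambda>\<omega>. tanh (k N p * J i0 \<omega>) ^ 4) \<le> (bw N p)\<^sup>2 * m4"
proof -
  assume N: "1 \<le> N" and p: "1 \<le> p"
  have "expectation (\<lambda>\<omega>. tanh (k N p * J i0 \<omega>) ^ 4) \<le> expectation (\<lambda>\<omega>. (k N p) ^ 4 * J i0 \<omega> ^ 4)"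
  proof (rule integral_mono)
    show "integrable M (\<lambda>\<omega>. tanh (k N p * J i0 \<omega>) ^ 4)" by (rule integrable_tanh[OF i0])
    show "integrable M (\<lambda>\<omega>. (k N p) ^ 4 * J i0 \<omega> ^ 4)" using J_fourth[OF i0] by simp
    fix \<omega>
    have "\<bar>tanh (k N p * J i0 \<omega>)\<bar> ^ 4 \<le> \<bar>k N p * J i0 \<omega>\<bar> ^ 4" by (intro power_mono tanh_abs_le) simp
    then show "tanh (k N p * J i0 \<omega>) ^ 4 \<le> (k N p) ^ 4 * J i0 \<omega> ^ 4" by (simp add: power_mult_distrib)
  qed
  also have "\<dots> = ((k N p)\<^sup>2)\<^sup>2 * m4" by (simp add: m4_def power_mult[symmetric])
  finally show ?thesis using k_sq[OF N p] by simp
qed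

lemma m4_nonneg: "0 \<le> m4" by (simp add: m4_def)

lemma k_tendsto: "2 \<le> p \<Longrightarrow> (\<lambda>N. k N p) \<longlonglongrightarrow> 0"
proof -
  assume p: "2 \<le> p"
  have "(\<lambda>N. real N powr (- ((real p - 1) / 2))) \<longlonglongrightarrow> 0"
    using p by (intro tendsto_neg_powr filterlim_real_sequentially) auto
  then have "(\<lambda>N. \<beta> * \<theta> p * real N powr (- ((real p - 1) / 2))) \<longlonglongrightarrow> \<beta> * \<theta> p * 0" by (intro tendsto_intros)
  moreover have "k N p = \<beta> * \<theta> p * real N powr (- ((real p - 1) / 2))" for N
    unfolding k_def by (simp only: powr_minus divide_inverse)
  ultimately show "(\<lambda>N. k N p) \<longlonglongrightarrow> 0" by (simp only: mult_zero_right)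
qed

text \<open>Dominated convergence with the square of the coupling as majorant, since \<open>tanh y / y\<close>
tends to 1 and is bounded by 1.\<close>

lemma \<alpha>_ratio:
  assumes p: "2 \<le> p" "\<theta> p \<noteq> 0"
  shows "(\<lambda>N. \<alpha> N p / bw N p) \<longlonglongrightarrow> 1"
proof -
  have k0: "\<forall>\<^sub>F N in sequentially. k N p \<noteq> 0"
    using eventually_ge_at_top[of 1] by eventually_elim (use p beta in \<open>simp add: k_def\<close>)
  have "(\<lambda>N. expectation (\<lambda>\<omega>. (tanh (k N p * J i0 \<omega>) / k N p)\<^sup>2)) \<longlonglongrightarrow> expectation (\<lambda>\<omega>. (J i0 \<omega>)\<^sup>2)"
  proof (rule integral_dominated_convergence[where w="\<lambda>\<omega>. (J i0 \<omega>)\<^sup>2"])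
    show "(\<lambda>\<omega>. (J i0 \<omega>)\<^sup>2) \<in> borel_measurable M" using J_meas[OF i0] by simp
    show "integrable M (\<lambda>\<omega>. (J i0 \<omega>)\<^sup>2)" by (rule J_sq(1)[OF i0])
    show "(\<lambda>\<omega>. (tanh (k N p * J i0 \<omega>) / k N p)\<^sup>2) \<in> borel_measurable M" for N
      using borel_measurable_integrable[OF integrable_tanh[OF i0, of "k N p" 2]] by (simp add: power_divide)
    show "AE \<omega> in M. (\<lambda>N. (tanh (k N p * J i0 \<omega>) / k N p)\<^sup>2) \<longlonglongrightarrow> (J i0 \<omega>)\<^sup>2"
    proof (rule AE_I2)
      fix \<omega>
      define z where "z = J i0 \<omega>"
      have "((\<lambda>h. tanh (h * z)) has_real_derivative (1 - tanh (0 * z) ^ 2) * z) (at 0)"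
        by (auto intro!: derivative_eq_intros)
      then have "(\<lambda>h. (tanh ((0 + h) * z) - tanh (0 * z)) / h) \<midarrow>0\<rightarrow> (1 - tanh (0 * z) ^ 2) * z"
        unfolding DERIV_def .
      then have "(\<lambda>h. tanh (h * z) / h) \<midarrow>0\<rightarrow> z" by simp
      moreover have "filterlim (\<lambda>N. k N p) (at 0) sequentially"
        using k_tendsto[OF p(1)] k0 by (simp add: filterlim_at)
      ultimately have "(\<lambda>N. tanh (k N p * z) / k N p) \<longlonglongrightarrow> z" by (rule filterlim_compose)
      then show "(\<lambda>N. (tanh (k N p * J i0 \<omega>) / k N p)\<^sup>2) \<longlonglongrightarrow> (J i0 \<omega>)\<^sup>2"
        unfolding z_def by (rule tendsto_power)
    qed
    show "AE \<omega> in M. norm ((tanh (k N p * J i0 \<omega>) / k N p)\<^sup>2) \<le> (J i0 \<omega>)\<^sup>2" for N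
    proof (rule AE_I2)
      fix \<omega>
      have "\<bar>tanh (k N p * J i0 \<omega>) / k N p\<bar> \<le> \<bar>J i0 \<omega>\<bar>"
      proof (cases "k N p = 0")
        case False
        then show ?thesis using tanh_abs_le[of "k N p * J i0 \<omega>"] by (simp add: abs_mult divide_le_eq mult.commute)
      qed simp
      then have "\<bar>tanh (k N p * J i0 \<omega>) / k N p\<bar>\<^sup>2 \<le> \<bar>J i0 \<omega>\<bar>\<^sup>2" by (intro power_mono) auto
      then show "norm ((tanh (k N p * J i0 \<omega>) / k N p)\<^sup>2) \<le> (J i0 \<omega>)\<^sup>2"
        unfolding power2_abs real_norm_def by (simp only: abs_of_nonneg zero_le_power2)
    qed
  qed
  then have lim: "(\<lambda>N. expectation (\<lambda>\<omega>. (tanh (k N p * J i0 \<omega>) / k N p)\<^sup>2)) \<longlonglongrightarrow> 1"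
    by (simp only: J_sq(2)[OF i0])
  have "\<forall>\<^sub>F N in sequentially. expectation (\<lambda>\<omega>. (tanh (k N p * J i0 \<omega>) / k N p)\<^sup>2) = \<alpha> N p / bw N p"
    using eventually_ge_at_top[of 1]
  proof eventually_elim
    case (elim N)
    then show ?case using k_sq[OF elim, of p] p by (simp add: power_divide \<alpha>_def)
  qed
  with lim show ?thesis by (rule Lim_transform_eventually)
qed

lemma sym_indep_edges:
  assumes "E \<subseteq> all_edges N"
  shows "sym_indep M (x N) E"
proof
  show "finite E" using assms finite_subset[OF _ finite_all_edges] by blast
  have dis: "edge_list e \<in> disorder_index" if "e \<in> E" for e using that assms edge_list_disorder by blast
  have "indep_vars (\<lambda>_. borel) J (edge_list ` E)" by (rule indep_vars_subset[OF J_indep]) (use dis in auto)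
  then have "indep_vars (\<lambda>_. borel) (\<lambda>e. J (edge_list e)) E"
    by (rule indep_vars_inj) (rule inj_on_subset[OF edge_list_inj assms])
  then have "indep_vars (\<lambda>_. borel) (\<lambda>e \<omega>. tanh (k N (card e) * J (edge_list e) \<omega>) ^ 1) E"
    by (rule indep_vars_compose2) (rule tanh_meas)
  then show "indep_vars (\<lambda>_. borel) (x N) E" by (simp add: x_eq[abs_def])
  fix e assume e: "e \<in> E"
  show "\<bar>x N e \<omega>\<bar> \<le> 1" for \<omega>
    unfolding x_eq using tanh_real_lt_1[of "k N (card e) * J (edge_list e) \<omega>"] tanh_real_gt_neg1[of "k N (card e) * J (edge_list e) \<omega>"] by linarith
  show "expectation (x N e) = 0"
    using J_odd[OF dis[OF e], of "\<lambda>z. tanh (k N (card e) * z) ^ 1"] tanh_meas[of "k N (card e)" 1] by (simp add: x_eq[abs_def])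
  show "expectation (\<lambda>\<omega>. x N e \<omega> ^ 3) = 0"
    using J_odd[OF dis[OF e], of "\<lambda>z. tanh (k N (card e) * z) ^ 3"] tanh_meas[of "k N (card e)" 3] by (simp add: x_eq)
qed

lemma x_moments:
  assumes "e \<in> all_edges N"
  shows "expectation (\<lambda>\<omega>. (x N e \<omega>)\<^sup>2) = \<alpha> N (card e)"
    "expectation (\<lambda>\<omega>. x N e \<omega> ^ 4) = expectation (\<lambda>\<omega>. tanh (k N (card e) * J i0 \<omega>) ^ 4)"
  unfolding x_eq \<alpha>_def
  using J_transfer[OF edge_list_disorder[OF assms] tanh_meas[of "k N (card e)" 2]]
    J_transfer[OF edge_list_disorder[OF assms] tanh_meas[of "k N (card e)" 4]] by simp_all

lemma xp_expand: "sym_indep.xp (x N) \<Gamma> \<omega> = (\<Prod>e\<in>\<Gamma>. edge_var \<theta> \<beta> (\<lambda>i. J i \<omega>) N e)"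
proof -
  interpret sym_indep M "x N" "{}" by (rule sym_indep_edges[of "{}" N]) simp
  show ?thesis by (simp add: xp_def x_def)
qed

end

section \<open>The leading order of the partition function\<close>

text \<open>A single edge is its own boundary, and two edges with equal boundaries coincide.\<close>

lemma closed_sets_small: "closed_sets N 1 = {}" "closed_sets N 2 = {}"
proof -
  have ne: "e \<noteq> {}" if "e \<in> all_edges N" for e using that by (auto simp: all_edges_def)
  have False if \<Gamma>: "\<Gamma> \<in> closed_sets N 1" for \<Gamma>
  proof -
    obtain e where e: "\<Gamma> = {e}" using \<Gamma> by (auto simp: closed_sets_def card_1_singleton_iff)
    then obtain i where i: "i \<in> e" using \<Gamma> ne by (auto simp: closed_sets_def)
    then have "{f \<in> \<Gamma>. i \<in> f} = {e}" using e by auto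
    then have "i \<in> bd \<Gamma>" using i e by (auto simp: bd_def)
    then show False using \<Gamma> by (auto simp: closed_sets_def)
  qed
  then show "closed_sets N 1 = {}" by blast
  have False if \<Gamma>: "\<Gamma> \<in> closed_sets N 2" for \<Gamma>
  proof -
    obtain e f where e: "\<Gamma> = {e, f}" "e \<noteq> f" using \<Gamma> by (auto simp: closed_sets_def card_2_iff)
    have "\<exists>i g h. {g, h} = {e, f} \<and> i \<in> g \<and> i \<notin> h" using e by blast
    then obtain i g h where i: "{g, h} = {e, f}" "i \<in> g" "i \<notin> h" by blast
    then have "{f \<in> \<Gamma>. i \<in> f} = {g}" "g \<in> \<Gamma>" using e by auto
    then have "i \<in> bd \<Gamma>" using i by (auto simp: bd_def)
    then show False using \<Gamma> by (auto simp: closed_sets_def)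
  qed
  then show "closed_sets N 2 = {}" by blast
qed

text \<open>The second-order Taylor bound holds near 0; away from 0 the truncation at 2, which is available for
differences of characters, is already dominated by \<open>8 * u^2\<close>.\<close>

lemma ln_remainder:
  fixes u lam :: real
  assumes "- 1 < u" "0 \<le> lam"
  shows "min 2 (lam * \<bar>ln (1 + u) - u\<bar>) \<le> (2 * lam + 8) * u\<^sup>2"
proof (cases "\<bar>u\<bar> \<le> 1 / 2")
  case True
  then have "\<bar>ln (1 + u) - u\<bar> \<le> 2 * u\<^sup>2" by (rule abs_ln_one_plus_x_minus_x_bound)
  then have "lam * \<bar>ln (1 + u) - u\<bar> \<le> lam * (2 * u\<^sup>2)" using assms by (intro mult_left_mono)
  also have "\<dots> \<le> (2 * lam + 8) * u\<^sup>2" by (simp add: algebra_simps)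
  finally show ?thesis by simp
next
  case False
  then have "(1 / 2)\<^sup>2 \<le> \<bar>u\<bar>\<^sup>2" by (intro power_mono) auto
  then have "2 \<le> 8 * u\<^sup>2" by (simp add: power2_eq_square)
  also have "\<dots> \<le> (2 * lam + 8) * u\<^sup>2" using assms by (intro mult_right_mono) auto
  finally show ?thesis by simp
qed

lemma iexp_diff_le: "cmod (iexp a - iexp b) \<le> min 2 \<bar>a - b\<bar>"
proof -
  have "iexp a - iexp b = iexp b * (iexp (a - b) - 1)"
    by (simp add: right_diff_distrib exp_add[symmetric])
  then have "cmod (iexp a - iexp b) = cmod (iexp (a - b) - 1)" by (simp add: norm_mult)
  also have "\<dots> \<le> \<bar>a - b\<bar>" using iexp_approx1[of "a - b" 0] by simp
  finally have "cmod (iexp a - iexp b) \<le> \<bar>a - b\<bar>" .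
  moreover have "cmod (iexp a - iexp b) \<le> 2" using norm_triangle_ineq4[of "iexp a" "iexp b"] by simp
  ultimately show ?thesis by simp
qed

lemma char_centred_normal: "0 \<le> v \<Longrightarrow> char (centred_normal v) t = complex_of_real (exp (- (t\<^sup>2 * v / 2)))"
proof -
  assume v: "0 \<le> v"
  have "char (centred_normal v) t = (\<integral>y. iexp (t * (sqrt v * y)) \<partial>gauss)"
    unfolding char_def centred_normal_def by (subst integral_distr) auto
  also have "\<dots> = char gauss (t * sqrt v)" by (simp add: char_def mult.assoc)
  also have "\<dots> = complex_of_real (exp (- (t\<^sup>2 * v / 2)))"
    using v by (simp add: char_std_normal_distribution power_mult_distrib)
  finally show ?thesis .
qed

sublocale spin_model \<subseteq> si: sym_indep M "x N" "all_edges N" for N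
  by (rule sym_indep_edges) simp

context spin_model begin

text \<open>The candidates for the leading order; an edge whose size has zero coupling contributes nothing to the
partition function.\<close>

definition crit :: "nat \<Rightarrow> nat \<Rightarrow> nat set set set" where
  "crit K N = {\<Gamma> \<in> closed_sets N 3 \<union> closed_sets N 4. (\<forall>e\<in>\<Gamma>. \<theta> (card e) \<noteq> 0) \<and> weight \<Gamma> = K}"

lemma finite_crit [simp]: "finite (crit K N)"
  by (rule finite_subset[of _ "closed_sets N 3 \<union> closed_sets N 4"]) (auto simp: crit_def)

lemma Z_minus_1: "Z_hat \<theta> \<beta> (\<lambda>i. J i \<omega>) N - 1 = (\<Sum>\<Gamma> | \<Gamma> \<subseteq> all_edges N \<and> bd \<Gamma> = {} \<and> \<Gamma> \<noteq> {}. si.xp N \<Gamma> \<omega>)"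
proof -
  have "{\<Gamma>. \<Gamma> \<subseteq> all_edges N \<and> bd \<Gamma> = {}} = insert {} {\<Gamma>. \<Gamma> \<subseteq> all_edges N \<and> bd \<Gamma> = {} \<and> \<Gamma> \<noteq> {}}"
    by (auto simp: bd_def)
  moreover have "finite {\<Gamma>. \<Gamma> \<subseteq> all_edges N \<and> bd \<Gamma> = {} \<and> \<Gamma> \<noteq> {}}"
    by (rule finite_subset[of _ "Pow (all_edges N)"]) auto
  ultimately show ?thesis by (simp add: Z_hat_expansion xp_expand)
qed

lemma ap_le:
  assumes "1 \<le> N" "\<Gamma> \<subseteq> all_edges N"
  shows "si.ap N \<Gamma> \<le> (\<Prod>e\<in>\<Gamma>. bw N (card e))"
  unfolding si.ap_def
proof (rule prod_mono)
  fix e assume "e \<in> \<Gamma>"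
  then have e: "e \<in> all_edges N" using assms by auto
  then have "1 \<le> card e" by (auto simp: all_edges_def)
  then show "0 \<le> si.a N e \<and> si.a N e \<le> bw N (card e)"
    using \<alpha>_bounds(1)[OF assms(1), of "card e"] \<alpha>_bounds(2)[of N "card e"] x_moments(1)[OF e] by (simp add: si.a_def)
qed

lemma second_moment_le:
  assumes "1 \<le> N" "F \<subseteq> Pow (all_edges N)"
  shows "expectation (\<lambda>\<omega>. (\<Sum>\<Gamma>\<in>F. l * si.xp N \<Gamma> \<omega>)\<^sup>2) \<le> l\<^sup>2 * (\<Sum>\<Gamma>\<in>F. \<Prod>e\<in>\<Gamma>. bw N (card e))"
proof -
  have fin: "finite F" using assms(2) by (rule finite_subset) simp
  have "expectation (\<lambda>\<omega>. (\<Sum>\<Gamma>\<in>F. l * si.xp N \<Gamma> \<omega>)\<^sup>2) \<le> 1 * (\<Sum>\<Gamma>\<in>F. l\<^sup>2 * si.ap N \<Gamma>)"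
  proof (rule si.expectation_sum_sq_le[OF fin])
    fix \<Gamma> assume \<Gamma>: "\<Gamma> \<in> F"
    show "\<Gamma> \<subseteq> all_edges N" using \<Gamma> assms(2) by auto
    have "{j \<in> F. j = \<Gamma>} = {\<Gamma>}" using \<Gamma> by auto
    then show "real (card {j \<in> F. j = \<Gamma>}) \<le> 1" by simp
  qed
  also have "\<dots> \<le> (\<Sum>\<Gamma>\<in>F. l\<^sup>2 * (\<Prod>e\<in>\<Gamma>. bw N (card e)))"
    unfolding mult_1 using assms by (intro sum_mono mult_left_mono ap_le) auto
  finally show ?thesis by (simp add: sum_distrib_left)
qed

lemma integrable_sum_xp:
  assumes "F \<subseteq> Pow (all_edges N)"
  shows "(\<lambda>\<omega>. \<Sum>\<Gamma>\<in>F. l * si.xp N \<Gamma> \<omega>) \<in> borel_measurable M"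
    "integrable M (\<lambda>\<omega>. (\<Sum>\<Gamma>\<in>F. l * si.xp N \<Gamma> \<omega>) ^ n)"
proof -
  show m: "(\<lambda>\<omega>. \<Sum>\<Gamma>\<in>F. l * si.xp N \<Gamma> \<omega>) \<in> borel_measurable M"
    using assms by (intro borel_measurable_sum borel_measurable_times si.xp_meas) auto
  show "integrable M (\<lambda>\<omega>. (\<Sum>\<Gamma>\<in>F. l * si.xp N \<Gamma> \<omega>) ^ n)"
  proof (rule integrable_bounded[where B="(\<Sum>\<Gamma>\<in>F. \<bar>l\<bar>) ^ n"])
    show "(\<lambda>\<omega>. (\<Sum>\<Gamma>\<in>F. l * si.xp N \<Gamma> \<omega>) ^ n) \<in> borel_measurable M"
      using m by (rule borel_measurable_power)
    fix \<omega> assume \<omega>: "\<omega> \<in> space M"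
    have "\<bar>\<Sum>\<Gamma>\<in>F. l * si.xp N \<Gamma> \<omega>\<bar> \<le> (\<Sum>\<Gamma>\<in>F. \<bar>l * si.xp N \<Gamma> \<omega>\<bar>)" by (rule sum_abs)
    also have "\<dots> \<le> (\<Sum>\<Gamma>\<in>F. \<bar>l\<bar> * 1)"
      unfolding abs_mult using assms si.xp_bound \<omega> by (intro sum_mono mult_left_mono) auto
    finally show "norm ((\<Sum>\<Gamma>\<in>F. l * si.xp N \<Gamma> \<omega>) ^ n) \<le> (\<Sum>\<Gamma>\<in>F. \<bar>l\<bar>) ^ n"
      unfolding real_norm_def power_abs by (intro power_mono) auto
  qed
qed

lemma Z_hat_meas: "(\<lambda>\<omega>. Z_hat \<theta> \<beta> (\<lambda>i. J i \<omega>) N) \<in> borel_measurable M"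
proof -
  have "(\<lambda>\<omega>. 1 + (\<Sum>\<Gamma> | \<Gamma> \<subseteq> all_edges N \<and> bd \<Gamma> = {} \<and> \<Gamma> \<noteq> {}. 1 * si.xp N \<Gamma> \<omega>)) \<in> borel_measurable M"
    by (intro borel_measurable_add borel_measurable_const integrable_sum_xp(1)) auto
  then show ?thesis unfolding mult_1 Z_minus_1[symmetric] by simp
qed

end

text \<open>No closed hypergraph with three or four admissible edges weighs less than \<open>K\<close>, and no
admissible edge has size below \<open>q\<close>, where an edge is admissible if its size carries a nonzero coupling.
The inequality between them ensures that five or more edges are of lower order. The limit \<open>v\<close> is the
asymptotic variance.\<close>

locale leading_order = spin_model M J \<theta> \<beta> for M :: "'a measure" and J \<theta> \<beta> +
  fixes K q :: nat and v :: real
  assumes K: "1 \<le> K" "K + 1 \<le> 5 * (q - 2)" and q: "3 \<le> q" "\<And>p. 3 \<le> p \<Longrightarrow> p < q \<Longrightarrow> \<theta> p = 0"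
    and weight_ge: "\<And>N n \<Gamma>. \<Gamma> \<in> closed_sets N n \<Longrightarrow> n \<in> {3, 4} \<Longrightarrow> (\<And>e. e \<in> \<Gamma> \<Longrightarrow> \<theta> (card e) \<noteq> 0) \<Longrightarrow> K \<le> weight \<Gamma>"
    and v_lim: "(\<lambda>N. sqrt (real N) ^ K * (\<Sum>\<Gamma>\<in>crit K N. \<Prod>e\<in>\<Gamma>. bw N (card e))) \<longlonglongrightarrow> v"
begin

text \<open>Edges of size above \<open>K + 2\<close> have weight above \<open>K\<close> and do not occur at
leading order.\<close>

definition U :: "nat set" where "U = {p \<in> {3..K + 2}. \<theta> p \<noteq> 0}"

definition edg :: "nat \<Rightarrow> nat set set" where "edg N = {e \<in> all_edges N. card e \<in> U}"

text \<open>Those hypergraphs of leading order to which the martingale argument applies; the others, having a vertex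
of degree four, are negligible.\<close>

definition fam :: "nat \<Rightarrow> nat set set set" where
  "fam N = {\<Gamma> \<in> crit K N. card {e \<in> \<Gamma>. Max (\<Union>\<Gamma>) \<in> e} = 2}"

definition lam :: "nat \<Rightarrow> real" where "lam N = sqrt (sqrt (real N) ^ K)"

definition c0 :: real where "c0 = 1 + (\<Sum>p\<in>U. \<beta>\<^sup>2 * (\<theta> p)\<^sup>2)"

definition rest :: "nat \<Rightarrow> nat set set set" where
  "rest N = {\<Gamma>. \<Gamma> \<subseteq> all_edges N \<and> bd \<Gamma> = {} \<and> \<Gamma> \<noteq> {}} - fam N"

lemma lam: "(lam N)\<^sup>2 = sqrt (real N) ^ K" "0 \<le> lam N"
  by (simp_all add: lam_def)

lemma c0: "1 \<le> c0" "p \<in> U \<Longrightarrow> \<beta>\<^sup>2 * (\<theta> p)\<^sup>2 \<le> c0"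
proof -
  show "1 \<le> c0" by (simp add: c0_def sum_nonneg)
  have "p \<in> U \<Longrightarrow> \<beta>\<^sup>2 * (\<theta> p)\<^sup>2 \<le> (\<Sum>p\<in>U. \<beta>\<^sup>2 * (\<theta> p)\<^sup>2)" by (intro member_le_sum) (auto simp: U_def)
  then show "p \<in> U \<Longrightarrow> \<beta>\<^sup>2 * (\<theta> p)\<^sup>2 \<le> c0" by (simp add: c0_def)
qed

lemma bw_le_c0: "e \<in> edg N \<Longrightarrow> bw N (card e) \<le> c0 / real N ^ (card e - 1)"
  unfolding bw_def using c0(2)[of "card e"] by (intro divide_right_mono) (auto simp: edg_def)

lemma critD:
  assumes "\<Gamma> \<in> crit K N"
  shows "\<Gamma> \<subseteq> edg N" "bd \<Gamma> = {}" "card \<Gamma> = 3 \<or> card \<Gamma> = 4" "(\<Sum>e\<in>\<Gamma>. card e - 2) = K" "finite \<Gamma>" "\<Gamma> \<noteq> {}" "\<Gamma> \<subseteq> all_edges N"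
proof -
  show \<Gamma>: "\<Gamma> \<subseteq> all_edges N" and "bd \<Gamma> = {}" and card: "card \<Gamma> = 3 \<or> card \<Gamma> = 4" and w: "(\<Sum>e\<in>\<Gamma>. card e - 2) = K"
    using assms by (auto simp: crit_def closed_sets_def weight_def)
  show fin: "finite \<Gamma>" using \<Gamma> by (rule finite_subset) simp
  show "\<Gamma> \<noteq> {}" using card by auto
  show "\<Gamma> \<subseteq> edg N"
  proof
    fix e assume e: "e \<in> \<Gamma>"
    have "card e - 2 \<le> (\<Sum>e\<in>\<Gamma>. card e - 2)" using e fin by (intro member_le_sum) auto
    then have "card e \<le> K + 2" using w by simp
    then show "e \<in> edg N" using e \<Gamma> assms by (auto simp: edg_def U_def all_edges_def crit_def)
  qed
qed

lemma crit_rest_bound: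
  assumes N: "1 \<le> N"
  shows "sqrt (real N) ^ K * (\<Sum>\<Gamma>\<in>crit K N - fam N. \<Prod>e\<in>\<Gamma>. bw N (card e)) \<le> c0 ^ 4 * cover_const (K + 8) / real N"
proof -
  have *: "sqrt (real N) ^ K * (\<Prod>e\<in>\<Gamma>. bw N (card e)) \<le> c0 ^ 4 * (1 / sqrt (real N) ^ (\<Sum>e\<in>\<Gamma>. card e))"
    if "\<Gamma> \<in> crit K N" for \<Gamma>
  proof (rule scaled_product_bound[OF N])
    show "finite \<Gamma>" "(\<Sum>e\<in>\<Gamma>. card e - 2) = K" using critD[OF that] by auto
    show "card \<Gamma> \<le> 4" using critD(3)[OF that] by auto
    show "1 \<le> c0" by (rule c0)
    fix e assume e: "e \<in> \<Gamma>"
    show "3 \<le> card e" using e critD(7)[OF that] by (auto simp: all_edges_def)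
    show "0 \<le> bw N (card e)" by simp
    show "bw N (card e) \<le> c0 / real N ^ (card e - 1)" using e critD(1)[OF that] by (intro bw_le_c0) auto
  qed
  have "sqrt (real N) ^ K * (\<Sum>\<Gamma>\<in>crit K N - fam N. \<Prod>e\<in>\<Gamma>. bw N (card e))
     \<le> c0 ^ 4 * (\<Sum>\<Gamma>\<in>crit K N - fam N. 1 / sqrt (real N) ^ (\<Sum>e\<in>\<Gamma>. card e))"
    unfolding sum_distrib_left using * by (intro sum_mono) auto
  also have "\<dots> \<le> c0 ^ 4 * (cover_const (K + 8) / sqrt (real N) ^ (2 * card ({} :: nat set) + 2))"
  proof (intro mult_left_mono sum_cover[OF N])
    show "0 \<le> c0 ^ 4" by simp
    fix \<Gamma> assume "\<Gamma> \<in> crit K N - fam N"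
    then have \<Gamma>: "\<Gamma> \<in> crit K N" and deg: "card {e \<in> \<Gamma>. Max (\<Union>\<Gamma>) \<in> e} \<noteq> 2" by (auto simp: fam_def)
    note g = critD[OF \<Gamma>]
    show "\<Gamma> \<subseteq> Pow {1..N}" using g(7) all_edges_subset by blast
    have fe: "finite e" if "e \<in> \<Gamma>" for e using that g(7) finite_edge by auto
    have ge3: "3 \<le> card e" if "e \<in> \<Gamma>" for e using that g(7) by (auto simp: all_edges_def)
    have "\<Union>\<Gamma> \<noteq> {}" using g(6) ge3 by fastforce
    then have "Max (\<Union>\<Gamma>) \<in> \<Union>\<Gamma>" using g(5) fe by (intro Max_in) auto
    then show d: "2 * card (\<Union>\<Gamma>) + 2 \<le> (\<Sum>e\<in>\<Gamma>. card e)"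
      using closed_card_Union_4[OF g(5) fe g(2) _ deg] by blast
    have "(\<Sum>e\<in>\<Gamma>. card e) = (\<Sum>e\<in>\<Gamma>. (card e - 2) + 2)" by (intro sum.cong refl) (use ge3 in fastforce)
    also have "\<dots> = K + 2 * card \<Gamma>" unfolding sum.distrib g(4) by simp
    finally show "card (\<Union>\<Gamma>) \<le> K + 8" using d g(3) by auto
  qed auto
  also have "\<dots> = c0 ^ 4 * cover_const (K + 8) / real N" by simp
  finally show ?thesis .
qed

text \<open>Everything but the main family is smaller in variance by a factor \<open>sqrt N\<close>: five or more
edges, three or four edges of larger weight, and hypergraphs of leading order with a vertex of degree four.\<close>

lemma rest_bound: "\<exists>C\<ge>0. \<forall>N\<ge>1. sqrt (real N) ^ (K + 1) * (\<Sum>\<Gamma>\<in>rest N. \<Prod>e\<in>\<Gamma>. bw N (card e)) \<le> C"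
proof -
  obtain \<rho> where \<rho>: "1 < \<rho>" "\<And>N x. 0 \<le> x \<Longrightarrow> x \<le> 1 \<Longrightarrow> \<rho> * (\<Sum>p\<in>{3..N}. \<beta>\<^sup>2 * (\<theta> p)\<^sup>2 * x ^ p / fact p) \<le> rate_I x"
    using beta_gap[OF theta_summable beta] by blast
  \<comment> \<open>An order between 1 and \<open>\<rho>\<close>: above 1 for the tail estimate, below
    \<open>\<rho>\<close> for the exponential moment.\<close>
  define \<kappa> where "\<kappa> = (1 + \<rho>) / 2"
  have \<kappa>: "1 < \<kappa>" "\<kappa> < \<rho>" using \<rho>(1) by (simp_all add: \<kappa>_def)
  obtain C0 where C0: "\<And>N. 1 \<le> N \<Longrightarrow> avg N (\<lambda>B. exp (\<kappa> * field N {3..N} B)) \<le> C0"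
    using exp_moment[of \<kappa> \<rho>] \<kappa> \<rho>(2) by auto
  have cz: "\<beta>\<^sup>2 * (\<theta> p)\<^sup>2 = 0" if "3 \<le> p" "p < q" for p using q(2)[OF that] by simp
  obtain C5 where C5: "0 \<le> C5" "\<And>N L. 1 \<le> N \<Longrightarrow> sqrt (real N) ^ (K + 1) * (\<Sum>n\<in>{5..L}. \<Sum>\<Gamma>\<in>closed_sets N n. \<Prod>e\<in>\<Gamma>. bw N (card e)) \<le> C5"
    using tail_large[OF q(1) cz K(2) \<kappa>(1) C0] by auto
  let ?T = "\<lambda>N n. {\<Gamma>. \<Gamma> \<in> closed_sets N n \<and> K + 1 \<le> weight \<Gamma>}"
  obtain C3 where C3: "0 \<le> C3" "\<And>N. 1 \<le> N \<Longrightarrow> sqrt (real N) ^ (K + 1) * (\<Sum>\<Gamma>\<in>?T N 3. \<Prod>e\<in>\<Gamma>. bw N (card e)) \<le> C3"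
    using tail_small[of 3 K] by auto
  obtain C4 where C4: "0 \<le> C4" "\<And>N. 1 \<le> N \<Longrightarrow> sqrt (real N) ^ (K + 1) * (\<Sum>\<Gamma>\<in>?T N 4. \<Prod>e\<in>\<Gamma>. bw N (card e)) \<le> C4"
    using tail_small[of 4 K] by auto
  define C where "C = C5 + (C3 + (C4 + c0 ^ 4 * cover_const (K + 8)))"
  have nn: "0 \<le> c0 ^ 4 * cover_const (K + 8)" by (simp add: cover_const_nonneg)
  have "sqrt (real N) ^ (K + 1) * (\<Sum>\<Gamma>\<in>rest N. \<Prod>e\<in>\<Gamma>. bw N (card e)) \<le> C" if N: "1 \<le> N" for N
  proof -
    define f where "f \<Gamma> = (\<Prod>e\<in>\<Gamma>. bw N (card e))" for \<Gamma> :: "nat set set"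
    have f: "0 \<le> f \<Gamma>" for \<Gamma> by (simp add: f_def prod_nonneg)
    define L where "L = card (all_edges N)"
    define P where "P = {\<Gamma> \<in> rest N. \<forall>e\<in>\<Gamma>. \<theta> (card e) \<noteq> 0}"
    have fin: "finite (rest N)" by (rule finite_subset[of _ "Pow (all_edges N)"]) (auto simp: rest_def)
    have zero: "sum f (rest N) = sum f P"
    proof (rule sum.mono_neutral_right[OF fin])
      show "P \<subseteq> rest N" by (auto simp: P_def)
      show "\<forall>\<Gamma>\<in>rest N - P. f \<Gamma> = 0"
      proof
        fix \<Gamma> assume "\<Gamma> \<in> rest N - P"
        then obtain e where "e \<in> \<Gamma>" "\<theta> (card e) = 0" "\<Gamma> \<subseteq> all_edges N" by (auto simp: P_def rest_def)
        moreover have "finite \<Gamma>" using calculation(3) by (rule finite_subset) simp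
        ultimately show "f \<Gamma> = 0" by (auto simp: f_def bw_def)
      qed
    qed
    let ?A = "\<Union>n\<in>{5..L}. closed_sets N n"
    have sub: "P \<subseteq> ?A \<union> (?T N 3 \<union> (?T N 4 \<union> (crit K N - fam N)))"
    proof
      fix \<Gamma> assume P: "\<Gamma> \<in> P"
      then have \<Gamma>: "\<Gamma> \<subseteq> all_edges N" "bd \<Gamma> = {}" "\<Gamma> \<noteq> {}" "\<Gamma> \<notin> fam N" "\<And>e. e \<in> \<Gamma> \<Longrightarrow> \<theta> (card e) \<noteq> 0"
        by (auto simp: P_def rest_def)
      have fin\<Gamma>: "finite \<Gamma>" using \<Gamma>(1) by (rule finite_subset) simp
      have cs: "\<Gamma> \<in> closed_sets N (card \<Gamma>)" using \<Gamma> by (simp add: closed_sets_def)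
      have "card \<Gamma> \<le> L" unfolding L_def by (rule card_mono[OF finite_all_edges \<Gamma>(1)])
      have "card \<Gamma> \<noteq> 0" using \<Gamma>(3) fin\<Gamma> by simp
      moreover have "card \<Gamma> \<noteq> 1" "card \<Gamma> \<noteq> 2" using cs closed_sets_small by auto
      ultimately consider "5 \<le> card \<Gamma>" | "card \<Gamma> = 3" | "card \<Gamma> = 4" by linarith
      then show "\<Gamma> \<in> ?A \<union> (?T N 3 \<union> (?T N 4 \<union> (crit K N - fam N)))"
      proof cases
        case 1
        then show ?thesis using cs \<open>card \<Gamma> \<le> L\<close> by auto
      next
        case 2
        then have cs3: "\<Gamma> \<in> closed_sets N 3" using cs by simp
        then have "K \<le> weight \<Gamma>" using weight_ge[of \<Gamma> N 3] \<Gamma>(5) by simp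
        then consider "K + 1 \<le> weight \<Gamma>" | "weight \<Gamma> = K" by linarith
        then show ?thesis using cs3 \<Gamma>(4,5) by cases (auto simp: crit_def)
      next
        case 3
        then have cs4: "\<Gamma> \<in> closed_sets N 4" using cs by simp
        then have "K \<le> weight \<Gamma>" using weight_ge[of \<Gamma> N 4] \<Gamma>(5) by simp
        then consider "K + 1 \<le> weight \<Gamma>" | "weight \<Gamma> = K" by linarith
        then show ?thesis using cs4 \<Gamma>(4,5) by cases (auto simp: crit_def)
      qed
    qed
    have finT: "finite (?T N n)" for n by (rule finite_subset[of _ "closed_sets N n"]) auto
    have finA: "finite ?A" by auto
    have finR: "finite (crit K N - fam N)" by simp
    have "sum f (rest N) \<le> sum f (?A \<union> (?T N 3 \<union> (?T N 4 \<union> (crit K N - fam N))))"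
      unfolding zero using f finA finT finR by (intro sum_mono2[OF _ sub]) auto
    also have "\<dots> \<le> sum f ?A + sum f (?T N 3 \<union> (?T N 4 \<union> (crit K N - fam N)))"
      using finA finT finR f by (intro sum_Un_le) auto
    also have "\<dots> \<le> sum f ?A + (sum f (?T N 3) + sum f (?T N 4 \<union> (crit K N - fam N)))"
      using finT finR f by (intro add_left_mono sum_Un_le) auto
    also have "\<dots> \<le> sum f ?A + (sum f (?T N 3) + (sum f (?T N 4) + sum f (crit K N - fam N)))"
      using finT finR f by (intro add_left_mono sum_Un_le) auto
    also have "\<dots> \<le> (\<Sum>n\<in>{5..L}. sum f (closed_sets N n)) + (sum f (?T N 3) + (sum f (?T N 4) + sum f (crit K N - fam N)))"
      using f by (intro add_right_mono sum_UNION_le) auto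
    finally have le: "sum f (rest N) \<le> (\<Sum>n\<in>{5..L}. sum f (closed_sets N n)) + (sum f (?T N 3) + (sum f (?T N 4) + sum f (crit K N - fam N)))" .
    let ?s = "sqrt (real N)"
    have s: "1 \<le> ?s" using N by simp
    have "?s * 1 \<le> ?s * ?s" using s by (intro mult_left_mono) auto
    then have sN: "?s \<le> real N" by simp
    have "?s ^ (K + 1) * sum f (crit K N - fam N) = ?s * (?s ^ K * sum f (crit K N - fam N))" by simp
    also have "\<dots> \<le> ?s * (c0 ^ 4 * cover_const (K + 8) / real N)"
      unfolding f_def using s by (intro mult_left_mono crit_rest_bound[OF N]) auto
    also have "\<dots> \<le> real N * (c0 ^ 4 * cover_const (K + 8) / real N)"
      using sN nn by (intro mult_right_mono divide_nonneg_nonneg) auto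
    also have "\<dots> = c0 ^ 4 * cover_const (K + 8)" using N by simp
    finally have cr: "?s ^ (K + 1) * sum f (crit K N - fam N) \<le> c0 ^ 4 * cover_const (K + 8)" .
    have "?s ^ (K + 1) * sum f (rest N) \<le> ?s ^ (K + 1) * ((\<Sum>n\<in>{5..L}. sum f (closed_sets N n)) + (sum f (?T N 3) + (sum f (?T N 4) + sum f (crit K N - fam N))))"
      using le s by (intro mult_left_mono) auto
    also have "\<dots> \<le> C"
      unfolding C_def distrib_left using C5(2)[OF N, of L] C3(2)[OF N] C4(2)[OF N] cr
      unfolding f_def[symmetric] by (intro add_mono) auto
    finally show ?thesis unfolding f_def .
  qed
  moreover have "0 \<le> C" using C5(1) C3(1) C4(1) nn by (simp add: C_def)
  ultimately show ?thesis by blast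
qed

lemma fam_subset: "fam N \<subseteq> {\<Gamma>. \<Gamma> \<subseteq> all_edges N \<and> bd \<Gamma> = {} \<and> \<Gamma> \<noteq> {}}" "fam N \<subseteq> crit K N" "finite (fam N)"
proof -
  show s: "fam N \<subseteq> crit K N" by (auto simp: fam_def)
  show "finite (fam N)" using s by (rule finite_subset) simp
  show "fam N \<subseteq> {\<Gamma>. \<Gamma> \<subseteq> all_edges N \<and> bd \<Gamma> = {} \<and> \<Gamma> \<noteq> {}}"
  proof
    fix \<Gamma> assume "\<Gamma> \<in> fam N"
    then have "\<Gamma> \<in> crit K N" using s by blast
    from critD(2,6,7)[OF this] show "\<Gamma> \<in> {\<Gamma>. \<Gamma> \<subseteq> all_edges N \<and> bd \<Gamma> = {} \<and> \<Gamma> \<noteq> {}}" by simp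
  qed
qed

definition V :: "nat \<Rightarrow> real" where
  "V N = sqrt (real N) ^ K * (\<Sum>\<Gamma>\<in>crit K N. \<Prod>e\<in>\<Gamma>. bw N (card e))"

definition var :: "nat \<Rightarrow> real" where
  "var N = (\<Sum>\<Gamma>\<in>fam N. (lam N)\<^sup>2 * si.ap N \<Gamma>)"

text \<open>Squeezed between the weights with \<open>bw\<close> and the same weights times the fourth power of a
factor that tends to 1: the variance of \<open>tanh\<close> is asymptotic to that of its argument, uniformly over
the finitely many edge sizes in \<open>U\<close>.\<close>

lemma var_lim: "var \<longlonglongrightarrow> v"
proof -
  \<comment> \<open>One factor for all sizes: each single ratio is at least their product, as all ratios are at
    most 1.\<close>
  define r where "r N = (\<Prod>p\<in>U. \<alpha> N p / bw N p)" for N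
  have finU: "finite U" by (simp add: U_def)
  have "r \<longlonglongrightarrow> (\<Prod>p\<in>U. 1)"
    unfolding r_def[abs_def] by (intro tendsto_prod \<alpha>_ratio) (auto simp: U_def)
  then have r: "r \<longlonglongrightarrow> 1" by simp
  have bwpos: "0 < bw N p" if "1 \<le> N" "p \<in> U" for N p using that beta by (auto simp: bw_def U_def)
  have ratio: "0 \<le> \<alpha> N p / bw N p" "\<alpha> N p / bw N p \<le> 1" if "1 \<le> N" "p \<in> U" for N p
    using bwpos[OF that] \<alpha>_bounds(1)[OF that(1), of p] \<alpha>_bounds(2)[of N p] that by (auto simp: U_def)
  have r01: "0 \<le> r N" "r N \<le> 1" if "1 \<le> N" for N
    unfolding r_def using ratio[OF that] by (auto intro!: prod_nonneg prod_le_1)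
  have r_le: "r N * bw N p \<le> \<alpha> N p" if N: "1 \<le> N" and p: "p \<in> U" for N p
  proof -
    have "r N = (\<Prod>p\<in>U - {p}. \<alpha> N p / bw N p) * (\<alpha> N p / bw N p)"
      unfolding r_def using finU p by (subst prod.remove[of _ p]) (auto simp: mult.commute)
    also have "\<dots> \<le> 1 * (\<alpha> N p / bw N p)"
      using ratio[OF N] p by (intro mult_right_mono prod_le_1) auto
    finally show ?thesis using bwpos[OF that] by (simp add: le_divide_eq)
  qed
  have V: "V \<longlonglongrightarrow> v" using v_lim by (simp add: V_def[abs_def])
  have up: "var N \<le> V N" if N: "1 \<le> N" for N
  proof -
    have "var N \<le> (\<Sum>\<Gamma>\<in>fam N. sqrt (real N) ^ K * (\<Prod>e\<in>\<Gamma>. bw N (card e)))"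
      unfolding var_def lam using fam_subset[of N] by (intro sum_mono mult_left_mono ap_le[OF N]) auto
    also have "\<dots> \<le> V N"
      unfolding V_def sum_distrib_left using fam_subset(2)
      by (intro sum_mono2) (auto intro!: mult_nonneg_nonneg prod_nonneg)
    finally show ?thesis .
  qed
  have low: "r N ^ 4 * (V N - c0 ^ 4 * cover_const (K + 8) / real N) \<le> var N" if N: "1 \<le> N" for N
  proof -
    have "(\<Sum>\<Gamma>\<in>crit K N. \<Prod>e\<in>\<Gamma>. bw N (card e)) = (\<Sum>\<Gamma>\<in>crit K N - fam N. \<Prod>e\<in>\<Gamma>. bw N (card e)) + (\<Sum>\<Gamma>\<in>fam N. \<Prod>e\<in>\<Gamma>. bw N (card e))"
      by (rule sum.subset_diff[OF fam_subset(2)]) simp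
    then have "V N - c0 ^ 4 * cover_const (K + 8) / real N \<le> sqrt (real N) ^ K * (\<Sum>\<Gamma>\<in>fam N. \<Prod>e\<in>\<Gamma>. bw N (card e))"
      using crit_rest_bound[OF N] unfolding V_def by (simp add: distrib_left)
    then have "r N ^ 4 * (V N - c0 ^ 4 * cover_const (K + 8) / real N) \<le> r N ^ 4 * (sqrt (real N) ^ K * (\<Sum>\<Gamma>\<in>fam N. \<Prod>e\<in>\<Gamma>. bw N (card e)))"
      by (rule mult_left_mono) (simp add: r01[OF N])
    also have "\<dots> = (\<Sum>\<Gamma>\<in>fam N. sqrt (real N) ^ K * (r N ^ 4 * (\<Prod>e\<in>\<Gamma>. bw N (card e))))"
      by (simp add: sum_distrib_left mult_ac)
    also have "\<dots> \<le> var N"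
      unfolding var_def lam
    proof (intro sum_mono mult_left_mono)
      fix \<Gamma> assume "\<Gamma> \<in> fam N"
      then have \<Gamma>: "\<Gamma> \<in> crit K N" using fam_subset by auto
      note g = critD[OF \<Gamma>]
      have "r N ^ 4 \<le> r N ^ card \<Gamma>" using g(3) r01[OF N] by (intro power_decreasing) auto
      then have "r N ^ 4 * (\<Prod>e\<in>\<Gamma>. bw N (card e)) \<le> r N ^ card \<Gamma> * (\<Prod>e\<in>\<Gamma>. bw N (card e))"
        by (intro mult_right_mono prod_nonneg) auto
      also have "\<dots> = (\<Prod>e\<in>\<Gamma>. r N * bw N (card e))" by (simp add: prod.distrib)
      also have "\<dots> \<le> si.ap N \<Gamma>"
        unfolding si.ap_def
      proof (rule prod_mono)
        fix e assume e: "e \<in> \<Gamma>"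
        then have "card e \<in> U" "e \<in> all_edges N" using g(1) by (auto simp: edg_def)
        then show "0 \<le> r N * bw N (card e) \<and> r N * bw N (card e) \<le> si.a N e"
          using r_le[OF N, of "card e"] r01[OF N] x_moments(1)[of e N] by (simp add: si.a_def)
      qed
      finally show "r N ^ 4 * (\<Prod>e\<in>\<Gamma>. bw N (card e)) \<le> si.ap N \<Gamma>" .
    qed simp
    finally show ?thesis .
  qed
  have "(\<lambda>N. c0 ^ 4 * cover_const (K + 8) / real N) \<longlonglongrightarrow> 0" by (rule lim_const_over_n)
  then have "(\<lambda>N. r N ^ 4 * (V N - c0 ^ 4 * cover_const (K + 8) / real N)) \<longlonglongrightarrow> 1 ^ 4 * (v - 0)"
    by (intro tendsto_intros r V)
  then have lowlim: "(\<lambda>N. r N ^ 4 * (V N - c0 ^ 4 * cover_const (K + 8) / real N)) \<longlonglongrightarrow> v" by simp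
  show ?thesis
    by (rule tendsto_sandwich[OF _ _ lowlim V]) (auto intro!: eventually_at_top_linorderI[of 1] low up)
qed

lemma v_nonneg: "0 \<le> v"
proof (rule LIMSEQ_le_const[OF var_lim])
  have "0 \<le> var N" for N
    unfolding var_def by (intro sum_nonneg mult_nonneg_nonneg si.ap_nonneg zero_le_power2)
  then show "\<exists>N. \<forall>n\<ge>N. 0 \<le> var n" by blast
qed

lemma main_family_eventually:
  "\<forall>\<^sub>F N in sequentially. main_family M (x N) (edg N) N K (fam N) (lam N) c0 (9 + 4 * m4)"
proof -
  have "\<forall>\<^sub>F N in sequentially. \<forall>p\<in>U. 1 / 2 < \<alpha> N p / bw N p"
  proof (rule eventually_ball_finite)
    show "finite U" by (simp add: U_def)
    show "\<forall>p\<in>U. \<forall>\<^sub>F N in sequentially. 1 / 2 < \<alpha> N p / bw N p"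
    proof
      fix p assume "p \<in> U"
      then have "(\<lambda>N. \<alpha> N p / bw N p) \<longlonglongrightarrow> 1" by (intro \<alpha>_ratio) (auto simp: U_def)
      then show "\<forall>\<^sub>F N in sequentially. 1 / 2 < \<alpha> N p / bw N p" by (rule order_tendstoD) simp
    qed
  qed
  then show ?thesis using eventually_ge_at_top[of 1]
  proof eventually_elim
    case (elim N)
    have half: "bw N p \<le> 2 * \<alpha> N p" if "p \<in> U" for p
    proof -
      have "0 < bw N p" using that beta elim(2) by (auto simp: bw_def U_def)
      then show ?thesis using elim(1) that by (fastforce simp: less_divide_eq)
    qed
    interpret E: sym_indep M "x N" "edg N" by (rule sym_indep_edges) (auto simp: edg_def)
    show ?case
    proof
      show "1 \<le> N" by (rule elim(2))
      show "edg N \<subseteq> all_edges N" by (auto simp: edg_def)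
      show "(lam N)\<^sup>2 = sqrt (real N) ^ K" by (rule lam)
      show "1 \<le> c0" by (rule c0)
      show "9 \<le> 9 + 4 * m4" using m4_nonneg by simp
      fix \<Gamma> assume \<Gamma>: "\<Gamma> \<in> fam N"
      then have "\<Gamma> \<in> crit K N" by (simp add: fam_def)
      note g = critD[OF this]
      show "\<Gamma> \<subseteq> edg N" "bd \<Gamma> = {}" "card \<Gamma> = 3 \<or> card \<Gamma> = 4" "(\<Sum>e\<in>\<Gamma>. card e - 2) = K" by (rule g)+
      show "card {e \<in> \<Gamma>. Max (\<Union>\<Gamma>) \<in> e} = 2" using \<Gamma> by (simp add: fam_def)
    next
      fix e assume e: "e \<in> edg N"
      then have eU: "card e \<in> U" "e \<in> all_edges N" "1 \<le> card e" by (auto simp: edg_def all_edges_def)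
      have a: "E.a e = \<alpha> N (card e)" unfolding E.a_def by (rule x_moments[OF eU(2)])
      show "E.a e \<le> c0 / real N ^ (card e - 1)"
        unfolding a using \<alpha>_bounds(1)[OF elim(2) eU(3)] bw_le_c0[OF e] by simp
      have "expectation (\<lambda>\<omega>. x N e \<omega> ^ 4) \<le> (bw N (card e))\<^sup>2 * m4"
        unfolding x_moments(2)[OF eU(2)] by (rule edge_fourth[OF elim(2) eU(3)])
      also have "\<dots> \<le> (2 * \<alpha> N (card e))\<^sup>2 * m4"
        using half[OF eU(1)] m4_nonneg by (intro mult_right_mono power_mono) auto
      also have "\<dots> \<le> (9 + 4 * m4) * (E.a e)\<^sup>2"
        unfolding a by (simp add: algebra_simps power_mult_distrib)
      finally show "expectation (\<lambda>\<omega>. x N e \<omega> ^ 4) \<le> (9 + 4 * m4) * (E.a e)\<^sup>2" .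
    qed
  qed
qed

end

lemma norm_diff_triangle3:
  fixes a b c d :: "'b::real_normed_vector"
  assumes "norm (a - b) \<le> x" "norm (b - c) \<le> y" "norm (c - d) \<le> z"
  shows "norm (a - d) \<le> x + y + z"
  using norm_diff_triangle_le[OF norm_diff_triangle_le[OF assms(1,2)] assms(3)] .

context leading_order begin

text \<open>Three replacements, each with an error in mean that tends to zero: \<open>ln (1 + u)\<close> by
\<open>u\<close>, since the second moment of \<open>u\<close> is of order \<open>1 / (lam N)^2\<close>; the full
sum by the main family; the characteristic function of the latter by the Gaussian one.\<close>

lemma char_limit:
  "(\<lambda>N. expectation (\<lambda>\<omega>. iexp (t * (lam N * ln (Z_hat \<theta> \<beta> (\<lambda>i. J i \<omega>) N))))) \<longlonglongrightarrow> complex_of_real (exp (- (t\<^sup>2 * v / 2)))"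
proof -
  obtain C where C: "0 \<le> C" "\<And>N. 1 \<le> N \<Longrightarrow> sqrt (real N) ^ (K + 1) * (\<Sum>\<Gamma>\<in>rest N. \<Prod>e\<in>\<Gamma>. bw N (card e)) \<le> C"
    using rest_bound by blast
  have "V \<longlonglongrightarrow> v" using v_lim by (simp add: V_def[abs_def])
  then have "Bseq V" by (intro convergent_imp_Bseq convergentI)
  then obtain B where B: "0 < B" "\<And>N. \<bar>V N\<bar> \<le> B" unfolding Bseq_def by auto
  define err where "err = main_family.err K c0 (9 + 4 * m4) t"
  \<comment> \<open>\<open>1 / lam N\<close> is at most \<open>h N\<close> because \<open>K\<close> is at
    least 1; all errors are expressed through \<open>h\<close>.\<close>
  define h where "h N = 1 / sqrt (sqrt (real N))" for N
  define bound where "bound N = (2 * \<bar>t\<bar> + 8) * (B + C) * h N + \<bar>t\<bar> * (sqrt C * h N) + err * (h N)\<^sup>2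
     + \<bar>exp (- (t\<^sup>2 * var N / 2)) - exp (- (t\<^sup>2 * v / 2))\<bar>" for N
  let ?Z = "\<lambda>N \<omega>. Z_hat \<theta> \<beta> (\<lambda>i. J i \<omega>) N"
  have step: "cmod (expectation (\<lambda>\<omega>. iexp (t * (lam N * ln (?Z N \<omega>)))) - complex_of_real (exp (- (t\<^sup>2 * v / 2)))) \<le> bound N"
    if N: "1 \<le> N" and mf: "main_family M (x N) (edg N) N K (fam N) (lam N) c0 (9 + 4 * m4)" for N
  proof -
    define s where "s = sqrt (real N)"
    have s: "1 \<le> s" using N by (simp add: s_def)
    have lam2: "(lam N)\<^sup>2 = s ^ K" by (simp add: lam s_def)
    have sK: "s \<le> s ^ K" using power_increasing[of 1 K s] K s by simp
    have "sqrt s \<le> sqrt (s ^ K)" using sK by simp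
    then have lam_ge: "sqrt s \<le> lam N" by (simp add: lam_def s_def)
    have sqs: "1 \<le> sqrt s" using s by simp
    have lam1: "1 \<le> lam N" using lam_ge sqs by linarith
    define F where "F = {\<Gamma>. \<Gamma> \<subseteq> all_edges N \<and> bd \<Gamma> = {} \<and> \<Gamma> \<noteq> {}}"
    have F: "F \<subseteq> Pow (all_edges N)" "finite F"
      by (auto simp: F_def intro: finite_subset[of _ "Pow (all_edges N)"])
    have fam: "fam N \<subseteq> F" "rest N = F - fam N" using fam_subset by (auto simp: F_def rest_def)
    define Y where "Y \<omega> = (\<Sum>\<Gamma>\<in>fam N. lam N * si.xp N \<Gamma> \<omega>)" for \<omega>
    define R where "R \<omega> = (\<Sum>\<Gamma>\<in>rest N. lam N * si.xp N \<Gamma> \<omega>)" for \<omega>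
    define u where "u \<omega> = (\<Sum>\<Gamma>\<in>F. 1 * si.xp N \<Gamma> \<omega>)" for \<omega>
    have Zu: "?Z N \<omega> = 1 + u \<omega>" for \<omega> using Z_minus_1[of \<omega> N] by (simp add: u_def F_def)
    have lu: "lam N * u \<omega> = Y \<omega> + R \<omega>" for \<omega>
      unfolding u_def Y_def R_def sum_distrib_left mult_1 fam(2)
      using sum.subset_diff[OF fam(1) F(2)] by (simp add: add.commute)
    note int_u = integrable_sum_xp[of F N 1, OF F(1), folded u_def]
    have Fr: "rest N \<subseteq> Pow (all_edges N)" "fam N \<subseteq> Pow (all_edges N)" using F fam by auto
    note int_R = integrable_sum_xp[of "rest N" N "lam N", OF Fr(1), folded R_def]
    note int_Y = integrable_sum_xp[of "fam N" N "lam N", OF Fr(2), folded Y_def]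
    let ?f = "\<lambda>\<Gamma>. \<Prod>e\<in>\<Gamma>. bw N (card e)"
    have rest_le: "s ^ K * sum ?f (rest N) \<le> C / s"
      using C(2)[OF N] s by (simp add: s_def[symmetric] le_divide_eq mult_ac)
    have ER: "expectation (\<lambda>\<omega>. (R \<omega>)\<^sup>2) \<le> C / s"
      using second_moment_le[OF N Fr(1), of "lam N"] rest_le unfolding lam2 R_def by linarith
    have Eu: "expectation (\<lambda>\<omega>. (u \<omega>)\<^sup>2) \<le> (B + C) / (lam N)\<^sup>2"
    proof -
      have "s ^ K * sum ?f F = s ^ K * sum ?f (rest N) + s ^ K * sum ?f (fam N)"
        using sum.subset_diff[OF fam(1) F(2), of ?f] by (simp add: fam(2) distrib_left)
      also have "\<dots> \<le> C / s + V N"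
      proof (intro add_mono rest_le)
        have "sum ?f (fam N) \<le> sum ?f (crit K N)"
          using fam_subset by (intro sum_mono2) (auto intro!: prod_nonneg)
        then show "s ^ K * sum ?f (fam N) \<le> V N"
          unfolding V_def s_def by (rule mult_left_mono) simp
      qed
      also have "\<dots> \<le> C + B"
      proof (rule add_mono)
        show "C / s \<le> C" using C(1) s by (simp add: divide_le_eq mult_le_cancel_left1)
        show "V N \<le> B" using B(2)[of N] by linarith
      qed
      finally have "sum ?f F \<le> (B + C) / (lam N)\<^sup>2"
        using s unfolding lam2 by (simp add: le_divide_eq mult.commute add.commute)
      moreover have "expectation (\<lambda>\<omega>. (u \<omega>)\<^sup>2) \<le> 1\<^sup>2 * sum ?f F"
        unfolding u_def by (rule second_moment_le[OF N F(1)])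
      ultimately show ?thesis by simp
    qed
    have ER1: "expectation (\<lambda>\<omega>. \<bar>R \<omega>\<bar>) \<le> sqrt C * h N"
    proof -
      have intR1: "integrable M R" using int_R(2)[of 1] by simp
      have "(expectation (\<lambda>\<omega>. \<bar>R \<omega>\<bar> * 1))\<^sup>2 \<le> expectation (\<lambda>\<omega>. \<bar>R \<omega>\<bar>\<^sup>2) * expectation (\<lambda>\<omega>. 1\<^sup>2)"
        using int_R(2)[of 2] intR1 by (intro cauchy_schwarz) simp_all
      then have "(expectation (\<lambda>\<omega>. \<bar>R \<omega>\<bar>))\<^sup>2 \<le> C / s" using ER prob_space by simp
      then have "expectation (\<lambda>\<omega>. \<bar>R \<omega>\<bar>) \<le> sqrt (C / s)" by (rule real_le_rsqrt)
      also have "\<dots> = sqrt C * h N" by (simp add: h_def s_def real_sqrt_divide)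
      finally show ?thesis .
    qed
    have pt: "cmod (iexp (t * (lam N * ln (?Z N \<omega>))) - iexp (t * Y \<omega>)) \<le> (2 * (\<bar>t\<bar> * lam N) + 8) * (u \<omega>)\<^sup>2 + \<bar>t\<bar> * \<bar>R \<omega>\<bar>" for \<omega>
    proof -
      have "cmod (iexp (t * (lam N * ln (?Z N \<omega>))) - iexp (t * (lam N * u \<omega>))) \<le> min 2 \<bar>t * (lam N * ln (?Z N \<omega>)) - t * (lam N * u \<omega>)\<bar>"
        by (rule iexp_diff_le)
      also have "\<bar>t * (lam N * ln (?Z N \<omega>)) - t * (lam N * u \<omega>)\<bar> = \<bar>t * lam N * (ln (1 + u \<omega>) - u \<omega>)\<bar>"
        unfolding Zu by (simp add: algebra_simps)
      also have "\<dots> = (\<bar>t\<bar> * lam N) * \<bar>ln (1 + u \<omega>) - u \<omega>\<bar>"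
        unfolding abs_mult using lam1 by simp
      also have "min 2 \<dots> \<le> (2 * (\<bar>t\<bar> * lam N) + 8) * (u \<omega>)\<^sup>2"
        using Z_hat_pos[of \<theta> \<beta> "\<lambda>i. J i \<omega>" N] lam1 unfolding Zu by (intro ln_remainder) auto
      finally have 1: "cmod (iexp (t * (lam N * ln (?Z N \<omega>))) - iexp (t * (lam N * u \<omega>))) \<le> (2 * (\<bar>t\<bar> * lam N) + 8) * (u \<omega>)\<^sup>2" .
      have "cmod (iexp (t * (lam N * u \<omega>)) - iexp (t * Y \<omega>)) \<le> \<bar>t * (lam N * u \<omega>) - t * Y \<omega>\<bar>"
        using iexp_diff_le[of "t * (lam N * u \<omega>)" "t * Y \<omega>"] by linarith
      also have "\<dots> = \<bar>t\<bar> * \<bar>R \<omega>\<bar>" unfolding lu abs_mult[symmetric] by (simp add: distrib_left)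
      finally show ?thesis
        using 1 norm_triangle_ineq[of "iexp (t * (lam N * ln (?Z N \<omega>))) - iexp (t * (lam N * u \<omega>))" "iexp (t * (lam N * u \<omega>)) - iexp (t * Y \<omega>)"]
        by simp
    qed
    have intE: "integrable M (\<lambda>\<omega>. iexp (f \<omega>))" if "f \<in> borel_measurable M" for f :: "'a \<Rightarrow> real"
    proof (rule integrable_bounded[where B=1])
      show "(\<lambda>\<omega>. iexp (f \<omega>)) \<in> borel_measurable M" using that by measurable
    qed simp
    have mZ: "(\<lambda>\<omega>. t * (lam N * ln (?Z N \<omega>))) \<in> borel_measurable M"
      using Z_hat_meas[of N] by measurable
    have mY: "(\<lambda>\<omega>. t * Y \<omega>) \<in> borel_measurable M" using int_Y(1) by measurable
    have int_rhs: "integrable M (\<lambda>\<omega>. (2 * (\<bar>t\<bar> * lam N) + 8) * (u \<omega>)\<^sup>2 + \<bar>t\<bar> * \<bar>R \<omega>\<bar>)"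
      using int_u(2)[of 2] int_R(2)[of 1] by simp
    have "cmod (expectation (\<lambda>\<omega>. iexp (t * (lam N * ln (?Z N \<omega>)))) - expectation (\<lambda>\<omega>. iexp (t * Y \<omega>)))
       = cmod (expectation (\<lambda>\<omega>. iexp (t * (lam N * ln (?Z N \<omega>))) - iexp (t * Y \<omega>)))"
      using intE[OF mZ] intE[OF mY] by (simp add: Bochner_Integration.integral_diff)
    also have "\<dots> \<le> expectation (\<lambda>\<omega>. (2 * (\<bar>t\<bar> * lam N) + 8) * (u \<omega>)\<^sup>2 + \<bar>t\<bar> * \<bar>R \<omega>\<bar>)"
      using intE[OF mZ] intE[OF mY] int_rhs pt by (intro expectation_mono_bound Bochner_Integration.integrable_diff) auto
    also have "\<dots> = (2 * (\<bar>t\<bar> * lam N) + 8) * expectation (\<lambda>\<omega>. (u \<omega>)\<^sup>2) + \<bar>t\<bar> * expectation (\<lambda>\<omega>. \<bar>R \<omega>\<bar>)"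
      using int_u(2)[of 2] int_R(2)[of 1] by simp
    also have "\<dots> \<le> (2 * \<bar>t\<bar> + 8) * (B + C) * h N + \<bar>t\<bar> * (sqrt C * h N)"
    proof (intro add_mono mult_left_mono ER1)
      have "(2 * (\<bar>t\<bar> * lam N) + 8) * expectation (\<lambda>\<omega>. (u \<omega>)\<^sup>2) \<le> ((2 * \<bar>t\<bar> + 8) * lam N) * ((B + C) / (lam N)\<^sup>2)"
        using lam1 B(1) C(1) Eu by (intro mult_mono) (auto simp: algebra_simps)
      also have "\<dots> = (2 * \<bar>t\<bar> + 8) * (B + C) * (1 / lam N)" using lam1 by (simp add: power2_eq_square)
      also have "\<dots> \<le> (2 * \<bar>t\<bar> + 8) * (B + C) * h N"
        unfolding h_def s_def[symmetric] using lam_ge lam1 sqs B(1) C(1)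
        by (intro mult_left_mono divide_left_mono mult_pos_pos mult_nonneg_nonneg) linarith+
      finally show "(2 * (\<bar>t\<bar> * lam N) + 8) * expectation (\<lambda>\<omega>. (u \<omega>)\<^sup>2) \<le> (2 * \<bar>t\<bar> + 8) * (B + C) * h N" .
    qed simp
    finally have A: "cmod (expectation (\<lambda>\<omega>. iexp (t * (lam N * ln (?Z N \<omega>)))) - expectation (\<lambda>\<omega>. iexp (t * Y \<omega>)))
       \<le> (2 * \<bar>t\<bar> + 8) * (B + C) * h N + \<bar>t\<bar> * (sqrt C * h N)" .
    have "err / s = err * (h N)\<^sup>2" using s by (simp add: h_def s_def power_divide)
    then have D: "cmod (expectation (\<lambda>\<omega>. iexp (t * Y \<omega>)) - complex_of_real (exp (- (t\<^sup>2 * var N / 2)))) \<le> err * (h N)\<^sup>2"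
      using main_family.char_main_family[OF mf, of t] unfolding main_family.s_def[OF mf]
      by (simp add: Y_def err_def var_def s_def)
    have G: "cmod (complex_of_real (exp (- (t\<^sup>2 * var N / 2))) - complex_of_real (exp (- (t\<^sup>2 * v / 2)))) \<le> \<bar>exp (- (t\<^sup>2 * var N / 2)) - exp (- (t\<^sup>2 * v / 2))\<bar>"
      unfolding of_real_diff[symmetric] norm_of_real by simp
    show ?thesis unfolding bound_def by (rule norm_diff_triangle3[OF A D G])
  qed
  have h: "h \<longlonglongrightarrow> 0"
  proof -
    have "filterlim (\<lambda>N. sqrt (sqrt (real N))) at_top sequentially"
      by (intro filterlim_compose[OF sqrt_at_top] filterlim_real_sequentially)
    then have "(\<lambda>N. inverse (sqrt (sqrt (real N)))) \<longlonglongrightarrow> 0" by (rule tendsto_inverse_0_at_top)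
    then show ?thesis by (simp only: h_def[abs_def] inverse_eq_divide)
  qed
  have "bound \<longlonglongrightarrow> (2 * \<bar>t\<bar> + 8) * (B + C) * 0 + \<bar>t\<bar> * (sqrt C * 0) + err * 0\<^sup>2 + \<bar>exp (- (t\<^sup>2 * v / 2)) - exp (- (t\<^sup>2 * v / 2))\<bar>"
    unfolding bound_def[abs_def] by (intro tendsto_intros h var_lim) auto
  then have bound: "bound \<longlonglongrightarrow> 0" by simp
  have "(\<lambda>N. expectation (\<lambda>\<omega>. iexp (t * (lam N * ln (?Z N \<omega>)))) - complex_of_real (exp (- (t\<^sup>2 * v / 2)))) \<longlonglongrightarrow> 0"
  proof (rule Lim_null_comparison[OF _ bound])
    show "\<forall>\<^sub>F N in sequentially. norm (expectation (\<lambda>\<omega>. iexp (t * (lam N * ln (?Z N \<omega>)))) - complex_of_real (exp (- (t\<^sup>2 * v / 2)))) \<le> bound N"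
      using main_family_eventually eventually_ge_at_top[of 1] by eventually_elim (rule step)
  qed
  then show ?thesis by (rule LIM_zero_cancel)
qed

theorem log_partition_CLT:
  "converges_in_distribution_to M (\<lambda>N \<omega>. real N powr (real K / 4) * ln (Z_hat \<theta> \<beta> (\<lambda>i. J i \<omega>) N)) (centred_normal v)"
  unfolding converges_in_distribution_to_def
proof (rule levy_continuity)
  have meas: "(\<lambda>\<omega>. real N powr (real K / 4) * ln (Z_hat \<theta> \<beta> (\<lambda>i. J i \<omega>) N)) \<in> borel_measurable M" for N
    using Z_hat_meas[of N] by measurable
  show "real_distribution (distr M borel (\<lambda>\<omega>. real N powr (real K / 4) * ln (Z_hat \<theta> \<beta> (\<lambda>i. J i \<omega>) N)))" for N
    by (rule real_distribution_distr[OF meas])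
  interpret G: real_distribution gauss by (rule real_dist_normal_dist)
  show "real_distribution (centred_normal v)"
    unfolding centred_normal_def by (rule G.real_distribution_distr) simp
  fix t
  have lam_powr: "real N powr (real K / 4) = lam N" for N
  proof (cases "N = 0")
    case False
    have "real N powr (real K / 4) = real N powr (1 / 2 * real K * (1 / 2))" by simp
    also have "\<dots> = lam N"
      using False by (simp only: powr_powr[symmetric] powr_realpow[symmetric] powr_half_sqrt) (simp add: lam_def powr_realpow powr_half_sqrt)
    finally show ?thesis .
  qed (use K in \<open>simp add: lam_def\<close>)
  have "char (distr M borel (\<lambda>\<omega>. real N powr (real K / 4) * ln (Z_hat \<theta> \<beta> (\<lambda>i. J i \<omega>) N))) t
     = expectation (\<lambda>\<omega>. iexp (t * (lam N * ln (Z_hat \<theta> \<beta> (\<lambda>i. J i \<omega>) N))))" for N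
    unfolding char_def using meas[of N] by (subst integral_distr) (auto simp: lam_powr)
  then show "(\<lambda>N. char (distr M borel (\<lambda>\<omega>. real N powr (real K / 4) * ln (Z_hat \<theta> \<beta> (\<lambda>i. J i \<omega>) N))) t) \<longlonglongrightarrow> char (centred_normal v) t"
    unfolding char_centred_normal[OF v_nonneg] using char_limit[of t] by simp
qed

end

section \<open>The three regimes\<close>

lemma powr_half_nat: "0 < y \<Longrightarrow> y powr (real n / 2) = sqrt y ^ n"
proof -
  assume y: "0 < y"
  have "y powr (real n / 2) = (y powr (1 / 2)) powr real n" by (simp add: powr_powr)
  also have "\<dots> = sqrt y ^ n" using y by (simp add: powr_half_sqrt powr_realpow)
  finally show ?thesis .
qed

lemma hermite_explicit: "hermite 2 y = y\<^sup>2 - 1" "hermite 3 y = y ^ 3 - 3 * y" "hermite 4 y = y ^ 4 - 6 * y\<^sup>2 + 3"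
proof -
  have 2: "hermite (Suc (Suc 0)) y = y\<^sup>2 - 1" by (simp add: power2_eq_square)
  then show "hermite 2 y = y\<^sup>2 - 1" by (simp add: numeral_2_eq_2)
  have 3: "hermite (Suc (Suc (Suc 0))) y = y ^ 3 - 3 * y" by (simp add: power3_eq_cube algebra_simps)
  then show "hermite 3 y = y ^ 3 - 3 * y" by (simp add: numeral_3_eq_3)
  have "hermite (Suc (Suc (Suc (Suc 0)))) y = y * (y ^ 3 - 3 * y) - 3 * (y\<^sup>2 - 1)"
    unfolding hermite.simps(3)[of "Suc (Suc 0)"] 2 3 by simp
  also have "\<dots> = y ^ 4 - 6 * y\<^sup>2 + 3" by (simp add: power4_eq_xxxx power3_eq_cube power2_eq_square algebra_simps)
  finally show "hermite 4 y = y ^ 4 - 6 * y\<^sup>2 + 3" by (simp add: eval_nat_numeral)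
qed

lemma hermite_power_integrable: "integrable gauss (\<lambda>x. hermite p x ^ n)" "integrable gauss (\<lambda>x. hermite p x * hermite r x ^ n)"
proof -
  have "poly_like (\<lambda>x. hermite p x ^ n)" for p n
  proof (induction n)
    case 0
    then show ?case using poly_like_one by simp
  next
    case (Suc n)
    then show ?case using poly_like_hermite[OF Suc, of p] by simp
  qed
  then show "integrable gauss (\<lambda>x. hermite p x ^ n)" "integrable gauss (\<lambda>x. hermite p x * hermite r x ^ n)"
    by (auto intro!: poly_like_integrable poly_like_hermite)
qed

text \<open>Rearranged into powers of the edge weights, the form in which the limits of the counts appear.\<close>

lemma v_sq_scaled:
  "v_sq \<theta> \<beta> i j = (\<beta>\<^sup>2 * (\<theta> (min_even \<theta>))\<^sup>2) ^ i * (\<beta>\<^sup>2 * (\<theta> (min_odd \<theta>))\<^sup>2) ^ j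
     * ((\<integral>x. hermite i (hermite (min_even \<theta>) x / sqrt (fact (min_even \<theta>))) * hermite j (hermite (min_odd \<theta>) x / sqrt (fact (min_odd \<theta>))) \<partial>gauss)
       / (fact i * fact j * sqrt (fact (min_even \<theta>)) ^ i * sqrt (fact (min_odd \<theta>)) ^ j))"
proof -
  have "\<beta> ^ (2 * (i + j)) * \<theta> (min_even \<theta>) ^ (2 * i) * \<theta> (min_odd \<theta>) ^ (2 * j)
     = (\<beta>\<^sup>2 * (\<theta> (min_even \<theta>))\<^sup>2) ^ i * (\<beta>\<^sup>2 * (\<theta> (min_odd \<theta>))\<^sup>2) ^ j"
    unfolding distrib_left power_add power_mult power_mult_distrib by (simp only: mult_ac)
  then show ?thesis unfolding v_sq_def Let_def by (simp only: powr_half_nat fact_gt_zero times_divide_eq_left times_divide_eq_right)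
qed

lemma v_sq_3_0:
  assumes "1 \<le> min_even \<theta>"
  shows "v_sq \<theta> \<beta> 3 0 = (\<beta>\<^sup>2 * (\<theta> (min_even \<theta>))\<^sup>2) ^ 3 * ((\<integral>x. hermite (min_even \<theta>) x ^ 3 \<partial>gauss) / (6 * fact (min_even \<theta>) ^ 3))"
proof -
  define p where "p = min_even \<theta>"
  define s :: real where "s = sqrt (fact p)"
  have s: "0 < s" "s\<^sup>2 = fact p" by (simp_all add: s_def)
  have "(\<integral>x. hermite 3 (hermite p x / s) \<partial>gauss) = (\<integral>x. hermite p x ^ 3 / s ^ 3 - 3 / s * hermite p x ^ 1 \<partial>gauss)"
    by (simp add: hermite_explicit power_divide)
  also have "\<dots> = (\<integral>x. hermite p x ^ 3 \<partial>gauss) / s ^ 3 - 3 / s * (\<integral>x. hermite p x ^ 1 \<partial>gauss)"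
    using hermite_power_integrable(1)[of p 3] hermite_power_integrable(1)[of p 1]
    by (subst Bochner_Integration.integral_diff) simp_all
  also have "\<dots> = (\<integral>x. hermite p x ^ 3 \<partial>gauss) / s ^ 3" using assms by (simp add: gauss_hermite p_def)
  finally have 1: "(\<integral>x. hermite 3 (hermite p x / s) \<partial>gauss) = (\<integral>x. hermite p x ^ 3 \<partial>gauss) / s ^ 3" .
  have 2: "s ^ 3 * s ^ 3 = (s\<^sup>2) ^ 3" by (simp only: power_add[symmetric] power_mult[symmetric]) simp
  show ?thesis
    unfolding v_sq_scaled p_def[symmetric] s_def[symmetric] unfolding s(2)[symmetric] 2[symmetric] using 1 s(1)
    by (simp add: fact_numeral mult.commute)
qed

text \<open>The lower-order term of the second Hermite polynomial drops out, as a Hermite polynomial of positive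
degree has mean zero.\<close>

lemma v_sq_1_2:
  assumes "1 \<le> min_even \<theta>"
  shows "v_sq \<theta> \<beta> 1 2 = (\<beta>\<^sup>2 * (\<theta> (min_even \<theta>))\<^sup>2) * (\<beta>\<^sup>2 * (\<theta> (min_odd \<theta>))\<^sup>2) ^ 2
    * ((\<integral>x. hermite (min_even \<theta>) x * hermite (min_odd \<theta>) x ^ 2 \<partial>gauss) / (2 * fact (min_even \<theta>) * fact (min_odd \<theta>) ^ 2))"
proof -
  define p where "p = min_even \<theta>"
  define r where "r = min_odd \<theta>"
  define s :: real where "s = sqrt (fact p)"
  define w :: real where "w = sqrt (fact r)"
  have s: "0 < s" "s\<^sup>2 = fact p" by (simp_all add: s_def)
  have w: "0 < w" "w\<^sup>2 = fact r" by (simp_all add: w_def)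
  have "(\<integral>x. hermite 1 (hermite p x / s) * hermite 2 (hermite r x / w) \<partial>gauss)
      = (\<integral>x. hermite p x * hermite r x ^ 2 / (s * w\<^sup>2) - 1 / s * hermite p x ^ 1 \<partial>gauss)"
    by (simp add: hermite_explicit power_divide right_diff_distrib)
  also have "\<dots> = (\<integral>x. hermite p x * hermite r x ^ 2 \<partial>gauss) / (s * w\<^sup>2) - 1 / s * (\<integral>x. hermite p x ^ 1 \<partial>gauss)"
    using hermite_power_integrable(2)[of p r 2] hermite_power_integrable(1)[of p 1]
    by (subst Bochner_Integration.integral_diff) simp_all
  also have "\<dots> = (\<integral>x. hermite p x * hermite r x ^ 2 \<partial>gauss) / (s * w\<^sup>2)" using assms by (simp add: gauss_hermite p_def)
  finally have 1: "(\<integral>x. hermite 1 (hermite p x / s) * hermite 2 (hermite r x / w) \<partial>gauss) = (\<integral>x. hermite p x * hermite r x ^ 2 \<partial>gauss) / (s * w\<^sup>2)" .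
  show ?thesis
    unfolding v_sq_scaled p_def[symmetric] r_def[symmetric] s_def[symmetric] w_def[symmetric] unfolding s(2)[symmetric] w(2)[symmetric] 1
    by (simp add: fact_numeral power2_eq_square mult_ac)
qed

text \<open>The second moment of a Hermite polynomial is a factorial, so the lower-order terms combine to the
subtracted pairings in the count of quadruples.\<close>

lemma v_sq_0_4:
  "v_sq \<theta> \<beta> 0 4 = (\<beta>\<^sup>2 * (\<theta> (min_odd \<theta>))\<^sup>2) ^ 4
    * (((\<integral>x. hermite (min_odd \<theta>) x ^ 4 \<partial>gauss) / fact (min_odd \<theta>) ^ 4 - 3 / (fact (min_odd \<theta>))\<^sup>2) / 24)"
proof -
  define r where "r = min_odd \<theta>"
  define w :: real where "w = sqrt (fact r)"
  have w: "0 < w" "w\<^sup>2 = fact r" by (simp_all add: w_def)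
  interpret G: prob_space gauss by (rule prob_space_normal_density) simp
  have sq: "(\<integral>x. hermite r x ^ 2 \<partial>gauss) = w\<^sup>2"
    using gauss_hermite_orthogonal[of r r] by (simp add: power2_eq_square[of "hermite r _"] w)
  have "(\<integral>x. hermite 4 (hermite r x / w) \<partial>gauss) = (\<integral>x. hermite r x ^ 4 / w ^ 4 - 6 / w\<^sup>2 * hermite r x ^ 2 + 3 \<partial>gauss)"
    by (simp add: hermite_explicit power_divide)
  also have "\<dots> = (\<integral>x. hermite r x ^ 4 \<partial>gauss) / w ^ 4 - 6 / w\<^sup>2 * (\<integral>x. hermite r x ^ 2 \<partial>gauss) + 3"
    using hermite_power_integrable(1)[of r 4] hermite_power_integrable(1)[of r 2] G.prob_space by simp
  also have "\<dots> = (\<integral>x. hermite r x ^ 4 \<partial>gauss) / w ^ 4 - 3" using w(1) unfolding sq by simp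
  finally have 1: "(\<integral>x. hermite 4 (hermite r x / w) \<partial>gauss) = (\<integral>x. hermite r x ^ 4 \<partial>gauss) / w ^ 4 - 3" .
  have 2: "(w\<^sup>2) ^ 4 = w ^ 4 * w ^ 4" "(w\<^sup>2)\<^sup>2 = w ^ 4" by (simp_all add: power_add[symmetric] power_mult[symmetric])
  show ?thesis
    unfolding v_sq_scaled r_def[symmetric] w_def[symmetric] unfolding w(2)[symmetric] 2 using 1
    by (simp add: fact_numeral diff_divide_distrib mult.commute)
qed

locale mixed_model = spin_model +
  assumes even_ex: "\<exists>p. even p \<and> 4 \<le> p \<and> \<theta> p \<noteq> 0" and odd_ex: "\<exists>p. odd p \<and> 3 \<le> p \<and> \<theta> p \<noteq> 0"
begin

abbreviation pe :: nat where "pe \<equiv> min_even \<theta>"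

abbreviation po :: nat where "po \<equiv> min_odd \<theta>"

lemma pe: "even pe" "4 \<le> pe" "\<theta> pe \<noteq> 0" "even p \<Longrightarrow> 3 \<le> p \<Longrightarrow> \<theta> p \<noteq> 0 \<Longrightarrow> pe \<le> p"
proof -
  show "even pe" "4 \<le> pe" "\<theta> pe \<noteq> 0" unfolding min_even_def using LeastI_ex[OF even_ex] by auto
  assume p: "even p" "3 \<le> p" "\<theta> p \<noteq> 0"
  then have "even p \<and> 4 \<le> p \<and> \<theta> p \<noteq> 0" by presburger
  then show "pe \<le> p" unfolding min_even_def by (rule Least_le)
qed

lemma po: "odd po" "3 \<le> po" "\<theta> po \<noteq> 0" "odd p \<Longrightarrow> 3 \<le> p \<Longrightarrow> \<theta> p \<noteq> 0 \<Longrightarrow> po \<le> p"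
proof -
  show "odd po" "3 \<le> po" "\<theta> po \<noteq> 0" unfolding min_odd_def using LeastI_ex[OF odd_ex] by auto
  assume p: "odd p" "3 \<le> p" "\<theta> p \<noteq> 0"
  then show "po \<le> p" unfolding min_odd_def by (intro Least_le) simp
qed

text \<open>The number \<open>d\<close> of odd edges is even, since the edge sizes add up to the sum of the even
degrees. For given \<open>d\<close> the weight is minimal precisely if all edges have the minimal size of their
parity.\<close>

lemma closed_type:
  assumes \<Gamma>: "\<Gamma> \<in> closed_sets N n" and \<theta>: "\<And>e. e \<in> \<Gamma> \<Longrightarrow> \<theta> (card e) \<noteq> 0"
    and d: "d = card {e \<in> \<Gamma>. odd (card e)}"
  shows "even d" "d \<le> n" "d * (po - 2) + (n - d) * (pe - 2) \<le> weight \<Gamma>"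
    "weight \<Gamma> = d * (po - 2) + (n - d) * (pe - 2) \<Longrightarrow> e \<in> \<Gamma> \<Longrightarrow> card e = (if odd (card e) then po else pe)"
proof -
  have sub: "\<Gamma> \<subseteq> all_edges N" and n: "card \<Gamma> = n" and cl: "bd \<Gamma> = {}" using \<Gamma> by (auto simp: closed_sets_def)
  have fin: "finite \<Gamma>" using sub by (rule finite_subset) simp
  have fe: "finite e" if "e \<in> \<Gamma>" for e using that sub finite_edge by auto
  have ge3: "3 \<le> card e" if "e \<in> \<Gamma>" for e using that sub by (auto simp: all_edges_def)
  define m where "m e = (if odd (card e) then po else pe)" for e :: "nat set"
  have m: "m e \<le> card e" "3 \<le> m e" if "e \<in> \<Gamma>" for e
    using that pe(2) po(2) pe(4)[of "card e"] po(4)[of "card e"] \<theta> ge3 by (auto simp: m_def)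
  have "even (\<Sum>e\<in>\<Gamma>. card e)" by (rule closed_even_sum_card[OF fin fe cl])
  then show "even d" using fin unfolding d by (simp add: even_sum_iff)
  show "d \<le> n" unfolding d n[symmetric] using fin by (intro card_mono) auto
  have "(\<Sum>e\<in>\<Gamma>. m e - 2) = (\<Sum>e\<in>{e \<in> \<Gamma>. odd (card e)}. m e - 2) + (\<Sum>e\<in>\<Gamma> - {e \<in> \<Gamma>. odd (card e)}. m e - 2)"
    using fin by (subst sum.subset_diff[of "{e \<in> \<Gamma>. odd (card e)}" \<Gamma>]) (auto simp: add.commute)
  also have "(\<Sum>e\<in>{e \<in> \<Gamma>. odd (card e)}. m e - 2) = d * (po - 2)" by (simp add: m_def d)
  also have "(\<Sum>e\<in>\<Gamma> - {e \<in> \<Gamma>. odd (card e)}. m e - 2) = (n - d) * (pe - 2)"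
    using fin by (simp add: m_def d n[symmetric] card_Diff_subset)
  finally have sm: "(\<Sum>e\<in>\<Gamma>. m e - 2) = d * (po - 2) + (n - d) * (pe - 2)" .
  have le: "m e - 2 \<le> card e - 2" if "e \<in> \<Gamma>" for e using m[OF that] by linarith
  then show "d * (po - 2) + (n - d) * (pe - 2) \<le> weight \<Gamma>"
    unfolding sm[symmetric] weight_def by (rule sum_mono)
  assume eq: "weight \<Gamma> = d * (po - 2) + (n - d) * (pe - 2)" and e: "e \<in> \<Gamma>"
  have "m e - 2 = card e - 2"
    using sum_mono_inv[of "\<lambda>e. m e - 2" \<Gamma> "\<lambda>e. card e - 2" e] eq le e fin unfolding sm[symmetric] weight_def by auto
  then show "card e = (if odd (card e) then po else pe)" using m[OF e] unfolding m_def by linarith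
qed

lemma closed_of_crit:
  assumes "3 \<le> p" "\<theta> p \<noteq> 0" "n = 3 \<or> n = 4" "K = n * (p - 2)"
  shows "closed_of N p n \<subseteq> crit K N"
proof
  fix \<Gamma> assume "\<Gamma> \<in> closed_of N p n"
  then have \<Gamma>: "\<Gamma> \<subseteq> edges N p" "card \<Gamma> = n" "bd \<Gamma> = {}" by (auto simp: closed_of_def)
  have c: "card e = p" if "e \<in> \<Gamma>" for e using that \<Gamma> by (auto simp: edges_def)
  have "\<Gamma> \<subseteq> all_edges N" using \<Gamma>(1) assms(1) by (auto simp: edges_def all_edges_def)
  moreover have "weight \<Gamma> = K" using c \<Gamma>(2) assms(4) by (simp add: weight_def)
  ultimately show "\<Gamma> \<in> crit K N" using \<Gamma> c assms by (auto simp: crit_def closed_sets_def)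
qed

lemma in_closed_of:
  assumes "\<Gamma> \<in> closed_sets N n" "\<And>e. e \<in> \<Gamma> \<Longrightarrow> card e = p"
  shows "\<Gamma> \<in> closed_of N p n"
  using assms by (auto simp: closed_sets_def closed_of_def edges_def all_edges_def)

lemma closed_mixed_crit: "closed_mixed N pe po \<subseteq> crit ((pe - 2) + 2 * (po - 2)) N"
proof
  fix \<Gamma> assume "\<Gamma> \<in> closed_mixed N pe po"
  then obtain e \<Gamma>' where e: "e \<in> edges N pe" and \<Gamma>': "\<Gamma>' \<subseteq> edges N po" "card \<Gamma>' = 2" and \<Gamma>: "\<Gamma> = insert e \<Gamma>'" "bd \<Gamma> = {}"
    by (auto simp: closed_mixed_def)
  have c: "card f = po" if "f \<in> \<Gamma>'" for f using that \<Gamma>' by (auto simp: edges_def)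
  have ce: "card e = pe" using e by (simp add: edges_def)
  have fin: "finite \<Gamma>'" using \<Gamma>'(2) card.infinite by fastforce
  have ne: "e \<notin> \<Gamma>'" using c ce pe(1) po(1) by auto
  have "\<Gamma> \<subseteq> all_edges N" using e \<Gamma>' \<Gamma> pe(2) po(2) by (auto simp: edges_def all_edges_def)
  moreover have "card \<Gamma> = 3" using ne fin \<Gamma>'(2) \<Gamma> by simp
  moreover have "weight \<Gamma> = (pe - 2) + 2 * (po - 2)" using ne fin c ce \<Gamma>'(2) \<Gamma> by (simp add: weight_def)
  moreover have "\<forall>f\<in>\<Gamma>. \<theta> (card f) \<noteq> 0" using c ce pe(3) po(3) \<Gamma>(1) by auto
  ultimately show "\<Gamma> \<in> crit ((pe - 2) + 2 * (po - 2)) N" using \<Gamma>(2) by (auto simp: crit_def closed_sets_def)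
qed

lemma in_closed_mixed:
  assumes \<Gamma>: "\<Gamma> \<in> closed_sets N 3" and two: "card {e \<in> \<Gamma>. odd (card e)} = 2"
    and c: "\<And>e. e \<in> \<Gamma> \<Longrightarrow> card e = (if odd (card e) then po else pe)"
  shows "\<Gamma> \<in> closed_mixed N pe po"
proof -
  define Od where "Od = {e \<in> \<Gamma>. odd (card e)}"
  have \<Gamma>': "\<Gamma> \<subseteq> all_edges N" "card \<Gamma> = 3" "bd \<Gamma> = {}" using \<Gamma> by (auto simp: closed_sets_def)
  have fin: "finite \<Gamma>" using \<Gamma>'(1) by (rule finite_subset) simp
  have Od: "Od \<subseteq> \<Gamma>" "card Od = 2" using two by (auto simp: Od_def)
  have "card (\<Gamma> - Od) = 1" using Od \<Gamma>'(2) fin finite_subset[OF Od(1) fin] by (simp add: card_Diff_subset)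
  then obtain e where e: "\<Gamma> - Od = {e}" by (auto simp: card_1_singleton_iff)
  then have "e \<in> \<Gamma>" "even (card e)" by (auto simp: Od_def)
  then have "card e = pe" "e \<in> all_edges N" using c[of e] \<Gamma>'(1) by auto
  then have "e \<in> edges N pe" by (simp add: edges_def all_edges_def)
  moreover have "Od \<subseteq> edges N po"
  proof
    fix f assume "f \<in> Od"
    then have "f \<in> \<Gamma>" "odd (card f)" by (auto simp: Od_def)
    then have "card f = po" "f \<in> all_edges N" using c[of f] \<Gamma>'(1) by auto
    then show "f \<in> edges N po" by (simp add: edges_def all_edges_def)
  qed
  moreover have "\<Gamma> = insert e Od" using e Od(1) by auto
  ultimately show ?thesis using Od(2) \<Gamma>'(3) unfolding closed_mixed_def by blast
qed

text \<open>With \<open>a = pe - 2\<close> and \<open>b = po - 2\<close> the possible minimal weights are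
\<open>3 * a\<close>, \<open>a + 2 * b\<close>, \<open>4 * a\<close>, \<open>2 * a + 2 * b\<close> and
\<open>4 * b\<close>. For \<open>a < b\<close> the first is the smallest.\<close>

lemma leading_order_even:
  assumes lt: "pe < po"
  shows "leading_order M J \<theta> \<beta> (3 * (pe - 2)) pe (v_mix1_sq \<theta> \<beta>)"
proof (unfold_locales)
  show "1 \<le> 3 * (pe - 2)" "3 * (pe - 2) + 1 \<le> 5 * (pe - 2)" "3 \<le> pe" using pe(2) by auto
  show "\<theta> p = 0" if "3 \<le> p" "p < pe" for p
    using that pe(4)[of p] po(4)[of p] lt by (cases "even p") auto
  have type: "3 * (pe - 2) \<le> weight \<Gamma> \<and> (weight \<Gamma> = 3 * (pe - 2) \<longrightarrow> \<Gamma> \<in> closed_of N pe 3)"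
    if \<Gamma>: "\<Gamma> \<in> closed_sets N n" and n: "n \<in> {3, 4}" and \<theta>: "\<And>e. e \<in> \<Gamma> \<Longrightarrow> \<theta> (card e) \<noteq> 0" for N n \<Gamma>
  proof -
    define d where "d = card {e \<in> \<Gamma>. odd (card e)}"
    note ty = closed_type[OF \<Gamma> \<theta> d_def]
    have "finite \<Gamma>" by (rule finite_subset[of _ "all_edges N"]) (use \<Gamma> in \<open>auto simp: closed_sets_def\<close>)
    then have d0: "even (card e)" if "d = 0" "e \<in> \<Gamma>" for e using that by (auto simp: d_def)
    consider "n = 3" "d = 0" | "n = 3" "d = 2" | "n = 4" "d = 0" | "n = 4" "d = 2" | "n = 4" "d = 4"
      using n ty(1,2) by fastforce
    then show ?thesis
    proof cases
      case 1
      then have "card e = pe" if "weight \<Gamma> = 3 * (pe - 2)" "e \<in> \<Gamma>" for e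
        using ty(4)[of e] d0[of e] that by simp
      then show ?thesis using ty(3) 1 \<Gamma> in_closed_of[of \<Gamma> N 3 pe] by auto
    qed (use ty(3) lt pe(2) in auto)
  qed
  show "3 * (pe - 2) \<le> weight \<Gamma>"
    if "\<Gamma> \<in> closed_sets N n" "n \<in> {3, 4}" "\<And>e. e \<in> \<Gamma> \<Longrightarrow> \<theta> (card e) \<noteq> 0" for N n \<Gamma>
    using type[OF that] by simp
  have "crit (3 * (pe - 2)) N = closed_of N pe 3" for N
  proof
    show "closed_of N pe 3 \<subseteq> crit (3 * (pe - 2)) N" using pe by (intro closed_of_crit) auto
    show "crit (3 * (pe - 2)) N \<subseteq> closed_of N pe 3"
    proof
      fix \<Gamma> assume "\<Gamma> \<in> crit (3 * (pe - 2)) N"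
      then have "\<Gamma> \<in> closed_sets N 3 \<or> \<Gamma> \<in> closed_sets N 4" "\<And>e. e \<in> \<Gamma> \<Longrightarrow> \<theta> (card e) \<noteq> 0" "weight \<Gamma> = 3 * (pe - 2)"
        by (auto simp: crit_def)
      then show "\<Gamma> \<in> closed_of N pe 3" using type[of \<Gamma> N 3] type[of \<Gamma> N 4] by auto
    qed
  qed
  then show "(\<lambda>N. sqrt (real N) ^ (3 * (pe - 2)) * (\<Sum>\<Gamma>\<in>crit (3 * (pe - 2)) N. \<Prod>e\<in>\<Gamma>. bw N (card e))) \<longlonglongrightarrow> v_mix1_sq \<theta> \<beta>"
    using closed_of_weight_limit[of pe 3, OF _ closed_3_limit] pe(2) v_sq_3_0[of \<theta> \<beta>] by (simp add: v_mix1_sq_def)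
qed

text \<open>For \<open>b < a \<le> 2 * b\<close> the smallest weight is \<open>a + 2 * b\<close>, from one
even and two odd edges. It is attained by four odd edges as well if \<open>a = 2 * b\<close>, and then both
kinds contribute to the variance. By parity \<open>pe < 2 * po\<close> already means
\<open>a \<le> 2 * b\<close>.\<close>

lemma leading_order_mixed:
  assumes lt: "po < pe" "pe < 2 * po"
  shows "leading_order M J \<theta> \<beta> ((pe - 2) + 2 * (po - 2)) po (v_mix2_sq \<theta> \<beta>)"
proof (unfold_locales)
  let ?K = "(pe - 2) + 2 * (po - 2)"
  have pp: "pe \<le> 2 * (po - 1)" using lt(2) pe(1) by (auto elim!: evenE)
  show "1 \<le> ?K" "?K + 1 \<le> 5 * (po - 2)" "3 \<le> po" using pe(2) po(2) pp by auto
  show "\<theta> p = 0" if "3 \<le> p" "p < po" for p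
    using that pe(4)[of p] po(4)[of p] lt by (cases "even p") auto
  have type: "?K \<le> weight \<Gamma> \<and> (weight \<Gamma> = ?K \<longrightarrow> \<Gamma> \<in> closed_mixed N pe po \<or> pe = 2 * (po - 1) \<and> \<Gamma> \<in> closed_of N po 4)"
    if \<Gamma>: "\<Gamma> \<in> closed_sets N n" and n: "n \<in> {3, 4}" and \<theta>: "\<And>e. e \<in> \<Gamma> \<Longrightarrow> \<theta> (card e) \<noteq> 0" for N n \<Gamma>
  proof -
    define d where "d = card {e \<in> \<Gamma>. odd (card e)}"
    note ty = closed_type[OF \<Gamma> \<theta> d_def]
    have fin: "finite \<Gamma>" by (rule finite_subset[of _ "all_edges N"]) (use \<Gamma> in \<open>auto simp: closed_sets_def\<close>)
    have dn: "odd (card e)" if "d = n" "e \<in> \<Gamma>" for e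
    proof -
      have "{e \<in> \<Gamma>. odd (card e)} = \<Gamma>" using that(1) \<Gamma> fin by (intro card_subset_eq) (auto simp: d_def closed_sets_def)
      then show ?thesis using that(2) by blast
    qed
    consider "n = 3" "d = 0" | "n = 3" "d = 2" | "n = 4" "d = 0" | "n = 4" "d = 2" | "n = 4" "d = 4"
      using n ty(1,2) by fastforce
    then show ?thesis
    proof cases
      case 2
      have "\<Gamma> \<in> closed_mixed N pe po" if "weight \<Gamma> = ?K"
        using in_closed_mixed[of \<Gamma> N] \<Gamma> 2 ty(4) that by (simp add: d_def)
      then show ?thesis using ty(3) 2 by auto
    next
      case 5
      have "pe = 2 * (po - 1) \<and> \<Gamma> \<in> closed_of N po 4" if w: "weight \<Gamma> = ?K"
      proof
        show eq: "pe = 2 * (po - 1)" using ty(3) 5 w pp po(2) by simp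
        have "card e = po" if "e \<in> \<Gamma>" for e
          using ty(4)[of e] dn[of e] that w 5 eq po(2) by (simp add: diff_mult_distrib2)
        then show "\<Gamma> \<in> closed_of N po 4" using in_closed_of[of \<Gamma> N 4 po] \<Gamma> 5 by auto
      qed
      then show ?thesis using ty(3) 5 pp po(2) by auto
    qed (use ty(3) lt po(2) in auto)
  qed
  show "?K \<le> weight \<Gamma>"
    if "\<Gamma> \<in> closed_sets N n" "n \<in> {3, 4}" "\<And>e. e \<in> \<Gamma> \<Longrightarrow> \<theta> (card e) \<noteq> 0" for N n \<Gamma>
    using type[OF that] by simp
  have sub: "crit ?K N \<subseteq> closed_mixed N pe po \<union> (if pe = 2 * (po - 1) then closed_of N po 4 else {})" for N
  proof
    fix \<Gamma> assume "\<Gamma> \<in> crit ?K N"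
    then have "\<Gamma> \<in> closed_sets N 3 \<or> \<Gamma> \<in> closed_sets N 4" "\<And>e. e \<in> \<Gamma> \<Longrightarrow> \<theta> (card e) \<noteq> 0" "weight \<Gamma> = ?K"
      by (auto simp: crit_def)
    then show "\<Gamma> \<in> closed_mixed N pe po \<union> (if pe = 2 * (po - 1) then closed_of N po 4 else {})"
      using type[of \<Gamma> N 3] type[of \<Gamma> N 4] by auto
  qed
  have mixed_lim: "(\<lambda>N. sqrt (real N) ^ ?K * (\<Sum>\<Gamma>\<in>closed_mixed N pe po. \<Prod>e\<in>\<Gamma>. bw N (card e))) \<longlonglongrightarrow> v_sq \<theta> \<beta> 1 2"
    using closed_mixed_weight_limit[of pe po] pe(2) po(2) lt v_sq_1_2[of \<theta> \<beta>] by simp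
  show "(\<lambda>N. sqrt (real N) ^ ?K * (\<Sum>\<Gamma>\<in>crit ?K N. \<Prod>e\<in>\<Gamma>. bw N (card e))) \<longlonglongrightarrow> v_mix2_sq \<theta> \<beta>"
  proof (cases "pe = 2 * (po - 1)")
    case False
    then have "crit ?K N = closed_mixed N pe po" for N using sub[of N] closed_mixed_crit[of N] by auto
    moreover have "v_mix2_sq \<theta> \<beta> = v_sq \<theta> \<beta> 1 2" using False pp by (simp add: v_mix2_sq_def)
    ultimately show ?thesis using mixed_lim by simp
  next
    case True
    have K4: "?K = 4 * (po - 2)" using True po(2) by simp
    have four: "closed_of N po 4 \<subseteq> crit ?K N" for N unfolding K4 using po by (intro closed_of_crit) auto
    have crit: "crit ?K N = closed_mixed N pe po \<union> closed_of N po 4" for N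
      using sub[of N] four[of N] closed_mixed_crit[of N] True by auto
    have fin: "finite (closed_mixed N pe po)" "finite (closed_of N po 4)" for N
      using finite_subset[OF closed_mixed_crit finite_crit] finite_subset[OF four finite_crit] by blast+
    have dis: "closed_mixed N pe po \<inter> closed_of N po 4 = {}" for N
      using pe(1) po(1) by (auto simp: closed_mixed_def closed_of_def edges_def)
    have "(\<lambda>N. sqrt (real N) ^ ?K * (\<Sum>\<Gamma>\<in>closed_of N po 4. \<Prod>e\<in>\<Gamma>. bw N (card e))) \<longlonglongrightarrow> v_sq \<theta> \<beta> 0 4"
      unfolding K4 v_sq_0_4 using closed_of_weight_limit[of po 4, OF _ closed_4_limit] po(2) by simp
    from tendsto_add[OF mixed_lim this]
    have "(\<lambda>N. sqrt (real N) ^ ?K * (\<Sum>\<Gamma>\<in>crit ?K N. \<Prod>e\<in>\<Gamma>. bw N (card e))) \<longlonglongrightarrow> v_sq \<theta> \<beta> 1 2 + v_sq \<theta> \<beta> 0 4"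
      unfolding crit sum.union_disjoint[OF fin dis] distrib_left .
    moreover have "v_mix2_sq \<theta> \<beta> = v_sq \<theta> \<beta> 1 2 + v_sq \<theta> \<beta> 0 4" using True by (simp add: v_mix2_sq_def)
    ultimately show ?thesis by simp
  qed
qed

text \<open>For \<open>2 * b < a\<close> four odd edges have the smallest weight \<open>4 * b\<close>.\<close>

lemma leading_order_odd:
  assumes ge: "2 * po \<le> pe"
  shows "leading_order M J \<theta> \<beta> (4 * (po - 2)) po (v_mix3_sq \<theta> \<beta>)"
proof (unfold_locales)
  show "1 \<le> 4 * (po - 2)" "4 * (po - 2) + 1 \<le> 5 * (po - 2)" "3 \<le> po" using po(2) by auto
  show "\<theta> p = 0" if "3 \<le> p" "p < po" for p
    using that pe(4)[of p] po(4)[of p] ge by (cases "even p") auto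
  have type: "4 * (po - 2) \<le> weight \<Gamma> \<and> (weight \<Gamma> = 4 * (po - 2) \<longrightarrow> \<Gamma> \<in> closed_of N po 4)"
    if \<Gamma>: "\<Gamma> \<in> closed_sets N n" and n: "n \<in> {3, 4}" and \<theta>: "\<And>e. e \<in> \<Gamma> \<Longrightarrow> \<theta> (card e) \<noteq> 0" for N n \<Gamma>
  proof -
    define d where "d = card {e \<in> \<Gamma>. odd (card e)}"
    note ty = closed_type[OF \<Gamma> \<theta> d_def]
    have fin: "finite \<Gamma>" by (rule finite_subset[of _ "all_edges N"]) (use \<Gamma> in \<open>auto simp: closed_sets_def\<close>)
    have dn: "odd (card e)" if "d = n" "e \<in> \<Gamma>" for e
    proof -
      have "{e \<in> \<Gamma>. odd (card e)} = \<Gamma>" using that(1) \<Gamma> fin by (intro card_subset_eq) (auto simp: d_def closed_sets_def)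
      then show ?thesis using that(2) by blast
    qed
    consider "n = 3" "d = 0" | "n = 3" "d = 2" | "n = 4" "d = 0" | "n = 4" "d = 2" | "n = 4" "d = 4"
      using n ty(1,2) by fastforce
    then show ?thesis
    proof cases
      case 5
      then have "card e = po" if "weight \<Gamma> = 4 * (po - 2)" "e \<in> \<Gamma>" for e
        using ty(4)[of e] dn[of e] that by simp
      then show ?thesis using ty(3) 5 \<Gamma> in_closed_of[of \<Gamma> N 4 po] by auto
    qed (use ty(3) ge po(2) in auto)
  qed
  show "4 * (po - 2) \<le> weight \<Gamma>"
    if "\<Gamma> \<in> closed_sets N n" "n \<in> {3, 4}" "\<And>e. e \<in> \<Gamma> \<Longrightarrow> \<theta> (card e) \<noteq> 0" for N n \<Gamma>
    using type[OF that] by simp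
  have "crit (4 * (po - 2)) N = closed_of N po 4" for N
  proof
    show "closed_of N po 4 \<subseteq> crit (4 * (po - 2)) N" using po by (intro closed_of_crit) auto
    show "crit (4 * (po - 2)) N \<subseteq> closed_of N po 4"
    proof
      fix \<Gamma> assume "\<Gamma> \<in> crit (4 * (po - 2)) N"
      then have "\<Gamma> \<in> closed_sets N 3 \<or> \<Gamma> \<in> closed_sets N 4" "\<And>e. e \<in> \<Gamma> \<Longrightarrow> \<theta> (card e) \<noteq> 0" "weight \<Gamma> = 4 * (po - 2)"
        by (auto simp: crit_def)
      then show "\<Gamma> \<in> closed_of N po 4" using type[of \<Gamma> N 3] type[of \<Gamma> N 4] by auto
    qed
  qed
  then show "(\<lambda>N. sqrt (real N) ^ (4 * (po - 2)) * (\<Sum>\<Gamma>\<in>crit (4 * (po - 2)) N. \<Prod>e\<in>\<Gamma>. bw N (card e))) \<longlonglongrightarrow> v_mix3_sq \<theta> \<beta>"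
    using closed_of_weight_limit[of po 4, OF _ closed_4_limit] po(2) unfolding v_mix3_sq_def v_sq_0_4 by simp
qed

end

theorem theorem2p1:
  fixes M :: "'a measure"
    and J :: "nat list \<Rightarrow> 'a \<Rightarrow> real"
    and \<theta> :: "nat \<Rightarrow> real"
    and \<beta> :: real
  assumes "prob_space M"
    and J_indep: "prob_space.indep_vars M (\<lambda>_. borel) J disorder_index"
    and J_ident: "\<And>i i'. i \<in> disorder_index \<Longrightarrow> i' \<in> disorder_index \<Longrightarrow>
          distr M borel (J i) = distr M borel (J i')"
    and J_symm: "\<And>i. i \<in> disorder_index \<Longrightarrow>
          distr M borel (\<lambda>\<omega>. - J i \<omega>) = distr M borel (J i)"
    and J_mean: "\<And>i. i \<in> disorder_index \<Longrightarrow> prob_space.expectation M (J i) = 0"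
    and J_var: "\<And>i. i \<in> disorder_index \<Longrightarrow> prob_space.variance M (J i) = 1"
    and J_fourth: "\<And>i. i \<in> disorder_index \<Longrightarrow> integrable M (\<lambda>\<omega>. J i \<omega> ^ 4)"
    and theta_summable: "(\<lambda>p. (\<theta> p)\<^sup>2 / fact (p - 2)) summable_on {2..}"
    and theta2: "\<theta> 2 = 0"
    and even_ex: "\<exists>p. even p \<and> 4 \<le> p \<and> \<theta> p \<noteq> 0"
    and odd_ex: "\<exists>p. odd p \<and> 3 \<le> p \<and> \<theta> p \<noteq> 0"
    and beta: "0 < \<beta>" "\<beta> < beta_f (xi \<theta>)"
  defines "pe \<equiv> min_even \<theta>"
    and "po \<equiv> min_odd \<theta>"
    and "logZ \<equiv> \<lambda>N \<omega>. ln (Z_hat \<theta> \<beta> (\<lambda>i. J i \<omega>) N)"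
  shows
    "(pe < po \<longrightarrow>
        converges_in_distribution_to M
          (\<lambda>N \<omega>. real N powr (3 * (real pe - 2) / 4) * logZ N \<omega>)
          (centred_normal (v_mix1_sq \<theta> \<beta>)))
   \<and> (po < pe \<and> pe < 2 * po \<longrightarrow>
        converges_in_distribution_to M
          (\<lambda>N \<omega>. real N powr ((2 * real po + real pe - 6) / 4) * logZ N \<omega>)
          (centred_normal (v_mix2_sq \<theta> \<beta>)))
   \<and> (2 * po \<le> pe \<longrightarrow>
        converges_in_distribution_to M
          (\<lambda>N \<omega>. real N powr (real po - 2) * logZ N \<omega>)
          (centred_normal (v_mix3_sq \<theta> \<beta>)))"
proof -
  interpret mixed: mixed_model M J \<theta> \<beta>
    using assms unfolding mixed_model_def mixed_model_axioms_def spin_model_def spin_model_axioms_def by blast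
  note ge = mixed.pe(2) mixed.po(2)
  show ?thesis
    unfolding pe_def po_def logZ_def
  proof (intro conjI impI)
    assume "min_even \<theta> < min_odd \<theta>"
    then interpret leading_order M J \<theta> \<beta> "3 * (min_even \<theta> - 2)" "min_even \<theta>" "v_mix1_sq \<theta> \<beta>"
      by (rule mixed.leading_order_even)
    have "real (3 * (min_even \<theta> - 2)) / 4 = 3 * (real (min_even \<theta>) - 2) / 4" using ge by (simp add: of_nat_diff)
    with log_partition_CLT
    show "converges_in_distribution_to M (\<lambda>N \<omega>. real N powr (3 * (real (min_even \<theta>) - 2) / 4) * ln (Z_hat \<theta> \<beta> (\<lambda>i. J i \<omega>) N)) (centred_normal (v_mix1_sq \<theta> \<beta>))"
      by (simp only:)
  next
    assume "min_odd \<theta> < min_even \<theta> \<and> min_even \<theta> < 2 * min_odd \<theta>"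
    then interpret leading_order M J \<theta> \<beta> "(min_even \<theta> - 2) + 2 * (min_odd \<theta> - 2)" "min_odd \<theta>" "v_mix2_sq \<theta> \<beta>"
      by (intro mixed.leading_order_mixed) auto
    have "real ((min_even \<theta> - 2) + 2 * (min_odd \<theta> - 2)) / 4 = (2 * real (min_odd \<theta>) + real (min_even \<theta>) - 6) / 4"
      using ge by (simp add: of_nat_diff)
    with log_partition_CLT
    show "converges_in_distribution_to M (\<lambda>N \<omega>. real N powr ((2 * real (min_odd \<theta>) + real (min_even \<theta>) - 6) / 4) * ln (Z_hat \<theta> \<beta> (\<lambda>i. J i \<omega>) N)) (centred_normal (v_mix2_sq \<theta> \<beta>))"
      by (simp only:)
  next
    assume "2 * min_odd \<theta> \<le> min_even \<theta>"
    then interpret leading_order M J \<theta> \<beta> "4 * (min_odd \<theta> - 2)" "min_odd \<theta>" "v_mix3_sq \<theta> \<beta>"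
      by (rule mixed.leading_order_odd)
    have "real (4 * (min_odd \<theta> - 2)) / 4 = real (min_odd \<theta>) - 2" using ge by (simp add: of_nat_diff)
    with log_partition_CLT
    show "converges_in_distribution_to M (\<lambda>N \<omega>. real N powr (real (min_odd \<theta>) - 2) * ln (Z_hat \<theta> \<beta> (\<lambda>i. J i \<omega>) N)) (centred_normal (v_mix3_sq \<theta> \<beta>))"
      by (simp only:)
  qed
qed

end
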